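(* Let $(H\to\mathbb C\times(M,t^0),\nabla)$ be a rank 2 $(TE)$-structure with trace free pole part over $(M,t^0)=(\mathbb C,0)$ whose restriction over $t^0=0$ is logarithmic. Let $\rho^{(1)}\in\mathbb C$ be its (constant) invariant, and let $k_1\in\mathbb N$ and $k_2\in\mathbb Z$ be its numerical invariants if the generic type is (Sem) or (Bra). (a) Suppose that the generic type is (Sem). (i) Then $k_2\ge k_1$. (ii) If $k_2>k_1$ then the eigenvalues of the residue endomorphism of the logarithmic pole at $z=0$ of the $(TE)$-structure over $t^0$ are $\rho^{(1)}\pm\frac{k_1-k_2}{2(k_1+k_2)}$. Their difference is smaller than $1$. Especially, the eigenvalues of the monodromy are different, and the monodromy is semisimple. (iii) Also if $k_1=k_2$, the monodromy is semisimple. (b) Suppose that the generic type is (Bra). (i) Then $k_2\in\mathbb N$. (ii) The eigenvalues of the residue endomorphism of the logarithmic pole at $z=0$ of the $(TE)$-structure over $t^0$ are $\rho^{(1)}\pm\frac{-k_2}{2(k_1+k_2)}$. Their difference is smaller than $1$. Especially, the eigenvalues of the monodromy are different, and the monodromy is semisimple.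
   Context: A $(TE)$-structure over a complex manifold $M$ (or a germ) is a holomorphic vector bundle $H\to\mathbb C\times M$ ($z$ the coordinate on $\mathbb C$) with a flat connection $\nabla$ on $H|_{\mathbb C^*\times M}$ such that $\nabla:\mathcal O(H)\to(z^{-1}\mathcal O_{\mathbb C\times M}\cdot\Omega^1_M+z^{-2}\mathcal O_{\mathbb C\times M}\,dz)\otimes\mathcal O(H)$. Put $K:=H|_{\{0\}\times M}$ and $\mathcal U:=[z^2\nabla_{\partial_z}]:K\to K$ (the pole part); it is trace free if $\operatorname{tr}\mathcal U=0$. For a local basis $\underline v$ of $H$ near $z=0$ write $z^2\nabla_{\partial_z}\underline v=\underline vB$, $B=\sum_{k\ge0}B^{(k)}z^k$, $\det B=\sum_{k\ge0}\delta^{(k)}z^k$, $\rho^{(1)}=\frac12\operatorname{tr}B^{(1)}$; then $\delta^{(0)}=\det\mathcal U,\delta^{(1)},\rho^{(1)}\in\mathcal O_M$ do not depend on $\underline v$, and $\rho^{(1)}$ is constant. The restriction over $t^0$ is logarithmic if $z\nabla_{\partial_z}$ preserves $\mathcal O(H|_{\mathbb C\times\{t^0\}})_0$; its residue endomorphism is $[\nabla_{z\partial_z}]$ on $H|_{(0,t^0)}$. The monodromy is the one along $z\mapsto ze^{2\pi i}$ on flat multivalued sections of $H|_{\mathbb C^*\times M}$. In the situation of the claim (coordinate $t$ on $(M,t^0)=(\mathbb C,0)$) the generic type is (Sem) if $\delta^{(0)}\ne0$; (Bra) if $\delta^{(0)}=0$, $\delta^{(1)}\neq0$; (Reg) if $\delta^{(0)}=\delta^{(1)}=0$,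 $\mathcal U\ne0$; (Log) if $\mathcal U=0$ (as germs at $0$). For generic types (Sem), (Bra), (Reg): $k_1:=\max\{k\in\mathbb N\mid\mathcal U(\mathcal O(K)_0)\subset t^k\mathcal O(K)_0\}$. For (Sem): $k_2:=\deg_t\delta^{(0)}-k_1$; for (Bra): $k_2:=\deg_t\delta^{(1)}-k_1$, where $\deg_t$ is the vanishing order at $t=0$. $\mathbb N=\{1,2,\dots\}$. *)

theory Defs
  imports "HOL-Complex_Analysis.Complex_Analysis"
begin

text \<open>Points are pairs \<open>(z, t)\<close>.  Holomorphic means complex differentiable in the
  Frechet sense at every point.\<close>

definition hol2 :: "(complex \<times> complex) set \<Rightarrow> (complex \<times> complex \<Rightarrow> complex) \<Rightarrow> bool" where
  "hol2 W f \<longleftrightarrow> (\<forall>p\<in>W. \<exists>a b. (f has_derivative (\<lambda>(h, k). a * h + b * k)) (at p))"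

definition partial_z :: "(complex \<times> complex \<Rightarrow> complex) \<Rightarrow> complex \<times> complex \<Rightarrow> complex" where
  "partial_z f p = deriv (\<lambda>z. f (z, snd p)) (fst p)"

definition partial_t :: "(complex \<times> complex \<Rightarrow> complex) \<Rightarrow> complex \<times> complex \<Rightarrow> complex" where
  "partial_t f p = deriv (\<lambda>t. f (fst p, t)) (snd p)"

text \<open>The coefficient \<open>f\<^sup>(\<^sup>k\<^sup>)(t)\<close> in the expansion of \<open>f\<close> in powers of \<open>z\<close>.\<close>

definition zcoeff :: "nat \<Rightarrow> (complex \<times> complex \<Rightarrow> complex) \<Rightarrow> complex \<Rightarrow> complex" where
  "zcoeff k f t = (deriv ^^ k) (\<lambda>z. f (z, t)) 0 / fact k"

text \<open>The base germ \<open>(M, 0)\<close> is represented by the disc \<open>M = ball 0 (rad H)\<close>.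

  Set-theoretically (fibrewise linearly, but with no continuity whatsoever) every rank 2 bundle
  over \<open>\<complex> \<times> M\<close> is the product with \<open>\<complex>\<^sup>2\<close>; the bundle itself is the atlas \<open>frames H\<close> of
  local frames.  A frame is a pair \<open>(U, \<Phi>)\<close> where the columns of \<open>\<Phi> p\<close> are the basis of the
  fibre at \<open>p \<in> U\<close>.  As a function into \<open>\<complex>\<^sup>2\<close> a frame need not be continuous; only the
  transition matrices are required to be holomorphic, and they may be any holomorphic cocycle.

  The fields \<open>nabz\<close> and \<open>nabt\<close> are the covariant derivatives along \<open>\<partial>\<^sub>z\<close> and \<open>\<partial>\<^sub>t\<close>.  Their
  values matter only at points \<open>p\<close> with \<open>z \<noteq> 0\<close> and on sections that are holomorphic near \<open>p\<close>.\<close>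

type_synonym sect = "complex \<times> complex \<Rightarrow> complex^2"

record te =
  rad :: real
  frames :: "((complex \<times> complex) set \<times> (complex \<times> complex \<Rightarrow> complex^2^2)) set"
  nabz :: "sect \<Rightarrow> sect"
  nabt :: "sect \<Rightarrow> sect"

definition base :: "te \<Rightarrow> complex set" where
  "base H = ball 0 (rad H)"

definition vector_bundle :: "te \<Rightarrow> bool" where
  "vector_bundle H \<longleftrightarrow>
     rad H > 0 \<and>
     (\<Union>(U, \<Phi>)\<in>frames H. U) = UNIV \<times> base H \<and>
     (\<forall>(U, \<Phi>)\<in>frames H. open U \<and> (\<forall>p\<in>U. invertible (\<Phi> p))) \<and>
     (\<forall>(U, \<Phi>)\<in>frames H. \<forall>(U', \<Phi>')\<in>frames H. \<forall>i j.
        hol2 (U \<inter> U') (\<lambda>p. (matrix_inv (\<Phi> p) ** \<Phi>' p) $ i $ j))"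

definition hol_section :: "te \<Rightarrow> (complex \<times> complex) set \<Rightarrow> sect \<Rightarrow> bool" where
  "hol_section H W s \<longleftrightarrow> open W \<and> W \<subseteq> UNIV \<times> base H \<and>
     (\<forall>(U, \<Phi>)\<in>frames H. \<forall>i. hol2 (W \<inter> U) (\<lambda>p. (matrix_inv (\<Phi> p) *v s p) $ i))"

text \<open>Holomorphic sections over \<open>V\<close> of the pullback of the bundle along a holomorphic curve
  \<open>\<iota>\<close>; used for the restrictions of \<open>H\<close> to \<open>{0} \<times> M\<close> and to \<open>\<complex> \<times> {0}\<close>.\<close>

definition hol_section_along ::
    "te \<Rightarrow> (complex \<Rightarrow> complex \<times> complex) \<Rightarrow> complex set \<Rightarrow> (complex \<Rightarrow> complex^2) \<Rightarrow> bool" where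
  "hol_section_along H \<iota> V \<sigma> \<longleftrightarrow> open V \<and> \<iota> ` V \<subseteq> UNIV \<times> base H \<and>
     (\<forall>(U, \<Phi>)\<in>frames H. \<forall>i.
        (\<lambda>x. (matrix_inv (\<Phi> (\<iota> x)) *v \<sigma> x) $ i) holomorphic_on {x \<in> V. \<iota> x \<in> U})"

definition punctured :: "te \<Rightarrow> (complex \<times> complex) set" where
  "punctured H = (UNIV - {0}) \<times> base H"

definition flat_connection :: "te \<Rightarrow> bool" where
  "flat_connection H \<longleftrightarrow>
     (\<forall>W s. W \<subseteq> punctured H \<and> hol_section H W s \<longrightarrow>
        hol_section H W (nabz H s) \<and> hol_section H W (nabt H s) \<and>
        (\<forall>s'. hol_section H W s' \<and> (\<forall>p\<in>W. s p = s' p) \<longrightarrow>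
           (\<forall>p\<in>W. nabz H s p = nabz H s' p \<and> nabt H s p = nabt H s' p)) \<and>
        (\<forall>s'. hol_section H W s' \<longrightarrow>
           (\<forall>p\<in>W. nabz H (\<lambda>q. s q + s' q) p = nabz H s p + nabz H s' p \<and>
                  nabt H (\<lambda>q. s q + s' q) p = nabt H s p + nabt H s' p)) \<and>
        (\<forall>f. hol2 W f \<longrightarrow>
           (\<forall>p\<in>W. nabz H (\<lambda>q. f q *s s q) p = partial_z f p *s s p + f p *s nabz H s p \<and>
                  nabt H (\<lambda>q. f q *s s q) p = partial_t f p *s s p + f p *s nabt H s p)) \<and>
        (\<forall>p\<in>W. nabz H (nabt H s) p = nabt H (nabz H s) p))"

definition pole_condition :: "te \<Rightarrow> bool" where
  "pole_condition H \<longleftrightarrow>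
     (\<forall>W s. hol_section H W s \<longrightarrow>
        (\<exists>u. hol_section H W u \<and> (\<forall>p\<in>W. fst p \<noteq> 0 \<longrightarrow> u p = fst p *s nabt H s p)) \<and>
        (\<exists>u. hol_section H W u \<and> (\<forall>p\<in>W. fst p \<noteq> 0 \<longrightarrow> u p = (fst p)\<^sup>2 *s nabz H s p)))"

definition TE_structure :: "te \<Rightarrow> bool" where
  "TE_structure H \<longleftrightarrow> vector_bundle H \<and> flat_connection H \<and> pole_condition H"

text \<open>The endomorphism \<open>\<U>\<close> of the fibre at \<open>(0, t)\<close>: \<open>u\<close> is \<open>z\<^sup>2\<nabla>\<^bsub>\<partial>\<^sub>z\<^esub>s\<close>, extended over \<open>z = 0\<close>.
  The value at \<open>(0, t)\<close> depends only on \<open>x = s(0, t)\<close>.\<close>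

definition pole_part :: "te \<Rightarrow> complex \<Rightarrow> complex^2 \<Rightarrow> complex^2" where
  "pole_part H t x = (THE y. \<exists>W s u. (0, t) \<in> W \<and> hol_section H W s \<and> hol_section H W u \<and>
     (\<forall>p\<in>W. fst p \<noteq> 0 \<longrightarrow> u p = (fst p)\<^sup>2 *s nabz H s p) \<and> s (0, t) = x \<and> u (0, t) = y)"

definition trace_free_pole_part :: "te \<Rightarrow> bool" where
  "trace_free_pole_part H \<longleftrightarrow> (\<forall>t\<in>base H. trace (matrix (pole_part H t)) = 0)"

text \<open>\<open>v\<close> is a basis of sections near \<open>(0, t)\<close> (the columns), and \<open>z\<^sup>2\<nabla>\<^bsub>\<partial>\<^sub>z\<^esub>v = v B\<close>.\<close>

definition basis_with_matrix ::
    "te \<Rightarrow> complex \<Rightarrow> (complex \<times> complex) set \<Rightarrow> (complex \<times> complex \<Rightarrow> complex^2^2) \<Rightarrow>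
     (complex \<times> complex \<Rightarrow> complex^2^2) \<Rightarrow> bool" where
  "basis_with_matrix H t U v B \<longleftrightarrow>
     (0, t) \<in> U \<and> (\<forall>j. hol_section H U (\<lambda>p. column j (v p))) \<and> (\<forall>p\<in>U. invertible (v p)) \<and>
     (\<forall>i j. hol2 U (\<lambda>p. B p $ i $ j)) \<and>
     (\<forall>p\<in>U. fst p \<noteq> 0 \<longrightarrow>
        (\<forall>j. (fst p)\<^sup>2 *s nabz H (\<lambda>q. column j (v q)) p = column j (v p ** B p)))"

text \<open>Independent of the basis for \<open>k \<in> {0, 1}\<close>; used only for these.\<close>

definition delta :: "te \<Rightarrow> nat \<Rightarrow> complex \<Rightarrow> complex" where
  "delta H k t = (THE d. \<exists>U v B. basis_with_matrix H t U v B \<and> d = zcoeff k (\<lambda>p. det (B p)) t)"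

definition rho1 :: "te \<Rightarrow> complex \<Rightarrow> complex" where
  "rho1 H t = (THE d. \<exists>U v B. basis_with_matrix H t U v B \<and>
     d = trace (\<chi> i j. zcoeff 1 (\<lambda>p. B p $ i $ j) t) / 2)"

definition generic_Sem :: "te \<Rightarrow> bool" where
  "generic_Sem H \<longleftrightarrow> \<not> (\<forall>\<^sub>F t in nhds 0. delta H 0 t = 0)"

definition generic_Bra :: "te \<Rightarrow> bool" where
  "generic_Bra H \<longleftrightarrow> (\<forall>\<^sub>F t in nhds 0. delta H 0 t = 0) \<and> \<not> (\<forall>\<^sub>F t in nhds 0. delta H 1 t = 0)"

text \<open>\<open>\<U>(\<O>(K)\<^sub>0) \<subseteq> t\<^sup>k \<O>(K)\<^sub>0\<close>\<close>

definition pole_part_divisible :: "te \<Rightarrow> nat \<Rightarrow> bool" where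
  "pole_part_divisible H k \<longleftrightarrow>
     (\<forall>V \<sigma>. 0 \<in> V \<and> hol_section_along H (\<lambda>t. (0, t)) V \<sigma> \<longrightarrow>
        (\<exists>V' \<tau>. 0 \<in> V' \<and> V' \<subseteq> V \<and> hol_section_along H (\<lambda>t. (0, t)) V' \<tau> \<and>
           (\<forall>t\<in>V'. pole_part H t (\<sigma> t) = t ^ k *s \<tau> t)))"

text \<open>Meaningful when the generic type is not (Log) and \<open>\<U>\<close> vanishes at \<open>t = 0\<close>: then the set of
  admissible \<open>k\<close> is finite and nonempty.\<close>

definition inv_k1 :: "te \<Rightarrow> nat" where
  "inv_k1 H = (GREATEST k. k \<ge> 1 \<and> pole_part_divisible H k)"

definition inv_k2 :: "te \<Rightarrow> int" where
  "inv_k2 H = (if generic_Sem H then zorder (delta H 0) 0 - int (inv_k1 H)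
               else zorder (delta H 1) 0 - int (inv_k1 H))"

text \<open>On \<open>V\<close>, \<open>\<tau>\<close> is \<open>z\<nabla>\<^bsub>\<partial>\<^sub>z\<^esub>\<sigma>\<close> with respect to the restricted (pulled back) connection on
  \<open>\<complex> \<times> {0}\<close>, which is computed by extending \<open>\<sigma>\<close> to a section \<open>s\<close> of \<open>H\<close>.\<close>

definition log_derivative ::
    "te \<Rightarrow> complex set \<Rightarrow> (complex \<Rightarrow> complex^2) \<Rightarrow> (complex \<Rightarrow> complex^2) \<Rightarrow> bool" where
  "log_derivative H V \<sigma> \<tau> \<longleftrightarrow>
     0 \<in> V \<and> hol_section_along H (\<lambda>z. (z, 0)) V \<sigma> \<and> hol_section_along H (\<lambda>z. (z, 0)) V \<tau> \<and>
     (\<exists>W s. hol_section H W s \<and> V \<times> {0} \<subseteq> W \<and> (\<forall>z\<in>V. s (z, 0) = \<sigma> z) \<and>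
        (\<forall>z\<in>V - {0}. \<tau> z = z *s nabz H s (z, 0)))"

definition logarithmic_over_0 :: "te \<Rightarrow> bool" where
  "logarithmic_over_0 H \<longleftrightarrow>
     (\<forall>V \<sigma>. 0 \<in> V \<and> hol_section_along H (\<lambda>z. (z, 0)) V \<sigma> \<longrightarrow>
        (\<exists>V' \<tau>. V' \<subseteq> V \<and> log_derivative H V' \<sigma> \<tau>))"

definition residue_endo :: "te \<Rightarrow> complex^2 \<Rightarrow> complex^2" where
  "residue_endo H x = (THE y. \<exists>V \<sigma> \<tau>. log_derivative H V \<sigma> \<tau> \<and> \<sigma> 0 = x \<and> \<tau> 0 = y)"

definition residue_eigenvalues :: "te \<Rightarrow> complex set" where
  "residue_eigenvalues H = {c. \<exists>x. x \<noteq> 0 \<and> residue_endo H x = c *s x}"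

text \<open>A flat multivalued section is a function on the universal covering \<open>\<complex> \<times> M\<close> of
  \<open>\<complex>\<^sup>* \<times> M\<close>, with covering map \<open>(\<zeta>, t) \<mapsto> (e\<^sup>\<zeta>, t)\<close>, all of whose local branches are flat.
  It is set to \<open>0\<close> outside \<open>\<complex> \<times> M\<close>, so that equality of functions is equality of sections.\<close>

definition flat_mv_section :: "te \<Rightarrow> sect \<Rightarrow> bool" where
  "flat_mv_section H S \<longleftrightarrow>
     (\<forall>p. snd p \<notin> base H \<longrightarrow> S p = 0) \<and>
     (\<forall>p. snd p \<in> base H \<longrightarrow>
        (\<exists>N W s. open N \<and> p \<in> N \<and> W \<subseteq> punctured H \<and> hol_section H W s \<and>
           (\<forall>q\<in>W. nabz H s q = 0 \<and> nabt H s q = 0) \<and>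
           (\<forall>q\<in>N. (exp (fst q), snd q) \<in> W \<and> S q = s (exp (fst q), snd q))))"

definition monodromy :: "sect \<Rightarrow> sect" where
  "monodromy S = (\<lambda>(\<zeta>, t). S (\<zeta> + 2 * of_real pi * \<i>, t))"

definition monodromy_eigensections :: "te \<Rightarrow> complex \<Rightarrow> sect set" where
  "monodromy_eigensections H c =
     {S. flat_mv_section H S \<and> S \<noteq> (\<lambda>_. 0) \<and> monodromy S = (\<lambda>p. c *s S p)}"

definition monodromy_eigenvalues :: "te \<Rightarrow> complex set" where
  "monodromy_eigenvalues H = {c. monodromy_eigensections H c \<noteq> {}}"

text \<open>Diagonalizable: the eigensections span the space of flat multivalued sections.\<close>

definition monodromy_semisimple :: "te \<Rightarrow> bool" where
  "monodromy_semisimple H \<longleftrightarrow>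
     (\<forall>S. flat_mv_section H S \<longrightarrow>
        (\<exists>F. finite F \<and> F \<subseteq> (\<Union>c. monodromy_eigensections H c) \<and> S = (\<lambda>p. \<Sum>E\<in>F. E p)))"

end

theory Submission
  imports Defs
begin

text \<open>In a frame near the origin let \<open>B = \<Sum> B\<^sub>i z\<^sup>i\<close> and \<open>A = \<Sum> A\<^sub>i z\<^sup>i\<close> be the matrices of \<open>z\<^sup>2 \<nabla>\<^sub>z\<close> and
  \<open>z \<nabla>\<^sub>t\<close>.  Flatness is the equation \<open>z B\<^sub>t = [B, A] + z\<^sup>2 A\<^sub>z - z A\<close>.  The pole part is \<open>B\<^sub>0 = t\<^sup>k C\<close> with
  \<open>k = k1 \<ge> 1\<close> and \<open>L = C(0) \<noteq> 0\<close>, since it vanishes at \<open>t = 0\<close>, and \<open>R = B\<^sub>1(0)\<close> is the residue endomorphism.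

  The lowest orders in \<open>z\<close> give everything about the residue.  They read \<open>[B\<^sub>0, A\<^sub>0] = 0\<close> and
  \<open>B\<^sub>0' = [B\<^sub>1, A\<^sub>0] + [B\<^sub>0, A\<^sub>1] - A\<^sub>0\<close>.  As \<open>C\<close> is trace free and \<open>L \<noteq> 0\<close>, the first and the trace of the second force \<open>A\<^sub>0 = a C\<close>
  (\<open>A0_multiple\<close>).  The function \<open>det B\<^sub>0\<close>, or if it vanishes the coefficient of \<open>z\<close> in \<open>det B\<close>, has
  logarithmic derivative \<open>- 2 a / t\<^sup>k\<close> or \<open>- a / t\<^sup>k\<close>, and its order in \<open>t\<close> is \<open>k1 + k2\<close>.  This determines the
  leading coefficient of \<open>a\<close>, and the coefficient of \<open>t\<^sup>(\<^sup>k\<^sup>-\<^sup>1\<^sup>)\<close> in the second equation becomes \<open>[R, L] = l L\<close> with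
  \<open>l = (k2 - k1) / (k1 + k2)\<close> for type (Sem) and \<open>l = k2 / (k1 + k2)\<close> for type (Bra).  If \<open>L\<close> is nilpotent, the
  eigenvalues of \<open>R\<close> differ by \<open>l\<close> (\<open>commutator_eigenvector\<close>); this covers (Bra) and \<open>k2 > k1\<close> in (Sem), and
  there \<open>0 < l < 1\<close> excludes every resonance (\<open>semisimple_case\<close>, \<open>nilpotent_case\<close>,
  \<open>distinct_residue_eigenvalues\<close>).

  For type (Sem) with \<open>k1 = k2\<close> the matrices \<open>R\<close> and \<open>L\<close> commute and \<open>L\<close> has two different eigenvalues, so both are
  diagonal in a suitable frame.  The eigenvalues of \<open>R\<close> may differ by a positive integer \<open>n\<close>, and the question is whether
  a logarithm occurs over \<open>t = 0\<close>.  It does not, for a reason that involves the whole family: with an eigenvalue \<open>q\<close> of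
  the pole part and the vector field \<open>k z \<partial>\<^sub>z + \<xi> \<partial>\<^sub>t\<close> with \<open>\<xi> q' = k q\<close>, the covariant derivative \<open>E\<close> along it
  extends over \<open>z = 0\<close>, and its commutator with \<open>z\<^sup>2 \<nabla>\<^sub>z\<close> is \<open>k z\<^sup>2 \<nabla>\<^sub>z\<close>.  Give \<open>z\<close> the weight \<open>k\<close> and \<open>t\<close> the
  weight \<open>1\<close>.  The obstruction to an eigenvector of \<open>E\<close> is a polynomial \<open>f\<close> of weight \<open>k n\<close>; comparing lowest
  weights after applying \<open>z\<^sup>2 \<nabla>\<^sub>z\<close> yields \<open>z\<^sup>2 f\<^sub>z = (n z + 2 \<alpha> t\<^sup>k) f\<close> with \<open>\<alpha> \<noteq> 0\<close>, hence \<open>f = 0\<close>.  At \<open>t = 0\<close>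
  the eigenvector of \<open>E\<close> is a formal solution that passes the resonance (\<open>no_resonance_obstruction\<close>).

  The monodromy enters as follows.  Flat multivalued sections form a locally constant sheaf over the convex set
  \<open>\<complex> \<times> M\<close>, so they are determined by their value at one point, which can be arbitrary (\<open>flat_unique\<close>,
  \<open>flat_extension\<close>).  Hence the monodromy can be read off over \<open>t = 0\<close>, where two independent solutions
  \<open>z\<^sup>-\<^sup>d y(z)\<close> with holomorphic \<open>y\<close>, found by the Frobenius method, diagonalize it (\<open>log_monodromy\<close>).\<close>

section \<open>Power series in \<open>t\<close> and the commutator relation\<close>

text \<open>Some entry of the first vector is a unit; the factor is the quotient of the entries at that place.\<close>

lemma fps_proportional:
  fixes c1 c2 c3 a1 a2 a3 :: "complex fps"
  assumes "fps_nth c1 0 \<noteq> 0 \<or> fps_nth c2 0 \<noteq> 0 \<or> fps_nth c3 0 \<noteq> 0"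
    and "c1 * a2 = c2 * a1" "c1 * a3 = c3 * a1" "c2 * a3 = c3 * a2"
  shows "\<exists>a. a1 = a * c1 \<and> a2 = a * c2 \<and> a3 = a * c3"
proof -
  have unit: "\<exists>v. v * c = 1" if "fps_nth c 0 \<noteq> 0" for c :: "complex fps"
    using inverse_mult_eq_1[OF that] by blast
  consider v where "v * c1 = 1" | v where "v * c2 = 1" | v where "v * c3 = 1" using assms(1) unit by blast
  then show ?thesis
  proof cases
    case 1
    then show ?thesis using assms(2-) by (intro exI[of _ "v * a1"] conjI) algebra+
  next
    case 2
    then show ?thesis using assms(2-) by (intro exI[of _ "v * a2"] conjI) algebra+
  next
    case 3
    then show ?thesis using assms(2-) by (intro exI[of _ "v * a3"] conjI) algebra+
  qed
qed

lemma fps_deriv_X_power_mult: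
  fixes c :: "complex fps"
  assumes "k \<ge> 1"
  shows "fps_deriv (fps_X ^ k * c) = fps_X ^ (k - 1) * (of_nat k * c + fps_X * fps_deriv c)"
proof -
  have "fps_deriv (fps_X ^ Suc n * c) = fps_X ^ n * (of_nat (Suc n) * c + fps_X * fps_deriv c)" for n and c :: "complex fps"
  proof (induction n arbitrary: c)
    case (Suc n)
    have "fps_deriv (fps_X ^ Suc (Suc n) * c) = fps_deriv (fps_X ^ Suc n * (fps_X * c))"
      by (simp only: power_Suc2 mult.assoc)
    also have "\<dots> = fps_X ^ n * (of_nat (Suc n) * (fps_X * c) + fps_X * fps_deriv (fps_X * c))"
      by (rule Suc)
    also have "\<dots> = fps_X ^ Suc n * (of_nat (Suc (Suc n)) * c + fps_X * fps_deriv c)"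
      by (simp add: algebra_simps)
    finally show ?case .
  qed (simp add: algebra_simps)
  then show ?thesis using assms by (cases k) auto
qed

text \<open>The logarithmic derivative of \<open>\<delta>\<close> has a simple pole whose residue is the order of \<open>\<delta>\<close>.\<close>

lemma fps_logarithmic_derivative:
  fixes \<delta> a :: "complex fps"
  assumes eq: "fps_X ^ k * fps_deriv \<delta> = - (fps_const \<kappa> * a * \<delta>)" and "\<delta> \<noteq> 0" "k \<ge> 1" "\<kappa> \<noteq> 0"
  shows "\<exists>a'. a = fps_X ^ (k - 1) * a' \<and> \<kappa> * fps_nth a' 0 = - of_nat (subdegree \<delta>)"
proof -
  define m where "m = subdegree \<delta>"
  define u where "u = fps_shift m \<delta>"
  have \<delta>: "\<delta> = fps_X ^ m * u" using subdegree_decompose[of \<delta>] by (simp add: u_def m_def mult.commute)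
  have u0: "fps_nth u 0 \<noteq> 0" using assms(2) by (simp add: u_def m_def)
  then have inv: "inverse u * u = 1" by (rule inverse_mult_eq_1)
  have X: "fps_X * fps_deriv \<delta> = fps_X ^ m * (of_nat m * u + fps_X * fps_deriv u)"
    using fps_deriv_X_power_mult[of m u] by (cases m) (simp_all add: \<delta> del: fps_deriv_mult)
  have k: "fps_X ^ k = fps_X * (fps_X :: complex fps) ^ (k - 1)" using assms(3) by (cases k) auto
  have "fps_X ^ m * fps_X * (fps_X ^ (k-1) * (of_nat m * u + fps_X * fps_deriv u)) = fps_X ^ m * fps_X * (- (fps_const \<kappa> * a * u))"
  proof -
    have "Q * x * (P * w) = Q * x * (- (\<kappa>' * a * u))" if "x * P * d = - (\<kappa>' * a * (Q * u))" "x * d = Q * w"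
      for x P d \<kappa>' a u Q w :: "complex fps" using that by algebra
    from this[OF eq[unfolded k \<delta>] X[unfolded \<delta>]] show ?thesis .
  qed
  then have "fps_X ^ (k-1) * (of_nat m * u + fps_X * fps_deriv u) = - (fps_const \<kappa> * a * u)"
    by (metis fps_X_neq_zero mult_cancel_left no_zero_divisors power_not_zero)
  moreover have "fps_const (1/\<kappa>) * fps_const \<kappa> = 1" using assms(4) by (simp flip: fps_const_mult)
  moreover have "a = P * (- c' * (m' + x * (d * v)))"
    if "P * (m' * u + x * d) = - (c * a * u)" "c' * c = 1" "v * u = 1" for P m' u x d c a c' v :: "complex fps"
    using that by algebra
  ultimately have "a = fps_X ^ (k - 1) * (- fps_const (1/\<kappa>) * (of_nat m + fps_X * (fps_deriv u * inverse u)))"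
    using inv by blast
  moreover have "\<kappa> * fps_nth (- fps_const (1/\<kappa>) * (of_nat m + fps_X * (fps_deriv u * inverse u))) 0 = - of_nat m"
    using assms(4) by simp
  ultimately show ?thesis unfolding m_def by blast
qed

text \<open>This is the coefficient of \<open>t\<^sup>(\<^sup>k\<^sup>-\<^sup>1\<^sup>)\<close>, to which the last summand does not contribute.\<close>

lemma fps_leading_coefficient_relation:
  fixes a' c w v :: "complex fps"
  assumes "k \<ge> 1" "fps_deriv (fps_X ^ k * c) = fps_X ^ (k-1) * a' * (w - c) + fps_X ^ k * v"
  shows "of_nat k * fps_nth c 0 = fps_nth a' 0 * (fps_nth w 0 - fps_nth c 0)"
proof -
  have k: "fps_X ^ k = fps_X ^ (k - 1) * (fps_X :: complex fps)" using assms(1) by (cases k) auto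
  have "fps_X ^ (k - 1) * (of_nat k * c + fps_X * fps_deriv c) = fps_X ^ (k-1) * a' * (w - c) + fps_X ^ k * v"
    using assms(2) by (simp only: fps_deriv_X_power_mult[OF assms(1)])
  also have "\<dots> = fps_X ^ (k - 1) * (a' * (w - c) + fps_X * v)"
    unfolding k by (simp only: algebra_simps)
  finally have "fps_X ^ (k - 1) * (of_nat k * c + fps_X * fps_deriv c) = fps_X ^ (k - 1) * (a' * (w - c) + fps_X * v)" .
  then have "of_nat k * c + fps_X * fps_deriv c = a' * (w - c) + fps_X * v"
    by (metis fps_X_neq_zero mult_cancel_left power_not_zero)
  then have "fps_nth (of_nat k * c + fps_X * fps_deriv c) 0 = fps_nth (a' * (w - c) + fps_X * v) 0" by simp
  then show ?thesis by simp
qed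

text \<open>The equations \<open>e\<close> say \<open>[R, C] = l C\<close> for the matrix \<open>R\<close> with rows \<open>(r1, r2)\<close>, \<open>(r3, r4)\<close> and the trace free
  matrix \<open>C\<close> with rows \<open>(c1, c2)\<close>, \<open>(c3, - c1)\<close>.  Such a \<open>C\<close> maps eigenvectors of \<open>R\<close> to eigenvectors with the
  eigenvalue shifted by \<open>l\<close>; if \<open>C\<close> is nilpotent and not zero, the eigenvalues of \<open>R\<close> therefore differ by \<open>l\<close>,
  and the discriminant of its characteristic polynomial is \<open>l\<^sup>2\<close>.  The last equation is \<open>tr (R C) = 0\<close>.\<close>

lemma commutator_eigenvector:
  fixes c1 c2 c3 r1 r2 r3 r4 l :: complex
  assumes nz: "c1 \<noteq> 0 \<or> c2 \<noteq> 0 \<or> c3 \<noteq> 0"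
    and e: "r2 * c3 - c2 * r3 = l * c1" "(r1 - r4) * c2 - 2 * r2 * c1 = l * c2" "2 * r3 * c1 - (r1 - r4) * c3 = l * c3"
  shows commutator_discriminant: "c1 * c1 + c2 * c3 = 0 \<Longrightarrow> (r1 - r4)^2 + 4 * r2 * r3 = l^2"
    and commutator_trace: "c1 * c1 + c2 * c3 = 0 \<Longrightarrow> c1 * (r1 - r4) + c2 * r3 + c3 * r2 = 0"
proof -
  assume nil: "c1 * c1 + c2 * c3 = 0"
  have 2: "c2 * c2 * ((r1 - r4)^2 + 4 * r2 * r3 - l^2) = 0" "c3 * c3 * ((r1 - r4)^2 + 4 * r2 * r3 - l^2) = 0"
    "c2 * (c1 * (r1 - r4) + c2 * r3 + c3 * r2) = 0" "c3 * (c1 * (r1 - r4) + c2 * r3 + c3 * r2) = 0"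
    using e nil by algebra+
  have "c2 \<noteq> 0 \<or> c3 \<noteq> 0" using nil nz by auto
  with 2 show "(r1 - r4)^2 + 4 * r2 * r3 = l^2" "c1 * (r1 - r4) + c2 * r3 + c3 * r2 = 0" by auto
qed

section \<open>Weighted power series in \<open>z\<close> and \<open>t\<close>\<close>

text \<open>The outer variable is \<open>z\<close>, the inner one \<open>t\<close>.\<close>

type_synonym series = "complex fps fps"

definition fps_deriv_coeffs :: "series \<Rightarrow> series" where
  "fps_deriv_coeffs f = Abs_fps (\<lambda>i. fps_deriv (fps_nth f i))"

abbreviation coeff2 :: "series \<Rightarrow> nat \<Rightarrow> nat \<Rightarrow> complex" where
  "coeff2 f i j \<equiv> fps_nth (fps_nth f i) j"

lemma fps_deriv_coeffs_simps [simp]: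
  "fps_deriv_coeffs (f + g) = fps_deriv_coeffs f + fps_deriv_coeffs g"
  "fps_deriv_coeffs (f - g) = fps_deriv_coeffs f - fps_deriv_coeffs g"
  "fps_deriv_coeffs (- f) = - fps_deriv_coeffs f"
  "fps_deriv_coeffs (f * g) = fps_deriv_coeffs f * g + f * fps_deriv_coeffs g"
  "fps_deriv_coeffs (fps_const c) = fps_const (fps_deriv c)"
  "fps_deriv_coeffs fps_X = 0" "fps_deriv_coeffs 0 = 0" "fps_deriv_coeffs 1 = 0" "fps_deriv_coeffs (of_nat n) = 0"
  "fps_deriv_coeffs (fps_deriv f) = fps_deriv (fps_deriv_coeffs f)"
  by (rule fps_ext; simp add: fps_deriv_coeffs_def fps_mult_nth sum.distrib fps_deriv_sum fps_X_def
      flip: fps_of_nat del: of_nat_Suc; fail)+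

text \<open>The derivations \<open>k z \<partial>\<^sub>z + t \<eta>(t) \<partial>\<^sub>t\<close> and \<open>z\<^sup>2 \<partial>\<^sub>z\<close>.\<close>

definition euler_deriv :: "nat \<Rightarrow> complex fps \<Rightarrow> series \<Rightarrow> series" where
  "euler_deriv k \<eta> f = of_nat k * (fps_X * fps_deriv f) + fps_const (fps_X * \<eta>) * fps_deriv_coeffs f"

definition pole_deriv :: "series \<Rightarrow> series" where
  "pole_deriv f = fps_X ^ 2 * fps_deriv f"

lemma euler_deriv_simps:
  "euler_deriv k \<eta> (f + g) = euler_deriv k \<eta> f + euler_deriv k \<eta> g"
  "euler_deriv k \<eta> (f - g) = euler_deriv k \<eta> f - euler_deriv k \<eta> g"
  "euler_deriv k \<eta> (f * g) = euler_deriv k \<eta> f * g + f * euler_deriv k \<eta> g"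
  by (simp_all add: euler_deriv_def algebra_simps)

lemma pole_deriv_simps:
  "pole_deriv (f + g) = pole_deriv f + pole_deriv g"
  "pole_deriv (f - g) = pole_deriv f - pole_deriv g"
  "pole_deriv (f * g) = pole_deriv f * g + f * pole_deriv g"
  by (simp_all add: pole_deriv_def algebra_simps)

text \<open>The derivation \<open>z\<^sup>2 \<partial>\<^sub>z\<close> is homogeneous of weight \<open>k\<close>.\<close>

lemma euler_pole_commutator:
  "euler_deriv k \<eta> (pole_deriv f) = pole_deriv (euler_deriv k \<eta> f) + of_nat k * pole_deriv f"
  by (simp add: euler_deriv_def pole_deriv_def power2_eq_square algebra_simps)

text \<open>The variable \<open>z\<close> has weight \<open>k\<close> and \<open>t\<close> has weight \<open>1\<close>.  In this way \<open>z\<close> has the same weight as the pole part,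
  which has order \<open>k\<close> in \<open>t\<close>.\<close>

definition weight_ge :: "nat \<Rightarrow> nat \<Rightarrow> series \<Rightarrow> bool" where
  "weight_ge k d f \<longleftrightarrow> (\<forall>i j. k * i + j < d \<longrightarrow> coeff2 f i j = 0)"

lemma weight_geD: "weight_ge k d f \<Longrightarrow> k * i + j < d \<Longrightarrow> coeff2 f i j = 0"
  by (simp add: weight_ge_def)

lemma weight_ge_0 [simp]: "weight_ge k 0 f" by (simp add: weight_ge_def)

lemma weight_ge_add: "weight_ge k d f \<Longrightarrow> weight_ge k d g \<Longrightarrow> weight_ge k d (f + g)"
  by (simp add: weight_ge_def)

lemma weight_ge_diff: "weight_ge k d f \<Longrightarrow> weight_ge k d g \<Longrightarrow> weight_ge k d (f - g)"
  by (simp add: weight_ge_def)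

lemma weight_ge_mono: "weight_ge k d f \<Longrightarrow> e \<le> d \<Longrightarrow> weight_ge k e f"
  by (auto simp: weight_ge_def)

lemma weight_ge_Suc: "weight_ge k (Suc d) f \<longleftrightarrow> weight_ge k d f \<and> (\<forall>i j. k * i + j = d \<longrightarrow> coeff2 f i j = 0)"
  by (auto simp: weight_ge_def less_Suc_eq)

lemma coeff2_add_eq_0: "coeff2 g i j = - coeff2 f i j \<Longrightarrow> coeff2 (f + g) i j = 0"
  by simp

lemma coeff2_mult:
  "coeff2 (f * g) i j = (\<Sum>a\<in>{0..i}. \<Sum>b\<in>{0..j}. coeff2 f a b * coeff2 g (i - a) (j - b))"
  by (simp add: fps_mult_nth fps_sum_nth)

lemma weight_ge_mult:
  assumes "weight_ge k d f" "weight_ge k e g"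
  shows "weight_ge k (d + e) (f * g)"
  unfolding weight_ge_def coeff2_mult
proof (intro allI impI sum.neutral ballI)
  fix i j a b assume h: "k * i + j < d + e" "a \<in> {0..i}" "b \<in> {0..j}"
  have "k * i = k * a + k * (i - a)" using h by (simp flip: distrib_left)
  then have "k * a + b < d \<or> k * (i - a) + (j - b) < e" using h by auto
  then show "coeff2 f a b * coeff2 g (i - a) (j - b) = 0"
    using weight_geD[OF assms(1)] weight_geD[OF assms(2)] by auto
qed

lemma weight_ge_mult_any: "weight_ge k d f \<Longrightarrow> weight_ge k d (g * f)"
  using weight_ge_mult[of k 0 g d f] by simp

text \<open>In lowest weight a factor only contributes its constant term.\<close>

lemma coeff2_mult_lowest:
  assumes "k \<ge> 1" "weight_ge k d f" "k * i + j = d"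
  shows "coeff2 (g * f) i j = coeff2 g 0 0 * coeff2 f i j"
proof -
  have "weight_ge k 1 (g - fps_const (fps_const (coeff2 g 0 0)))"
    using assms(1) by (auto simp: weight_ge_def)
  from weight_ge_mult[OF this assms(2)] have "coeff2 ((g - fps_const (fps_const (coeff2 g 0 0))) * f) i j = 0"
    using assms(3) by (intro weight_geD[of k "1 + d"]) auto
  then show ?thesis by (simp add: left_diff_distrib)
qed

lemma coeff2_X_deriv: "coeff2 (fps_X * fps_deriv f) i j = of_nat i * coeff2 f i j"
  by (cases i) (simp_all flip: fps_of_nat del: of_nat_Suc)

lemma coeff2_t_deriv: "coeff2 (fps_const fps_X * fps_deriv_coeffs f) i j = of_nat j * coeff2 f i j"
  by (cases j) (simp_all add: fps_deriv_coeffs_def del: of_nat_Suc)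

lemma euler_deriv_lowest:
  assumes "k \<ge> 1" "weight_ge k d f" "fps_nth \<eta> 0 = 1"
  shows weight_ge_euler_deriv: "weight_ge k d (euler_deriv k \<eta> f)"
    and coeff2_euler_deriv: "k * i + j = d \<Longrightarrow> coeff2 (euler_deriv k \<eta> f) i j = of_nat d * coeff2 f i j"
proof -
  have f: "weight_ge k d (fps_X * fps_deriv f)" "weight_ge k d (fps_const fps_X * fps_deriv_coeffs f)"
    using assms(2) unfolding weight_ge_def coeff2_X_deriv coeff2_t_deriv by auto
  have e: "euler_deriv k \<eta> f = of_nat k * (fps_X * fps_deriv f) + fps_const \<eta> * (fps_const fps_X * fps_deriv_coeffs f)"
    by (simp add: euler_deriv_def algebra_simps flip: fps_const_mult)
  show "weight_ge k d (euler_deriv k \<eta> f)"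
    unfolding e by (intro weight_ge_add weight_ge_mult_any f)
  assume ij: "k * i + j = d"
  have "coeff2 (of_nat k) 0 0 = of_nat k" by (simp flip: fps_of_nat)
  then show "coeff2 (euler_deriv k \<eta> f) i j = of_nat d * coeff2 f i j"
    unfolding e fps_add_nth coeff2_mult_lowest[OF assms(1) f(1) ij] coeff2_mult_lowest[OF assms(1) f(2) ij]
      coeff2_X_deriv coeff2_t_deriv using assms(3)
    by (simp add: algebra_simps flip: ij)
qed

lemma coeff2_pole_deriv:
  "coeff2 (pole_deriv f) i j = (if i = 0 then 0 else of_nat (i - 1) * coeff2 f (i - 1) j)"
proof -
  have e: "pole_deriv f = fps_X * (fps_X * fps_deriv f)" by (simp add: pole_deriv_def power2_eq_square mult.assoc)
  have shift: "fps_nth (fps_X * g) (Suc m) = fps_nth g m" for g :: series and m by simp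
  show ?thesis unfolding e by (cases i) (simp, simp only: shift coeff2_X_deriv, simp)
qed

lemma weight_ge_pole_deriv: "weight_ge k d f \<Longrightarrow> weight_ge k (d + k) (pole_deriv f)"
  unfolding weight_ge_def coeff2_pole_deriv
proof (intro allI impI)
  fix i j assume f: "\<forall>i j. k * i + j < d \<longrightarrow> coeff2 f i j = 0" and ij: "k * i + j < d + k"
  show "(if i = 0 then 0 else of_nat (i - 1) * coeff2 f (i - 1) j) = (0::complex)"
    using f[rule_format, of "i - 1" j] ij by (cases i) auto
qed

text \<open>The vector \<open>(y1, y2)\<close> is an approximate eigenvector of \<open>E = k z \<partial>\<^sub>z + t \<eta> \<partial>\<^sub>t + M\<close> for the eigenvalue
  \<open>k b1\<close> of \<open>M\<close> at the origin.  It is constructed weight by weight: on the parts of lowest weight \<open>d\<close> of the two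
  components \<open>E - k b1\<close> acts by \<open>d\<close> and \<open>d - k n\<close>, so that the first obstruction sits in weight \<open>k n\<close> of the
  second component.\<close>

lemma approximate_eigenvector:
  fixes M11 M12 M21 M22 :: series and k n :: nat and \<eta> :: "complex fps" and b1 b2 :: complex
  assumes k: "k \<ge> 1" and n: "n \<ge> 1" "b1 - b2 = of_nat n" and \<eta>: "fps_nth \<eta> 0 = 1"
    and M: "coeff2 M11 0 0 = of_nat k * b1" "coeff2 M12 0 0 = 0" "coeff2 M21 0 0 = 0"
      "coeff2 M22 0 0 = of_nat k * b2"
  defines "l \<equiv> fps_const (fps_const (of_nat k * b1))"
  shows "\<exists>y1 y2. coeff2 y1 0 0 = 1 \<and> coeff2 y2 0 0 = 0 \<and>
    weight_ge k (k * n + 1) (euler_deriv k \<eta> y1 + (M11 * y1 + M12 * y2) - l * y1) \<and>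
    weight_ge k (k * n) (euler_deriv k \<eta> y2 + (M21 * y1 + M22 * y2) - l * y2)"
proof -
  let ?r1 = "\<lambda>y1 y2. euler_deriv k \<eta> y1 + (M11 * y1 + M12 * y2) - l * y1"
  let ?r2 = "\<lambda>y1 y2. euler_deriv k \<eta> y2 + (M21 * y1 + M22 * y2) - l * y2"
  define hom where "hom = (\<lambda>d f. Abs_fps (\<lambda>i. Abs_fps (\<lambda>j. if k * i + j = d then f i j else 0)) :: series)"
  have hom: "weight_ge k d (hom d f)" "k * i + j = d \<Longrightarrow> coeff2 (hom d f) i j = f i j" for d f i j
    by (auto simp: hom_def weight_ge_def)
  have lead: "weight_ge k d (?r1 u1 u2)" "weight_ge k d (?r2 u1 u2)"
    "\<And>i j. k * i + j = d \<Longrightarrow> coeff2 (?r1 u1 u2) i j = of_nat d * coeff2 u1 i j"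
    "\<And>i j. k * i + j = d \<Longrightarrow> coeff2 (?r2 u1 u2) i j = (of_nat d - of_nat (k * n)) * coeff2 u2 i j"
    if u: "weight_ge k d u1" "weight_ge k d u2" for d u1 u2
  proof -
    show "weight_ge k d (?r1 u1 u2)" "weight_ge k d (?r2 u1 u2)"
      using u by (auto intro!: weight_ge_add weight_ge_diff weight_ge_mult_any weight_ge_euler_deriv[OF k _ \<eta>])
    fix i j assume ij: "k * i + j = d"
    have b: "b1 = b2 + of_nat n" using n(2) by (simp add: algebra_simps)
    note c = coeff2_mult_lowest[OF k u(1) ij] coeff2_mult_lowest[OF k u(2) ij]
      coeff2_euler_deriv[OF k u(1) \<eta> ij] coeff2_euler_deriv[OF k u(2) \<eta> ij]
    show "coeff2 (?r1 u1 u2) i j = of_nat d * coeff2 u1 i j"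
      "coeff2 (?r2 u1 u2) i j = (of_nat d - of_nat (k * n)) * coeff2 u2 i j"
      unfolding fps_sub_nth fps_add_nth c M by (simp_all add: l_def b algebra_simps)
  qed
  have "\<exists>y1 y2. coeff2 y1 0 0 = 1 \<and> coeff2 y2 0 0 = 0 \<and> weight_ge k (Suc d) (?r1 y1 y2) \<and> weight_ge k (Suc d) (?r2 y1 y2)"
    if "d < k * n" for d
    using that
  proof (induction d)
    case 0
    have "euler_deriv k \<eta> 1 = 0" "euler_deriv k \<eta> 0 = 0" by (simp_all add: euler_deriv_def)
    then show ?case using k M by (intro exI[of _ 1] exI[of _ 0]) (auto simp: weight_ge_def l_def)
  next
    case (Suc d)
    then obtain y1 y2 where y: "coeff2 y1 0 0 = 1" "coeff2 y2 0 0 = 0"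
      "weight_ge k (Suc d) (?r1 y1 y2)" "weight_ge k (Suc d) (?r2 y1 y2)" by auto
    define u1 where "u1 = hom (Suc d) (\<lambda>i j. - coeff2 (?r1 y1 y2) i j / of_nat (Suc d))"
    define u2 where "u2 = hom (Suc d) (\<lambda>i j. - coeff2 (?r2 y1 y2) i j / (of_nat (Suc d) - of_nat (k * n)))"
    have u: "weight_ge k (Suc d) u1" "weight_ge k (Suc d) u2" by (simp_all add: u1_def u2_def hom)
    have nz: "of_nat (Suc d) - of_nat (k * n) \<noteq> (0 :: complex)"
      using Suc.prems by (metis eq_iff_diff_eq_0 nat_neq_iff of_nat_eq_iff)
    have "?r1 (y1 + u1) (y2 + u2) = ?r1 y1 y2 + ?r1 u1 u2" "?r2 (y1 + u1) (y2 + u2) = ?r2 y1 y2 + ?r2 u1 u2"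
      by (simp_all add: euler_deriv_simps algebra_simps)
    moreover have "weight_ge k (Suc (Suc d)) (?r1 y1 y2 + ?r1 u1 u2)"
      unfolding weight_ge_Suc[of k "Suc d"]
    proof (intro conjI allI impI)
      show "weight_ge k (Suc d) (?r1 y1 y2 + ?r1 u1 u2)" using y(3) lead(1)[OF u] by (rule weight_ge_add)
      fix i j assume ij: "k * i + j = Suc d"
      have "coeff2 (?r1 u1 u2) i j = - coeff2 (?r1 y1 y2) i j"
        unfolding lead(3)[OF u ij] by (simp add: u1_def hom(2)[OF ij] del: of_nat_Suc)
      then show "coeff2 (?r1 y1 y2 + ?r1 u1 u2) i j = 0" by (rule coeff2_add_eq_0)
    qed
    moreover have "weight_ge k (Suc (Suc d)) (?r2 y1 y2 + ?r2 u1 u2)"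
      unfolding weight_ge_Suc[of k "Suc d"]
    proof (intro conjI allI impI)
      show "weight_ge k (Suc d) (?r2 y1 y2 + ?r2 u1 u2)" using y(4) lead(2)[OF u] by (rule weight_ge_add)
      fix i j assume ij: "k * i + j = Suc d"
      have "coeff2 (?r2 u1 u2) i j = - coeff2 (?r2 y1 y2) i j"
        unfolding lead(4)[OF u ij] using nz by (simp only: u2_def hom(2)[OF ij]) simp
      then show "coeff2 (?r2 y1 y2 + ?r2 u1 u2) i j = 0" by (rule coeff2_add_eq_0)
    qed
    moreover have "coeff2 (y1 + u1) 0 0 = 1" "coeff2 (y2 + u2) 0 0 = 0"
      using y(1,2) weight_geD[OF u(1), of 0 0] weight_geD[OF u(2), of 0 0] by auto
    ultimately show ?case by (intro exI[of _ "y1 + u1"] exI[of _ "y2 + u2"] conjI) simp_all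
  qed
  note ex = this
  have "k * n - 1 < k * n" "Suc (k * n - 1) = k * n" using k n(1) by auto
  with ex[of "k * n - 1"] obtain y1 y2 where y: "coeff2 y1 0 0 = 1" "coeff2 y2 0 0 = 0"
    "weight_ge k (k * n) (?r1 y1 y2)" "weight_ge k (k * n) (?r2 y1 y2)" by auto
  define u where "u = hom (k * n) (\<lambda>i j. - coeff2 (?r1 y1 y2) i j / of_nat (k * n))"
  have u: "weight_ge k (k * n) u" "weight_ge k (k * n) 0"
    by (simp only: u_def hom) (simp add: weight_ge_def)
  have eq: "?r1 (y1 + u) y2 = ?r1 y1 y2 + ?r1 u 0" "?r2 (y1 + u) y2 = ?r2 y1 y2 + ?r2 u 0"
    by (simp_all add: euler_deriv_simps euler_deriv_def algebra_simps)
  have "weight_ge k (Suc (k * n)) (?r1 (y1 + u) y2)"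
    unfolding eq weight_ge_Suc[of k "k * n"]
  proof (intro conjI allI impI)
    show "weight_ge k (k * n) (?r1 y1 y2 + ?r1 u 0)" using y(3) lead(1)[OF u] by (rule weight_ge_add)
    fix i j assume ij: "k * i + j = k * n"
    have "coeff2 (?r1 u 0) i j = - coeff2 (?r1 y1 y2) i j"
      unfolding lead(3)[OF u ij] using k n by (simp only: u_def hom(2)[OF ij]) simp
    then show "coeff2 (?r1 y1 y2 + ?r1 u 0) i j = 0" by (rule coeff2_add_eq_0)
  qed
  moreover have "weight_ge k (k * n) (?r2 (y1 + u) y2)"
    unfolding eq using y(4) lead(2)[OF u] by (rule weight_ge_add)
  moreover have "coeff2 (y1 + u) 0 0 = 1" using y(1) weight_geD[OF u(1), of 0 0] k n by simp
  ultimately show ?thesis using y(2) unfolding Suc_eq_plus1[symmetric] by blast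
qed

section \<open>The flatness equation in power series\<close>

definition commutator :: "(2 \<Rightarrow> 2 \<Rightarrow> 'a::comm_ring_1) \<Rightarrow> (2 \<Rightarrow> 2 \<Rightarrow> 'a) \<Rightarrow> 2 \<Rightarrow> 2 \<Rightarrow> 'a" where
  "commutator P Q i j = P i 1 * Q 1 j + P i 2 * Q 2 j - (Q i 1 * P 1 j + Q i 2 * P 2 j)"

text \<open>Flatness of \<open>d + A dt/z + B dz/z\<^sup>2\<close>.\<close>

definition flat_series :: "(2 \<Rightarrow> 2 \<Rightarrow> series) \<Rightarrow> (2 \<Rightarrow> 2 \<Rightarrow> series) \<Rightarrow> bool" where
  "flat_series A B \<longleftrightarrow> (\<forall>i j. fps_X * fps_deriv_coeffs (B i j) =
     commutator B A i j + fps_X ^ 2 * fps_deriv (A i j) - fps_X * A i j)"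

abbreviation zpart :: "(2 \<Rightarrow> 2 \<Rightarrow> series) \<Rightarrow> nat \<Rightarrow> 2 \<Rightarrow> 2 \<Rightarrow> complex fps" where
  "zpart B n i j \<equiv> fps_nth (B i j) n"

lemma flat_series_low_orders:
  assumes "flat_series A B"
  shows "commutator (zpart B 0) (zpart A 0) i j = 0"
    and "fps_deriv (zpart B 0 i j) = commutator (zpart B 1) (zpart A 0) i j + commutator (zpart B 0) (zpart A 1) i j
           - zpart A 0 i j"
    and "fps_deriv (zpart B 1 i j) = commutator (zpart B 2) (zpart A 0) i j + commutator (zpart B 1) (zpart A 1) i j
           + commutator (zpart B 0) (zpart A 2) i j"
proof -
  have e: "fps_nth (fps_X * fps_deriv_coeffs (B i j)) n =
     fps_nth (commutator B A i j + fps_X ^ 2 * fps_deriv (A i j) - fps_X * A i j) n" for n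
    using assms by (simp add: flat_series_def)
  have s: "{0..Suc 0} = {0, 1}" "{0..2} = {0, 1, 2::nat}" by auto
  show "commutator (zpart B 0) (zpart A 0) i j = 0"
    using e[of 0] by (simp add: commutator_def fps_mult_nth)
  show "fps_deriv (zpart B 0 i j) = commutator (zpart B 1) (zpart A 0) i j + commutator (zpart B 0) (zpart A 1) i j
           - zpart A 0 i j"
    using e[of 1] by (simp add: commutator_def fps_mult_nth s fps_X_def power2_eq_square fps_deriv_coeffs_def)
  show "fps_deriv (zpart B 1 i j) = commutator (zpart B 2) (zpart A 0) i j + commutator (zpart B 1) (zpart A 1) i j
           + commutator (zpart B 0) (zpart A 2) i j"
    using e[of 2] by (simp add: commutator_def fps_mult_nth s fps_X_def power2_eq_square fps_deriv_coeffs_def numeral_2_eq_2 algebra_simps)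
qed

lemma fps_mult_cancel: "(f::complex fps) \<noteq> 0 \<Longrightarrow> f * g = f * h \<Longrightarrow> g = h" by simp

text \<open>The formal situation at a point with a logarithmic pole: \<open>t\<^sup>k\<close> is the exact power of \<open>t\<close> in the pole part of a flat
  connection.\<close>

locale pole_part_series =
  fixes A B :: "2 \<Rightarrow> 2 \<Rightarrow> series" and C :: "2 \<Rightarrow> 2 \<Rightarrow> complex fps" and k :: nat
  assumes flat: "flat_series A B" and k: "k \<ge> 1" and B0: "\<And>i j. zpart B 0 i j = fps_X ^ k * C i j"
    and trace_free: "C 2 2 = - C 1 1" and nz: "\<exists>i j. fps_nth (C i j) 0 \<noteq> 0"
begin

lemma nz': "fps_nth (C 1 1) 0 \<noteq> 0 \<or> fps_nth (C 1 2) 0 \<noteq> 0 \<or> fps_nth (C 2 1) 0 \<noteq> 0"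
proof -
  obtain i j where "fps_nth (C i j) 0 \<noteq> 0" using nz by blast
  then show ?thesis using exhaust_2[of i] exhaust_2[of j] trace_free by auto
qed

text \<open>The matrix \<open>A\<^sub>0\<close> commutes with \<open>C\<close>, which is trace free and not zero at \<open>t = 0\<close>; so it is a combination of \<open>C\<close>
  and the identity.  Taking traces in \<open>B\<^sub>0' = [B\<^sub>1, A\<^sub>0] + [B\<^sub>0, A\<^sub>1] - A\<^sub>0\<close> shows that the identity does not occur.\<close>

lemma A0_multiple: "\<exists>a. \<forall>i j. zpart A 0 i j = a * C i j"
proof -
  note lo = flat_series_low_orders[OF flat]
  have X: "fps_X ^ k \<noteq> (0 :: complex fps)" by simp
  have comm: "commutator C (zpart A 0) i j = 0" for i j
  proof -
    have "fps_X ^ k * commutator C (zpart A 0) i j = 0"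
      using lo(1)[of i j] by (simp add: commutator_def B0 algebra_simps)
    then show ?thesis by simp
  qed
  have "fps_deriv (zpart B 0 1 1) + fps_deriv (zpart B 0 2 2) = 0"
    unfolding B0 trace_free by simp
  then have tr: "zpart A 0 2 2 = - zpart A 0 1 1"
    unfolding lo(2) commutator_def by algebra
  have "C 1 1 * zpart A 0 1 2 = C 1 2 * zpart A 0 1 1" "C 1 1 * zpart A 0 2 1 = C 2 1 * zpart A 0 1 1"
    "C 1 2 * zpart A 0 2 1 = C 2 1 * zpart A 0 1 2"
    using comm[of 1 2] comm[of 2 1] comm[of 1 1] unfolding commutator_def tr trace_free
    by (simp_all add: algebra_simps flip: mult_2)
  then obtain a where "zpart A 0 1 1 = a * C 1 1 \<and> zpart A 0 1 2 = a * C 1 2 \<and> zpart A 0 2 1 = a * C 2 1"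
    using fps_proportional[OF nz'] by metis
  then have "zpart A 0 i j = a * C i j" for i j
    using exhaust_2[of i] exhaust_2[of j] tr trace_free by auto
  then show ?thesis by blast
qed

definition scale :: "complex fps" where "scale = (SOME a. \<forall>i j. zpart A 0 i j = a * C i j)"

lemma A0: "zpart A 0 i j = scale * C i j"
  unfolding scale_def using someI_ex[OF A0_multiple] by blast

text \<open>Commutators with \<open>B\<^sub>0\<close>, and so with \<open>A\<^sub>0\<close>, do not contribute to the derivative of \<open>det B\<^sub>0\<close>; the term \<open>- A\<^sub>0\<close>
  remains and gives a linear equation of first order.  The same happens for the next coefficient of \<open>det B\<close>.\<close>

lemma det_leading_equation:
  "fps_X ^ k * fps_deriv (zpart B 0 1 1 * zpart B 0 2 2 - zpart B 0 1 2 * zpart B 0 2 1) =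
   - (fps_const 2 * scale * (zpart B 0 1 1 * zpart B 0 2 2 - zpart B 0 1 2 * zpart B 0 2 1))"
proof -
  define x where "x = (fps_X ^ k :: complex fps)"
  define c1 c2 c3 where c: "c1 = C 1 1" "c2 = C 1 2" "c3 = C 2 1"
  have b: "zpart B 0 1 1 = x * c1" "zpart B 0 1 2 = x * c2" "zpart B 0 2 1 = x * c3" "zpart B 0 2 2 = - (x * c1)"
    by (simp_all add: B0 trace_free x_def c)
  have a: "zpart A 0 1 1 = scale * c1" "zpart A 0 1 2 = scale * c2" "zpart A 0 2 1 = scale * c3" "zpart A 0 2 2 = - (scale * c1)"
    by (simp_all add: A0 trace_free c)
  note d = flat_series_low_orders(2)[OF flat]
  have two: "fps_const 2 = (2 :: complex fps)" by (simp add: numeral_fps_const)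
  show ?thesis
    unfolding two fps_deriv_mult fps_deriv_sub d unfolding commutator_def a b x_def[symmetric]
    by (simp add: algebra_simps)
qed

lemma det_next_equation:
  "fps_X ^ k * fps_deriv (zpart B 0 1 1 * zpart B 1 2 2 + zpart B 1 1 1 * zpart B 0 2 2
      - zpart B 0 1 2 * zpart B 1 2 1 - zpart B 1 1 2 * zpart B 0 2 1) =
   - (scale * (zpart B 0 1 1 * zpart B 1 2 2 + zpart B 1 1 1 * zpart B 0 2 2
      - zpart B 0 1 2 * zpart B 1 2 1 - zpart B 1 1 2 * zpart B 0 2 1))"
proof -
  define x where "x = (fps_X ^ k :: complex fps)"
  define c1 c2 c3 where c: "c1 = C 1 1" "c2 = C 1 2" "c3 = C 2 1"
  have b: "zpart B 0 1 1 = x * c1" "zpart B 0 1 2 = x * c2" "zpart B 0 2 1 = x * c3" "zpart B 0 2 2 = - (x * c1)"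
    by (simp_all add: B0 trace_free x_def c)
  have a: "zpart A 0 1 1 = scale * c1" "zpart A 0 1 2 = scale * c2" "zpart A 0 2 1 = scale * c3" "zpart A 0 2 2 = - (scale * c1)"
    by (simp_all add: A0 trace_free c)
  note d = flat_series_low_orders(2,3)[OF flat]
  show ?thesis
    unfolding fps_deriv_mult fps_deriv_sub fps_deriv_add d unfolding commutator_def a b x_def[symmetric]
    by (simp add: algebra_simps)
qed

definition residue_part :: "2 \<Rightarrow> 2 \<Rightarrow> complex" where "residue_part i j = coeff2 (B i j) 1 0"

definition leading_part :: "2 \<Rightarrow> 2 \<Rightarrow> complex" where "leading_part i j = fps_nth (C i j) 0"

text \<open>This is the coefficient of \<open>t\<^sup>(\<^sup>k\<^sup>-\<^sup>1\<^sup>)\<close> in \<open>B\<^sub>0' = [B\<^sub>1, A\<^sub>0] + [B\<^sub>0, A\<^sub>1] - A\<^sub>0\<close>.\<close>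

lemma residue_commutator:
  assumes s: "scale = fps_X ^ (k - 1) * s"
  shows "of_nat k * leading_part i j = fps_nth s 0 * (commutator residue_part leading_part i j - leading_part i j)"
proof -
  have "of_nat k * fps_nth (C i j) 0 = fps_nth s 0 * (fps_nth (commutator (zpart B 1) C i j) 0 - fps_nth (C i j) 0)"
  proof (rule fps_leading_coefficient_relation[OF k, where v = "commutator C (zpart A 1) i j"])
    show "fps_deriv (fps_X ^ k * C i j) = fps_X ^ (k - 1) * s * (commutator (zpart B 1) C i j - C i j)
        + fps_X ^ k * commutator C (zpart A 1) i j"
      using flat_series_low_orders(2)[OF flat, of i j] unfolding B0 A0 s commutator_def
      by (simp add: algebra_simps)
  qed
  then show ?thesis by (simp add: commutator_def residue_part_def leading_part_def)
qed

text \<open>If a function of \<open>t\<close> of order \<open>m\<close> solves the equation of the determinant (\<open>\<kappa> = 2\<close>) or of the next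
  coefficient (\<open>\<kappa> = 1\<close>), then \<open>C(0)\<close> is an eigenvector of the commutator with the residue.\<close>

lemma residue_commutator_eigenvalue:
  assumes "fps_X ^ k * fps_deriv \<delta> = - (fps_const \<kappa> * scale * \<delta>)" "\<delta> \<noteq> 0" "\<kappa> \<noteq> 0" "subdegree \<delta> > 0"
  shows "commutator residue_part leading_part i j = (1 - \<kappa> * of_nat k / of_nat (subdegree \<delta>)) * leading_part i j"
proof -
  obtain s where s: "scale = fps_X ^ (k - 1) * s" "\<kappa> * fps_nth s 0 = - of_nat (subdegree \<delta>)"
    using fps_logarithmic_derivative[OF assms(1,2) k assms(3)] by blast
  define m where "m = (of_nat (subdegree \<delta>) :: complex)"
  have m: "m \<noteq> 0" using assms(4) by (simp add: m_def)
  have s0: "fps_nth s 0 = - m / \<kappa>" using s(2) assms(3) by (simp add: m_def field_simps)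
  show ?thesis
    using residue_commutator[OF s(1), of i j] assms(3) m
    unfolding s0 m_def[symmetric] by (simp add: field_simps)
qed

text \<open>The commutator relation in the form to which \<open>commutator_eigenvector\<close> applies.\<close>

lemma residue_relations:
  assumes "\<And>i j. commutator residue_part leading_part i j = l * leading_part i j"
  shows "residue_part 1 2 * leading_part 2 1 - leading_part 1 2 * residue_part 2 1 = l * leading_part 1 1"
    "(residue_part 1 1 - residue_part 2 2) * leading_part 1 2 - 2 * residue_part 1 2 * leading_part 1 1 = l * leading_part 1 2"
    "2 * residue_part 2 1 * leading_part 1 1 - (residue_part 1 1 - residue_part 2 2) * leading_part 2 1 = l * leading_part 2 1"
proof -
  have "leading_part 2 2 = - leading_part 1 1" by (simp add: leading_part_def trace_free)
  then show "residue_part 1 2 * leading_part 2 1 - leading_part 1 2 * residue_part 2 1 = l * leading_part 1 1"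
    "(residue_part 1 1 - residue_part 2 2) * leading_part 1 2 - 2 * residue_part 1 2 * leading_part 1 1 = l * leading_part 1 2"
    "2 * residue_part 2 1 * leading_part 1 1 - (residue_part 1 1 - residue_part 2 2) * leading_part 2 1 = l * leading_part 2 1"
    using assms[of 1 1] assms[of 1 2] assms[of 2 1] unfolding commutator_def by algebra+
qed

text \<open>This is \<open>- det C\<close>, the square of the eigenvalues of \<open>C\<close>.\<close>

definition discriminant_part :: "complex fps" where
  "discriminant_part = C 1 1 * C 1 1 + C 1 2 * C 2 1"

lemma det_leading: "zpart B 0 1 1 * zpart B 0 2 2 - zpart B 0 1 2 * zpart B 0 2 1
   = - (fps_X ^ (2 * k) * discriminant_part)"
  unfolding B0 trace_free discriminant_part_def mult_2 power_add by (simp add: algebra_simps)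

text \<open>If the order of \<open>det B\<^sub>0 = t\<^sup>2\<^sup>k det C\<close> is larger than \<open>2 k\<close>, then \<open>C(0)\<close> is nilpotent.  If it is \<open>2 k\<close>, then
  the eigenvalue \<open>l0\<close> of the commutator with the residue vanishes.\<close>

theorem semisimple_case:
  defines "\<delta> \<equiv> zpart B 0 1 1 * zpart B 0 2 2 - zpart B 0 1 2 * zpart B 0 2 1"
    and "l0 \<equiv> (1 - 2 * of_nat k / (of_nat (subdegree (zpart B 0 1 1 * zpart B 0 2 2 - zpart B 0 1 2 * zpart B 0 2 1))) :: complex)"
  assumes \<delta>: "\<delta> \<noteq> 0"
  shows "subdegree \<delta> \<ge> 2 * k"
    and "subdegree \<delta> > 2 * k \<Longrightarrow> (residue_part 1 1 - residue_part 2 2)^2 + 4 * residue_part 1 2 * residue_part 2 1 = l0^2"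
    and "subdegree \<delta> = 2 * k \<Longrightarrow> fps_nth discriminant_part 0 \<noteq> 0"
    and "subdegree \<delta> = 2 * k \<Longrightarrow> commutator residue_part leading_part i j = 0"
proof -
  have d: "\<delta> = - (fps_X ^ (2 * k) * discriminant_part)" unfolding \<delta>_def by (rule det_leading)
  have dn: "discriminant_part \<noteq> 0" using \<delta> d by auto
  then have sd: "subdegree \<delta> = 2 * k + subdegree discriminant_part" unfolding d by simp
  then show "subdegree \<delta> \<ge> 2 * k" by simp
  then have pos: "subdegree \<delta> > 0" using k by linarith
  have l: "commutator residue_part leading_part i j = l0 * leading_part i j" for i j
    using residue_commutator_eigenvalue[OF det_leading_equation, of i j] \<delta> pos unfolding l0_def \<delta>_def by simp
  note r = residue_relations[OF l]
  have nzl: "leading_part 1 1 \<noteq> 0 \<or> leading_part 1 2 \<noteq> 0 \<or> leading_part 2 1 \<noteq> 0"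
    using nz' by (simp add: leading_part_def)
  show "(residue_part 1 1 - residue_part 2 2)^2 + 4 * residue_part 1 2 * residue_part 2 1 = l0^2" if "subdegree \<delta> > 2 * k"
  proof (rule commutator_discriminant[OF nzl r])
    have "subdegree discriminant_part > 0" using that sd by simp
    then have "fps_nth discriminant_part 0 = 0" by (rule nth_less_subdegree_zero)
    then show "leading_part 1 1 * leading_part 1 1 + leading_part 1 2 * leading_part 2 1 = 0"
      by (simp add: discriminant_part_def leading_part_def)
  qed
  show "fps_nth discriminant_part 0 \<noteq> 0" if "subdegree \<delta> = 2 * k"
    using that sd dn by (metis add_cancel_right_right subdegree_eq_0_iff)
  show "commutator residue_part leading_part i j = 0" if "subdegree \<delta> = 2 * k"
    using l k that unfolding l0_def \<delta>_def by simp
qed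

text \<open>The coefficient of \<open>z\<close> in \<open>det B\<close> is \<open>- t\<^sup>k tr (C B\<^sub>1)\<close>.  As \<open>C(0)\<close> is nilpotent, \<open>tr (C(0) R) = 0\<close>, and this raises
  the order above \<open>k\<close>.\<close>

theorem nilpotent_case:
  defines "\<delta> \<equiv> zpart B 0 1 1 * zpart B 1 2 2 + zpart B 1 1 1 * zpart B 0 2 2
      - zpart B 0 1 2 * zpart B 1 2 1 - zpart B 1 1 2 * zpart B 0 2 1"
  defines "l0 \<equiv> (1 - of_nat k / of_nat (subdegree \<delta>) :: complex)"
  assumes nil: "zpart B 0 1 1 * zpart B 0 2 2 - zpart B 0 1 2 * zpart B 0 2 1 = 0" and \<delta>: "\<delta> \<noteq> 0"
  shows "subdegree \<delta> > k"
    and "(residue_part 1 1 - residue_part 2 2)^2 + 4 * residue_part 1 2 * residue_part 2 1 = l0^2"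
proof -
  define g where "g = C 1 1 * (zpart B 1 1 1 - zpart B 1 2 2) + C 1 2 * zpart B 1 2 1 + C 2 1 * zpart B 1 1 2"
  have dg: "\<delta> = - (fps_X ^ k * g)" by (simp add: \<delta>_def B0 trace_free g_def algebra_simps)
  then have gn: "g \<noteq> 0" using \<delta> by auto
  have sd: "subdegree \<delta> = k + subdegree g" using gn unfolding dg by simp
  then have pos: "subdegree \<delta> > 0" using k by simp
  have one: "fps_const 1 = (1 :: complex fps)" by simp
  have l: "commutator residue_part leading_part i j = l0 * leading_part i j" for i j
    using residue_commutator_eigenvalue[of \<delta> 1 i j] det_next_equation \<delta> pos unfolding l0_def \<delta>_def by simp
  note r = residue_relations[OF l]
  have nzl: "leading_part 1 1 \<noteq> 0 \<or> leading_part 1 2 \<noteq> 0 \<or> leading_part 2 1 \<noteq> 0"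
    using nz' by (simp add: leading_part_def)
  have "discriminant_part = 0" using nil unfolding det_leading by simp
  then have "fps_nth discriminant_part 0 = 0" by simp
  then have nl: "leading_part 1 1 * leading_part 1 1 + leading_part 1 2 * leading_part 2 1 = 0"
    by (simp add: discriminant_part_def leading_part_def)
  show "(residue_part 1 1 - residue_part 2 2)^2 + 4 * residue_part 1 2 * residue_part 2 1 = l0^2"
    by (rule commutator_discriminant[OF nzl r nl])
  have "fps_nth g 0 = 0"
    using commutator_trace[OF nzl r nl] by (simp add: g_def residue_part_def leading_part_def)
  then have "subdegree g > 0" using gn by (metis subdegree_eq_0_iff gr0I)
  then show "subdegree \<delta> > k" using sd by simp
qed

end

section \<open>Resonance: no logarithms\<close>

lemma fps_square_root:
  fixes u :: "complex fps" and c :: complex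
  assumes "c^2 = fps_nth u 0" "fps_nth u 0 \<noteq> 0"
  obtains s where "s^2 = u" "fps_nth s 0 = c"
proof
  have "(\<lambda>_ _. c) (Suc 1) (fps_nth u 0) ^ Suc 1 = fps_nth u 0" using assms(1) by (simp add: power2_eq_square)
  from power_radical[of u "\<lambda>_ _. c" 1] assms(2) this
  show "(fps_radical (\<lambda>_ _. c) 2 u)^2 = u" by (simp add: numeral_2_eq_2)
  show "fps_nth (fps_radical (\<lambda>_ _. c) 2 u) 0 = c" by (simp add: numeral_2_eq_2)
qed

text \<open>On the part of lowest weight \<open>d\<close> of the two components of \<open>w\<close> the operator \<open>E - k b1 - k\<close> acts by \<open>d - k\<close> and
  \<open>d - k n - k\<close>.  Neither vanishes for \<open>k < d < k n + k\<close>; so \<open>w\<close> starts in weight \<open>k n + k\<close>, where the second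
  component is annihilated.\<close>

lemma lowest_weight_vanishes:
  fixes M11 M12 M21 M22 w1 w2 :: series and k n :: nat and \<eta> :: "complex fps" and b1 b2 :: complex
  assumes k: "k \<ge> 1" and b: "b1 - b2 = of_nat n" and \<eta>: "fps_nth \<eta> 0 = 1"
    and M: "coeff2 M11 0 0 = of_nat k * b1" "coeff2 M12 0 0 = 0" "coeff2 M21 0 0 = 0"
      "coeff2 M22 0 0 = of_nat k * b2"
    and l: "l = fps_const (fps_const (of_nat k * b1 + of_nat k))"
    and w: "weight_ge k (k + 1) w1" "weight_ge k (k + 1) w2"
    and R: "weight_ge k (k * n + k) (euler_deriv k \<eta> w1 + (M11 * w1 + M12 * w2) - l * w1)"
           "weight_ge k (k * n + k) (euler_deriv k \<eta> w2 + (M21 * w1 + M22 * w2) - l * w2)"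
    and ij: "k * i + j = k * n + k" and n: "n \<ge> 1"
  shows "coeff2 (euler_deriv k \<eta> w2 + (M21 * w1 + M22 * w2) - l * w2) i j = 0"
proof -
  let ?r1 = "euler_deriv k \<eta> w1 + (M11 * w1 + M12 * w2) - l * w1"
  let ?r2 = "euler_deriv k \<eta> w2 + (M21 * w1 + M22 * w2) - l * w2"
  have b1: "b1 = b2 + of_nat n" using b by (simp add: algebra_simps)
  have lead: "coeff2 ?r1 i j = (of_nat d - of_nat k) * coeff2 w1 i j"
    "coeff2 ?r2 i j = (of_nat d - of_nat (k * n + k)) * coeff2 w2 i j"
    if u: "weight_ge k d w1" "weight_ge k d w2" and ij: "k * i + j = d" for d i j
  proof -
    note c = coeff2_mult_lowest[OF k u(1) ij] coeff2_mult_lowest[OF k u(2) ij]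
      coeff2_euler_deriv[OF k u(1) \<eta> ij] coeff2_euler_deriv[OF k u(2) \<eta> ij]
    show "coeff2 ?r1 i j = (of_nat d - of_nat k) * coeff2 w1 i j"
      "coeff2 ?r2 i j = (of_nat d - of_nat (k * n + k)) * coeff2 w2 i j"
      unfolding fps_sub_nth fps_add_nth c M by (simp_all add: l b1 algebra_simps)
  qed
  have "weight_ge k (k + 1 + m) w1 \<and> weight_ge k (k + 1 + m) w2" if "k + 1 + m \<le> k * n + k" for m
    using that
  proof (induction m)
    case 0 then show ?case using w by simp
  next
    case (Suc m)
    define d where "d = k + 1 + m"
    have IH: "weight_ge k d w1" "weight_ge k d w2" using Suc by (auto simp: d_def)
    have d: "k < d" "d < k * n + k" using Suc.prems by (auto simp: d_def)
    have nz: "of_nat d - of_nat k \<noteq> (0 :: complex)" "of_nat d - of_nat (k * n + k) \<noteq> (0 :: complex)"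
      using d by (simp_all only: right_minus_eq of_nat_eq_iff)
    have "coeff2 w1 i j = 0" "coeff2 w2 i j = 0" if ij: "k * i + j = d" for i j
      using lead[OF IH ij] nz weight_geD[OF R(1), of i j] weight_geD[OF R(2), of i j] ij d(2) by auto
    then have "weight_ge k (Suc d) w1" "weight_ge k (Suc d) w2" using IH by (auto simp: weight_ge_Suc)
    then show ?case by (simp add: d_def)
  qed
  from this[of "k * n - 1"] have "weight_ge k (k * n + k) w1" "weight_ge k (k * n + k) w2"
    using k n by (auto simp: algebra_simps)
  from lead(2)[OF this ij] show ?thesis by simp
qed

text \<open>With \<open>f = \<Sum> r i j z\<^sup>i t\<^sup>j\<close> the hypothesis is \<open>z\<^sup>2 f\<^sub>z = (n z + 2 \<alpha> t\<^sup>k) f\<close> in weight \<open>k n + k\<close>.  It kills the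
  coefficients of \<open>f\<close> one after the other, beginning with the lowest power of \<open>z\<close>.\<close>

lemma obstruction_recursion:
  fixes r :: "nat \<Rightarrow> nat \<Rightarrow> complex" and \<alpha> :: complex
  assumes \<alpha>: "\<alpha> \<noteq> 0" and k: "k \<ge> 1"
    and rec: "\<And>i j. k * i + j = k * n + k \<Longrightarrow>
       (if i = 0 then 0 else (of_nat (i - 1) - of_nat n) * r (i - 1) j) - 2 * \<alpha> * (if j < k then 0 else r i (j - k)) = 0"
  shows "i \<le> n \<Longrightarrow> r i (k * (n - i)) = 0"
proof (induction i)
  case 0
  show ?case using rec[of 0 "k * n + k"] \<alpha> by simp
next
  case (Suc i)
  then obtain d where n: "n = Suc i + d" using le_Suc_ex by blast
  have "k * Suc i + (k * d + k) = k * n + k" by (simp add: n algebra_simps)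
  from rec[OF this] Suc.IH \<alpha> show ?case by (simp add: n algebra_simps)
qed

context pole_part_series begin

text \<open>The recursion for a formal solution \<open>\<Sum> Y\<^sub>i z\<^sup>i\<close> at \<open>t = 0\<close> starting with the eigenvector of \<open>b1\<close> has a resonance in
  degree \<open>n\<close>; the lemma says that it is solvable there.  Let \<open>P = z\<^sup>2 \<nabla>\<^sub>z\<close>, let \<open>y\<close> be the approximate eigenvector of \<open>E\<close>
  with eigenvalue \<open>k b1\<close> and error \<open>r\<close>, and let \<open>p = q + b1 z\<close>, which satisfies \<open>E p = k p\<close>.  From \<open>[E, P] = k P\<close> the
  vector \<open>w = (P - p) y\<close> satisfies \<open>(E - k b1 - k) w = (P - p) r\<close>, so that the part of weight \<open>k n + k\<close> of the
  second component of \<open>(P - p) r\<close> vanishes.  This is the differential equation that forces the part of weight \<open>k n\<close>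
  of \<open>r\<close> to be zero.\<close>

lemma no_resonance_obstruction:
  fixes \<alpha> b1 b2 :: complex and n :: nat
  assumes \<alpha>: "leading_part 1 1 = \<alpha>" "\<alpha> \<noteq> 0" "leading_part 1 2 = 0" "leading_part 2 1 = 0"
    and R: "residue_part 1 1 = b1" "residue_part 2 2 = b2" "residue_part 1 2 = 0" "residue_part 2 1 = 0"
    and n: "b1 - b2 = of_nat n" "n \<ge> 1"
  shows "\<exists>Y :: nat \<Rightarrow> 2 \<Rightarrow> complex. Y 0 1 = 1 \<and> Y 0 2 = 0 \<and> (\<forall>i\<le>n. \<forall>l. of_nat i * Y i l +
     (\<Sum>m\<le>i. coeff2 (B l 1) (Suc m) 0 * Y (i - m) 1 + coeff2 (B l 2) (Suc m) 0 * Y (i - m) 2) = b1 * Y i l)"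
proof -
  let ?X = "fps_X :: complex fps"
  \<comment> \<open>The eigenvalue \<open>q\<close> of the pole part, and the vector field with \<open>k z \<partial>\<^sub>z + \<xi> \<partial>\<^sub>t\<close> acting on \<open>q\<close> by \<open>k\<close>.\<close>
  have d0: "fps_nth discriminant_part 0 = \<alpha>^2"
    using \<alpha> by (simp add: discriminant_part_def leading_part_def power2_eq_square)
  obtain s where s: "s^2 = discriminant_part" "fps_nth s 0 = \<alpha>"
    using fps_square_root[of \<alpha> discriminant_part] d0 \<alpha>(2) by auto
  define q where "q = ?X ^ k * s"
  define g where "g = of_nat k * s + ?X * fps_deriv s"
  have g0: "fps_nth g 0 = of_nat k * \<alpha>" using s by (simp add: g_def flip: fps_of_nat)
  define \<eta> where "\<eta> = of_nat k * s * inverse g"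
  have ginv: "inverse g * g = 1" using g0 k \<alpha>(2) by (intro inverse_mult_eq_1) simp
  have \<eta>0: "fps_nth \<eta> 0 = 1" using g0 k \<alpha>(2) s by (simp add: \<eta>_def field_simps flip: fps_of_nat)
  have Xk: "?X ^ k = ?X * ?X ^ (k - 1)" using k by (cases k) auto
  have qd: "fps_deriv q = ?X ^ (k - 1) * g" unfolding q_def g_def by (rule fps_deriv_X_power_mult[OF k])
  have \<xi>q: "?X * \<eta> * fps_deriv q = of_nat k * q"
    unfolding qd unfolding q_def \<eta>_def Xk using ginv by (simp add: mult_ac)
  have \<delta>q: "- (?X ^ (2 * k) * discriminant_part) = - (q * q)"
    by (simp add: q_def mult_2 power_add flip: s(1)) (simp add: power2_eq_square mult_ac)
  have qn: "q \<noteq> 0" using s \<alpha>(2) by (auto simp: q_def)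
  have "2 * q * (?X ^ k * fps_deriv q) = 2 * q * (- (scale * q))"
  proof -
    have "?X ^ k * (- (q * fps_deriv q + fps_deriv q * q)) = - (2 * scale * (- (q * q)))"
      using det_leading_equation unfolding det_leading \<delta>q fps_deriv_neg fps_deriv_mult by (simp add: numeral_fps_const)
    moreover have "2 * q * (x * d) = 2 * q * (- (s * q))" if "x * (- (q * d + d * q)) = - (2 * s * (- (q * q)))"
      for x d s :: "complex fps" using that by algebra
    ultimately show ?thesis by blast
  qed
  then have aq: "?X ^ k * fps_deriv q = - (scale * q)" using qn by (metis fps_mult_cancel mult_eq_0_iff zero_neq_numeral)
  have "q * (?X * \<eta> * scale) = - (?X ^ k) * (?X * \<eta> * fps_deriv q)" using aq by (simp add: algebra_simps)
  then have "q * (?X * \<eta> * scale) = q * (- (of_nat k * ?X ^ k))" unfolding \<xi>q by (simp add: algebra_simps)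
  then have \<xi>a: "?X * \<eta> * scale = - (of_nat k * ?X ^ k)" using qn by (metis fps_mult_cancel)
  \<comment> \<open>The operator \<open>E = (k z\<^sup>2 \<nabla>\<^sub>z + \<xi> z \<nabla>\<^sub>t) / z\<close> has no pole, because \<open>\<xi>\<close> is chosen such that the terms
    without \<open>z\<close> cancel.\<close>
  define \<xi> where "\<xi> = (fps_const (?X * \<eta>) :: series)"
  define M where "M = (\<lambda>i j. fps_shift 1 (of_nat k * B i j + \<xi> * A i j))"
  have kn: "fps_nth (of_nat k * f) m = of_nat k * fps_nth f m" for f :: series and m
    by (simp flip: fps_of_nat)
  have kn': "fps_nth (of_nat k * f) m = of_nat k * fps_nth f m" for f :: "complex fps" and m
    by (simp flip: fps_of_nat)
  have zM: "fps_X * M i j = of_nat k * B i j + \<xi> * A i j" for i j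
  proof -
    have "fps_nth (of_nat k * B i j + \<xi> * A i j) 0 = (of_nat k * ?X ^ k + ?X * \<eta> * scale) * C i j"
      by (simp add: kn \<xi>_def B0 A0 algebra_simps)
    also have "\<dots> = 0" unfolding \<xi>a by simp
    finally show ?thesis unfolding M_def
      by (intro fps_ext) (simp add: fps_X_mult_nth del: fps_add_nth)
  qed
  have M_nth: "fps_nth (M i j) m = of_nat k * fps_nth (B i j) (Suc m) + ?X * \<eta> * fps_nth (A i j) (Suc m)" for i j m
    by (simp add: M_def kn \<xi>_def)
  have M0: "coeff2 (M i j) m 0 = of_nat k * coeff2 (B i j) (Suc m) 0" for i j m
    unfolding M_nth by (simp add: kn' mult.assoc)
  have M00: "coeff2 (M i j) 0 0 = of_nat k * residue_part i j" for i j
    unfolding M0 by (simp add: residue_part_def)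
  let ?E = "euler_deriv k \<eta>" and ?P = pole_deriv
  have comm: "?E (B i j) + commutator M B i j - ?P (M i j) = of_nat k * B i j" for i j
  proof -
    have fl: "fps_X * fps_deriv_coeffs (B i j) = commutator B A i j + fps_X ^ 2 * fps_deriv (A i j) - fps_X * A i j"
      using flat by (simp add: flat_series_def)
    have c: "fps_X * commutator M B i j = \<xi> * commutator A B i j"
    proof -
      have "fps_X * commutator M B i j = commutator (\<lambda>i j. fps_X * M i j) B i j"
        by (simp add: commutator_def algebra_simps)
      then show ?thesis unfolding zM by (simp add: commutator_def algebra_simps)
    qed
    have "fps_X * fps_deriv (M i j) + M i j = of_nat k * fps_deriv (B i j) + \<xi> * fps_deriv (A i j)"
      using arg_cong[OF zM[of i j], of fps_deriv] by (simp add: \<xi>_def)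
    then have dM: "fps_X * fps_deriv (M i j) = of_nat k * fps_deriv (B i j) + \<xi> * fps_deriv (A i j) - M i j"
      by (simp add: algebra_simps)
    have pM: "fps_X * ?P (M i j) = fps_X ^ 2 * (of_nat k * fps_deriv (B i j) + \<xi> * fps_deriv (A i j)) - fps_X * (of_nat k * B i j + \<xi> * A i j)"
    proof -
      have "fps_X * ?P (M i j) = fps_X ^ 2 * (fps_X * fps_deriv (M i j))" by (simp add: pole_deriv_def mult_ac)
      then show ?thesis unfolding dM right_diff_distrib using zM[of i j] by (simp add: power2_eq_square mult.assoc)
    qed
    have "fps_X * (?E (B i j) + commutator M B i j - ?P (M i j)) =
       \<xi> * (fps_X * fps_deriv_coeffs (B i j)) + of_nat k * fps_X ^ 2 * fps_deriv (B i j) + \<xi> * commutator A B i j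
       - (fps_X ^ 2 * (of_nat k * fps_deriv (B i j) + \<xi> * fps_deriv (A i j)) - fps_X * (of_nat k * B i j + \<xi> * A i j))"
      unfolding right_diff_distrib[of fps_X] distrib_left[of fps_X] c pM
      by (simp add: euler_deriv_def \<xi>_def power2_eq_square algebra_simps)
    also have "\<dots> = fps_X * (of_nat k * B i j)"
      unfolding fl by (simp add: commutator_def algebra_simps)
    finally show ?thesis by (metis fps_X_neq_zero mult_left_cancel)
  qed
  obtain y1 y2 where y: "coeff2 y1 0 0 = 1" "coeff2 y2 0 0 = 0"
    "weight_ge k (k * n + 1) (?E y1 + (M 1 1 * y1 + M 1 2 * y2) - fps_const (fps_const (of_nat k * b1)) * y1)"
    "weight_ge k (k * n) (?E y2 + (M 2 1 * y1 + M 2 2 * y2) - fps_const (fps_const (of_nat k * b1)) * y2)"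
    using approximate_eigenvector[OF k n(2,1) \<eta>0, of "M 1 1" "M 1 2" "M 2 1" "M 2 2"] M00 R by auto
  define r1 where "r1 = ?E y1 + (M 1 1 * y1 + M 1 2 * y2) - fps_const (fps_const (of_nat k * b1)) * y1"
  define r2 where "r2 = ?E y2 + (M 2 1 * y1 + M 2 2 * y2) - fps_const (fps_const (of_nat k * b1)) * y2"
  note r = y(3,4)[folded r1_def r2_def]
  define p where "p = fps_const q + fps_const (fps_const b1) * fps_X"
  define w1 where "w1 = ?P y1 + (B 1 1 * y1 + B 1 2 * y2) - p * y1"
  define w2 where "w2 = ?P y2 + (B 2 1 * y1 + B 2 2 * y2) - p * y2"
  let ?l = "fps_const (fps_const (of_nat k * b1 + of_nat k)) :: series"
  have lk: "?l = fps_const (fps_const (of_nat k * b1)) + of_nat k"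
    by (simp flip: fps_of_nat fps_const_add)
  have Ep: "?E p = of_nat k * p"
    unfolding p_def euler_deriv_def using \<xi>q by (simp add: algebra_simps) (simp add: fps_of_nat flip: fps_const_mult)
  have Pc: "?P (fps_const c) = 0" "?E (fps_const (fps_const c')) = 0" for c c' by (simp_all add: pole_deriv_def euler_deriv_def)
  have Rw1: "?E w1 + (M 1 1 * w1 + M 1 2 * w2) - ?l * w1 = ?P r1 + (B 1 1 * r1 + B 1 2 * r2) - p * r1"
    using comm[of 1 1] comm[of 1 2] unfolding w1_def w2_def r1_def r2_def lk euler_deriv_simps pole_deriv_simps Ep Pc
      euler_pole_commutator commutator_def by algebra
  have Rw2: "?E w2 + (M 2 1 * w1 + M 2 2 * w2) - ?l * w2 = ?P r2 + (B 2 1 * r1 + B 2 2 * r2) - p * r2"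
    using comm[of 2 1] comm[of 2 2] unfolding w1_def w2_def r1_def r2_def lk euler_deriv_simps pole_deriv_simps Ep Pc
      euler_pole_commutator commutator_def by algebra
  \<comment> \<open>Up to higher weight \<open>B\<close> is diagonal with the entries \<open>p\<close> and \<open>p - 2 \<alpha> t\<^sup>k - n z\<close>.\<close>
  have low: "i = 0 \<and> j < k \<or> i = 0 \<and> j = k \<or> i = 1 \<and> j = 0" if "k * i + j < k + 1" for i j
  proof -
    have "i < 2" using that k by (cases "i \<ge> 2") (auto dest: mult_le_mono2[of 2 i k])
    then show ?thesis using that by (auto simp: less_2_cases_iff)
  qed
  have Bz: "coeff2 (B i j) 0 m = (if m < k then 0 else fps_nth (C i j) (m - k))" for i j m
    by (simp add: B0 fps_X_power_mult_nth)
  have qz: "fps_nth q m = (if m < k then 0 else fps_nth s (m - k))" for m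
    by (simp add: q_def fps_X_power_mult_nth)
  have p0: "coeff2 p 0 m = fps_nth q m" "coeff2 p 1 0 = b1" for m
    by (simp_all add: p_def)
  have wI: "weight_ge k (k + 1) f" if "\<And>m. m \<le> k \<Longrightarrow> coeff2 f 0 m = 0" "coeff2 f 1 0 = 0" for f
    unfolding weight_ge_def
  proof (intro allI impI)
    fix i j assume "k * i + j < k + 1"
    from low[OF this] show "coeff2 f i j = 0" using that by auto
  qed
  have wI': "weight_ge k k f" if "\<And>m. m < k \<Longrightarrow> coeff2 f 0 m = 0" for f
    unfolding weight_ge_def
  proof (intro allI impI)
    fix i j assume h: "k * i + j < k"
    from low[of i j] h k show "coeff2 f i j = 0" using that by auto
  qed
  have R': "coeff2 (B 1 1) 1 0 = b1" "coeff2 (B 2 2) 1 0 = b2" "coeff2 (B 1 2) 1 0 = 0" "coeff2 (B 2 1) 1 0 = 0"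
    "fps_nth (C 1 1) 0 = \<alpha>" "fps_nth (C 1 2) 0 = 0" "fps_nth (C 2 1) 0 = 0" "fps_nth (C 2 2) 0 = - \<alpha>"
    using R \<alpha> trace_free by (simp_all add: residue_part_def leading_part_def)
  have wB: "weight_ge k (k + 1) (B 1 1 - p)" "weight_ge k (k + 1) (B 1 2)" "weight_ge k (k + 1) (B 2 1)"
    by (rule wI; auto simp: Bz qz p0 R' R'[unfolded One_nat_def] p0[unfolded One_nat_def] s(2))+
  have w: "weight_ge k (k + 1) w1" "weight_ge k (k + 1) w2"
  proof -
    have P: "weight_ge k (k + 1) (?P f)" for f
      by (rule wI) (simp_all add: coeff2_pole_deriv)
    have "w1 = ?P y1 + (y1 * (B 1 1 - p) + y2 * B 1 2)" by (simp add: w1_def algebra_simps)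
    then show "weight_ge k (k + 1) w1"
      by (simp only:) (intro weight_ge_add P weight_ge_mult_any wB)
    have y2: "weight_ge k 1 y2" using y(2) k by (auto simp: weight_ge_def)
    have "weight_ge k k (B 2 2 - p)"
      by (rule wI') (simp add: Bz qz p0)
    from weight_ge_mult[OF this y2] have "weight_ge k (k + 1) ((B 2 2 - p) * y2)" .
    moreover have "w2 = ?P y2 + (y1 * B 2 1 + (B 2 2 - p) * y2)" by (simp add: w2_def algebra_simps)
    ultimately show "weight_ge k (k + 1) w2"
      using weight_ge_add[OF P weight_ge_add[OF weight_ge_mult_any[OF wB(3)]]] by metis
  qed
  have wB2: "weight_ge k k (B 2 2 - p)"
    by (rule wI') (simp add: Bz qz p0)
  have RR1: "weight_ge k (k * n + k) (?P r1 + (B 1 1 * r1 + B 1 2 * r2) - p * r1)"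
  proof -
    have "weight_ge k (k + 1 + k * n) (B 1 2 * r2)" using weight_ge_mult[OF wB(2) r(2)] .
    moreover have "weight_ge k (k * n + 1 + k) (?P r1)" using weight_ge_pole_deriv[OF r(1)] .
    moreover have "weight_ge k (k + 1 + (k * n + 1)) ((B 1 1 - p) * r1)" using weight_ge_mult[OF wB(1) r(1)] .
    ultimately have "weight_ge k (k * n + k) (?P r1 + (B 1 2 * r2 + (B 1 1 - p) * r1))"
      by (auto intro!: weight_ge_add elim!: weight_ge_mono)
    then show ?thesis by (simp add: algebra_simps)
  qed
  have r1': "weight_ge k (k * n) r1" using r(1) by (rule weight_ge_mono) simp
  have RR2: "weight_ge k (k * n + k) (?P r2 + (B 2 1 * r1 + B 2 2 * r2) - p * r2)"
  proof -
    have "weight_ge k (k + 1 + k * n) (B 2 1 * r1)" using weight_ge_mult[OF wB(3) r1'] .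
    moreover have "weight_ge k (k * n + k) (?P r2)" using weight_ge_pole_deriv[OF r(2)] .
    moreover have "weight_ge k (k + k * n) ((B 2 2 - p) * r2)" using weight_ge_mult[OF wB2 r(2)] .
    ultimately have "weight_ge k (k * n + k) (?P r2 + (B 2 1 * r1 + (B 2 2 - p) * r2))"
      by (auto intro!: weight_ge_add elim!: weight_ge_mono)
    then show ?thesis by (simp add: algebra_simps)
  qed
  have rec: "(if i = 0 then 0 else (of_nat (i - 1) - of_nat n) * coeff2 r2 (i - 1) j)
      - 2 * \<alpha> * (if j < k then 0 else coeff2 r2 i (j - k)) = 0" if ij: "k * i + j = k * n + k" for i j
  proof -
    have "coeff2 (?P r2 + (B 2 1 * r1 + B 2 2 * r2) - p * r2) i j = 0"
    proof -
      have Mc: "coeff2 (M 1 1) 0 0 = of_nat k * b1" "coeff2 (M 1 2) 0 0 = 0" "coeff2 (M 2 1) 0 0 = 0" "coeff2 (M 2 2) 0 0 = of_nat k * b2"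
        using M00 R by auto
      show ?thesis unfolding Rw2[symmetric]
        by (rule lowest_weight_vanishes[OF k n(1) \<eta>0 Mc refl w RR1[folded Rw1] RR2[folded Rw2] ij n(2)])
    qed
    moreover have "?P r2 + (B 2 1 * r1 + B 2 2 * r2) - p * r2 = ?P r2 + (B 2 1 * r1 + (B 2 2 - p) * r2)"
      by (simp add: algebra_simps)
    moreover have "coeff2 (B 2 1 * r1) i j = 0"
      using weight_ge_mult[OF wB(3) r1'] ij by (intro weight_geD[of k "k + 1 + k * n"]) auto
    moreover have "coeff2 ((B 2 2 - p) * r2) i j
        = (if i = 0 then 0 else - of_nat n * coeff2 r2 (i - 1) j) - 2 * \<alpha> * (if j < k then 0 else coeff2 r2 i (j - k))"
    proof -
      define ld :: series where "ld = fps_const (fps_const (- of_nat n)) * fps_X - fps_const (fps_const (2 * \<alpha>) * ?X ^ k)"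
      have "weight_ge k (k + 1) (B 2 2 - p - ld)"
        using diff_eq_eq[THEN iffD1, OF n(1)] by (intro wI) (auto simp: Bz qz p0 R' R'[unfolded One_nat_def] p0[unfolded One_nat_def] s(2) ld_def fps_X_power_nth)
      from weight_ge_mult[OF this r(2)] have "coeff2 ((B 2 2 - p - ld) * r2) i j = 0"
        using ij by (intro weight_geD[of k "k + 1 + k * n"]) auto
      then have "coeff2 ((B 2 2 - p) * r2) i j = coeff2 (ld * r2) i j" by (simp add: algebra_simps)
      also have "ld * r2 = fps_const (fps_const (- of_nat n)) * (fps_X * r2) - fps_const (fps_const (2 * \<alpha>)) * (fps_const (?X ^ k) * r2)"
        by (simp add: ld_def algebra_simps flip: fps_const_mult)
      also have "coeff2 \<dots> i j = - of_nat n * coeff2 (fps_X * r2) i j - 2 * \<alpha> * coeff2 (fps_const (?X ^ k) * r2) i j"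
        by (simp only: fps_sub_nth fps_mult_left_const_nth)
      also have "\<dots> = (if i = 0 then 0 else - of_nat n * coeff2 r2 (i - 1) j) - 2 * \<alpha> * (if j < k then 0 else coeff2 r2 i (j - k))"
        by (simp add: fps_X_power_mult_nth)
      finally show ?thesis .
    qed
    ultimately have "coeff2 (?P r2) i j + (0 + ((if i = 0 then 0 else - of_nat n * coeff2 r2 (i - 1) j)
        - 2 * \<alpha> * (if j < k then 0 else coeff2 r2 i (j - k)))) = 0"
      by (metis fps_add_nth)
    then show ?thesis unfolding coeff2_pole_deriv by (simp add: algebra_simps split: if_splits)
  qed
  have "coeff2 r2 n (k * (n - n)) = 0" by (rule obstruction_recursion[OF \<alpha>(2) k rec]) auto
  then have r2n: "coeff2 r2 n 0 = 0" by simp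
  have rz: "coeff2 r1 i 0 = 0" "coeff2 r2 i 0 = 0" if "i \<le> n" for i
  proof -
    have "k * i + 0 < k * n + 1" using mult_le_mono2[OF that, of k] by linarith
    then show "coeff2 r1 i 0 = 0" by (rule weight_geD[OF r(1)])
    show "coeff2 r2 i 0 = 0"
    proof (cases "i = n")
      case False
      then have "k * i < k * n" using that k by simp
      then show ?thesis by (intro weight_geD[OF r(2)]) simp
    qed (simp add: r2n)
  qed
  \<comment> \<open>At \<open>t = 0\<close> the vector field \<open>k z \<partial>\<^sub>z + \<xi> \<partial>\<^sub>t\<close> is \<open>k z \<partial>\<^sub>z\<close>, and \<open>E\<close> becomes the operator of the restriction.\<close>
  define Y where "Y = (\<lambda>i l. if l = (1::2) then coeff2 y1 i 0 else coeff2 y2 i 0)"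
  have E0: "coeff2 (?E f) i 0 = of_nat k * (of_nat i * coeff2 f i 0)" for f i
  proof -
    have "coeff2 (?E f) i 0 = of_nat k * coeff2 (fps_X * fps_deriv f) i 0"
      unfolding euler_deriv_def fps_add_nth kn kn' by (simp add: mult.assoc)
    then show ?thesis by (simp only: coeff2_X_deriv)
  qed
  have mul0: "coeff2 (f * h) i 0 = (\<Sum>m\<le>i. coeff2 f m 0 * coeff2 h (i - m) 0)" for f h :: series and i
    by (simp add: coeff2_mult atLeast0AtMost)
  have sum_eq: "of_nat k * (of_nat i * coeff2 f i 0) + ((\<Sum>m\<le>i. of_nat k * coeff2 (B l 1) (Suc m) 0 * coeff2 y1 (i - m) 0)
      + (\<Sum>m\<le>i. of_nat k * coeff2 (B l 2) (Suc m) 0 * coeff2 y2 (i - m) 0)) - of_nat k * b1 * coeff2 f i 0 = 0 \<Longrightarrow>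
      of_nat i * coeff2 f i 0 + (\<Sum>m\<le>i. coeff2 (B l 1) (Suc m) 0 * coeff2 y1 (i - m) 0 + coeff2 (B l 2) (Suc m) 0 * coeff2 y2 (i - m) 0)
      = b1 * coeff2 f i 0" for i l f
  proof -
    assume h: "of_nat k * (of_nat i * coeff2 f i 0) + ((\<Sum>m\<le>i. of_nat k * coeff2 (B l 1) (Suc m) 0 * coeff2 y1 (i - m) 0)
      + (\<Sum>m\<le>i. of_nat k * coeff2 (B l 2) (Suc m) 0 * coeff2 y2 (i - m) 0)) - of_nat k * b1 * coeff2 f i 0 = 0"
    have "of_nat k * (of_nat i * coeff2 f i 0 + (\<Sum>m\<le>i. coeff2 (B l 1) (Suc m) 0 * coeff2 y1 (i - m) 0 + coeff2 (B l 2) (Suc m) 0 * coeff2 y2 (i - m) 0)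
       - b1 * coeff2 f i 0) = 0"
      using h by (simp add: sum.distrib sum_distrib_left algebra_simps)
    then show ?thesis using k by simp
  qed
  have "of_nat i * Y i l + (\<Sum>m\<le>i. coeff2 (B l 1) (Suc m) 0 * Y (i - m) 1 + coeff2 (B l 2) (Suc m) 0 * Y (i - m) 2) = b1 * Y i l"
    if i: "i \<le> n" for i l
  proof -
    have "of_nat i * coeff2 y1 i 0 + (\<Sum>m\<le>i. coeff2 (B 1 1) (Suc m) 0 * coeff2 y1 (i - m) 0 + coeff2 (B 1 2) (Suc m) 0 * coeff2 y2 (i - m) 0) = b1 * coeff2 y1 i 0"
      using rz(1)[OF i] unfolding r1_def fps_sub_nth fps_add_nth E0 mul0 M0 fps_mult_left_const_nth by (rule sum_eq)
    moreover have "of_nat i * coeff2 y2 i 0 + (\<Sum>m\<le>i. coeff2 (B 2 1) (Suc m) 0 * coeff2 y1 (i - m) 0 + coeff2 (B 2 2) (Suc m) 0 * coeff2 y2 (i - m) 0) = b1 * coeff2 y2 i 0"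
      using rz(2)[OF i] unfolding r2_def fps_sub_nth fps_add_nth E0 mul0 M0 fps_mult_left_const_nth by (rule sum_eq)
    ultimately show ?thesis using exhaust_2[of l] by (auto simp: Y_def)
  qed
  moreover have "Y 0 1 = 1" "Y 0 2 = 0" using y by (auto simp: Y_def)
  ultimately show ?thesis by blast
qed

end


(* From here on the dollar sign is reserved for the components of vectors. *)
no_notation fps_nth (infixl "$" 75)

section \<open>Holomorphic functions of two variables\<close>

lemma hol2I:
  assumes "\<And>p. p \<in> W \<Longrightarrow> (f has_derivative (\<lambda>x. a p * fst x + b p * snd x)) (at p)"
  shows "hol2 W f"
  unfolding hol2_def using assms by (auto simp: case_prod_unfold)

lemma hol2_slices:
  assumes "hol2 W f" "(z, t) \<in> W"
  shows hol2_slice_z: "((\<lambda>z. f (z, t)) has_field_derivative partial_z f (z, t)) (at z)"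
    and hol2_slice_t: "((\<lambda>t. f (z, t)) has_field_derivative partial_t f (z, t)) (at t)"
    and hol2_has_derivative:
      "(f has_derivative (\<lambda>x. partial_z f (z, t) * fst x + partial_t f (z, t) * snd x)) (at (z, t))"
proof -
  obtain a b where ab: "(f has_derivative (\<lambda>(h, k). a * h + b * k)) (at (z, t))"
    using assms unfolding hol2_def by blast
  have "((\<lambda>z. f (z, t)) has_derivative (\<lambda>h. (\<lambda>(h, k). a * h + b * k) (h, 0))) (at z)"
    by (rule has_derivative_compose[where f = "\<lambda>z. (z, t)"]) (auto intro!: derivative_eq_intros ab)
  then have z: "((\<lambda>z. f (z, t)) has_field_derivative a) (at z)"
    by (simp add: has_field_derivative_def)
  have "((\<lambda>t. f (z, t)) has_derivative (\<lambda>h. (\<lambda>(h, k). a * h + b * k) (0, h))) (at t)"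
    by (rule has_derivative_compose[where f = "\<lambda>t. (z, t)"]) (auto intro!: derivative_eq_intros ab)
  then have t: "((\<lambda>t. f (z, t)) has_field_derivative b) (at t)"
    by (simp add: has_field_derivative_def)
  have [simp]: "partial_z f (z, t) = a" "partial_t f (z, t) = b"
    using DERIV_imp_deriv[OF z] DERIV_imp_deriv[OF t] by (auto simp: partial_z_def partial_t_def)
  show "((\<lambda>z. f (z, t)) has_field_derivative partial_z f (z, t)) (at z)"
    "((\<lambda>t. f (z, t)) has_field_derivative partial_t f (z, t)) (at t)"
    "(f has_derivative (\<lambda>x. partial_z f (z, t) * fst x + partial_t f (z, t) * snd x)) (at (z, t))"
    using z t ab by (auto simp: case_prod_unfold)
qed

lemma hol2_has_derivative':
  assumes "hol2 W f" "p \<in> W"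
  shows "(f has_derivative (\<lambda>x. partial_z f p * fst x + partial_t f p * snd x)) (at p)"
  using hol2_has_derivative[of W f "fst p" "snd p"] assms by simp

lemma hol2_subset: "hol2 W f \<Longrightarrow> V \<subseteq> W \<Longrightarrow> hol2 V f"
  by (auto simp: hol2_def)

lemma hol2_continuous: "hol2 W f \<Longrightarrow> continuous_on W f"
  unfolding hol2_def by (meson continuous_at_imp_continuous_on has_derivative_continuous)

lemma hol2_transform:
  assumes "hol2 W f" "open W" "\<And>p. p \<in> W \<Longrightarrow> g p = f p"
  shows "hol2 W g"
  unfolding hol2_def
proof
  fix p assume p: "p \<in> W"
  then obtain a b where "(f has_derivative (\<lambda>(h, k). a * h + b * k)) (at p)"
    using assms unfolding hol2_def by blast
  then have "(g has_derivative (\<lambda>(h, k). a * h + b * k)) (at p)"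
    by (rule has_derivative_transform_within_open[OF _ assms(2) p]) (simp add: assms(3))
  then show "\<exists>a b. (g has_derivative (\<lambda>(h, k). a * h + b * k)) (at p)" by blast
qed

lemma partials_transform:
  assumes "open W" "p \<in> W" "\<And>p. p \<in> W \<Longrightarrow> g p = f p"
  shows "partial_z g p = partial_z f p" "partial_t g p = partial_t f p"
proof -
  obtain z t where [simp]: "p = (z, t)" by (cases p)
  have "isCont (\<lambda>z. (z, t)) z" "isCont (\<lambda>t. (z, t)) t" by (auto intro!: continuous_intros)
  then have "eventually (\<lambda>z. (z, t) \<in> W) (nhds z)" "eventually (\<lambda>t. (z, t) \<in> W) (nhds t)"
    using assms(1,2) topological_tendstoD[of "\<lambda>z. (z, t)" "(z, t)" "nhds z" W]
      topological_tendstoD[of "\<lambda>t. (z, t)" "(z, t)" "nhds t" W]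
    by (auto simp: isCont_def tendsto_nhds_iff)
  then show "partial_z g p = partial_z f p" "partial_t g p = partial_t f p"
    unfolding partial_z_def partial_t_def
    by (auto intro!: deriv_cong_ev elim!: eventually_mono simp: assms(3))
qed

lemma hol2_const: "hol2 W (\<lambda>_. c)"
  by (rule hol2I[where a = "\<lambda>_. 0" and b = "\<lambda>_. 0"]) simp

lemma hol2_fst: "hol2 W fst"
  by (rule hol2I[where a = "\<lambda>_. 1" and b = "\<lambda>_. 0"]) (auto intro!: derivative_eq_intros)

lemma hol2_snd: "hol2 W snd"
  by (rule hol2I[where a = "\<lambda>_. 0" and b = "\<lambda>_. 1"]) (auto intro!: derivative_eq_intros)

lemma hol2_add: "hol2 W f \<Longrightarrow> hol2 W g \<Longrightarrow> hol2 W (\<lambda>p. f p + g p)"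
  by (rule hol2I[where a = "\<lambda>p. partial_z f p + partial_z g p" and b = "\<lambda>p. partial_t f p + partial_t g p"])
    (auto intro!: derivative_eq_intros hol2_has_derivative' simp: algebra_simps)

lemma hol2_mult: "hol2 W f \<Longrightarrow> hol2 W g \<Longrightarrow> hol2 W (\<lambda>p. f p * g p)"
  by (rule hol2I[where a = "\<lambda>p. partial_z f p * g p + f p * partial_z g p"
        and b = "\<lambda>p. partial_t f p * g p + f p * partial_t g p"])
    (auto intro!: derivative_eq_intros hol2_has_derivative' simp: algebra_simps)

lemma hol2_compose:
  assumes "hol2 V g" "hol2 V h" "hol2 W f" "\<And>p. p \<in> V \<Longrightarrow> (g p, h p) \<in> W"
  shows "hol2 V (\<lambda>p. f (g p, h p))"
proof (rule hol2I)
  fix p assume p: "p \<in> V"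
  obtain z t where [simp]: "p = (z, t)" by (cases p)
  let ?q = "(g p, h p)"
  have "((\<lambda>p. (g p, h p)) has_derivative (\<lambda>x. (partial_z g p * fst x + partial_t g p * snd x,
      partial_z h p * fst x + partial_t h p * snd x))) (at p)"
    using hol2_has_derivative'[OF assms(1) p] hol2_has_derivative'[OF assms(2) p]
    by (auto intro!: has_derivative_Pair)
  from has_derivative_compose[OF this hol2_has_derivative[OF assms(3) assms(4)[OF p]]]
  show "((\<lambda>p. f (g p, h p)) has_derivative
     (\<lambda>x. (partial_z f ?q * partial_z g p + partial_t f ?q * partial_z h p) * fst x +
          (partial_z f ?q * partial_t g p + partial_t f ?q * partial_t h p) * snd x)) (at p)"
    by (simp add: algebra_simps)
qed

lemma hol2_of_fst:
  assumes "f holomorphic_on S" "open S" "\<And>p. p \<in> W \<Longrightarrow> fst p \<in> S"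
  shows "hol2 W (\<lambda>p. f (fst p))"
proof (rule hol2I)
  fix p assume "p \<in> W"
  then have "(f has_field_derivative deriv f (fst p)) (at (fst p))"
    using assms by (intro holomorphic_derivI[OF assms(1,2)] assms(3)) auto
  then show "((\<lambda>p. f (fst p)) has_derivative (\<lambda>x. deriv f (fst p) * fst x + 0 * snd x)) (at p)"
    unfolding has_field_derivative_def
    by (auto intro!: has_derivative_eq_rhs[OF has_derivative_compose[OF has_derivative_fst[OF has_derivative_ident]]])
qed

lemma hol2_compose1:
  assumes "hol2 W g" "f holomorphic_on S" "open S" "\<And>p. p \<in> W \<Longrightarrow> g p \<in> S"
  shows "hol2 W (\<lambda>p. f (g p))"
  using hol2_compose[OF assms(1) hol2_const hol2_of_fst[where W = "S \<times> UNIV", OF assms(2,3)]] assms(4)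
  by auto

lemma hol2_minus: "hol2 W f \<Longrightarrow> hol2 W (\<lambda>p. - f p)"
  using hol2_mult[OF hol2_const[of W "-1"]] by simp

lemma hol2_diff: "hol2 W f \<Longrightarrow> hol2 W g \<Longrightarrow> hol2 W (\<lambda>p. f p - g p)"
  using hol2_add[OF _ hol2_minus, of W f g] by simp

lemma hol2_inverse: "hol2 W f \<Longrightarrow> (\<And>p. p \<in> W \<Longrightarrow> f p \<noteq> 0) \<Longrightarrow> hol2 W (\<lambda>p. inverse (f p))"
  by (rule hol2_compose1[where S = "- {0}" and f = inverse]) (auto intro!: holomorphic_intros)

lemma hol2_divide:
  "hol2 W f \<Longrightarrow> hol2 W g \<Longrightarrow> (\<And>p. p \<in> W \<Longrightarrow> g p \<noteq> 0) \<Longrightarrow> hol2 W (\<lambda>p. f p / g p)"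
  using hol2_mult[OF _ hol2_inverse, of W f g] by (simp add: divide_inverse)

lemma hol2_power: "hol2 W f \<Longrightarrow> hol2 W (\<lambda>p. f p ^ n)"
  by (induction n) (auto intro: hol2_const hol2_mult)

lemma hol2_sum: "(\<And>i. i \<in> I \<Longrightarrow> hol2 W (f i)) \<Longrightarrow> hol2 W (\<lambda>p. \<Sum>i\<in>I. f i p)"
  by (induction I rule: infinite_finite_induct) (auto intro: hol2_const hol2_add)

lemmas hol2_intros = hol2_const hol2_fst hol2_snd hol2_add hol2_mult hol2_minus hol2_diff
  hol2_inverse hol2_divide hol2_power hol2_sum

lemma hol2_holomorphic:
  assumes "hol2 W f"
  shows "(\<lambda>z. f (z, t)) holomorphic_on {z. (z, t) \<in> W}"
    and "(\<lambda>t. f (z, t)) holomorphic_on {t. (z, t) \<in> W}"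
  using hol2_slices(1,2)[OF assms] unfolding holomorphic_on_def field_differentiable_def
  by (blast intro: has_field_derivative_at_within)+

lemma open_slices:
  assumes "open (W :: (complex \<times> complex) set)"
  shows "open {z. (z, t) \<in> W}" "open {t. (z, t) \<in> W}"
proof -
  have "open ((\<lambda>z. (z, t)) -` W)" "open ((\<lambda>t. (z, t)) -` W)"
    by (auto intro!: open_vimage assms continuous_intros)
  then show "open {z. (z, t) \<in> W}" "open {t. (z, t) \<in> W}" by (simp_all add: vimage_def)
qed

lemma polydisc_nhd:
  assumes "open (W :: (complex \<times> complex) set)" "(z, t) \<in> W"
  obtains r where "r > 0" "cball z r \<times> cball t r \<subseteq> W"
proof -
  obtain A B where AB: "open A" "open B" "(z, t) \<in> A \<times> B" "A \<times> B \<subseteq> W"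
    by (rule open_prod_elim[OF assms])
  obtain a where a: "a > 0" "cball z a \<subseteq> A" using AB by (auto simp: open_contains_cball)
  obtain b where b: "b > 0" "cball t b \<subseteq> B" using AB by (auto simp: open_contains_cball)
  have "cball z (min a b) \<times> cball t (min a b) \<subseteq> A \<times> B"
    using a(2) b(2) subset_cball[of "min a b" a z] subset_cball[of "min a b" b t] by (intro Sigma_mono) auto
  then have "min a b > 0" "cball z (min a b) \<times> cball t (min a b) \<subseteq> W"
    using AB(4) a(1) b(1) by auto
  then show ?thesis using that by blast
qed

text \<open>The Cauchy estimate bounds the change of the \<open>z\<close>-derivative by the change of the function on a
  compact circle, where continuity is uniform in \<open>t\<close>.\<close>

lemma continuous_partial_z:
  assumes W: "open W" and cont: "continuous_on W f"
    and hol: "\<And>t. (\<lambda>z. f (z, t)) holomorphic_on {z. (z, t) \<in> W}"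
  shows "continuous_on W (partial_z f)"
proof (rule continuous_at_imp_continuous_on, rule ballI)
  fix p assume p: "p \<in> W"
  obtain z t where [simp]: "p = (z, t)" by (cases p)
  obtain r where r: "r > 0" "cball z r \<times> cball t r \<subseteq> W" using polydisc_nhd[OF W] p by auto
  have unif: "uniformly_continuous_on (cball z r \<times> cball t r) f"
    by (intro compact_uniformly_continuous continuous_on_subset[OF cont r(2)] compact_Times) auto
  show "isCont (partial_z f) p"
    unfolding continuous_at_eps_delta
  proof (intro allI impI)
    fix e :: real assume e: "e > 0"
    have e': "e * r / 4 > 0" using e r by simp
    obtain d where d: "d > 0" "\<And>x y. x \<in> cball z r \<times> cball t r \<Longrightarrow> y \<in> cball z r \<times> cball t r \<Longrightarrow>
        dist x y < d \<Longrightarrow> dist (f x) (f y) < e * r / 4"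
      using unif e' unfolding uniformly_continuous_on_def by metis
    have main: "dist (partial_z f (z', t')) (partial_z f p) < e"
      if "dist (z', t') p < min d (r / 2)" for z' t'
    proof -
      have zt: "dist z' z < r / 2" "dist t' t < r / 2" "dist z' z < d" "dist t' t < d"
        using that dist_fst_le[of "(z', t')" "(z, t)"] dist_snd_le[of "(z', t')" "(z, t)"] by auto
      let ?g = "\<lambda>h. f (z' + h, t') - f (z + h, t)"
      have in_r: "z' + h \<in> cball z r" "z + h \<in> cball z r" "t' \<in> cball t r" if "norm h \<le> r / 2" for h
        using zt that r norm_triangle_ineq[of "z' - z" h]
        by (auto simp: dist_norm norm_minus_commute algebra_simps)
      have h1: "(\<lambda>z. f (z, t')) holomorphic_on {z. (z, t') \<in> W}" "(\<lambda>z. f (z, t)) holomorphic_on {z. (z, t) \<in> W}"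
        using hol by auto
      have W_h: "(z' + h, t') \<in> W" "(z + h, t) \<in> W" if "h \<in> cball 0 (r/2)" for h
        using that in_r[of h] r by auto
      have sub: "cball z' (r/2) \<subseteq> {z. (z, t') \<in> W}" "cball z (r/2) \<subseteq> {z. (z, t) \<in> W}"
        using W_h(1)[of "x - z'" for x] W_h(2)[of "x - z" for x]
        by (auto simp: dist_norm norm_minus_commute)
      have "(\<lambda>z. f (z, t')) \<circ> (\<lambda>h. z' + h) holomorphic_on cball 0 (r/2)"
        using sub by (intro holomorphic_on_compose_gen[OF _ h1(1)] holomorphic_intros) auto
      moreover have "(\<lambda>z. f (z, t)) \<circ> (\<lambda>h. z + h) holomorphic_on cball 0 (r/2)"
        using sub by (intro holomorphic_on_compose_gen[OF _ h1(2)] holomorphic_intros) auto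
      ultimately have c: "(\<lambda>h. f (z' + h, t')) holomorphic_on cball 0 (r/2)"
        "(\<lambda>h. f (z + h, t)) holomorphic_on cball 0 (r/2)"
        by (simp_all add: o_def)
      then have hg: "?g holomorphic_on cball 0 (r/2)" by (intro holomorphic_intros)
      have "norm ((deriv ^^ 1) ?g 0) \<le> fact 1 * (e * r / 4) / (r / 2) ^ 1"
      proof (rule Cauchy_inequality)
        show "?g holomorphic_on ball 0 (r/2)" using hg by (rule holomorphic_on_subset) auto
        show "continuous_on (cball 0 (r/2)) ?g" using hg by (rule holomorphic_on_imp_continuous_on)
        fix x :: complex assume "norm (0 - x) = r / 2"
        then have x: "norm x \<le> r / 2" by simp
        have "dist (z' + x, t') (z + x, t) = dist (z', t') (z, t)" by (simp add: dist_Pair_Pair)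
        then have "dist (f (z' + x, t')) (f (z + x, t)) < e * r / 4"
          using in_r[OF x] that r(1) by (intro d(2)) auto
        then show "norm (?g x) \<le> e * r / 4" by (simp add: dist_norm)
      qed (use r in auto)
      also have "\<dots> < e" using e r by (simp add: field_simps)
      finally have "norm (deriv ?g 0) < e" by simp
      moreover have "deriv ?g 0 = partial_z f (z', t') - partial_z f (z, t)"
      proof -
        have "((\<lambda>z. f (z, s)) has_field_derivative partial_z f (w, s)) (at w)" if "(w, s) \<in> W" for w s
          unfolding partial_z_def using hol[of s] that
          by (auto intro!: holomorphic_derivI[OF _ open_slices(1)[OF W, of s]])
        note D = this
        have "(z', t') \<in> W" "(z, t) \<in> W" using r in_r[of 0] by auto
        note D = this[THEN D]
        have "((\<lambda>h. f (z' + h, t')) has_field_derivative partial_z f (z', t')) (at 0)"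
          "((\<lambda>h. f (z + h, t)) has_field_derivative partial_z f (z, t)) (at 0)"
          using DERIV_shift[of "\<lambda>z. f (z, t')" "partial_z f (z', t')" 0 z'] D
            DERIV_shift[of "\<lambda>z. f (z, t)" "partial_z f (z, t)" 0 z]
          by (simp_all add: add.commute)
        then show ?thesis by (intro DERIV_imp_deriv DERIV_diff)
      qed
      ultimately show ?thesis by (simp add: dist_norm)
    qed
    show "\<exists>d>0. \<forall>x'. dist x' p < d \<longrightarrow> dist (partial_z f x') (partial_z f p) < e"
      using main d r by (intro exI[of _ "min d (r/2)"]) auto
  qed
qed

text \<open>The partial derivatives exist and are continuous by the Cauchy estimate, hence the function is differentiable.\<close>

lemma hol2_Osgood:
  assumes W: "open W" and cont: "continuous_on W f"
    and holz: "\<And>t. (\<lambda>z. f (z, t)) holomorphic_on {z. (z, t) \<in> W}"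
    and holt: "\<And>z. (\<lambda>t. f (z, t)) holomorphic_on {t. (z, t) \<in> W}"
  shows "hol2 W f"
proof (rule hol2I)
  fix p assume p: "p \<in> W"
  obtain z t where [simp]: "p = (z, t)" by (cases p)
  obtain r where r: "r > 0" "cball z r \<times> cball t r \<subseteq> W" using polydisc_nhd[OF W] p by auto
  define f' where "f' = (\<lambda>(t, z). f (z, t))"
  have W': "open (prod.swap ` W)"
  proof -
    have "prod.swap ` W = prod.swap -` W" by force
    moreover have "open (prod.swap -` W)"
      unfolding prod.swap_def by (intro open_vimage W continuous_intros)
    ultimately show ?thesis by simp
  qed
  have "continuous_on (prod.swap ` W) (partial_z f')"
  proof (rule continuous_partial_z[OF W'])
    have "continuous_on (prod.swap ` W) (f \<circ> prod.swap)"
      by (intro continuous_on_compose) (auto simp: image_image prod.swap_def intro!: continuous_intros cont)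
    moreover have "f \<circ> prod.swap = f'" by (auto simp: f'_def)
    ultimately show "continuous_on (prod.swap ` W) f'" by simp
    fix z show "(\<lambda>t. f' (t, z)) holomorphic_on {t. (t, z) \<in> prod.swap ` W}"
      using holt[of z] by (simp add: f'_def image_iff Bex_def)
  qed
  then have "continuous_on W (partial_z f' \<circ> prod.swap)"
    by (intro continuous_on_compose) (auto simp: prod.swap_def intro!: continuous_intros)
  moreover have "partial_z f' \<circ> prod.swap = partial_t f"
    by (auto simp: partial_z_def partial_t_def f'_def)
  ultimately have ct: "continuous_on W (partial_t f)" by simp
  have "((\<lambda>(x, y). f (x, y)) has_derivative
      (\<lambda>(tx, ty). partial_z f (z, t) * tx + blinfun_mult_right (partial_t f (z, t)) ty))
      (at (z, t) within ball z r \<times> ball t r)"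
  proof (rule has_derivative_partialsI)
    have "((\<lambda>x. f (x, t)) has_field_derivative partial_z f (z, t)) (at z)"
      unfolding partial_z_def using p by (auto intro!: holomorphic_derivI[OF holz[of t] open_slices(1)[OF W]])
    then show "((\<lambda>x. f (x, t)) has_derivative (\<lambda>tx. partial_z f (z, t) * tx)) (at z within ball z r)"
      by (simp add: has_field_derivative_def has_derivative_at_withinI)
    fix x y assume "x \<in> ball z r" "y \<in> ball t r"
    then have "(x, y) \<in> W" using r by auto
    then have "((\<lambda>y. f (x, y)) has_field_derivative partial_t f (x, y)) (at y)"
      unfolding partial_t_def by (auto intro!: holomorphic_derivI[OF holt[of x] open_slices(2)[OF W]])
    then show "((\<lambda>y. f (x, y)) has_derivative (blinfun_apply (blinfun_mult_right (partial_t f (x, y)))))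
        (at y within ball t r)"
      by (simp add: has_field_derivative_def has_derivative_at_withinI)
  next
    have "isCont (partial_t f) (z, t)"
      using ct W p by (simp add: continuous_on_eq_continuous_at)
    then have "((\<lambda>q. blinfun_mult_right (partial_t f q)) \<longlongrightarrow> blinfun_mult_right (partial_t f (z, t))) (at (z, t))"
      by (intro bounded_linear.tendsto[OF bounded_linear_blinfun_mult_right]) (simp add: isCont_def)
    then show "continuous (at (z, t) within ball z r \<times> ball t r) (\<lambda>(x, y). blinfun_mult_right (partial_t f (x, y)))"
      unfolding continuous_within case_prod_unfold prod.collapse by (rule tendsto_within_subset) simp
  qed (use r in auto)
  then have "(f has_derivative (\<lambda>x. partial_z f p * fst x + partial_t f p * snd x))
      (at (z, t) within ball z r \<times> ball t r)"
    by (simp add: case_prod_unfold)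
  then show "(f has_derivative (\<lambda>x. partial_z f p * fst x + partial_t f p * snd x)) (at p)"
    using r by (subst (asm) at_within_open[of "(z,t)"]) (auto intro: open_Times)
qed

lemma continuous_partial_z_hol2: "open W \<Longrightarrow> hol2 W f \<Longrightarrow> continuous_on W (partial_z f)"
  using hol2_holomorphic(1) hol2_continuous by (intro continuous_partial_z)

text \<open>By the mean value inequality the difference quotients in \<open>z\<close> converge uniformly in \<open>t\<close>.\<close>

lemma difference_quotient_uniform_limit:
  assumes W: "open W" and hol: "hol2 W f" and zt0: "(z, t0) \<in> W"
  obtains r where "r > 0" "cball z r \<times> cball t0 r \<subseteq> W"
    "uniform_limit (ball t0 r) (\<lambda>n t. (f (z + of_real (r / Suc n), t) - f (z, t)) / of_real (r / Suc n))
      (\<lambda>t. partial_z f (z, t)) sequentially"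
proof -
  have cont: "continuous_on W (partial_z f)" using W hol by (rule continuous_partial_z_hol2)
  obtain r where r: "r > 0" "cball z r \<times> cball t0 r \<subseteq> W" by (rule polydisc_nhd[OF W zt0])
  define q where "q = (\<lambda>n t. (f (z + of_real (r / Suc n), t) - f (z, t)) / of_real (r / Suc n))"
  have hr: "z + of_real (r / Suc n) \<in> cball z r" for n
    using r(1) by (auto simp: dist_norm norm_divide field_simps simp del: of_nat_Suc)
  have ulim: "uniform_limit (ball t0 r) q (\<lambda>t. partial_z f (z, t)) sequentially"
  proof (rule uniform_limitI)
    fix e :: real assume e: "e > 0"
    have "uniformly_continuous_on (cball z r \<times> cball t0 r) (partial_z f)"
      by (intro compact_uniformly_continuous continuous_on_subset[OF cont r(2)] compact_Times) auto
    then obtain d where d: "d > 0" "\<And>x y. x \<in> cball z r \<times> cball t0 r \<Longrightarrow> y \<in> cball z r \<times> cball t0 r \<Longrightarrow>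
        dist x y < d \<Longrightarrow> dist (partial_z f x) (partial_z f y) < e / 2"
      using e unfolding uniformly_continuous_on_def by (metis half_gt_zero)
    have "(\<lambda>n. r / Suc n) \<longlonglongrightarrow> 0"
      using tendsto_mult_right_zero[OF LIMSEQ_inverse_real_of_nat, of r] by (simp add: divide_inverse)
    then have "eventually (\<lambda>n. r / Suc n < d) sequentially"
      using d(1) by (rule order_tendstoD)
    then show "\<forall>\<^sub>F n in sequentially. \<forall>t\<in>ball t0 r. dist (q n t) (partial_z f (z, t)) < e"
    proof (rule eventually_mono, intro ballI)
      fix n t assume n: "r / Suc n < d" and t: "t \<in> ball t0 r"
      define h where "h = r / Suc n"
      have h: "0 < h" "h \<le> r" "h < d"
        using r(1) n by (auto simp: h_def field_simps simp del: of_nat_Suc)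
      let ?c = "partial_z f (z, t)"
      have "norm ((f (z + of_real h, t) - ?c * (z + of_real h)) - (f (z, t) - ?c * z)) \<le> e / 2 * norm (z + of_real h - z)"
      proof (rule field_differentiable_bound[of "cball z h"])
        fix w assume w: "w \<in> cball z h"
        have wt: "(w, t) \<in> W" using w h t r(2) by (auto dest: subsetD)
        show "((\<lambda>w. f (w, t) - ?c * w) has_field_derivative (partial_z f (w, t) - ?c)) (at w within cball z h)"
          by (rule has_field_derivative_at_within) (auto intro!: derivative_eq_intros hol2_slice_z[OF hol wt])
        have "dist (w, t) (z, t) < d"
          using w h by (auto simp: dist_Pair_Pair dist_commute)
        then have "dist (partial_z f (w, t)) ?c < e / 2"
          using w h t r by (intro d(2)) auto
        then show "norm (partial_z f (w, t) - ?c) \<le> e / 2" by (simp add: dist_norm)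
      qed (use h in \<open>auto simp: dist_norm\<close>)
      then have "norm (f (z + of_real h, t) - f (z, t) - ?c * of_real h) \<le> e / 2 * h"
        using h by (simp add: algebra_simps)
      moreover have "q n t - ?c = (f (z + of_real h, t) - f (z, t) - ?c * of_real h) / of_real h"
      proof -
        have "q n t = (f (z + of_real h, t) - f (z, t)) / of_real h" by (simp only: q_def h_def)
        then show ?thesis using h(1) by (simp add: diff_divide_distrib)
      qed
      ultimately have "norm (q n t - ?c) \<le> e / 2"
        using h(1) by (simp add: norm_divide divide_le_eq)
      then show "dist (q n t) ?c < e" using e by (simp add: dist_norm)
    qed
  qed
  show thesis using that[OF r ulim[unfolded q_def]] .
qed

text \<open>The derivative is holomorphic in \<open>t\<close> as a locally uniform limit of difference quotients.\<close>

lemma hol2_partial_z: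
  assumes W: "open W" and hol: "hol2 W f"
  shows "hol2 W (partial_z f)"
proof (rule hol2_Osgood[OF W])
  show cont: "continuous_on W (partial_z f)"
    using W hol by (rule continuous_partial_z_hol2)
  show "(\<lambda>z. partial_z f (z, t)) holomorphic_on {z. (z, t) \<in> W}" for t
    using holomorphic_deriv[OF hol2_holomorphic(1)[OF hol] open_slices(1)[OF W]]
    by (simp add: partial_z_def)
  fix z
  have "(\<lambda>t. partial_z f (z, t)) field_differentiable at t0" if zt0: "(z, t0) \<in> W" for t0
  proof -
    obtain r where r: "r > 0" "cball z r \<times> cball t0 r \<subseteq> W"
      "uniform_limit (ball t0 r) (\<lambda>n t. (f (z + of_real (r / Suc n), t) - f (z, t)) / of_real (r / Suc n))
        (\<lambda>t. partial_z f (z, t)) sequentially"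
      by (rule difference_quotient_uniform_limit[OF W hol zt0])
    define q where "q = (\<lambda>n t. (f (z + of_real (r / Suc n), t) - f (z, t)) / of_real (r / Suc n))"
    note ulim = r(3)[folded q_def]
    have hr: "z + of_real (r / Suc n) \<in> cball z r" for n
      using r(1) by (auto simp: dist_norm norm_divide field_simps simp del: of_nat_Suc)
    have "(\<lambda>t. partial_z f (z, t)) holomorphic_on ball t0 r"
    proof (rule holomorphic_uniform_sequence[where f = q])
      fix n
      have "(\<lambda>t. f (z + of_real (r / Suc n), t)) holomorphic_on ball t0 r" "(\<lambda>t. f (z, t)) holomorphic_on ball t0 r"
        using hr[of n] r(1,2) by (auto intro!: holomorphic_on_subset[OF hol2_holomorphic(2)[OF hol]] dest: subsetD)
      then show "q n holomorphic_on ball t0 r"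
        unfolding q_def using r(1) by (intro holomorphic_intros) (auto simp del: of_nat_Suc)
    next
      fix x assume "x \<in> ball t0 r"
      then obtain d where "d > 0" "cball x d \<subseteq> ball t0 r" by (meson open_ball open_contains_cball)
      then show "\<exists>d>0. cball x d \<subseteq> ball t0 r \<and> uniform_limit (cball x d) q (\<lambda>t. partial_z f (z, t)) sequentially"
        using uniform_limit_on_subset[OF ulim] by blast
    qed auto
    then show ?thesis using r(1) by (simp add: holomorphic_on_imp_differentiable_at)
  qed
  then show "(\<lambda>t. partial_z f (z, t)) holomorphic_on {t. (z, t) \<in> W}"
    unfolding holomorphic_on_def using field_differentiable_at_within by blast
qed

lemma funpow_partial_z: "((partial_z ^^ k) f) (z, t) = (deriv ^^ k) (\<lambda>z. f (z, t)) z"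
proof (induction k arbitrary: z)
  case (Suc k)
  then have "(\<lambda>z. ((partial_z ^^ k) f) (z, t)) = (deriv ^^ k) (\<lambda>z. f (z, t))" by auto
  then show ?case by (simp add: partial_z_def[of "(partial_z ^^ k) f"])
qed simp

lemma zcoeff_holomorphic:
  assumes "open W" "hol2 W f"
  shows "zcoeff k f holomorphic_on {t. (0, t) \<in> W}"
proof -
  have "hol2 W ((partial_z ^^ k) f)"
    by (induction k) (auto intro: assms hol2_partial_z)
  then have "(\<lambda>t. ((partial_z ^^ k) f) (0, t) / fact k) holomorphic_on {t. (0, t) \<in> W}"
    by (intro holomorphic_intros hol2_holomorphic(2)) auto
  moreover have "zcoeff k f = (\<lambda>t. ((partial_z ^^ k) f) (0, t) / fact k)"
    by (simp add: fun_eq_iff zcoeff_def funpow_partial_z)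
  ultimately show ?thesis by simp
qed

lemma zcoeff_has_fps_expansion:
  assumes "open W" "hol2 W f" "(0, t) \<in> W"
  shows "(\<lambda>z. f (z, t)) has_fps_expansion Abs_fps (\<lambda>k. zcoeff k f t)"
  using has_fps_expansion_fps_expansion[OF open_slices(1)[OF assms(1)] _ hol2_holomorphic(1)[OF assms(2)], of t] assms(3)
  by (simp add: fps_expansion_def zcoeff_def)

lemma zcoeffI: "(\<lambda>z. f (z, t)) has_fps_expansion F \<Longrightarrow> zcoeff k f t = fps_nth F k"
  by (simp add: zcoeff_def fps_nth_fps_expansion)

section \<open>The Frobenius method\<close>

lemma norm_mult_vec_le:
  fixes A :: "complex^'n^'m"
  assumes "\<And>i j. norm (A $ i $ j) \<le> K"
  shows "norm (A *v x) \<le> real CARD('m) * real CARD('n) * K * norm x"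
proof -
  have "norm (A *v x) \<le> (\<Sum>i\<in>UNIV. norm ((A *v x) $ i))"
    unfolding norm_vec_def by (rule L2_set_le_sum) auto
  also have "\<dots> \<le> (\<Sum>i\<in>(UNIV :: 'm set). real CARD('n) * K * norm x)"
  proof (rule sum_mono)
    fix i
    have "norm ((A *v x) $ i) \<le> (\<Sum>j\<in>(UNIV :: 'n set). norm (A $ i $ j * x $ j))"
      unfolding matrix_vector_mult_def by (simp add: sum_norm_le)
    also have "\<dots> \<le> (\<Sum>j\<in>(UNIV :: 'n set). K * norm x)"
      by (rule sum_mono) (auto simp: norm_mult intro!: mult_mono assms Finite_Cartesian_Product.norm_nth_le
          order_trans[OF norm_ge_zero assms])
    finally show "norm ((A *v x) $ i) \<le> real CARD('n) * K * norm x" by simp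
  qed
  finally show ?thesis by simp
qed

text \<open>The recursion solved by the coefficients of a solution \<open>y = \<Sum> y\<^sub>n z\<^sup>n\<close> of \<open>z y' + M y = \<mu> y\<close>
  when \<open>M = \<Sum> M\<^sub>m z\<^sup>m\<close> and \<open>M\<^sub>0\<close> is diagonal; \<open>e\<close> is the diagonal of \<open>M\<^sub>0 - \<mu>\<close>.  The first \<open>N + 1\<close>
  coefficients are prescribed, so that resonances up to degree \<open>N\<close> are left to the caller.\<close>

function frobenius_coeff :: "complex^2 \<Rightarrow> nat \<Rightarrow> (nat \<Rightarrow> complex^2) \<Rightarrow> (nat \<Rightarrow> complex^2^2) \<Rightarrow> nat \<Rightarrow> complex^2"
  where "frobenius_coeff e N c M n = (if n \<le> N then c n else
    (\<chi> i. - (\<Sum>m\<in>{1..n}. M m *v frobenius_coeff e N c M (n - m)) $ i / (of_nat n + e $ i)))"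
  by auto
termination by (relation "Wellfounded.measure (\<lambda>(e, N, c, M, n). n)") auto

declare frobenius_coeff.simps[simp del]

text \<open>A geometric majorant.  Its constant \<open>8\<close> is the product of the number of entries of \<open>M\<^sub>m\<close> and the number of
  components of a vector; with it the sum over the earlier coefficients telescopes.\<close>

lemma frobenius_coeff_bound:
  fixes M :: "nat \<Rightarrow> complex^2^2" and e :: "complex^2"
  assumes "r > 0" "L \<ge> 0" "C \<ge> 0" "\<And>m i j. norm (M m $ i $ j) \<le> L / r ^ m"
    and C: "\<And>n i. n > N \<Longrightarrow> norm (inverse (of_nat n + e $ i)) \<le> C"
    and G: "\<And>n. n \<le> N \<Longrightarrow> norm (c n) \<le> G * ((1 + 8 * C * L) / r) ^ n" "G \<ge> 0"
  shows "norm (frobenius_coeff e N c M n) \<le> G * ((1 + 8 * C * L) / r) ^ n"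
proof (induction n rule: less_induct)
  case (less n)
  define D where "D = 8 * C * L"
  define x where "x = 1 / (1 + D)"
  define Q where "Q = (1 + D) / r"
  have D: "D \<ge> 0" using assms by (simp add: D_def)
  have Q: "Q > 0" using D assms(1) by (auto simp: Q_def)
  have geo: "D * (\<Sum>m=1..n. x ^ m) \<le> 1 - x ^ n" for n
  proof (induction n)
    case (Suc n)
    have "D * x = 1 - x" using D by (simp add: x_def field_simps)
    then have "D * x ^ Suc n = (1 - x) * x ^ n" by (metis mult.assoc power_Suc)
    then show ?case using Suc.IH by (simp add: algebra_simps)
  qed simp
  show ?case
  proof (cases "n \<le> N")
    case True
    then show ?thesis using G(1) by (simp add: frobenius_coeff.simps)
  next
    case False
    let ?y = "frobenius_coeff e N c M" and ?S = "\<Sum>m\<in>{1..n}. M m *v frobenius_coeff e N c M (n - m)"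
    have "norm ?S \<le> (\<Sum>m\<in>{1..n}. 4 * (L / r ^ m) * (G * Q ^ (n - m)))"
    proof (rule sum_norm_le)
      fix m assume m: "m \<in> {1..n}"
      have "norm (M m *v ?y (n - m)) \<le> 4 * (L / r ^ m) * norm (?y (n - m))"
        using norm_mult_vec_le[OF assms(4), of m] by simp
      also have "\<dots> \<le> 4 * (L / r ^ m) * (G * Q ^ (n - m))"
        using less.IH[of "n - m"] m assms(1,2) by (intro mult_left_mono) (auto simp: Q_def D_def)
      finally show "norm (M m *v ?y (n - m)) \<le> 4 * (L / r ^ m) * (G * Q ^ (n - m))" .
    qed
    also have "\<dots> = (\<Sum>m\<in>{1..n}. 4 * L * G * Q ^ n * x ^ m)"
    proof (rule sum.cong)
      fix m assume "m \<in> {1..n}"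
      then have "Q ^ n = Q ^ (n - m) * Q ^ m" by (simp flip: power_add)
      moreover have "Q ^ m * x ^ m = 1 / r ^ m"
        using D by (simp add: Q_def x_def power_divide)
      ultimately have "4 * L * G * Q ^ n * x ^ m = 4 * L * G * Q ^ (n - m) * (1 / r ^ m)"
        by (metis mult.assoc)
      then show "4 * (L / r ^ m) * (G * Q ^ (n - m)) = 4 * L * G * Q ^ n * x ^ m"
        by simp
    qed simp
    also have "\<dots> = 4 * L * G * Q ^ n * (\<Sum>m=1..n. x ^ m)" by (simp add: sum_distrib_left)
    finally have S: "norm ?S \<le> 4 * L * G * Q ^ n * (\<Sum>m=1..n. x ^ m)" .
    have "norm (?y n) \<le> (\<Sum>i\<in>UNIV. norm (?y n $ i))"
      unfolding norm_vec_def by (rule L2_set_le_sum) auto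
    also have "\<dots> \<le> (\<Sum>i\<in>(UNIV :: 2 set). C * norm ?S)"
    proof (rule sum_mono)
      fix i
      have "norm (?y n $ i) = norm (inverse (of_nat n + e $ i)) * norm (?S $ i)"
        using False by (subst frobenius_coeff.simps) (simp add: norm_divide norm_inverse divide_inverse norm_mult mult.commute)
      also have "\<dots> \<le> C * norm ?S"
        using C[of n i] False assms(3) by (intro mult_mono Finite_Cartesian_Product.norm_nth_le) auto
      finally show "norm (?y n $ i) \<le> C * norm ?S" .
    qed
    also have "\<dots> = 2 * C * norm ?S" by simp
    also have "\<dots> \<le> 2 * C * (4 * L * G * Q ^ n * (\<Sum>m=1..n. x ^ m))"
      using S assms(3) by (intro mult_left_mono) auto
    also have "\<dots> = G * Q ^ n * (D * (\<Sum>m=1..n. x ^ m))" by (simp add: D_def)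
    also have "\<dots> \<le> G * Q ^ n * 1"
      using geo[of n] D Q G(2) by (intro mult_left_mono) (auto simp: x_def intro: order_trans)
    finally show ?thesis by (simp add: Q_def D_def)
  qed
qed

text \<open>The inverses tend to \<open>0\<close>; a vanishing denominator is harmless because \<open>inverse 0 = 0\<close>.\<close>

lemma bounded_shifted_inverses:
  fixes e :: complex
  shows "\<exists>C\<ge>0. \<forall>n. norm (inverse (of_nat n + e)) \<le> C"
proof -
  have "filterlim (\<lambda>n. of_nat n + e) at_infinity sequentially"
    by (rule tendsto_add_filterlim_at_infinity'[OF tendsto_of_nat tendsto_const])
  then have "(\<lambda>n. inverse (of_nat n + e)) \<longlonglongrightarrow> 0"
    by (rule filterlim_compose[OF tendsto_inverse_0])
  then have "Bseq (\<lambda>n. inverse (of_nat n + e))" by (metis convergentI convergent_imp_Bseq)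
  then obtain K where "\<forall>n. norm (inverse (of_nat n + e)) \<le> K" by (auto simp: Bseq_def)
  then show ?thesis by (intro exI[of _ "\<bar>K\<bar>"]) (auto intro: order_trans)
qed

lemma matrix_vector_2:
  "((A :: complex^2^2) *v x) $ i = A $ i $ 1 * x $ 1 + A $ i $ 2 * x $ 2"
  by (simp add: matrix_vector_mult_def sum_2)

text \<open>A holomorphic solution of \<open>z y' + M y = \<mu> y\<close> at a simple pole that depends on the parameter \<open>t\<close>.  Up to the degree \<open>N\<close>
  the coefficients are given; they may not depend on \<open>t\<close>.  After that the recursion has no resonance, its solutions are
  holomorphic in \<open>t\<close>, and the majorant makes the series converge uniformly.\<close>

theorem frobenius_method:
  fixes M :: "complex \<times> complex \<Rightarrow> complex^2^2" and d :: "complex^2" and c :: "nat \<Rightarrow> complex^2"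
  assumes U: "open U" and r: "r > 0" "cball 0 r \<times> cball t0 r \<subseteq> U"
    and hol: "\<And>i j. hol2 U (\<lambda>p. M p $ i $ j)"
    and M0: "\<And>t i j. t \<in> ball t0 r \<Longrightarrow> M (0, t) $ i $ j = (if i = j then d $ i else 0)"
    and init: "\<And>t n i. t \<in> ball t0 r \<Longrightarrow> n \<le> N \<Longrightarrow> of_nat n * c n $ i
        + (\<Sum>m\<le>n. (\<chi> i j. zcoeff m (\<lambda>p. M p $ i $ j) t) *v c (n - m)) $ i = \<mu> * c n $ i"
    and nonres: "\<And>n i. n > N \<Longrightarrow> of_nat n + d $ i - \<mu> \<noteq> 0"
  obtains s y where "0 < s" "s \<le> r" "\<And>i. hol2 (ball 0 s \<times> ball t0 s) (\<lambda>p. y p $ i)"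
    "\<And>t. t \<in> ball t0 s \<Longrightarrow> y (0, t) = c 0"
    "\<And>p i. p \<in> ball 0 s \<times> ball t0 s \<Longrightarrow>
       fst p * partial_z (\<lambda>p. y p $ i) p + (M p *v y p) $ i = \<mu> * y p $ i"
proof -
  define Mc where "Mc = (\<lambda>m t. (\<chi> i j. zcoeff m (\<lambda>p. M p $ i $ j) t) :: complex^2^2)"
  define e :: "complex^2" where "e = (\<chi> i. d $ i - \<mu>)"
  define a where "a = (\<lambda>n t. frobenius_coeff e N c (\<lambda>m. Mc m t) n)"
  have slice: "(0, t) \<in> U" if "t \<in> ball t0 r" for t using that r by auto
  \<comment> \<open>One bound for all entries on the closed polydisc, for the Cauchy estimates of their coefficients.\<close>
  have "\<exists>K\<ge>0. \<forall>p\<in>cball 0 r \<times> cball t0 r. norm (M p $ i $ j) \<le> K" for i j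
  proof -
    have "continuous_on (cball 0 r \<times> cball t0 r) (\<lambda>p. M p $ i $ j)"
      using hol2_continuous[OF hol] r(2) continuous_on_subset by blast
    then have "bounded ((\<lambda>p. M p $ i $ j) ` (cball 0 r \<times> cball t0 r))"
      by (intro compact_imp_bounded compact_continuous_image compact_Times) auto
    then show ?thesis unfolding bounded_iff by (metis (no_types, lifting) imageI norm_ge_zero order_trans abs_ge_self abs_ge_zero)
  qed
  then obtain K where K: "\<And>i j. K i j \<ge> 0" "\<And>i j p. p \<in> cball 0 r \<times> cball t0 r \<Longrightarrow> norm (M p $ i $ j) \<le> K i j"
    by metis
  define L where "L = (\<Sum>i\<in>UNIV. \<Sum>j\<in>UNIV. K i j)"
  have KL: "K i j \<le> L" for i j
  proof -
    have "K i j \<le> (\<Sum>j\<in>UNIV. K i j)" using K(1) by (intro member_le_sum) auto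
    also have "\<dots> \<le> L" unfolding L_def using K(1) by (intro member_le_sum sum_nonneg) auto
    finally show ?thesis .
  qed
  have L: "L \<ge> 0" using K(1) KL order_trans by blast
  have Mc_bound: "norm (Mc m t $ i $ j) \<le> L / r ^ m" if t: "t \<in> ball t0 r" for m t i j
  proof -
    have "norm ((deriv ^^ m) (\<lambda>z. M (z, t) $ i $ j) 0) \<le> fact m * L / r ^ m"
    proof (rule Cauchy_inequality)
      have "(\<lambda>z. M (z, t) $ i $ j) holomorphic_on cball 0 r"
        using t r(2) by (intro holomorphic_on_subset[OF hol2_holomorphic(1)[OF hol]]) auto
      then show "(\<lambda>z. M (z, t) $ i $ j) holomorphic_on ball 0 r" "continuous_on (cball 0 r) (\<lambda>z. M (z, t) $ i $ j)"
        by (auto intro: holomorphic_on_imp_continuous_on holomorphic_on_subset)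
      fix x :: complex assume "norm (0 - x) = r"
      then show "norm (M (x, t) $ i $ j) \<le> L" using t K(2)[of "(x, t)" i j] KL[of i j] by auto
    qed (use r in auto)
    then show ?thesis by (simp add: Mc_def zcoeff_def norm_divide field_simps)
  qed
  obtain C where C: "C \<ge> 0" "\<And>n i. norm (inverse (of_nat n + e $ i)) \<le> C"
  proof -
    obtain C1 C2 where "C1 \<ge> 0" "C2 \<ge> 0" "\<forall>n. norm (inverse (of_nat n + e $ 1)) \<le> C1"
      "\<forall>n. norm (inverse (of_nat n + e $ 2)) \<le> C2" using bounded_shifted_inverses by metis
    then have "max C1 C2 \<ge> 0" "norm (inverse (of_nat n + e $ i)) \<le> max C1 C2" for n i
      using exhaust_2[of i] by (auto simp: le_max_iff_disj)
    then show ?thesis using that by blast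
  qed
  define Q where "Q = (1 + 8 * C * L) / r"
  define G where "G = (\<Sum>n\<le>N. norm (c n) / Q ^ n)"
  have Q: "Q > 0" "1 / r \<le> Q" using C(1) L r(1) by (auto simp: Q_def field_simps intro!: add_pos_nonneg)
  have G: "G \<ge> 0" using Q by (auto simp: G_def intro!: sum_nonneg)
  have "norm (c n) \<le> G * Q ^ n" if "n \<le> N" for n
  proof -
    have "norm (c n) / Q ^ n \<le> G" unfolding G_def using that Q by (intro member_le_sum) auto
    then show ?thesis using Q by (simp add: field_simps)
  qed
  then have a_bound: "norm (a n t) \<le> G * Q ^ n" if "t \<in> ball t0 r" for n t
    unfolding a_def Q_def using r(1) L C Mc_bound[OF that] G
    by (intro frobenius_coeff_bound) (auto simp: Q_def)
  have a_eq: "of_nat n * a n t $ i + (\<Sum>m\<le>n. Mc m t *v a (n - m) t) $ i = \<mu> * a n t $ i"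
    if t: "t \<in> ball t0 r" for n t i
  proof (cases "n \<le> N")
    case True
    have "a k t = c k" if "k \<le> N" for k using that by (simp add: a_def frobenius_coeff.simps)
    with True have "a n t = c n" "(\<Sum>m\<le>n. Mc m t *v a (n - m) t) = (\<Sum>m\<le>n. Mc m t *v c (n - m))"
      by (auto intro!: sum.cong)
    then show ?thesis using init[OF t True, of i] by (simp only: Mc_def)
  next
    case False
    have split: "(\<Sum>m\<le>n. Mc m t *v a (n - m) t) = Mc 0 t *v a n t + (\<Sum>m\<in>{1..n}. Mc m t *v a (n - m) t)"
    proof -
      have "{..n} = insert 0 {1..n}" by auto
      then show ?thesis by simp
    qed
    have "zcoeff 0 (\<lambda>p. M p $ i $ j) t = (if i = j then d $ i else 0)" for j
      using M0[OF t] by (simp add: zcoeff_def)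
    then have "(Mc 0 t *v a n t) $ i = d $ i * a n t $ i"
      using exhaust_2[of i] by (auto simp: matrix_vector_2 Mc_def)
    moreover have "(of_nat n + e $ i) * a n t $ i = - (\<Sum>m\<in>{1..n}. Mc m t *v a (n - m) t) $ i"
      unfolding a_def using False nonres[of n i]
      by (subst frobenius_coeff.simps) (simp add: e_def add_diff_eq)
    ultimately show ?thesis unfolding split by (simp add: e_def algebra_simps)
  qed
  define s where "s = 1 / (2 * Q)"
  have s: "s > 0" "s \<le> r" using Q r(1) by (auto simp: s_def field_simps)
  define F where "F = (\<lambda>t i. Abs_fps (\<lambda>n. a n t $ i))"
  define y where "y = (\<lambda>p. (\<chi> i. eval_fps (F (snd p) i) (fst p)) :: complex^2)"
  let ?D = "ball (0::complex) s \<times> ball t0 s"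
  have tr: "t \<in> ball t0 r" if "t \<in> ball t0 s" for t using that s by auto
  have a_comp: "norm (a n t $ i) \<le> G * Q ^ n" if "t \<in> ball t0 r" for n t i
    using a_bound[OF that] Finite_Cartesian_Product.norm_nth_le order_trans by blast
  have rad: "fps_conv_radius (F t i) > s" if t: "t \<in> ball t0 r" for t i
  proof -
    have "fps_conv_radius (F t i) \<ge> ereal (1 / Q)" unfolding fps_conv_radius_def
    proof (rule conv_radius_geI_ex)
      fix x assume x: "0 < x" "ereal x < ereal (1 / Q)"
      have "summable (\<lambda>n. fps_nth (F t i) n * of_real x ^ n)"
      proof (rule summable_comparison_test')
        show "summable (\<lambda>n. G * (Q * x) ^ n)"
          using x Q by (intro summable_mult summable_geometric) (auto simp: field_simps)
        fix n show "norm (fps_nth (F t i) n * of_real x ^ n) \<le> G * (Q * x) ^ n"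
          using x a_comp[OF t, of n i] by (simp add: F_def norm_mult norm_power power_mult_distrib mult_right_mono mult.assoc[symmetric])
      qed
      then show "\<exists>z. norm z = x \<and> summable (\<lambda>n. fps_nth (F t i) n * z ^ n)"
        using x(1) by (intro exI[of _ "of_real x"]) auto
    qed
    moreover have "ereal s < ereal (1 / Q)" using Q by (simp add: s_def field_simps)
    ultimately show ?thesis by (rule less_le_trans[rotated])
  qed
  have exp: "(\<lambda>z. y (z, t) $ i) has_fps_expansion F t i" if "t \<in> ball t0 r" for t i
    using order_less_trans[of 0 "ereal s", OF _ rad[OF that, of i]] s(1) by (auto simp: y_def has_fps_expansion_def)
  have holz: "(\<lambda>z. y (z, t) $ i) holomorphic_on ball 0 s" if "t \<in> ball t0 r" for t i
  proof -
    have "ball 0 s \<subseteq> eball 0 (fps_conv_radius (F t i))"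
      using order_less_trans[OF _ rad[OF that, of i], of "ereal x" for x] by (auto simp: in_eball_iff)
    then show ?thesis unfolding y_def by (auto intro: holomorphic_on_eval_fps)
  qed
  have ulim: "uniform_limit ?D (\<lambda>n p. \<Sum>k<n. a k (snd p) $ i * fst p ^ k) (\<lambda>p. y p $ i) sequentially" for i
    unfolding y_def eval_fps_def F_def vec_lambda_beta fps_nth_Abs_fps
  proof (rule Weierstrass_m_test)
    show "summable (\<lambda>n. G * (1/2) ^ n)" by (intro summable_mult summable_geometric) auto
    fix n p assume p: "p \<in> ?D"
    have "norm (a n (snd p) $ i * fst p ^ n) \<le> (G * Q ^ n) * (1 / (2 * Q)) ^ n"
      using p a_comp[OF tr, of "snd p" n i] Q G by (auto simp: norm_mult norm_power s_def intro!: mult_mono power_mono)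
    also have "\<dots> = G * (1/2) ^ n" using Q by (simp add: power_mult_distrib power_divide)
    finally show "norm (a n (snd p) $ i * fst p ^ n) \<le> G * (1/2) ^ n" .
  qed
  have a_hol: "(\<lambda>t. a n t $ i) holomorphic_on ball t0 r" for n i
  proof (induction n arbitrary: i rule: less_induct)
    case (less n)
    have Mch: "(\<lambda>t. Mc m t $ i $ j) holomorphic_on ball t0 r" for m i j
      by (auto simp: Mc_def intro!: holomorphic_on_subset[OF zcoeff_holomorphic[OF U hol]] slice)
    show ?case
    proof (cases "n \<le> N")
      case False
      let ?rhs = "\<lambda>t. - (\<Sum>m\<in>{1..n}. Mc m t $ i $ 1 * a (n - m) t $ 1 + Mc m t $ i $ 2 * a (n - m) t $ 2) / (of_nat n + e $ i)"
      have "?rhs holomorphic_on ball t0 r"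
        using nonres[of n i] False by (intro holomorphic_intros Mch less.IH) (auto simp: e_def add_diff_eq)
      moreover have "?rhs t = a n t $ i" for t
        unfolding a_def using False by (subst (3) frobenius_coeff.simps) (simp add: matrix_vector_2)
      ultimately show ?thesis by simp
    next
      case True
      then show ?thesis by (simp add: a_def frobenius_coeff.simps)
    qed
  qed
  have holt: "(\<lambda>t. y (z, t) $ i) holomorphic_on ball t0 s" if z: "z \<in> ball 0 s" for z i
  proof (rule holomorphic_uniform_sequence)
    show "(\<lambda>t. \<Sum>k<n. a k t $ i * z ^ k) holomorphic_on ball t0 s" for n
      using s by (intro holomorphic_intros holomorphic_on_subset[OF a_hol]) auto
    fix x assume "x \<in> ball t0 s"
    then obtain \<delta> where \<delta>: "\<delta> > 0" "cball x \<delta> \<subseteq> ball t0 s" by (meson open_ball open_contains_cball)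
    have "uniform_limit (cball x \<delta>) (\<lambda>n t. (\<Sum>k<n. a k (snd (z, t)) $ i * fst (z, t) ^ k)) (\<lambda>t. y (z, t) $ i) sequentially"
      using \<delta>(2) z by (intro uniform_limit_compose'[OF ulim]) auto
    then show "\<exists>d>0. cball x d \<subseteq> ball t0 s \<and> uniform_limit (cball x d) (\<lambda>n t. \<Sum>k<n. a k t $ i * z ^ k) (\<lambda>t. y (z, t) $ i) sequentially"
      using \<delta> by auto
  qed auto
  have hol_y: "hol2 ?D (\<lambda>p. y p $ i)" for i
  proof (rule hol2_Osgood)
    show "open ?D" by (auto intro: open_Times)
    show "continuous_on ?D (\<lambda>p. y p $ i)"
    proof (rule uniform_limit_theorem[OF _ ulim])
      have "continuous_on ?D (\<lambda>p. a k (snd p) $ i)" for k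
        using s by (intro continuous_on_compose2[OF holomorphic_on_imp_continuous_on[OF a_hol]]) (auto intro: continuous_intros)
      then show "\<forall>\<^sub>F n in sequentially. continuous_on ?D (\<lambda>p. \<Sum>k<n. a k (snd p) $ i * fst p ^ k)"
        by (intro always_eventually allI continuous_on_sum continuous_on_mult continuous_on_power
            continuous_on_fst continuous_on_id)
    qed auto
    show "(\<lambda>z. y (z, t) $ i) holomorphic_on {z. (z, t) \<in> ?D}" for t
      using holz[OF tr, of t i] by (cases "t \<in> ball t0 s", simp add: ball_def) (simp add: holomorphic_on_def)
    show "(\<lambda>t. y (z, t) $ i) holomorphic_on {t. (z, t) \<in> ?D}" for z
      using holt[of z i] by (cases "z \<in> ball 0 s", simp add: ball_def) (simp add: holomorphic_on_def)
  qed
  have ode: "z * partial_z (\<lambda>p. y p $ i) (z, t) + (M (z, t) *v y (z, t)) $ i = \<mu> * y (z, t) $ i"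
    if z: "z \<in> ball 0 s" and t: "t \<in> ball t0 s" for z t i
  proof -
    let ?f = "\<lambda>z. z * deriv (\<lambda>z. y (z, t) $ i) z + (M (z, t) $ i $ 1 * y (z, t) $ 1 + M (z, t) $ i $ 2 * y (z, t) $ 2) - \<mu> * y (z, t) $ i"
    let ?Mf = "\<lambda>j. Abs_fps (\<lambda>m. Mc m t $ i $ j)"
    let ?F = "fps_X * fps_deriv (F t i) + (?Mf 1 * F t 1 + ?Mf 2 * F t 2) - fps_const \<mu> * F t i"
    have Mf: "(\<lambda>z. M (z, t) $ i $ j) has_fps_expansion ?Mf j" for j
      using zcoeff_has_fps_expansion[OF U hol slice[OF tr[OF t]]] by (simp add: Mc_def)
    have "?f has_fps_expansion ?F"
      by (intro fps_expansion_intros Mf exp tr t)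
    moreover have "?F = 0"
    proof (rule fps_ext)
      fix n
      have "(\<Sum>m\<le>n. Mc m t *v a (n - m) t) $ i
        = (\<Sum>m\<le>n. Mc m t $ i $ 1 * a (n - m) t $ 1) + (\<Sum>m\<le>n. Mc m t $ i $ 2 * a (n - m) t $ 2)"
        by (simp add: matrix_vector_2 sum.distrib)
      moreover have "fps_nth (fps_X * fps_deriv (F t i)) n = of_nat n * a n t $ i"
        by (cases n) (simp_all add: F_def)
      moreover have "fps_nth (?Mf j * F t j) n = (\<Sum>m\<le>n. Mc m t $ i $ j * a (n - m) t $ j)" for j
        by (simp add: F_def fps_mult_nth atLeast0AtMost)
      ultimately show "fps_nth ?F n = fps_nth 0 n"
        using a_eq[OF tr[OF t], of n i]
        by (simp only: fps_sub_nth fps_add_nth fps_mult_left_const_nth fps_zero_nth) (simp add: F_def)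
    qed
    ultimately have "?f has_fps_expansion 0" by simp
    then have ev: "eventually (\<lambda>z. ?f z = 0) (nhds 0)" by (auto simp: has_fps_expansion_def)
    have "(\<lambda>z. M (z, t) $ i $ j) holomorphic_on ball 0 s" for j
      using t s r(2) by (intro holomorphic_on_subset[OF hol2_holomorphic(1)[OF hol]]) auto
    then have hf: "?f holomorphic_on ball 0 s"
      by (intro holomorphic_intros holz tr t) auto
    obtain S where S: "open S" "0 \<in> S" "\<And>z. z \<in> S \<Longrightarrow> ?f z = 0"
      using ev unfolding eventually_nhds by blast
    have "?f z = 0"
    proof (rule analytic_continuation_open[where s = "S \<inter> ball 0 s" and s' = "ball 0 s" and g = "\<lambda>_. 0" and f = ?f])
      show "S \<inter> ball 0 s \<noteq> {}" using S s by auto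
    qed (use S z hf in auto)
    then show ?thesis by (simp add: partial_z_def matrix_vector_2)
  qed
  have y0: "y (0, t) = c 0" for t
    by (simp add: y_def F_def eval_fps_at_0 a_def frobenius_coeff.simps vec_eq_iff)
  show thesis
    using that[OF s hol_y] y0 ode by (auto simp: mem_Times_iff)
qed

section \<open>Sections in a local frame\<close>

lemma matrix_inv_mult:
  fixes M :: "complex^2^2"
  assumes "invertible M"
  shows "matrix_inv M ** M = mat 1" "M ** matrix_inv M = mat 1"
proof -
  have "\<exists>N. M ** N = mat 1 \<and> N ** M = mat 1" using assms by (auto simp: invertible_def)
  from someI_ex[OF this] show "matrix_inv M ** M = mat 1" "M ** matrix_inv M = mat 1"
    by (auto simp: matrix_inv_def)
qed

lemma matrix_inv_vec:
  fixes M :: "complex^2^2"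
  assumes "invertible M"
  shows "M *v (matrix_inv M *v x) = x" "matrix_inv M *v (M *v x) = x"
  using matrix_inv_mult[OF assms] by (simp_all add: matrix_vector_mul_assoc)

lemma invertible_mult_cancel:
  fixes M :: "complex^2^2"
  assumes "invertible M" "M *v x = M *v y"
  shows "x = y"
  using assms(2) matrix_inv_vec(2)[OF assms(1)] by metis

lemma matrix_vector_columns:
  "(M :: complex^2^2) *v y = y $ 1 *s column 1 M + y $ 2 *s column 2 M"
  by (simp add: vec_eq_iff matrix_vector_2 column_def mult.commute)

lemma column_mult: "column j ((M :: complex^2^2) ** N) = M *v column j N"
  by (simp add: vec_eq_iff column_def matrix_matrix_mult_def matrix_vector_mult_def)

lemma hol_section_subset:
  "hol_section H W s \<Longrightarrow> open V \<Longrightarrow> V \<subseteq> W \<Longrightarrow> hol_section H V s"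
  unfolding hol_section_def by (fastforce intro: hol2_subset)

lemma hol_section_add: "hol_section H W s \<Longrightarrow> hol_section H W s' \<Longrightarrow> hol_section H W (\<lambda>p. s p + s' p)"
  unfolding hol_section_def by (fastforce simp: matrix_vector_right_distrib intro: hol2_add)

lemma hol_section_scale:
  assumes "hol2 W f" "hol_section H W s"
  shows "hol_section H W (\<lambda>p. f p *s s p)"
proof -
  have "(matrix_inv M *v (c *s x)) $ i = c * (matrix_inv M *v x) $ i" for M :: "complex^2^2" and c x i
    by (simp add: matrix_vector_2 algebra_simps)
  then show ?thesis
    using assms unfolding hol_section_def by (auto intro!: hol2_mult intro: hol2_subset)
qed

lemma hol_section_combination:
  fixes F :: "complex \<times> complex \<Rightarrow> complex^2^2"
  assumes "\<And>j. hol_section H W (\<lambda>p. column j (F p))" "\<And>i. hol2 W (\<lambda>p. y p $ i)"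
  shows "hol_section H W (\<lambda>p. F p *v y p)"
  unfolding matrix_vector_columns by (intro hol_section_add hol_section_scale assms)

lemma bundle_frame:
  assumes "vector_bundle H" "(U, \<Phi>) \<in> frames H"
  shows "open U" "\<And>p. p \<in> U \<Longrightarrow> invertible (\<Phi> p)" "U \<subseteq> UNIV \<times> base H"
  using assms unfolding vector_bundle_def by fast+

lemma frame_columns:
  assumes "vector_bundle H" "(U, \<Phi>) \<in> frames H"
  shows "hol_section H U (\<lambda>p. column j (\<Phi> p))"
  unfolding hol_section_def
proof (intro conjI ballI, simp_all only: bundle_frame[OF assms] split_paired_all prod.case)
  fix U' \<Phi>' assume "(U', \<Phi>') \<in> frames H"
  then have "\<forall>i j. hol2 (U' \<inter> U) (\<lambda>p. (matrix_inv (\<Phi>' p) ** \<Phi> p) $ i $ j)"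
    using assms unfolding vector_bundle_def by fast
  moreover have "(matrix_inv M *v column j N) $ i = (matrix_inv M ** N) $ i $ j" for M N :: "complex^2^2" and i
    by (simp add: column_def matrix_vector_mult_def matrix_matrix_mult_def)
  ultimately show "\<forall>i. hol2 (U \<inter> U') (\<lambda>p. (matrix_inv (\<Phi>' p) *v column j (\<Phi> p)) $ i)"
    by (simp add: Int_commute)
qed

lemma section_coordinates:
  assumes "(U, \<Phi>) \<in> frames H" "hol_section H W s"
  shows "hol2 (W \<inter> U) (\<lambda>p. (matrix_inv (\<Phi> p) *v s p) $ i)"
  using assms unfolding hol_section_def by fast

lemma connection_Leibniz:
  fixes F :: "complex \<times> complex \<Rightarrow> complex^2^2"
  assumes fc: "flat_connection H" and W: "W \<subseteq> punctured H"
    and F: "\<And>j. hol_section H W (\<lambda>p. column j (F p))" and y: "\<And>i. hol2 W (\<lambda>p. y p $ i)" and p: "p \<in> W"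
  shows "nabz H (\<lambda>q. F q *v y q) p = F p *v (\<chi> i. partial_z (\<lambda>q. y q $ i) p)
      + (y p $ 1 *s nabz H (\<lambda>q. column 1 (F q)) p + y p $ 2 *s nabz H (\<lambda>q. column 2 (F q)) p)"
    and "nabt H (\<lambda>q. F q *v y q) p = F p *v (\<chi> i. partial_t (\<lambda>q. y q $ i) p)
      + (y p $ 1 *s nabt H (\<lambda>q. column 1 (F q)) p + y p $ 2 *s nabt H (\<lambda>q. column 2 (F q)) p)"
proof -
  have add: "nabz H (\<lambda>q. s q + s' q) p = nabz H s p + nabz H s' p \<and> nabt H (\<lambda>q. s q + s' q) p = nabt H s p + nabt H s' p"
    if "hol_section H W s" "hol_section H W s'" for s s'
    using fc W that p unfolding flat_connection_def by blast
  have mul: "nabz H (\<lambda>q. f q *s s q) p = partial_z f p *s s p + f p *s nabz H s p \<and>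
             nabt H (\<lambda>q. f q *s s q) p = partial_t f p *s s p + f p *s nabt H s p"
    if "hol_section H W s" "hol2 W f" for s f
    using fc W that p unfolding flat_connection_def by blast
  note a = add[OF hol_section_scale[OF y F] hol_section_scale[OF y F], of 1 1 2 2]
  show "nabz H (\<lambda>q. F q *v y q) p = F p *v (\<chi> i. partial_z (\<lambda>q. y q $ i) p)
      + (y p $ 1 *s nabz H (\<lambda>q. column 1 (F q)) p + y p $ 2 *s nabz H (\<lambda>q. column 2 (F q)) p)"
    unfolding matrix_vector_columns using a mul[OF F y] by (simp add: algebra_simps)
  show "nabt H (\<lambda>q. F q *v y q) p = F p *v (\<chi> i. partial_t (\<lambda>q. y q $ i) p)
      + (y p $ 1 *s nabt H (\<lambda>q. column 1 (F q)) p + y p $ 2 *s nabt H (\<lambda>q. column 2 (F q)) p)"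
    unfolding matrix_vector_columns using a mul[OF F y] by (simp add: algebra_simps)
qed

lemma connection_cong:
  assumes "flat_connection H" "W \<subseteq> punctured H" "hol_section H W s" "hol_section H W s'"
    "\<And>p. p \<in> W \<Longrightarrow> s p = s' p" "p \<in> W"
  shows "nabz H s p = nabz H s' p" "nabt H s p = nabt H s' p"
proof -
  have "\<forall>s'. hol_section H W s' \<and> (\<forall>p\<in>W. s p = s' p) \<longrightarrow> (\<forall>p\<in>W. nabz H s p = nabz H s' p \<and> nabt H s p = nabt H s' p)"
    using assms(1)[unfolded flat_connection_def, THEN spec[of _ W], THEN spec[of _ s]] assms(2,3) by simp
  then show "nabz H s p = nabz H s' p" "nabt H s p = nabt H s' p" using assms(4-6) by blast+
qed

lemma connection_section:
  assumes "flat_connection H" "W \<subseteq> punctured H" "hol_section H W s"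
  shows "hol_section H W (nabz H s)" "hol_section H W (nabt H s)"
    and "p \<in> W \<Longrightarrow> nabz H (nabt H s) p = nabt H (nabz H s) p"
  using assms(1)[unfolded flat_connection_def, THEN spec[of _ W], THEN spec[of _ s]] assms(2,3) by simp_all

lemma hol_section_zero: "open W \<Longrightarrow> W \<subseteq> UNIV \<times> base H \<Longrightarrow> hol_section H W (\<lambda>_. 0)"
  unfolding hol_section_def by (auto intro: hol2_const)

lemma connection_zero:
  assumes fc: "flat_connection H" and W: "W \<subseteq> punctured H" "open W" "p \<in> W"
  shows "nabz H (\<lambda>_. 0) p = 0" "nabt H (\<lambda>_. 0) p = 0"
proof -
  have "hol_section H W (\<lambda>_. 0)" using W by (intro hol_section_zero) (auto simp: punctured_def)
  then have "nabz H (\<lambda>q. 0 *s 0) p = partial_z (\<lambda>_. 0) p *s 0 + 0 *s nabz H (\<lambda>_. 0) p \<and>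
     nabt H (\<lambda>q. 0 *s 0) p = partial_t (\<lambda>_. 0) p *s 0 + 0 *s nabt H (\<lambda>_. 0) p"
    using fc W(1,3) hol2_const[of W 0] unfolding flat_connection_def by blast
  then show "nabz H (\<lambda>_. 0) p = 0" "nabt H (\<lambda>_. 0) p = 0" by simp_all
qed

text \<open>A holomorphic frame \<open>\<Phi>\<close> with the matrices \<open>B\<close> and \<open>A\<close> of \<open>z\<^sup>2 \<nabla>\<^sub>z\<close> and \<open>z \<nabla>\<^sub>t\<close>.  The frame is characterized by its
  effect on holomorphic sections and not as a member of the atlas, because constant changes of basis lead out of the
  atlas.\<close>

locale te_frame =
  fixes H :: te and U :: "(complex \<times> complex) set" and \<Phi> A B :: "complex \<times> complex \<Rightarrow> complex^2^2"
  assumes vb: "vector_bundle H" and conn: "flat_connection H"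
    and open_U: "open U" and U_base: "U \<subseteq> UNIV \<times> base H"
    and inv: "\<And>p. p \<in> U \<Longrightarrow> invertible (\<Phi> p)"
    and cols: "\<And>j. hol_section H U (\<lambda>p. column j (\<Phi> p))"
    and coords: "\<And>W s i. hol_section H W s \<Longrightarrow> hol2 (W \<inter> U) (\<lambda>p. (matrix_inv (\<Phi> p) *v s p) $ i)"
    and coords_along: "\<And>\<iota> V \<sigma> i. hol_section_along H \<iota> V \<sigma> \<Longrightarrow>
        (\<lambda>x. (matrix_inv (\<Phi> (\<iota> x)) *v \<sigma> x) $ i) holomorphic_on {x \<in> V. \<iota> x \<in> U}"
    and hol_B: "\<And>i j. hol2 U (\<lambda>p. B p $ i $ j)" and hol_A: "\<And>i j. hol2 U (\<lambda>p. A p $ i $ j)"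
    and nabz_cols: "\<And>p j. p \<in> U \<Longrightarrow> fst p \<noteq> 0 \<Longrightarrow>
        (fst p)^2 *s nabz H (\<lambda>q. column j (\<Phi> q)) p = \<Phi> p *v column j (B p)"
    and nabt_cols: "\<And>p j. p \<in> U \<Longrightarrow> fst p \<noteq> 0 \<Longrightarrow>
        fst p *s nabt H (\<lambda>q. column j (\<Phi> q)) p = \<Phi> p *v column j (A p)"
begin

lemma section_eq: "p \<in> U \<Longrightarrow> s p = \<Phi> p *v (matrix_inv (\<Phi> p) *v s p)"
  using matrix_inv_vec(1)[OF inv] by simp

lemma cancel: "p \<in> U \<Longrightarrow> \<Phi> p *v x = \<Phi> p *v y \<Longrightarrow> x = y"
  using invertible_mult_cancel[OF inv] by blast

lemma hol_section_frame:
  assumes "open W" "W \<subseteq> U" "\<And>i. hol2 W (\<lambda>p. y p $ i)"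
  shows "hol_section H W (\<lambda>p. \<Phi> p *v y p)"
  using assms by (intro hol_section_combination hol_section_subset[OF cols])

lemma punctured_sub: "W \<subseteq> U \<Longrightarrow> (\<And>p. p \<in> W \<Longrightarrow> fst p \<noteq> 0) \<Longrightarrow> W \<subseteq> punctured H"
  using U_base by (fastforce simp: punctured_def)

lemma nab_frame:
  assumes W: "open W" "W \<subseteq> U" "\<And>p. p \<in> W \<Longrightarrow> fst p \<noteq> 0" and y: "\<And>i. hol2 W (\<lambda>p. y p $ i)" and p: "p \<in> W"
  shows "(fst p)^2 *s nabz H (\<lambda>q. \<Phi> q *v y q) p = \<Phi> p *v ((fst p)^2 *s (\<chi> i. partial_z (\<lambda>q. y q $ i) p) + B p *v y p)"
    and "fst p *s nabt H (\<lambda>q. \<Phi> q *v y q) p = \<Phi> p *v (fst p *s (\<chi> i. partial_t (\<lambda>q. y q $ i) p) + A p *v y p)"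
proof -
  have cW: "hol_section H W (\<lambda>p. column j (\<Phi> p))" for j using hol_section_subset[OF cols W(1,2)] .
  note L = connection_Leibniz[where F = \<Phi> and y = y, OF conn punctured_sub[OF W(2,3)] cW y p]
  have pU: "p \<in> U" "fst p \<noteq> 0" using W p by auto
  have dist: "c *s (u + (e *s v + f *s w)) = c *s u + (e *s (c *s v) + f *s (c *s w))"
    for c e f :: complex and u v w :: "complex^2" by (simp add: vec_eq_iff algebra_simps)
  have lin: "M *v (a *s column 1 N + b *s column 2 N) = a *s (M *v column 1 N) + b *s (M *v column 2 N)"
    for M N :: "complex^2^2" and a b by (simp add: vec_eq_iff matrix_vector_2 algebra_simps)
  show "(fst p)^2 *s nabz H (\<lambda>q. \<Phi> q *v y q) p = \<Phi> p *v ((fst p)^2 *s (\<chi> i. partial_z (\<lambda>q. y q $ i) p) + B p *v y p)"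
  proof -
    have "(fst p)^2 *s nabz H (\<lambda>q. \<Phi> q *v y q) p = (fst p)^2 *s (\<Phi> p *v (\<chi> i. partial_z (\<lambda>q. y q $ i) p))
      + (y p $ 1 *s ((fst p)^2 *s nabz H (\<lambda>q. column 1 (\<Phi> q)) p) + y p $ 2 *s ((fst p)^2 *s nabz H (\<lambda>q. column 2 (\<Phi> q)) p))"
      using L(1) by (simp only: dist)
    also have "\<dots> = \<Phi> p *v ((fst p)^2 *s (\<chi> i. partial_z (\<lambda>q. y q $ i) p) + B p *v y p)"
      unfolding nabz_cols[OF pU] by (simp add: vec_eq_iff matrix_vector_2 column_def algebra_simps)
    finally show ?thesis .
  qed
  show "fst p *s nabt H (\<lambda>q. \<Phi> q *v y q) p = \<Phi> p *v (fst p *s (\<chi> i. partial_t (\<lambda>q. y q $ i) p) + A p *v y p)"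
  proof -
    have "fst p *s nabt H (\<lambda>q. \<Phi> q *v y q) p = fst p *s (\<Phi> p *v (\<chi> i. partial_t (\<lambda>q. y q $ i) p))
      + (y p $ 1 *s (fst p *s nabt H (\<lambda>q. column 1 (\<Phi> q)) p) + y p $ 2 *s (fst p *s nabt H (\<lambda>q. column 2 (\<Phi> q)) p))"
      using L(2) by (simp only: dist)
    also have "\<dots> = \<Phi> p *v (fst p *s (\<chi> i. partial_t (\<lambda>q. y q $ i) p) + A p *v y p)"
      unfolding nabt_cols[OF pU] by (simp add: vec_eq_iff matrix_vector_2 column_def algebra_simps)
    finally show ?thesis .
  qed
qed

lemma nab_section:
  assumes s: "hol_section H W s" and p: "p \<in> W" "p \<in> U" "fst p \<noteq> 0"
  defines "y \<equiv> \<lambda>q. matrix_inv (\<Phi> q) *v s q"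
  shows "(fst p)^2 *s nabz H s p = \<Phi> p *v ((fst p)^2 *s (\<chi> i. partial_z (\<lambda>q. y q $ i) p) + B p *v y p)"
    and "fst p *s nabt H s p = \<Phi> p *v (fst p *s (\<chi> i. partial_t (\<lambda>q. y q $ i) p) + A p *v y p)"
proof -
  define V where "V = (W \<inter> U) \<inter> {q. fst q \<noteq> 0}"
  have oW: "open W" using s by (simp add: hol_section_def)
  have V: "open V" "V \<subseteq> U" "V \<subseteq> W" "\<And>q. q \<in> V \<Longrightarrow> fst q \<noteq> 0" "p \<in> V"
    using p oW open_U by (auto simp: V_def intro!: open_Int open_Collect_neq continuous_intros)
  have y: "hol2 V (\<lambda>p. y p $ i)" for i
    unfolding y_def by (rule hol2_subset[OF coords[OF s]]) (auto simp: V_def)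
  have sV: "hol_section H V s" using hol_section_subset[OF s V(1,3)] .
  have "s q = \<Phi> q *v y q" if "q \<in> V" for q
    using section_eq[of q s] that V(2) by (auto simp: y_def)
  note c = connection_cong[OF conn punctured_sub[OF V(2,4)] sV hol_section_frame[OF V(1,2) y] this V(5)]
  have "nabz H s p = nabz H (\<lambda>q. \<Phi> q *v y q) p" "nabt H s p = nabt H (\<lambda>q. \<Phi> q *v y q) p"
    by (rule c; assumption)+
  then show "(fst p)^2 *s nabz H s p = \<Phi> p *v ((fst p)^2 *s (\<chi> i. partial_z (\<lambda>q. y q $ i) p) + B p *v y p)"
    "fst p *s nabt H s p = \<Phi> p *v (fst p *s (\<chi> i. partial_t (\<lambda>q. y q $ i) p) + A p *v y p)"
    using nab_frame[OF V(1,2,4) y V(5)] by simp_all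
qed

text \<open>The two covariant derivatives commute on the columns of the frame.\<close>

lemma flatness_equation:
  assumes p: "p \<in> U" "fst p \<noteq> 0"
  shows "fst p * partial_t (\<lambda>p. B p $ i $ j) p = (B p ** A p - A p ** B p) $ i $ j
      + (fst p)^2 * partial_z (\<lambda>p. A p $ i $ j) p - fst p * A p $ i $ j"
proof -
  define V where "V = U \<inter> {q. fst q \<noteq> 0}"
  have V: "open V" "V \<subseteq> U" "\<And>q. q \<in> V \<Longrightarrow> fst q \<noteq> 0" "p \<in> V"
    using p open_U by (auto simp: V_def intro!: open_Int open_Collect_neq continuous_intros)
  note VP = punctured_sub[OF V(2,3)]
  define s where "s = (\<lambda>q. column j (\<Phi> q))"
  define a where "a = (\<lambda>q. (1 / fst q) *s column j (A q))"
  define b where "b = (\<lambda>q. (1 / (fst q)^2) *s column j (B q))"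
  have sV: "hol_section H V s" unfolding s_def using hol_section_subset[OF cols V(1,2)] .
  have hA: "hol2 V (\<lambda>q. A q $ i $ j)" "hol2 V (\<lambda>q. B q $ i $ j)" for i j
    using V(2) by (auto intro: hol2_subset hol_A hol_B)
  have ha: "hol2 V (\<lambda>q. a q $ i)" "hol2 V (\<lambda>q. b q $ i)" for i
    unfolding a_def b_def column_def using V(3) by (auto intro!: hol2_intros hA)
  have eq: "nabt H s q = \<Phi> q *v a q" "nabz H s q = \<Phi> q *v b q" if "q \<in> V" for q
  proof -
    have q: "q \<in> U" "fst q \<noteq> 0" using that V by auto
    have "(1 / fst q) *s (fst q *s nabt H s q) = nabt H s q" "(1 / (fst q)^2) *s ((fst q)^2 *s nabz H s q) = nabz H s q"
      using q(2) by (simp_all add: vec_eq_iff)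
    then show "nabt H s q = \<Phi> q *v a q" "nabz H s q = \<Phi> q *v b q"
      unfolding s_def a_def b_def nabz_cols[OF q] nabt_cols[OF q]
      by (simp_all add: vec_eq_iff matrix_vector_2 algebra_simps)
  qed
  have "nabz H (nabt H s) p = nabz H (\<lambda>q. \<Phi> q *v a q) p"
    by (rule connection_cong(1)[OF conn VP connection_section(2)[OF conn VP sV] hol_section_frame[OF V(1,2) ha(1)] eq(1) V(4)])
  moreover have "nabt H (nabz H s) p = nabt H (\<lambda>q. \<Phi> q *v b q) p"
    by (rule connection_cong(2)[OF conn VP connection_section(1)[OF conn VP sV] hol_section_frame[OF V(1,2) ha(2)] eq(2) V(4)])
  ultimately have "nabz H (\<lambda>q. \<Phi> q *v a q) p = nabt H (\<lambda>q. \<Phi> q *v b q) p"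
    using connection_section(3)[OF conn VP sV V(4)] by simp
  then have "fst p *s ((fst p)^2 *s nabz H (\<lambda>q. \<Phi> q *v a q) p) = (fst p)^2 *s (fst p *s nabt H (\<lambda>q. \<Phi> q *v b q) p)"
    by (simp add: vec_eq_iff)
  then have "fst p *s (\<Phi> p *v ((fst p)^2 *s (\<chi> i. partial_z (\<lambda>q. a q $ i) p) + B p *v a p)) =
     (fst p)^2 *s (\<Phi> p *v (fst p *s (\<chi> i. partial_t (\<lambda>q. b q $ i) p) + A p *v b p))"
    using nab_frame(1)[OF V(1-3) ha(1) V(4)] nab_frame(2)[OF V(1-3) ha(2) V(4)] by simp
  moreover have "c *s (M *v x) = M *v (c *s x)" for M :: "complex^2^2" and c x
    by (simp add: vec_eq_iff matrix_vector_2 algebra_simps)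
  ultimately have key: "fst p *s ((fst p)^2 *s (\<chi> i. partial_z (\<lambda>q. a q $ i) p) + B p *v a p) =
     (fst p)^2 *s (fst p *s (\<chi> i. partial_t (\<lambda>q. b q $ i) p) + A p *v b p)"
    using cancel[OF p(1)] by metis
  obtain z t where zt: "p = (z, t)" by (cases p)
  have z: "z \<noteq> 0" "(z, t) \<in> U" using p by (auto simp: zt)
  have pa: "partial_z (\<lambda>q. a q $ i) p = partial_z (\<lambda>q. A q $ i $ j) p / z - A p $ i $ j / z^2"
  proof -
    have "((\<lambda>z. A (z, t) $ i $ j / z) has_field_derivative
       (partial_z (\<lambda>q. A q $ i $ j) (z, t) * z - A (z, t) $ i $ j * 1) / (z * z)) (at z)"
      by (rule DERIV_divide[OF hol2_slice_z[OF hol_A z(2)] DERIV_ident z(1)])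
    then have "((\<lambda>z. a (z, t) $ i) has_field_derivative
      partial_z (\<lambda>q. A q $ i $ j) (z, t) / z - A (z, t) $ i $ j / z\<^sup>2) (at z)"
      using z(1) by (simp add: a_def column_def field_simps power2_eq_square)
    then show ?thesis unfolding partial_z_def[of "\<lambda>q. a q $ i"] by (simp add: zt DERIV_imp_deriv)
  qed
  have pb: "partial_t (\<lambda>q. b q $ i) p = partial_t (\<lambda>q. B q $ i $ j) p / z^2"
  proof -
    have "((\<lambda>t. b (z, t) $ i) has_field_derivative partial_t (\<lambda>q. B q $ i $ j) (z, t) / z\<^sup>2) (at t)"
      using DERIV_cdivide[OF hol2_slice_t[OF hol_B z(2)], of i j "z^2"] by (simp add: b_def column_def)
    then show ?thesis unfolding partial_t_def[of "\<lambda>q. b q $ i"] by (simp add: zt DERIV_imp_deriv)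
  qed
  have "z * (z^2 * (partial_z (\<lambda>q. A q $ i $ j) p / z - A p $ i $ j / z^2) + (B p ** A p) $ i $ j / z) =
     z^2 * (z * (partial_t (\<lambda>q. B q $ i $ j) p / z^2) + (A p ** B p) $ i $ j / z^2)"
    using arg_cong[OF key, of "\<lambda>x. x $ i"] unfolding vector_smult_component vector_add_component vec_lambda_beta pa pb
    by (simp add: zt a_def b_def column_def matrix_vector_2 matrix_matrix_mult_def sum_2 add_divide_distrib)
  note that = this
  have "z * partial_t (\<lambda>q. B q $ i $ j) p + (A p ** B p) $ i $ j = z^2 * partial_z (\<lambda>q. A q $ i $ j) p - z * A p $ i $ j + (B p ** A p) $ i $ j"
  proof -
    have "T * z + P = z^2 * Q - z * a + S" if "z * (z^2 * (Q / z - a / z^2) + S / z) = z^2 * (z * (T / z^2) + P / z^2)"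
      for T P Q a S :: complex
    proof -
      have "z * (z^2 * (Q / z - a / z^2) + S / z) = z^2 * Q - z * a + S" "z^2 * (z * (T / z^2) + P / z^2) = T * z + P"
        using z(1) by (simp_all add: field_simps power2_eq_square)
      then show ?thesis using that by simp
    qed
    then show ?thesis using that by (metis mult.commute)
  qed
  then show ?thesis by (simp add: zt algebra_simps)
qed

end

text \<open>By the pole condition the matrices of \<open>z\<^sup>2 \<nabla>\<^sub>z\<close> and \<open>z \<nabla>\<^sub>t\<close> are holomorphic also at \<open>z = 0\<close>.\<close>

lemma te_frame_exists:
  assumes TE: "TE_structure H" and fr: "(U, \<Phi>) \<in> frames H"
  shows "\<exists>A B. te_frame H U \<Phi> A B"
proof -
  have b: "vector_bundle H" and c: "flat_connection H" and pc: "pole_condition H"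
    using TE by (auto simp: TE_structure_def)
  note cols = frame_columns[OF b fr]
  have "\<exists>u v. hol_section H U u \<and> (\<forall>p\<in>U. fst p \<noteq> 0 \<longrightarrow> u p = fst p *s nabt H (\<lambda>q. column j (\<Phi> q)) p) \<and>
      hol_section H U v \<and> (\<forall>p\<in>U. fst p \<noteq> 0 \<longrightarrow> v p = (fst p)\<^sup>2 *s nabz H (\<lambda>q. column j (\<Phi> q)) p)" for j
    using pc[unfolded pole_condition_def, THEN spec[of _ U], THEN spec[of _ "\<lambda>q. column j (\<Phi> q)"]] cols by blast
  then obtain u v where u: "\<And>j. hol_section H U (u j)" "\<And>j p. p \<in> U \<Longrightarrow> fst p \<noteq> 0 \<Longrightarrow> u j p = fst p *s nabt H (\<lambda>q. column j (\<Phi> q)) p"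
    and v: "\<And>j. hol_section H U (v j)" "\<And>j p. p \<in> U \<Longrightarrow> fst p \<noteq> 0 \<Longrightarrow> v j p = (fst p)\<^sup>2 *s nabz H (\<lambda>q. column j (\<Phi> q)) p"
    by metis
  define A where "A = (\<lambda>p. (\<chi> i j. (matrix_inv (\<Phi> p) *v u j p) $ i) :: complex^2^2)"
  define B where "B = (\<lambda>p. (\<chi> i j. (matrix_inv (\<Phi> p) *v v j p) $ i) :: complex^2^2)"
  have col: "column j (A p) = matrix_inv (\<Phi> p) *v u j p" "column j (B p) = matrix_inv (\<Phi> p) *v v j p" for j p
    by (simp_all add: A_def B_def column_def vec_eq_iff)
  have "te_frame H U \<Phi> A B"
  proof
    show "hol2 U (\<lambda>p. B p $ i $ j)" "hol2 U (\<lambda>p. A p $ i $ j)" for i j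
      using section_coordinates[OF fr v(1)] section_coordinates[OF fr u(1)] by (simp_all add: A_def B_def)
    fix W s i assume "hol_section H W s"
    then show "hol2 (W \<inter> U) (\<lambda>p. (matrix_inv (\<Phi> p) *v s p) $ i)" by (rule section_coordinates[OF fr])
  next
    fix \<iota> V \<sigma> i assume "hol_section_along H \<iota> V \<sigma>"
    then show "(\<lambda>x. (matrix_inv (\<Phi> (\<iota> x)) *v \<sigma> x) $ i) holomorphic_on {x \<in> V. \<iota> x \<in> U}"
      using fr unfolding hol_section_along_def by blast
  next
    fix p j assume p: "p \<in> U" "fst p \<noteq> 0"
    show "(fst p)\<^sup>2 *s nabz H (\<lambda>q. column j (\<Phi> q)) p = \<Phi> p *v column j (B p)"
      "fst p *s nabt H (\<lambda>q. column j (\<Phi> q)) p = \<Phi> p *v column j (A p)"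
      unfolding col matrix_inv_vec(1)[OF bundle_frame(2)[OF b fr p(1)]] u(2)[OF p] v(2)[OF p] by simp_all
  qed (use b c bundle_frame[OF b fr] cols in auto)
  then show ?thesis by blast
qed

lemma matrix_inv_prod:
  fixes M g :: "complex^2^2"
  assumes "invertible M" "invertible g"
  shows "matrix_inv (M ** g) = matrix_inv g ** matrix_inv M"
proof -
  have i: "invertible (M ** g)" using assms by (rule invertible_mult)
  have "(matrix_inv g ** matrix_inv M) ** (M ** g) = matrix_inv g ** ((matrix_inv M ** M) ** g)"
    by (simp only: matrix_mul_assoc)
  then have l: "(matrix_inv g ** matrix_inv M) ** (M ** g) = mat 1"
    using matrix_inv_mult[OF assms(1)] matrix_inv_mult[OF assms(2)] by simp
  have "(matrix_inv g ** matrix_inv M) ** ((M ** g) ** matrix_inv (M ** g)) = matrix_inv (M ** g)"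
    using l by (simp add: matrix_mul_assoc)
  then show ?thesis using matrix_inv_mult(2)[OF i] by simp
qed

lemma hol2_matrix_vector:
  fixes y :: "complex \<times> complex \<Rightarrow> complex^2"
  shows "(\<And>i. hol2 W (\<lambda>p. y p $ i)) \<Longrightarrow> hol2 W (\<lambda>p. ((g :: complex^2^2) *v y p) $ i)"
  unfolding matrix_vector_2 by (intro hol2_intros)

text \<open>Constant changes of basis serve to diagonalize the residue or the leading coefficient of the pole part.\<close>

lemma te_frame_gauge:
  fixes g :: "complex^2^2"
  assumes te: "te_frame H U \<Phi> A B" and g: "invertible g"
  shows "te_frame H U (\<lambda>p. \<Phi> p ** g) (\<lambda>p. matrix_inv g ** (A p ** g)) (\<lambda>p. matrix_inv g ** (B p ** g))"
proof -
  interpret te_frame H U \<Phi> A B by (rule te)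
  have mi: "matrix_inv (\<Phi> p ** g) *v x = matrix_inv g *v (matrix_inv (\<Phi> p) *v x)" if "p \<in> U" for p x
    using matrix_inv_prod[OF inv[OF that] g] by (simp add: matrix_vector_mul_assoc)
  have entry: "(matrix_inv g ** (M ** g)) $ i $ j = (\<Sum>a\<in>UNIV. \<Sum>b\<in>UNIV. matrix_inv g $ i $ a * M $ a $ b * g $ b $ j)"
    for M :: "complex^2^2" and i j
    by (simp add: matrix_matrix_mult_def sum_2 algebra_simps)
  show ?thesis
  proof
    show "invertible (\<Phi> p ** g)" if "p \<in> U" for p using inv[OF that] g by (rule invertible_mult)
    show "hol_section H U (\<lambda>p. column j (\<Phi> p ** g))" for j
      unfolding column_mult by (rule hol_section_frame[OF open_U subset_refl hol2_const])
    fix W s i assume s: "hol_section H W s"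
    have "open (W \<inter> U)" using s open_U by (auto simp: hol_section_def)
    then show "hol2 (W \<inter> U) (\<lambda>p. (matrix_inv (\<Phi> p ** g) *v s p) $ i)"
      by (rule hol2_transform[OF hol2_matrix_vector[OF coords[OF s]], where g1 = "matrix_inv g"]) (simp add: mi)
  next
    fix \<iota> V \<sigma> i assume s: "hol_section_along H \<iota> V \<sigma>"
    have "(\<lambda>x. (matrix_inv g *v (matrix_inv (\<Phi> (\<iota> x)) *v \<sigma> x)) $ i) holomorphic_on {x \<in> V. \<iota> x \<in> U}"
      unfolding matrix_vector_2[of "matrix_inv g"] by (intro holomorphic_intros coords_along[OF s])
    then show "(\<lambda>x. (matrix_inv (\<Phi> (\<iota> x) ** g) *v \<sigma> x) $ i) holomorphic_on {x \<in> V. \<iota> x \<in> U}"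
      by (rule holomorphic_transform) (simp add: mi)
  next
    show "hol2 U (\<lambda>p. (matrix_inv g ** (B p ** g)) $ i $ j)" "hol2 U (\<lambda>p. (matrix_inv g ** (A p ** g)) $ i $ j)" for i j
      unfolding entry by (intro hol2_intros hol_A hol_B)+
  next
    fix p j assume p: "p \<in> U" "fst p \<noteq> 0"
    define W where "W = U \<inter> {q. fst q \<noteq> 0}"
    have W: "open W" "W \<subseteq> U" "\<And>q. q \<in> W \<Longrightarrow> fst q \<noteq> 0" "p \<in> W"
      using p open_U by (auto simp: W_def intro!: open_Int open_Collect_neq continuous_intros)
    note nf = nab_frame[OF W(1-3) hol2_const W(4), of "column j g"]
    have z: "(\<chi> i. partial_z (\<lambda>q. column j g $ i) p) = 0" "(\<chi> i. partial_t (\<lambda>q. column j g $ i) p) = 0"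
      by (simp_all add: vec_eq_iff partial_z_def partial_t_def)
    have c: "(\<Phi> p ** g) *v column j (matrix_inv g ** (M ** g)) = \<Phi> p *v (M *v column j g)" for M :: "complex^2^2"
    proof -
      have "(\<Phi> p ** g) *v column j (matrix_inv g ** (M ** g)) = \<Phi> p *v (g *v (matrix_inv g *v (M *v column j g)))"
        by (simp add: column_mult matrix_vector_mul_assoc[symmetric])
      then show ?thesis using matrix_inv_vec(1)[OF g] by simp
    qed
    show "(fst p)\<^sup>2 *s nabz H (\<lambda>q. column j (\<Phi> q ** g)) p = (\<Phi> p ** g) *v column j (matrix_inv g ** (B p ** g))"
      unfolding c unfolding column_mult using nf(1) unfolding z by simp
    show "fst p *s nabt H (\<lambda>q. column j (\<Phi> q ** g)) p = (\<Phi> p ** g) *v column j (matrix_inv g ** (A p ** g))"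
      unfolding c unfolding column_mult using nf(2) unfolding z by simp
  qed (use vb conn open_U U_base in auto)
qed

section \<open>Taylor series of holomorphic functions of two variables\<close>

lemma partial_t_swap: "partial_t f (z, t) = partial_z (\<lambda>p. f (snd p, fst p)) (t, z)"
  by (simp add: partial_t_def partial_z_def)

lemma open_swap: "open W \<Longrightarrow> open {p. (snd p, fst p) \<in> (W :: (complex \<times> complex) set)}"
proof -
  assume "open W"
  then have "open ((\<lambda>p. (snd p, fst p)) -` W)" by (intro open_vimage continuous_intros)
  then show ?thesis by (simp add: vimage_def)
qed

lemma hol2_partial_t:
  assumes "open W" "hol2 W f"
  shows "hol2 W (partial_t f)"
proof -
  let ?W = "{p. (snd p, fst p) \<in> W}"
  have "hol2 ?W (\<lambda>p. f (snd p, fst p))"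
    by (rule hol2_compose[OF hol2_snd hol2_fst assms(2)]) auto
  then have "hol2 ?W (partial_z (\<lambda>p. f (snd p, fst p)))"
    by (rule hol2_partial_z[OF open_swap[OF assms(1)]])
  then have "hol2 W (\<lambda>p. partial_z (\<lambda>p. f (snd p, fst p)) (snd p, fst p))"
    by (rule hol2_compose[OF hol2_snd hol2_fst]) auto
  then show ?thesis
    by (rule hol2_transform[OF _ assms(1)]) (simp add: partial_t_swap[symmetric])
qed

text \<open>The difference quotients in \<open>z\<close> converge locally uniformly in \<open>t\<close>, and so do their derivatives with respect to \<open>t\<close>.\<close>

lemma partials_commute:
  assumes W: "open W" and hol: "hol2 W f" and p: "(z, t) \<in> W"
  shows "partial_t (partial_z f) (z, t) = partial_z (partial_t f) (z, t)"
proof -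
  obtain r where r: "r > 0" "cball z r \<times> cball t r \<subseteq> W"
    "uniform_limit (ball t r) (\<lambda>n t. (f (z + of_real (r / Suc n), t) - f (z, t)) / of_real (r / Suc n))
      (\<lambda>t. partial_z f (z, t)) sequentially"
    by (rule difference_quotient_uniform_limit[OF W hol p])
  define h where "h = (\<lambda>n. complex_of_real (r / Suc n))"
  have hd: "complex_of_real (r / Suc n) = h n" for n by (simp add: h_def)
  have hr: "z + h n \<in> cball z r" "h n \<noteq> 0" for n
    using r(1) by (auto simp: h_def dist_norm norm_divide field_simps simp del: of_nat_Suc)
  have mem: "(z + h n, s) \<in> W" "(z, s) \<in> W" if "s \<in> ball t r" for n s
    using hr(1)[of n] r(1,2) that by auto
  have h0: "h \<longlonglongrightarrow> 0"
    using tendsto_of_real[OF tendsto_mult_right_zero[OF LIMSEQ_inverse_real_of_nat, of r]]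
    by (simp only: h_def divide_inverse of_real_0)
  have d: "deriv (\<lambda>s. (f (z + h n, s) - f (z, s)) / h n) t = (partial_t f (z + h n, t) - partial_t f (z, t)) / h n" for n
    using mem r(1) by (intro DERIV_imp_deriv DERIV_cdivide DERIV_diff hol2_slice_t[OF hol]) auto
  have "(\<lambda>n. (deriv ^^ 1) (\<lambda>s. (f (z + h n, s) - f (z, s)) / h n) t) \<longlonglongrightarrow> (deriv ^^ 1) (\<lambda>s. partial_z f (z, s)) t"
  proof (rule higher_deriv_complex_uniform_limit[OF r(3)[unfolded hd]])
    have "(\<lambda>s. (f (z + h n, s) - f (z, s)) / h n) holomorphic_on ball t r" for n
      using mem hr(2)[of n] by (intro holomorphic_intros holomorphic_on_subset[OF hol2_holomorphic(2)[OF hol]]) auto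
    then show "\<forall>\<^sub>F n in sequentially. (\<lambda>s. (f (z + h n, s) - f (z, s)) / h n) holomorphic_on ball t r" by simp
  qed (use r(1) in auto)
  then have 1: "(\<lambda>n. (partial_t f (z + h n, t) - partial_t f (z, t)) / h n) \<longlonglongrightarrow> partial_t (partial_z f) (z, t)"
    by (simp add: d partial_t_def[of "partial_z f"])
  have "((\<lambda>z. partial_t f (z, t)) has_field_derivative partial_z (partial_t f) (z, t)) (at z)"
    by (rule hol2_slice_z[OF hol2_partial_t[OF W hol] p])
  then have "((\<lambda>h. (partial_t f (z + h, t) - partial_t f (z, t)) / h) \<longlongrightarrow> partial_z (partial_t f) (z, t)) (at 0)"
    by (simp add: DERIV_def)
  moreover have "filterlim h (at 0) sequentially"
    using h0 hr(2) by (simp add: filterlim_at)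
  ultimately have "(\<lambda>n. (partial_t f (z + h n, t) - partial_t f (z, t)) / h n) \<longlonglongrightarrow> partial_z (partial_t f) (z, t)"
    by (rule filterlim_compose)
  then show ?thesis using 1 LIMSEQ_unique by blast
qed

text \<open>The complement of \<open>z = 0\<close> is dense, so identities extend by continuity.\<close>

lemma hol2_extend_eq:
  assumes W: "open W" and f: "hol2 W f" and g: "hol2 W g"
    and eq: "\<And>p. p \<in> W \<Longrightarrow> fst p \<noteq> 0 \<Longrightarrow> f p = g p" and p: "p \<in> W"
  shows "f p = g p"
proof (cases "fst p = 0")
  case True
  then obtain t where pt: "p = (0, t)" by (cases p) auto
  have "isCont (\<lambda>z. f (z, t)) 0" "isCont (\<lambda>z. g (z, t)) 0"
    using hol2_slice_z[OF f] hol2_slice_z[OF g] p pt DERIV_isCont by blast+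
  then have "((\<lambda>z. f (z, t) - g (z, t)) \<longlongrightarrow> f (0, t) - g (0, t)) (at 0)"
    unfolding isCont_def by (rule tendsto_diff)
  moreover have "eventually (\<lambda>z. (z, t) \<in> W) (nhds 0)"
    using eventually_nhds_in_open[OF open_slices(1)[OF W], of 0 t] p pt by simp
  then have "eventually (\<lambda>z. f (z, t) - g (z, t) = 0) (at 0)"
    unfolding eventually_at_filter by eventually_elim (auto simp: eq)
  then have "((\<lambda>z. f (z, t) - g (z, t)) \<longlongrightarrow> 0) (at 0)" by (rule tendsto_eventually)
  ultimately show ?thesis using pt LIM_unique by fastforce
qed (use eq p in auto)

text \<open>The Taylor series at the origin; meaningful for functions that are holomorphic near it.\<close>

definition taylor :: "(complex \<times> complex \<Rightarrow> complex) \<Rightarrow> series" where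
  "taylor f = Abs_fps (\<lambda>i. fps_expansion (zcoeff i f) 0)"

context
  fixes W :: "(complex \<times> complex) set"
  assumes W: "open W" "(0, 0) \<in> W"
begin

lemma slice_nhd: "eventually (\<lambda>t. (0, t) \<in> W) (nhds 0)"
  using eventually_nhds_in_open[OF open_slices(2)[OF W(1)], of 0 0] W(2) by simp

lemma taylor_nth: "hol2 W f \<Longrightarrow> zcoeff i f has_fps_expansion fps_nth (taylor f) i"
  unfolding taylor_def fps_nth_Abs_fps
  by (rule has_fps_expansion_fps_expansion[OF open_slices(2)[OF W(1)] _ zcoeff_holomorphic[OF W(1)]]) (use W(2) in auto)

lemma taylor_eqI:
  assumes "\<And>i t. (0, t) \<in> W \<Longrightarrow> zcoeff i f t = g i t" "\<And>i. g i has_fps_expansion fps_nth G i"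
  shows "taylor f = G"
proof (rule fps_ext)
  fix i
  have "zcoeff i f has_fps_expansion fps_nth G i"
    using assms(2)[of i] by (subst has_fps_expansion_cong[OF _ refl]) (auto intro: eventually_mono[OF slice_nhd] assms(1))
  then show "fps_nth (taylor f) i = fps_nth G i" by (simp add: taylor_def fps_expansion_eqI)
qed

lemma taylor_add: "hol2 W f \<Longrightarrow> hol2 W g \<Longrightarrow> taylor (\<lambda>p. f p + g p) = taylor f + taylor g"
proof (rule taylor_eqI[where g = "\<lambda>i t. zcoeff i f t + zcoeff i g t"])
  fix i t assume fg: "hol2 W f" "hol2 W g" and t: "(0, t) \<in> W"
  show "zcoeff i (\<lambda>p. f p + g p) t = zcoeff i f t + zcoeff i g t"
    using zcoeffI[of "\<lambda>p. f p + g p" t, OF has_fps_expansion_add[OF zcoeff_has_fps_expansion[OF W(1) fg(1) t] zcoeff_has_fps_expansion[OF W(1) fg(2) t]]]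
    by simp
qed (auto intro!: has_fps_expansion_add taylor_nth)

lemma taylor_mult: "hol2 W f \<Longrightarrow> hol2 W g \<Longrightarrow> taylor (\<lambda>p. f p * g p) = taylor f * taylor g"
proof (rule taylor_eqI[where g = "\<lambda>i t. \<Sum>a\<in>{0..i}. zcoeff a f t * zcoeff (i - a) g t"])
  fix i t assume fg: "hol2 W f" "hol2 W g" and t: "(0, t) \<in> W"
  show "zcoeff i (\<lambda>p. f p * g p) t = (\<Sum>a\<in>{0..i}. zcoeff a f t * zcoeff (i - a) g t)"
    using zcoeffI[of "\<lambda>p. f p * g p" t, OF has_fps_expansion_mult[OF zcoeff_has_fps_expansion[OF W(1) fg(1) t] zcoeff_has_fps_expansion[OF W(1) fg(2) t]]]
    by (simp add: fps_mult_nth)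
qed (auto simp: fps_mult_nth intro!: has_fps_expansion_sum has_fps_expansion_mult taylor_nth)

lemma taylor_const: "taylor (\<lambda>_. c) = fps_const (fps_const c)"
proof (rule taylor_eqI[where g = "\<lambda>i _. if i = 0 then c else 0"])
  fix i t
  show "zcoeff i (\<lambda>_. c) t = (if i = 0 then c else 0)"
    using zcoeffI[of "\<lambda>_. c" t, OF has_fps_expansion_const] by simp
qed auto

lemma taylor_fst: "taylor fst = fps_X"
proof (rule taylor_eqI[where g = "\<lambda>i _. if i = 1 then 1 else 0"])
  fix i t
  show "zcoeff i fst t = (if i = 1 then 1 else 0)"
  proof -
    have "(\<lambda>z. fst (z, t)) has_fps_expansion fps_X" by (simp add: has_fps_expansion_fps_X)
    from zcoeffI[OF this, of i] show ?thesis by simp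
  qed
qed (auto simp: fps_X_def)

lemma taylor_minus: "hol2 W f \<Longrightarrow> taylor (\<lambda>p. - f p) = - taylor f"
  using taylor_mult[OF hol2_const, of f "-1"] by (simp add: taylor_const flip: fps_const_neg)

lemma taylor_diff: "hol2 W f \<Longrightarrow> hol2 W g \<Longrightarrow> taylor (\<lambda>p. f p - g p) = taylor f - taylor g"
  using taylor_add[OF _ hol2_minus, of f g] by (simp add: taylor_minus)

lemma taylor_partial_z: "hol2 W f \<Longrightarrow> taylor (partial_z f) = fps_deriv (taylor f)"
proof (rule taylor_eqI[where g = "\<lambda>i t. of_nat (Suc i) * zcoeff (Suc i) f t"])
  fix i t
  show "zcoeff i (partial_z f) t = of_nat (Suc i) * zcoeff (Suc i) f t"
    by (simp add: zcoeff_def partial_z_def funpow_Suc_right field_simps del: funpow.simps of_nat_Suc)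
next
  fix i assume "hol2 W f"
  have "(\<lambda>t. of_nat (Suc i) * zcoeff (Suc i) f t) has_fps_expansion fps_const (of_nat (Suc i)) * fps_nth (taylor f) (Suc i)"
    using \<open>hol2 W f\<close> by (intro has_fps_expansion_cmult_left taylor_nth)
  then show "(\<lambda>t. of_nat (Suc i) * zcoeff (Suc i) f t) has_fps_expansion fps_nth (fps_deriv (taylor f)) i"
    unfolding fps_of_nat fps_deriv_nth Suc_eq_plus1 .
qed

lemma taylor_partial_t: "hol2 W f \<Longrightarrow> taylor (partial_t f) = fps_deriv_coeffs (taylor f)"
proof (rule taylor_eqI[where g = "\<lambda>i t. deriv (zcoeff i f) t"])
  fix i t assume f: "hol2 W f" and t: "(0, t) \<in> W"
  have hp: "hol2 W ((partial_z ^^ i) f)" for i by (induction i) (auto intro: f hol2_partial_z[OF W(1)])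
  have e: "(partial_z ^^ i) (partial_t f) p = partial_t ((partial_z ^^ i) f) p" if "p \<in> W" for p i
    using that
  proof (induction i arbitrary: p)
    case (Suc i)
    obtain z t where [simp]: "p = (z, t)" by (cases p)
    have "(partial_z ^^ Suc i) (partial_t f) p = partial_z (partial_t ((partial_z ^^ i) f)) p"
      using partials_transform(1)[OF W(1) Suc.prems Suc.IH] by simp
    also have "\<dots> = partial_t (partial_z ((partial_z ^^ i) f)) p"
      using partials_commute[OF W(1) hp[of i]] Suc.prems by simp
    finally show ?case by simp
  qed simp
  have "zcoeff i (partial_t f) t = partial_t ((partial_z ^^ i) f) (0, t) / fact i"
    using e[OF t] by (simp add: zcoeff_def funpow_partial_z[symmetric])
  also have "\<dots> = deriv (\<lambda>t. (partial_z ^^ i) f (0, t) / fact i) t"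
    using DERIV_cdivide[OF hol2_slice_t[OF hp t], THEN DERIV_imp_deriv] by simp
  also have "\<dots> = deriv (zcoeff i f) t"
    by (simp add: zcoeff_def[abs_def] funpow_partial_z[symmetric])
  finally show "zcoeff i (partial_t f) t = deriv (zcoeff i f) t" .
qed (auto simp: fps_deriv_coeffs_def intro!: has_fps_expansion_deriv taylor_nth)

lemma taylor_cong: "(\<And>p. p \<in> W \<Longrightarrow> f p = g p) \<Longrightarrow> hol2 W g \<Longrightarrow> taylor f = taylor g"
proof (rule taylor_eqI[where g = "\<lambda>i. zcoeff i g"])
  fix i t assume eq: "\<And>p. p \<in> W \<Longrightarrow> f p = g p" and t: "(0, t) \<in> W"
  have "eventually (\<lambda>z. f (z, t) = g (z, t)) (nhds 0)"
    using eventually_nhds_in_open[OF open_slices(1)[OF W(1)], of 0 t] t by (auto elim!: eventually_mono simp: eq)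
  then show "zcoeff i f t = zcoeff i g t" unfolding zcoeff_def by (simp add: higher_deriv_cong_ev)
qed (auto intro: taylor_nth)

end

context te_frame begin

lemma flat_series_taylor:
  assumes O: "(0, 0) \<in> U"
  shows "flat_series (\<lambda>i j. taylor (\<lambda>p. A p $ i $ j)) (\<lambda>i j. taylor (\<lambda>p. B p $ i $ j))"
  unfolding flat_series_def
proof (intro allI)
  fix i j
  let ?l = "\<lambda>p. fst p * partial_t (\<lambda>p. B p $ i $ j) p"
  let ?c = "\<lambda>p. B p $ i $ 1 * A p $ 1 $ j + B p $ i $ 2 * A p $ 2 $ j - (A p $ i $ 1 * B p $ 1 $ j + A p $ i $ 2 * B p $ 2 $ j)"
  let ?r = "\<lambda>p. ?c p + fst p * fst p * partial_z (\<lambda>p. A p $ i $ j) p - fst p * A p $ i $ j"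
  have dz: "hol2 U (partial_z (\<lambda>p. A p $ i $ j))" and dt: "hol2 U (partial_t (\<lambda>p. B p $ i $ j))"
    using hol2_partial_z[OF open_U hol_A] hol2_partial_t[OF open_U hol_B] .
  have hl: "hol2 U ?l" by (intro hol2_intros dt)
  have hr: "hol2 U ?r" by (intro hol2_intros hol_A hol_B dz)
  have "?l p = ?r p" if "p \<in> U" for p
  proof (rule hol2_extend_eq[OF open_U hl hr _ that])
    fix p assume "p \<in> U" "fst p \<noteq> 0"
    then show "?l p = ?r p"
      using flatness_equation[of p i j] by (simp add: matrix_matrix_mult_def sum_2 power2_eq_square)
  qed
  then have e: "taylor ?l = taylor ?r" using hr by (rule taylor_cong[OF open_U O])
  note ti = taylor_add[OF open_U O] taylor_mult[OF open_U O] taylor_diff[OF open_U O] taylor_fst[OF open_U O]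
    taylor_partial_z[OF open_U O hol_A] taylor_partial_t[OF open_U O hol_B]
  have "fps_X * fps_deriv_coeffs (taylor (\<lambda>p. B p $ i $ j)) = taylor ?l"
    by (simp add: ti hol2_intros hol_A hol_B dz dt)
  also have "\<dots> = commutator (\<lambda>i j. taylor (\<lambda>p. B p $ i $ j)) (\<lambda>i j. taylor (\<lambda>p. A p $ i $ j)) i j
      + fps_X ^ 2 * fps_deriv (taylor (\<lambda>p. A p $ i $ j)) - fps_X * taylor (\<lambda>p. A p $ i $ j)"
    unfolding e by (simp add: ti hol2_intros hol_A hol_B dz dt commutator_def power2_eq_square)
  finally show "fps_X * fps_deriv_coeffs (taylor (\<lambda>p. B p $ i $ j)) =
      commutator (\<lambda>i j. taylor (\<lambda>p. B p $ i $ j)) (\<lambda>i j. taylor (\<lambda>p. A p $ i $ j)) i j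
      + fps_X ^ 2 * fps_deriv (taylor (\<lambda>p. A p $ i $ j)) - fps_X * taylor (\<lambda>p. A p $ i $ j)" .
qed

end

section \<open>The invariants in a local frame\<close>

lemma invertible_matrix_inv: "invertible (M :: complex^2^2) \<Longrightarrow> invertible (matrix_inv M)"
  using matrix_inv_mult[of M] unfolding invertible_def[of "matrix_inv M"] by blast

text \<open>Dividing by the unit \<open>c\<close> shows that \<open>f\<close> and \<open>g\<close> differ by a multiple of \<open>z\<^sup>2\<close>.\<close>

lemma zcoeff_low_orders_eq:
  assumes f: "(\<lambda>z. f (z, t)) has_fps_expansion F" and g: "(\<lambda>z. g (z, t)) has_fps_expansion G"
    and c: "(\<lambda>z. c (z, t)) has_fps_expansion C" "fps_nth C 0 \<noteq> 0" and x: "(\<lambda>z. x (z, t)) has_fps_expansion X"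
    and eq: "eventually (\<lambda>z. c (z, t) * f (z, t) = c (z, t) * g (z, t) + z^2 * x (z, t)) (nhds 0)" and k: "k \<le> 1"
  shows "zcoeff k f t = zcoeff k g t"
proof -
  have l: "(\<lambda>z. c (z, t) * f (z, t)) has_fps_expansion C * F" by (intro has_fps_expansion_mult f c)
  have "(\<lambda>z. c (z, t) * g (z, t) + z^2 * x (z, t)) has_fps_expansion C * G + fps_X ^ 2 * X"
    by (intro has_fps_expansion_add has_fps_expansion_mult g c x has_fps_expansion_fps_X_power)
  then have "(\<lambda>z. c (z, t) * f (z, t)) has_fps_expansion C * G + fps_X ^ 2 * X"
    using has_fps_expansion_cong[OF eq refl] by blast
  with l have "C * F = C * G + fps_X ^ 2 * X" by (rule fps_expansion_unique_complex)
  then have e: "C * (F - G) = fps_X ^ 2 * X" by (simp add: algebra_simps)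
  have 0: "fps_nth (F - G) 0 = 0" using arg_cong[OF e, of "\<lambda>x. fps_nth x 0"] c(2) by (simp add: power2_eq_square)
  have "fps_nth (C * (F - G)) 1 = 0" unfolding e by (simp add: power2_eq_square mult.assoc)
  then have "fps_nth (F - G) 1 = 0" using 0 c(2) by (simp add: fps_mult_nth_1)
  with 0 k have "fps_nth F k = fps_nth G k" by (cases k) auto
  then show ?thesis using zcoeffI[OF f] zcoeffI[OF g] by simp
qed

context te_frame begin

lemma basis_self:
  assumes "(0, t) \<in> U" shows "basis_with_matrix H t U \<Phi> B"
  unfolding basis_with_matrix_def column_mult
  using assms cols inv hol_B nabz_cols by blast

lemma hol2_det: "hol2 V (\<lambda>p. M p $ 1 $ 1) \<Longrightarrow> hol2 V (\<lambda>p. M p $ 1 $ 2) \<Longrightarrow> hol2 V (\<lambda>p. M p $ 2 $ 1) \<Longrightarrow>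
   hol2 V (\<lambda>p. M p $ 2 $ 2) \<Longrightarrow> hol2 V (\<lambda>p. det (M p :: complex^2^2))"
  unfolding det_2 by (intro hol2_intros)

text \<open>A change of basis \<open>G\<close> replaces \<open>B\<close> by \<open>G\<^sup>-\<^sup>1 (B G + z\<^sup>2 G\<^sub>z)\<close>.  Hence it changes the determinant and the trace of \<open>B\<close>
  by multiples of \<open>z\<^sup>2\<close>.\<close>

lemma basis_change:
  assumes b: "basis_with_matrix H t U' v B'" and t: "(0, t) \<in> U" and k: "k \<le> 1"
  shows "zcoeff k (\<lambda>p. det (B' p)) t = zcoeff k (\<lambda>p. det (B p)) t"
    and "zcoeff k (\<lambda>p. B' p $ 1 $ 1 + B' p $ 2 $ 2) t = zcoeff k (\<lambda>p. B p $ 1 $ 1 + B p $ 2 $ 2) t"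
proof -
  define V where "V = U' \<inter> U"
  define G where "G = (\<lambda>p. matrix_inv (\<Phi> p) ** v p)"
  have U': "open U'" "(0, t) \<in> U'" "\<And>j. hol_section H U' (\<lambda>p. column j (v p))" "\<And>p. p \<in> U' \<Longrightarrow> invertible (v p)"
    "\<And>i j. hol2 U' (\<lambda>p. B' p $ i $ j)"
    "\<And>p j. p \<in> U' \<Longrightarrow> fst p \<noteq> 0 \<Longrightarrow> (fst p)\<^sup>2 *s nabz H (\<lambda>q. column j (v q)) p = v p *v column j (B' p)"
    using b unfolding basis_with_matrix_def column_mult by (auto simp: hol_section_def)
  have V: "open V" "(0, t) \<in> V" "V \<subseteq> U" "V \<subseteq> U'" using U' t open_U by (auto simp: V_def)
  have Gcol: "G p $ i $ j = (matrix_inv (\<Phi> p) *v column j (v p)) $ i" for p i j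
    by (simp add: G_def column_def matrix_vector_mult_def matrix_matrix_mult_def)
  have hG: "hol2 V (\<lambda>p. G p $ i $ j)" for i j
    unfolding Gcol V_def by (rule coords[OF U'(3)])
  define D where "D = (\<lambda>p. (\<chi> i j. partial_z (\<lambda>q. G q $ i $ j) p) :: complex^2^2)"
  have hD: "hol2 V (\<lambda>p. D p $ i $ j)" for i j
    unfolding D_def using hol2_partial_z[OF V(1) hG] by simp
  have hB: "hol2 V (\<lambda>p. B p $ i $ j)" "hol2 V (\<lambda>p. B' p $ i $ j)" for i j
    using hol2_subset[OF hol_B V(3)] hol2_subset[OF U'(5) V(4)] by auto
  have invG: "invertible (G p)" if "p \<in> V" for p
    unfolding G_def using that V(3,4) inv U'(4) by (intro invertible_mult) (blast intro: invertible_matrix_inv)+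
  have eq: "(G p ** B' p) $ i $ j = (B p ** G p) $ i $ j + (fst p)^2 * D p $ i $ j" if "p \<in> V" for p i j
  proof (rule hol2_extend_eq[OF V(1) _ _ _ that])
    show "hol2 V (\<lambda>p. (G p ** B' p) $ i $ j)" "hol2 V (\<lambda>p. (B p ** G p) $ i $ j + (fst p)^2 * D p $ i $ j)"
      unfolding matrix_matrix_mult_def vec_lambda_beta sum_2 by (intro hol2_intros hG hB hD)+
    fix p assume p: "p \<in> V" "fst p \<noteq> 0"
    then have pU: "p \<in> U" "p \<in> U'" using V by auto
    have a: "v p *v column j (B' p) = \<Phi> p *v (G p *v column j (B' p))"
      unfolding G_def using matrix_inv_vec(1)[OF inv[OF pU(1)]] by (simp add: matrix_vector_mul_assoc[symmetric])
    have b: "v p *v column j (B' p) = \<Phi> p *v ((fst p)^2 *s (\<chi> i. partial_z (\<lambda>q. (matrix_inv (\<Phi> q) *v column j (v q)) $ i) p)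
        + B p *v (matrix_inv (\<Phi> p) *v column j (v p)))"
      using nab_section(1)[OF U'(3) pU(2,1) p(2), of j] U'(6)[OF pU(2) p(2), of j] by simp
    have e: "G p *v column j (B' p) = (fst p)^2 *s (\<chi> i. partial_z (\<lambda>q. (matrix_inv (\<Phi> q) *v column j (v q)) $ i) p)
        + B p *v (matrix_inv (\<Phi> p) *v column j (v p))"
      by (rule cancel[OF pU(1) trans[OF a[symmetric] b]])
    have mc: "(M ** N) $ i $ j = (M *v column j N) $ i" for M N :: "complex^2^2"
      by (simp add: column_mult[symmetric]) (simp add: column_def)
    have cG: "column j (G p) = matrix_inv (\<Phi> p) *v column j (v p)" by (simp add: G_def column_mult)
    show "(G p ** B' p) $ i $ j = (B p ** G p) $ i $ j + (fst p)^2 * D p $ i $ j"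
      unfolding mc e cG by (simp add: D_def Gcol)
  qed
  let ?X = "\<lambda>p. (B p ** G p) $ 1 $ 1 * D p $ 2 $ 2 + D p $ 1 $ 1 * (B p ** G p) $ 2 $ 2 + (fst p)^2 * (D p $ 1 $ 1 * D p $ 2 $ 2)
     - (B p ** G p) $ 1 $ 2 * D p $ 2 $ 1 - D p $ 1 $ 2 * (B p ** G p) $ 2 $ 1 - (fst p)^2 * (D p $ 1 $ 2 * D p $ 2 $ 1)"
  let ?Y = "\<lambda>p. G p $ 2 $ 2 * D p $ 1 $ 1 - G p $ 1 $ 2 * D p $ 2 $ 1 - G p $ 2 $ 1 * D p $ 1 $ 2 + G p $ 1 $ 1 * D p $ 2 $ 2"
  have hX: "hol2 V ?X" "hol2 V ?Y"
    unfolding matrix_matrix_mult_def vec_lambda_beta sum_2 by (intro hol2_intros hG hB hD)+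
  have detX: "det (G p) * det (B' p) = det (G p) * det (B p) + (fst p)^2 * ?X p" if p: "p \<in> V" for p
  proof -
    have "det (G p) * det (B' p) = (G p ** B' p) $ 1 $ 1 * (G p ** B' p) $ 2 $ 2 - (G p ** B' p) $ 1 $ 2 * (G p ** B' p) $ 2 $ 1"
      unfolding det_mul[symmetric] unfolding det_2 by (rule refl)
    also have "\<dots> = det (B p ** G p) + (fst p)^2 * ?X p"
      unfolding eq[OF p] det_2 by (simp add: algebra_simps)
    finally show ?thesis by (simp add: det_mul mult.commute)
  qed
  have trY: "det (G p) * (B' p $ 1 $ 1 + B' p $ 2 $ 2) = det (G p) * (B p $ 1 $ 1 + B p $ 2 $ 2) + (fst p)^2 * ?Y p" if p: "p \<in> V" for p
  proof -
    have "det (G p) * (B' p $ 1 $ 1 + B' p $ 2 $ 2) = G p $ 2 $ 2 * (G p ** B' p) $ 1 $ 1 - G p $ 1 $ 2 * (G p ** B' p) $ 2 $ 1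
       - G p $ 2 $ 1 * (G p ** B' p) $ 1 $ 2 + G p $ 1 $ 1 * (G p ** B' p) $ 2 $ 2"
      by (simp add: det_2 matrix_matrix_mult_def sum_2 algebra_simps)
    also have "\<dots> = det (G p) * (B p $ 1 $ 1 + B p $ 2 $ 2) + (fst p)^2 * ?Y p"
      unfolding eq[OF p] by (simp add: det_2 matrix_matrix_mult_def sum_2 algebra_simps)
    finally show ?thesis .
  qed
  have ev: "eventually (\<lambda>z. (z, t) \<in> V) (nhds 0)"
    using eventually_nhds_in_open[OF open_slices(1)[OF V(1)], of 0 t] V(2) by simp
  note ex = zcoeff_has_fps_expansion[OF V(1) _ V(2)]
  have nz: "fps_nth (Abs_fps (\<lambda>k. zcoeff k (\<lambda>p. det (G p)) t)) 0 \<noteq> 0"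
    using invG[OF V(2)] by (simp add: zcoeff_def invertible_det_nz)
  show "zcoeff k (\<lambda>p. det (B' p)) t = zcoeff k (\<lambda>p. det (B p)) t"
    by (rule zcoeff_low_orders_eq[OF ex[OF hol2_det] ex[OF hol2_det] ex[OF hol2_det] nz ex[OF hX(1)] _ k])
      (auto intro!: hB hG intro: eventually_mono[OF ev] simp: detX)
  show "zcoeff k (\<lambda>p. B' p $ 1 $ 1 + B' p $ 2 $ 2) t = zcoeff k (\<lambda>p. B p $ 1 $ 1 + B p $ 2 $ 2) t"
    by (rule zcoeff_low_orders_eq[OF ex[OF hol2_add] ex[OF hol2_add] ex[OF hol2_det] nz ex[OF hX(2)] _ k])
      (auto intro!: hB hG intro: eventually_mono[OF ev] simp: trY)
qed

lemma delta_eq: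
  assumes t: "(0, t) \<in> U" and k: "k \<le> 1"
  shows "delta H k t = zcoeff k (\<lambda>p. det (B p)) t"
  unfolding delta_def
proof (rule the_equality)
  show "\<exists>V v B'. basis_with_matrix H t V v B' \<and> zcoeff k (\<lambda>p. det (B p)) t = zcoeff k (\<lambda>p. det (B' p)) t"
    using basis_self[OF t] by blast
qed (use basis_change(1)[OF _ t k] in blast)

lemma zcoeff_add:
  assumes "open V" "hol2 V f" "hol2 V g" "(0, t) \<in> V"
  shows "zcoeff k (\<lambda>p. f p + g p) t = zcoeff k f t + zcoeff k g t"
  using zcoeffI[of "\<lambda>p. f p + g p" t, OF has_fps_expansion_add[OF zcoeff_has_fps_expansion[OF assms(1,2,4)] zcoeff_has_fps_expansion[OF assms(1,3,4)]]]
  by simp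

lemma rho1_eq:
  assumes t: "(0, t) \<in> U"
  shows "rho1 H t = (zcoeff 1 (\<lambda>p. B p $ 1 $ 1) t + zcoeff 1 (\<lambda>p. B p $ 2 $ 2) t) / 2"
proof -
  have tr: "trace (\<chi> i j. zcoeff 1 (\<lambda>p. B' p $ i $ j) t) / 2 = zcoeff 1 (\<lambda>p. B' p $ 1 $ 1 + B' p $ 2 $ 2) t / 2"
    if b: "basis_with_matrix H t U' v B'" for U' v B'
    using b unfolding basis_with_matrix_def hol_section_def
    by (subst zcoeff_add[of U']) (auto simp: trace_def sum_2)
  show ?thesis
    unfolding rho1_def
  proof (rule the_equality)
    have "(zcoeff 1 (\<lambda>p. B p $ 1 $ 1) t + zcoeff 1 (\<lambda>p. B p $ 2 $ 2) t) / 2 = trace (\<chi> i j. zcoeff 1 (\<lambda>p. B p $ i $ j) t) / 2"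
      by (simp add: trace_def sum_2)
    then show "\<exists>U v B'. basis_with_matrix H t U v B' \<and> (zcoeff 1 (\<lambda>p. B p $ 1 $ 1) t + zcoeff 1 (\<lambda>p. B p $ 2 $ 2) t) / 2
        = trace (\<chi> i j. zcoeff 1 (\<lambda>p. B' p $ i $ j) t) / 2" using basis_self[OF t] by blast
    fix d assume "\<exists>U v B'. basis_with_matrix H t U v B' \<and> d = trace (\<chi> i j. zcoeff 1 (\<lambda>p. B' p $ i $ j) t) / 2"
    then obtain V v B' where b: "basis_with_matrix H t V v B'" "d = trace (\<chi> i j. zcoeff 1 (\<lambda>p. B' p $ i $ j) t) / 2" by blast
    have "d = zcoeff 1 (\<lambda>p. B p $ 1 $ 1 + B p $ 2 $ 2) t / 2"
      unfolding b(2) tr[OF b(1)] basis_change(2)[OF b(1) t order_refl] ..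
    then show "d = (zcoeff 1 (\<lambda>p. B p $ 1 $ 1) t + zcoeff 1 (\<lambda>p. B p $ 2 $ 2) t) / 2"
      by (simp add: zcoeff_add[OF open_U hol_B hol_B t])
  qed
qed

lemma pole_part_eq:
  assumes pc: "pole_condition H" and t: "(0, t) \<in> U"
  shows "pole_part H t x = \<Phi> (0, t) *v (B (0, t) *v (matrix_inv (\<Phi> (0, t)) *v x))"
proof -
  have uniq: "y = \<Phi> (0, t) *v (B (0, t) *v (matrix_inv (\<Phi> (0, t)) *v s (0, t)))"
    if h: "(0, t) \<in> W" "hol_section H W s" "hol_section H W u"
      "\<forall>p\<in>W. fst p \<noteq> 0 \<longrightarrow> u p = (fst p)\<^sup>2 *s nabz H s p" "u (0, t) = y" for W s u y
  proof -
    define V where "V = W \<inter> U"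
    have V: "open V" "(0, t) \<in> V" using h(1,2) t open_U by (auto simp: V_def hol_section_def)
    let ?f = "\<lambda>p. matrix_inv (\<Phi> p) *v s p"
    have hs: "hol2 V (\<lambda>p. ?f p $ i)" "hol2 V (\<lambda>p. (matrix_inv (\<Phi> p) *v u p) $ i)" for i
      using coords[OF h(2)] coords[OF h(3)] by (simp_all add: V_def)
    have "(matrix_inv (\<Phi> p) *v u p) $ i = (fst p)^2 * partial_z (\<lambda>p. ?f p $ i) p + (B p $ i $ 1 * ?f p $ 1 + B p $ i $ 2 * ?f p $ 2)"
      if "p \<in> V" for p i
    proof (rule hol2_extend_eq[OF V(1) _ _ _ that])
      show "hol2 V (\<lambda>p. (fst p)^2 * partial_z (\<lambda>p. ?f p $ i) p + (B p $ i $ 1 * ?f p $ 1 + B p $ i $ 2 * ?f p $ 2))"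
        by (intro hol2_intros hol2_partial_z[OF V(1)] hs hol2_subset[OF hol_B]) (auto simp: V_def)
      fix p assume p: "p \<in> V" "fst p \<noteq> 0"
      then have pU: "p \<in> W" "p \<in> U" by (auto simp: V_def)
      have "u p = \<Phi> p *v ((fst p)\<^sup>2 *s (\<chi> i. partial_z (\<lambda>q. ?f q $ i) p) + B p *v ?f p)"
        using h(4) pU(1) p(2) nab_section(1)[OF h(2) pU p(2)] by simp
      then have "matrix_inv (\<Phi> p) *v u p = (fst p)\<^sup>2 *s (\<chi> i. partial_z (\<lambda>q. ?f q $ i) p) + B p *v ?f p"
        by (simp add: matrix_inv_vec(2)[OF inv[OF pU(2)]])
      from arg_cong[OF this, of "\<lambda>x. x $ i"]
      show "(matrix_inv (\<Phi> p) *v u p) $ i = (fst p)^2 * partial_z (\<lambda>p. ?f p $ i) p + (B p $ i $ 1 * ?f p $ 1 + B p $ i $ 2 * ?f p $ 2)"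
        by (simp add: matrix_vector_2[of "B p"])
    qed (rule hs(2))
    from this[OF V(2)] have "matrix_inv (\<Phi> (0, t)) *v u (0, t) = B (0, t) *v ?f (0, t)"
      by (simp add: vec_eq_iff matrix_vector_2[of "B (0, t)"])
    then show ?thesis using matrix_inv_vec(1)[OF inv[OF t], of "u (0, t)"] h(5) by metis
  qed
  define c where "c = matrix_inv (\<Phi> (0, t)) *v x"
  define s where "s = (\<lambda>p. \<Phi> p *v c)"
  have hs: "hol_section H U s" unfolding s_def using hol_section_frame[OF open_U subset_refl hol2_const] .
  obtain u where u: "hol_section H U u" "\<forall>p\<in>U. fst p \<noteq> 0 \<longrightarrow> u p = (fst p)\<^sup>2 *s nabz H s p"
    using pc hs unfolding pole_condition_def by blast
  have s0: "s (0, t) = x" using matrix_inv_vec(1)[OF inv[OF t]] by (simp add: s_def c_def)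
  show ?thesis
    unfolding pole_part_def
  proof (rule the_equality)
    show "\<exists>W s u. (0, t) \<in> W \<and> hol_section H W s \<and> hol_section H W u \<and>
        (\<forall>p\<in>W. fst p \<noteq> 0 \<longrightarrow> u p = (fst p)\<^sup>2 *s nabz H s p) \<and> s (0, t) = x \<and>
        u (0, t) = \<Phi> (0, t) *v (B (0, t) *v (matrix_inv (\<Phi> (0, t)) *v x))"
      using t hs u s0 uniq[OF t hs u refl, unfolded s0]
      by (intro exI[of _ U] exI[of _ s] exI[of _ u] conjI)
  next
    fix y assume "\<exists>W s u. (0, t) \<in> W \<and> hol_section H W s \<and> hol_section H W u \<and>
        (\<forall>p\<in>W. fst p \<noteq> 0 \<longrightarrow> u p = (fst p)\<^sup>2 *s nabz H s p) \<and> s (0, t) = x \<and> u (0, t) = y"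
    then obtain W s u where h: "(0, t) \<in> W" "hol_section H W s" "hol_section H W u"
      "\<forall>p\<in>W. fst p \<noteq> 0 \<longrightarrow> u p = (fst p)\<^sup>2 *s nabz H s p" "s (0, t) = x" "u (0, t) = y" by blast
    show "y = \<Phi> (0, t) *v (B (0, t) *v (matrix_inv (\<Phi> (0, t)) *v x))"
      using uniq[OF h(1-4,6)] unfolding h(5) .
  qed
qed

lemma trace_pole_part:
  assumes pc: "pole_condition H" and t: "(0, t) \<in> U" and tf: "trace_free_pole_part H"
  shows "B (0, t) $ 1 $ 1 + B (0, t) $ 2 $ 2 = 0"
proof -
  have "(0 :: complex, t) \<in> UNIV \<times> base H" by (rule subsetD[OF U_base t])
  then have "t \<in> base H" by simp
  then have "trace (matrix (pole_part H t)) = 0" using tf by (simp add: trace_free_pole_part_def)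
  moreover have "pole_part H t = (\<lambda>x. (\<Phi> (0, t) ** (B (0, t) ** matrix_inv (\<Phi> (0, t)))) *v x)"
    unfolding fun_eq_iff pole_part_eq[OF pc t] by (simp only: matrix_vector_mul_assoc[symmetric]) simp
  ultimately have "trace (\<Phi> (0, t) ** (B (0, t) ** matrix_inv (\<Phi> (0, t)))) = 0" by simp
  then have "trace ((B (0, t) ** matrix_inv (\<Phi> (0, t))) ** \<Phi> (0, t)) = 0" by (subst trace_mul_sym)
  then have "trace (B (0, t)) = 0"
    using matrix_inv_mult(1)[OF inv[OF t]] by (simp add: matrix_mul_assoc[symmetric])
  then show ?thesis by (simp add: trace_def sum_2)
qed

end

subsection \<open>The restriction over \<open>t = 0\<close>\<close>

lemma section_along_slices:
  assumes "hol_section H W s"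
  shows "hol_section_along H (\<lambda>z. (z, t)) {z. (z, t) \<in> W} (\<lambda>z. s (z, t))"
    and "hol_section_along H (\<lambda>t. (z, t)) {t. (z, t) \<in> W} (\<lambda>t. s (z, t))"
proof -
  have W: "open W" "W \<subseteq> UNIV \<times> base H" and
    fr: "\<And>U \<Phi> i. (U, \<Phi>) \<in> frames H \<Longrightarrow> hol2 (W \<inter> U) (\<lambda>p. (matrix_inv (\<Phi> p) *v s p) $ i)"
    using assms unfolding hol_section_def by auto
  show "hol_section_along H (\<lambda>z. (z, t)) {z. (z, t) \<in> W} (\<lambda>z. s (z, t))"
    unfolding hol_section_along_def using W(2) open_slices(1)[OF W(1)] hol2_holomorphic(1)[OF fr]
    by (auto simp: Int_def)
  show "hol_section_along H (\<lambda>t. (z, t)) {t. (z, t) \<in> W} (\<lambda>t. s (z, t))"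
    unfolding hol_section_along_def using W(2) open_slices(2)[OF W(1)] hol2_holomorphic(2)[OF fr]
    by (auto simp: Int_def)
qed

lemma section_along_subset:
  "hol_section_along H \<iota> V \<sigma> \<Longrightarrow> open V' \<Longrightarrow> V' \<subseteq> V \<Longrightarrow> hol_section_along H \<iota> V' \<sigma>"
  unfolding hol_section_along_def by (fastforce intro: holomorphic_on_subset)

lemma section_along_add:
  "hol_section_along H \<iota> V \<sigma> \<Longrightarrow> hol_section_along H \<iota> V \<tau> \<Longrightarrow> hol_section_along H \<iota> V (\<lambda>x. \<sigma> x + \<tau> x)"
  unfolding hol_section_along_def by (fastforce simp: matrix_vector_right_distrib intro: holomorphic_on_add)

lemma section_along_scale:
  assumes "f holomorphic_on V" "hol_section_along H \<iota> V \<sigma>"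
  shows "hol_section_along H \<iota> V (\<lambda>x. f x *s \<sigma> x)"
proof -
  have "(matrix_inv M *v (c *s x)) $ i = c * (matrix_inv M *v x) $ i" for M :: "complex^2^2" and c x i
    by (simp add: matrix_vector_2 algebra_simps)
  then show ?thesis
    using assms unfolding hol_section_along_def
    by (auto intro!: holomorphic_on_mult intro: holomorphic_on_subset)
qed

lemma has_fps_expansion_transform:
  "eventually (\<lambda>x. f x = g x) (nhds 0) \<Longrightarrow> g has_fps_expansion F \<Longrightarrow> f has_fps_expansion F"
  using has_fps_expansion_cong[of f g F F] by blast

lemma matrix_vector_axis: "((M :: complex^2^2) *v axis j 1) $ i = M $ i $ j"
  using exhaust_2[of j] by (auto simp: matrix_vector_2 axis_def)

lemma holomorphic_extend_eq:
  assumes N: "open N" "0 \<in> N" and f: "f holomorphic_on N" and g: "g holomorphic_on N"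
    and eq: "\<And>z. z \<in> N \<Longrightarrow> z \<noteq> 0 \<Longrightarrow> f z = g z" and z: "z \<in> N"
  shows "f z = g z"
proof (cases "z = 0")
  case True
  have "isCont f 0" "isCont g 0"
    using N f g holomorphic_on_imp_continuous_on continuous_on_eq_continuous_at by blast+
  then have "((\<lambda>z. f z - g z) \<longlongrightarrow> f 0 - g 0) (at 0)"
    unfolding isCont_def by (rule tendsto_diff)
  moreover have "eventually (\<lambda>z. f z - g z = 0) (at 0)"
    using eventually_nhds_in_open[OF N] unfolding eventually_at_filter by eventually_elim (auto simp: eq)
  then have "((\<lambda>z. f z - g z) \<longlongrightarrow> 0) (at 0)" by (rule tendsto_eventually)
  ultimately show ?thesis using True LIM_unique by fastforce
qed (use eq z in auto)

lemma has_fps_expansion_power_factor: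
  fixes f :: "complex \<Rightarrow> complex"
  assumes f: "f has_fps_expansion fps_X ^ k * c"
  obtains S g where "open S" "0 \<in> S" "g holomorphic_on S" "\<And>t. t \<in> S \<Longrightarrow> f t = t ^ k * g t"
proof -
  obtain S g where S: "open S" "0 \<in> S" "g holomorphic_on S" "\<And>t. t \<in> S \<Longrightarrow> t \<noteq> 0 \<Longrightarrow> f t = t ^ k * g t" "g 0 = fps_nth c 0"
  proof (cases "c = 0")
    case True
    then have "eventually (\<lambda>t. f t = 0) (nhds 0)" using f by (auto simp: has_fps_expansion_def)
    then obtain S where "open S" "0 \<in> S" "\<And>t. t \<in> S \<Longrightarrow> f t = 0" unfolding eventually_nhds by blast
    then show ?thesis using that[of S "\<lambda>_. 0"] True by auto
  next
    case False
    define g where "g = (\<lambda>x. if x = 0 then fps_nth (fps_X ^ k * c) k else f x / x ^ k)"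
    have "g has_fps_expansion fps_shift k (fps_X ^ k * c)"
      unfolding g_def using False by (intro has_fps_expansion_shift f) auto
    then obtain S where "open S" "0 \<in> S" "g holomorphic_on S"
      by (rule has_fps_expansion_imp_holomorphic)
    then show ?thesis using that[of S g] by (auto simp: g_def fps_X_power_mult_nth)
  qed
  have "f 0 = fps_nth (fps_X ^ k * c) 0" using fps_nth_fps_expansion[OF f, of 0] by simp
  also have "\<dots> = 0 ^ k * g 0" using S(5) by (cases k) auto
  finally have "f t = t ^ k * g t" if "t \<in> S" for t using S(4)[OF that] by (cases "t = 0") auto
  then show ?thesis using that S(1-3) by blast
qed

context te_frame begin

text \<open>In coordinates \<open>z \<nabla>\<^sub>z\<close> is \<open>z y' + z\<^sup>-\<^sup>1 B y\<close>.  It is holomorphic at \<open>z = 0\<close> only if \<open>B\<close> annihilates \<open>y\<close> there, and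
  its value is then given by the coefficient of \<open>z\<close> in \<open>B\<close>.\<close>

lemma log_derivative_coords:
  assumes ld: "log_derivative H V \<sigma> \<tau>" and O: "(0, 0) \<in> U"
  shows "(B (0, 0) *v (matrix_inv (\<Phi> (0, 0)) *v \<sigma> 0)) $ i = 0"
    and "B (0, 0) = 0 \<Longrightarrow> matrix_inv (\<Phi> (0, 0)) *v \<tau> 0 =
      (\<chi> i j. zcoeff 1 (\<lambda>p. B p $ i $ j) 0) *v (matrix_inv (\<Phi> (0, 0)) *v \<sigma> 0)"
proof -
  obtain W s where h: "0 \<in> V" "hol_section_along H (\<lambda>z. (z, 0)) V \<sigma>" "hol_section_along H (\<lambda>z. (z, 0)) V \<tau>"
    "hol_section H W s" "V \<times> {0} \<subseteq> W" "\<And>z. z \<in> V \<Longrightarrow> s (z, 0) = \<sigma> z" "\<And>z. z \<in> V \<Longrightarrow> z \<noteq> 0 \<Longrightarrow> \<tau> z = z *s nabz H s (z, 0)"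
    using ld unfolding log_derivative_def by blast
  define N where "N = {z \<in> V. (z, 0) \<in> U}"
  have oV: "open V" using h(2) by (simp add: hol_section_along_def)
  have N: "open N" "0 \<in> N"
  proof -
    have "N = V \<inter> {z. (z, 0) \<in> U}" by (auto simp: N_def)
    then show "open N" using oV open_slices(1)[OF open_U] by auto
  qed (use h(1) O in \<open>simp add: N_def\<close>)
  define y where "y = (\<lambda>i z. (matrix_inv (\<Phi> (z, 0)) *v \<sigma> z) $ i)"
  define w where "w = (\<lambda>i z. (matrix_inv (\<Phi> (z, 0)) *v \<tau> z) $ i)"
  have hy: "y i holomorphic_on N" "w i holomorphic_on N" for i
    unfolding y_def w_def N_def using coords_along[OF h(2)] coords_along[OF h(3)] by auto
  have hB: "(\<lambda>z. B (z, 0) $ i $ j) holomorphic_on N" for i j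
    by (rule holomorphic_on_subset[OF hol2_holomorphic(1)[OF hol_B]]) (auto simp: N_def)
  have eq: "z * w i z = z^2 * deriv (y i) z + (B (z, 0) $ i $ 1 * y 1 z + B (z, 0) $ i $ 2 * y 2 z)" if "z \<in> N" for z i
  proof (rule holomorphic_extend_eq[OF N _ _ _ that])
    show "(\<lambda>z. z * w i z) holomorphic_on N" "(\<lambda>z. z^2 * deriv (y i) z + (B (z, 0) $ i $ 1 * y 1 z + B (z, 0) $ i $ 2 * y 2 z)) holomorphic_on N"
      by (intro holomorphic_intros hy hB N)+
    fix z assume z: "z \<in> N" "z \<noteq> 0"
    then have zz: "(z, 0) \<in> W" "(z, 0) \<in> U" "z \<in> V" using h(5) by (auto simp: N_def)
    have pd: "partial_z (\<lambda>q. (matrix_inv (\<Phi> q) *v s q) $ i) (z, 0) = deriv (y i) z" for i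
    proof -
      have "eventually (\<lambda>z. (matrix_inv (\<Phi> (z, 0)) *v s (z, 0)) $ i = y i z) (nhds z)"
        using eventually_nhds_in_open[OF oV zz(3)] by eventually_elim (simp add: y_def h(6))
      then show ?thesis unfolding partial_z_def by (auto intro: deriv_cong_ev)
    qed
    have "z^2 *s nabz H s (z, 0) = \<Phi> (z, 0) *v (z^2 *s (\<chi> i. deriv (y i) z) + B (z, 0) *v (matrix_inv (\<Phi> (z, 0)) *v \<sigma> z))"
      using nab_section(1)[OF h(4) zz(1,2)] z(2) unfolding pd h(6)[OF zz(3)] fst_conv by simp
    moreover have "z *s \<tau> z = z^2 *s nabz H s (z, 0)"
      using h(7)[OF zz(3) z(2)] by (simp add: power2_eq_square vector_smult_assoc)
    ultimately have "matrix_inv (\<Phi> (z, 0)) *v (z *s \<tau> z) = z^2 *s (\<chi> i. deriv (y i) z) + B (z, 0) *v (matrix_inv (\<Phi> (z, 0)) *v \<sigma> z)"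
      by (simp add: matrix_inv_vec(2)[OF inv[OF zz(2)]])
    moreover have "matrix_inv (\<Phi> (z, 0)) *v (z *s \<tau> z) = z *s (matrix_inv (\<Phi> (z, 0)) *v \<tau> z)"
      by (simp add: vec_eq_iff matrix_vector_2 algebra_simps)
    ultimately have "z *s (matrix_inv (\<Phi> (z, 0)) *v \<tau> z) = z^2 *s (\<chi> i. deriv (y i) z) + B (z, 0) *v (matrix_inv (\<Phi> (z, 0)) *v \<sigma> z)"
      by simp
    from arg_cong[OF this, of "\<lambda>x. x $ i"]
    show "z * w i z = z^2 * deriv (y i) z + (B (z, 0) $ i $ 1 * y 1 z + B (z, 0) $ i $ 2 * y 2 z)"
      by (simp add: y_def w_def matrix_vector_2[of "B (z, 0)"])
  qed
  let ?Y = "\<lambda>i. fps_expansion (y i) 0" and ?W = "\<lambda>i. fps_expansion (w i) 0"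
  let ?B = "\<lambda>i j. Abs_fps (\<lambda>k. zcoeff k (\<lambda>p. B p $ i $ j) 0)"
  have ex: "y i has_fps_expansion ?Y i" "w i has_fps_expansion ?W i" "(\<lambda>z. B (z, 0) $ i $ j) has_fps_expansion ?B i j" for i j
    using hy N zcoeff_has_fps_expansion[OF open_U hol_B O] by (auto intro: has_fps_expansion_fps_expansion)
  have F: "fps_X * ?W i = fps_X ^ 2 * fps_deriv (?Y i) + (?B i 1 * ?Y 1 + ?B i 2 * ?Y 2)" for i
  proof (rule fps_expansion_unique_complex)
    show "(\<lambda>z. z * w i z) has_fps_expansion fps_X * ?W i"
      by (intro has_fps_expansion_mult has_fps_expansion_fps_X ex)
    have "(\<lambda>z. z^2 * deriv (y i) z + (B (z, 0) $ i $ 1 * y 1 z + B (z, 0) $ i $ 2 * y 2 z)) has_fps_expansion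
        fps_X ^ 2 * fps_deriv (?Y i) + (?B i 1 * ?Y 1 + ?B i 2 * ?Y 2)"
      by (intro has_fps_expansion_mult has_fps_expansion_add has_fps_expansion_deriv has_fps_expansion_fps_X_power ex)
    moreover have "eventually (\<lambda>z. z * w i z = z^2 * deriv (y i) z + (B (z, 0) $ i $ 1 * y 1 z + B (z, 0) $ i $ 2 * y 2 z)) (nhds 0)"
      using eventually_nhds_in_open[OF N] by eventually_elim (rule eq)
    ultimately show "(\<lambda>z. z * w i z) has_fps_expansion fps_X ^ 2 * fps_deriv (?Y i) + (?B i 1 * ?Y 1 + ?B i 2 * ?Y 2)"
      by (rule has_fps_expansion_transform[rotated])
  qed
  have n0: "fps_nth (?Y i) 0 = y i 0" "fps_nth (?W i) 0 = w i 0" "zcoeff 0 (\<lambda>p. B p $ i $ j) 0 = B (0, 0) $ i $ j" for i j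
    by (simp_all add: fps_expansion_def zcoeff_def)
  have "B (0, 0) $ i $ 1 * y 1 0 + B (0, 0) $ i $ 2 * y 2 0 = 0"
    using arg_cong[OF F[of i], of "\<lambda>x. fps_nth x 0"] by (simp add: n0)
  then show "(B (0, 0) *v (matrix_inv (\<Phi> (0, 0)) *v \<sigma> 0)) $ i = 0"
    by (simp add: y_def matrix_vector_2[of "B (0, 0)"])
  assume B0: "B (0, 0) = 0"
  have "w i 0 = zcoeff 1 (\<lambda>p. B p $ i $ 1) 0 * y 1 0 + zcoeff 1 (\<lambda>p. B p $ i $ 2) 0 * y 2 0" for i
    using arg_cong[OF F[of i], of "\<lambda>x. fps_nth x 1"] n0 B0 by (simp add: fps_mult_nth_1 power2_eq_square mult.assoc)
  then show "matrix_inv (\<Phi> (0, 0)) *v \<tau> 0 = (\<chi> i j. zcoeff 1 (\<lambda>p. B p $ i $ j) 0) *v (matrix_inv (\<Phi> (0, 0)) *v \<sigma> 0)"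
    unfolding vec_eq_iff matrix_vector_2[of "\<chi> i j. zcoeff 1 (\<lambda>p. B p $ i $ j) 0"] by (simp add: w_def y_def)
qed

lemma constant_along:
  "hol_section_along H (\<lambda>z. (z, t)) {z. (z, t) \<in> U} (\<lambda>z. \<Phi> (z, t) *v c)"
  "hol_section_along H (\<lambda>t. (z, t)) {t. (z, t) \<in> U} (\<lambda>t. \<Phi> (z, t) *v c)"
  using section_along_slices[OF hol_section_frame[OF open_U subset_refl hol2_const]] by blast+

lemma log_derivative_exists:
  assumes lg: "logarithmic_over_0 H" and O: "(0, 0) \<in> U"
  obtains V \<tau> where "log_derivative H V (\<lambda>z. \<Phi> (z, 0) *v c) \<tau>"
  using lg[unfolded logarithmic_over_0_def, THEN spec[of _ "{z. (z, 0) \<in> U}"], THEN spec[of _ "\<lambda>z. \<Phi> (z, 0) *v c"]]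
    constant_along(1)[of 0 c] O that by auto

lemma pole_part_zero:
  assumes lg: "logarithmic_over_0 H" and O: "(0, 0) \<in> U"
  shows "B (0, 0) = 0"
proof -
  have "B (0, 0) $ i $ j = 0" for i j
  proof -
    obtain V \<tau> where "log_derivative H V (\<lambda>z. \<Phi> (z, 0) *v axis j 1) \<tau>"
      by (rule log_derivative_exists[OF lg O])
    from log_derivative_coords(1)[OF this O, of i] show ?thesis
      by (simp add: matrix_inv_vec(2)[OF inv[OF O]] matrix_vector_axis)
  qed
  then show ?thesis by (simp add: vec_eq_iff)
qed

lemma residue_endo_eq:
  assumes lg: "logarithmic_over_0 H" and O: "(0, 0) \<in> U"
  shows "residue_endo H x = \<Phi> (0, 0) *v ((\<chi> i j. zcoeff 1 (\<lambda>p. B p $ i $ j) 0) *v (matrix_inv (\<Phi> (0, 0)) *v x))"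
    (is "_ = ?r x")
proof -
  have uniq: "\<tau> 0 = ?r (\<sigma> 0)" if "log_derivative H V \<sigma> \<tau>" for V \<sigma> \<tau>
    using log_derivative_coords(2)[OF that O pole_part_zero[OF lg O]] matrix_inv_vec(1)[OF inv[OF O], of "\<tau> 0"] by simp
  obtain V \<tau> where ex: "log_derivative H V (\<lambda>z. \<Phi> (z, 0) *v (matrix_inv (\<Phi> (0, 0)) *v x)) \<tau>"
    by (rule log_derivative_exists[OF lg O])
  have s0: "\<Phi> (0, 0) *v (matrix_inv (\<Phi> (0, 0)) *v x) = x" by (rule matrix_inv_vec(1)[OF inv[OF O]])
  show ?thesis
    unfolding residue_endo_def
  proof (rule the_equality)
    show "\<exists>V \<sigma> \<tau>. log_derivative H V \<sigma> \<tau> \<and> \<sigma> 0 = x \<and> \<tau> 0 = ?r x"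
      using ex uniq[OF ex] s0 by (intro exI[of _ V] exI[of _ "\<lambda>z. \<Phi> (z, 0) *v (matrix_inv (\<Phi> (0, 0)) *v x)"] exI[of _ \<tau>]) simp
  qed (use uniq in blast)
qed

lemma residue_eigenvalues_eq:
  assumes lg: "logarithmic_over_0 H" and O: "(0, 0) \<in> U"
  shows "residue_eigenvalues H = {c. \<exists>x. x \<noteq> 0 \<and> (\<chi> i j. zcoeff 1 (\<lambda>p. B p $ i $ j) 0) *v x = c *s x}"
proof -
  let ?R = "(\<chi> i j. zcoeff 1 (\<lambda>p. B p $ i $ j) 0) :: complex^2^2" and ?F = "\<Phi> (0, 0)"
  note F = matrix_inv_vec[OF inv[OF O]]
  have sc: "M *v (c *s x) = c *s (M *v x)" for M :: "complex^2^2" and c x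
    by (simp add: vec_eq_iff matrix_vector_2 algebra_simps)
  have "(\<exists>x. x \<noteq> 0 \<and> residue_endo H x = c *s x) \<longleftrightarrow> (\<exists>x. x \<noteq> 0 \<and> ?R *v x = c *s x)" for c
  proof
    assume "\<exists>x. x \<noteq> 0 \<and> residue_endo H x = c *s x"
    then obtain x where x: "x \<noteq> 0" "?F *v (?R *v (matrix_inv ?F *v x)) = c *s x"
      using residue_endo_eq[OF lg O] by auto
    have "?R *v (matrix_inv ?F *v x) = c *s (matrix_inv ?F *v x)"
      using arg_cong[OF x(2), of "\<lambda>x. matrix_inv ?F *v x"] by (simp add: F sc)
    moreover have "matrix_inv ?F *v x \<noteq> 0" using F(1)[of x] x(1) by auto
    ultimately show "\<exists>x. x \<noteq> 0 \<and> ?R *v x = c *s x" by blast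
  next
    assume "\<exists>x. x \<noteq> 0 \<and> ?R *v x = c *s x"
    then obtain x where x: "x \<noteq> 0" "?R *v x = c *s x" by blast
    have "residue_endo H (?F *v x) = c *s (?F *v x)"
      by (simp only: residue_endo_eq[OF lg O] F(2) x(2) sc)
    moreover have "?F *v x \<noteq> 0" using F(2)[of x] x(1) by auto
    ultimately show "\<exists>x. x \<noteq> 0 \<and> residue_endo H x = c *s x" by blast
  qed
  then show ?thesis by (simp add: residue_eigenvalues_def)
qed

text \<open>In a frame the pole part is multiplication by the matrix \<open>B(0, t)\<close>; it suffices to test the columns of the frame.\<close>

lemma pole_part_divisible_iff:
  assumes pc: "pole_condition H" and O: "(0, 0) \<in> U"
    and b: "\<And>i j. (\<lambda>t. B (0, t) $ i $ j) has_fps_expansion b i j"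
  shows "pole_part_divisible H k \<longleftrightarrow> (\<forall>i j. \<exists>c. b i j = fps_X ^ k * c)"
proof
  assume div: "pole_part_divisible H k"
  show "\<forall>i j. \<exists>c. b i j = fps_X ^ k * c"
  proof (intro allI)
    fix i j
    let ?\<sigma> = "\<lambda>t. \<Phi> (0, t) *v axis j 1"
    obtain V' \<tau> where V': "0 \<in> V'" "V' \<subseteq> {t. (0, t) \<in> U}" "hol_section_along H (\<lambda>t. (0, t)) V' \<tau>"
      "\<And>t. t \<in> V' \<Longrightarrow> pole_part H t (?\<sigma> t) = t ^ k *s \<tau> t"
      using div[unfolded pole_part_divisible_def, THEN spec[of _ "{t. (0, t) \<in> U}"], THEN spec[of _ ?\<sigma>]]
        constant_along(2)[of 0 "axis j 1"] O by auto
    have oV: "open V'" using V'(3) by (simp add: hol_section_along_def)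
    let ?w = "\<lambda>t. (matrix_inv (\<Phi> (0, t)) *v \<tau> t) $ i"
    have "{t \<in> V'. (0, t) \<in> U} = V'" using V'(2) by auto
    then have w: "?w holomorphic_on V'" using coords_along[OF V'(3), of i] by simp
    have eq: "B (0, t) $ i $ j = t ^ k * ?w t" if t: "t \<in> V'" for t
    proof -
      have tU: "(0, t) \<in> U" using t V'(2) by auto
      have "\<Phi> (0, t) *v (B (0, t) *v axis j 1) = t ^ k *s \<tau> t"
        using V'(4)[OF t] by (simp add: pole_part_eq[OF pc tU] matrix_inv_vec(2)[OF inv[OF tU]])
      from arg_cong[OF this, of "\<lambda>x. (matrix_inv (\<Phi> (0, t)) *v x) $ i"]
      show ?thesis
        unfolding matrix_inv_vec(2)[OF inv[OF tU]] matrix_vector_axis by (simp add: matrix_vector_2 algebra_simps)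
    qed
    have "(\<lambda>t. t ^ k * ?w t) has_fps_expansion fps_X ^ k * fps_expansion ?w 0"
      using w oV V'(1) by (intro has_fps_expansion_mult has_fps_expansion_fps_X_power has_fps_expansion_fps_expansion) auto
    moreover have "eventually (\<lambda>t. B (0, t) $ i $ j = t ^ k * ?w t) (nhds 0)"
      using eventually_nhds_in_open[OF oV V'(1)] by eventually_elim (rule eq)
    ultimately have "(\<lambda>t. B (0, t) $ i $ j) has_fps_expansion fps_X ^ k * fps_expansion ?w 0"
      by (rule has_fps_expansion_transform[rotated])
    then show "\<exists>c. b i j = fps_X ^ k * c" using b[of i j] fps_expansion_unique_complex by blast
  qed
next
  assume "\<forall>i j. \<exists>c. b i j = fps_X ^ k * c"
  then have "\<exists>S g. open S \<and> 0 \<in> S \<and> g holomorphic_on S \<and> (\<forall>t\<in>S. B (0, t) $ i $ j = t ^ k * g t)" for i j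
    using b[of i j] has_fps_expansion_power_factor[of "\<lambda>t. B (0, t) $ i $ j" k] by metis
  then obtain S g where S: "\<And>i j. open (S i j)" "\<And>i j. 0 \<in> S i j" "\<And>i j. g i j holomorphic_on S i j"
    "\<And>i j t. t \<in> S i j \<Longrightarrow> B (0, t) $ i $ j = t ^ k * g i j t" by metis
  define T where "T = S 1 1 \<inter> S 1 2 \<inter> (S 2 1 \<inter> S 2 2) \<inter> {t. (0, t) \<in> U}"
  have T: "open T" unfolding T_def by (intro open_Int S(1) open_slices(2)[OF open_U])
  have T: "open T" "0 \<in> T" "T \<subseteq> {t. (0, t) \<in> U}" using T S(2) O by (auto simp: T_def)
  have TS: "T \<subseteq> S i j" for i j using exhaust_2[of i] exhaust_2[of j] by (auto simp: T_def)
  show "pole_part_divisible H k"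
    unfolding pole_part_divisible_def
  proof (intro allI impI)
    fix V \<sigma> assume h: "0 \<in> V \<and> hol_section_along H (Pair 0) V \<sigma>"
    define V' where "V' = V \<inter> T"
    have oV: "open V" using h by (simp add: hol_section_along_def)
    have V': "open V'" "0 \<in> V'" "V' \<subseteq> V" "V' \<subseteq> T" using h oV T by (auto simp: V'_def)
    define y where "y = (\<lambda>i t. (matrix_inv (\<Phi> (0, t)) *v \<sigma> t) $ i)"
    have hy: "y i holomorphic_on V'" for i
      unfolding y_def using h T V' by (intro holomorphic_on_subset[OF coords_along[of "Pair 0" V \<sigma>]]) auto
    have hg: "g i j holomorphic_on V'" for i j using S(3) TS V'(4) by (meson holomorphic_on_subset subset_trans)
    define e where "e = (\<lambda>i t. g i 1 t * y 1 t + g i 2 t * y 2 t)"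
    define \<tau> where "\<tau> = (\<lambda>t. e 1 t *s column 1 (\<Phi> (0, t)) + e 2 t *s column 2 (\<Phi> (0, t)))"
    have cols': "hol_section_along H (Pair 0) V' (\<lambda>t. column j (\<Phi> (0, t)))" for j
      using section_along_subset[OF section_along_slices(2)[OF cols] V'(1)] V'(4) T(3) by blast
    have "hol_section_along H (Pair 0) V' \<tau>"
      unfolding \<tau>_def e_def by (intro section_along_add section_along_scale cols' holomorphic_intros hy hg)
    moreover have "pole_part H t (\<sigma> t) = t ^ k *s \<tau> t" if t: "t \<in> V'" for t
    proof -
      have tU: "(0, t) \<in> U" using t V'(4) T(3) by auto
      have "B (0, t) $ i $ j = t ^ k * g i j t" for i j using S(4) TS V'(4) t by blast
      then have "B (0, t) *v (matrix_inv (\<Phi> (0, t)) *v \<sigma> t) = t ^ k *s (\<chi> i. e i t)"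
        by (simp add: vec_eq_iff matrix_vector_2[of "B (0, t)"] y_def e_def algebra_simps)
      then show ?thesis
        by (simp add: pole_part_eq[OF pc tU] \<tau>_def matrix_vector_columns[of "\<Phi> (0, t)"] vec_eq_iff algebra_simps)
    qed
    ultimately show "\<exists>V' \<tau>. 0 \<in> V' \<and> V' \<subseteq> V \<and> hol_section_along H (Pair 0) V' \<tau> \<and> (\<forall>t\<in>V'. pole_part H t (\<sigma> t) = t ^ k *s \<tau> t)"
      using V'(2,3) by blast
  qed
qed

end

section \<open>Locally constant sheaves on convex sets\<close>

text \<open>\<open>P S q\<close> says that \<open>S\<close> is flat at \<open>q\<close>.  Locally the flat functions are those of the form \<open>Y c\<close> with a
  constant vector \<open>c\<close>.\<close>

locale local_system =
  fixes \<Omega> :: "'a::euclidean_space set" and P :: "('a \<Rightarrow> complex^2) \<Rightarrow> 'a \<Rightarrow> bool"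
  assumes open_\<Omega>: "open \<Omega>" and convex_\<Omega>: "convex \<Omega>"
    and trivial: "\<And>p. p \<in> \<Omega> \<Longrightarrow> \<exists>N Y. open N \<and> p \<in> N \<and> N \<subseteq> \<Omega> \<and> (\<forall>q\<in>N. invertible (Y q :: complex^2^2)) \<and>
        (\<forall>S. \<forall>q\<in>N. P S q \<longleftrightarrow> (\<exists>c. \<forall>\<^sub>F q' in nhds q. S q' = Y q' *v c))"
begin

lemma flat_cong:
  assumes "q \<in> \<Omega>" "\<forall>\<^sub>F q' in nhds q. S q' = S' q'" "P S' q"
  shows "P S q"
proof -
  from trivial[OF assms(1)] obtain N and Y :: "'a \<Rightarrow> complex^2^2" where triv: "open N \<and> q \<in> N \<and> N \<subseteq> \<Omega> \<and>
      (\<forall>q\<in>N. invertible (Y q)) \<and> (\<forall>S. \<forall>q\<in>N. P S q \<longleftrightarrow> (\<exists>c. \<forall>\<^sub>F q' in nhds q. S q' = Y q' *v c))"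
    by (elim exE)
  have N: "open N" "q \<in> N" "N \<subseteq> \<Omega>" "\<And>q. q \<in> N \<Longrightarrow> invertible (Y q)"
    "\<And>S q. q \<in> N \<Longrightarrow> P S q \<longleftrightarrow> (\<exists>c. \<forall>\<^sub>F q' in nhds q. S q' = Y q' *v c)"
    using triv by simp_all
  then obtain c where "\<forall>\<^sub>F q' in nhds q. S' q' = Y q' *v c" using assms(3) N(2,5) by blast
  with assms(2) have "\<forall>\<^sub>F q' in nhds q. S q' = Y q' *v c" by eventually_elim simp
  then show ?thesis using N(2,5) by blast
qed

text \<open>Near a point two flat functions are \<open>Y c\<close> and \<open>Y c'\<close>.  Hence the set where they agree and its complement are open.\<close>

lemma flat_unique:
  assumes C: "connected C" "open C" "C \<subseteq> \<Omega>" and S: "\<And>q. q \<in> C \<Longrightarrow> P S q" "\<And>q. q \<in> C \<Longrightarrow> P S' q"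
    and q: "q0 \<in> C" "S q0 = S' q0" "q \<in> C"
  shows "S q = S' q"
proof (rule connected_induction_simple[OF C(1) q(1,3), of "\<lambda>q. S q = S' q", OF q(2)])
  fix a assume a: "a \<in> C"
  from trivial[OF subsetD[OF C(3) a]] obtain N and Y :: "'a \<Rightarrow> complex^2^2" where triv: "open N \<and> a \<in> N \<and> N \<subseteq> \<Omega> \<and>
      (\<forall>q\<in>N. invertible (Y q)) \<and> (\<forall>S. \<forall>q\<in>N. P S q \<longleftrightarrow> (\<exists>c. \<forall>\<^sub>F q' in nhds q. S q' = Y q' *v c))"
    by (elim exE)
  have N: "open N" "a \<in> N" "N \<subseteq> \<Omega>" "\<And>q. q \<in> N \<Longrightarrow> invertible (Y q)"
    "\<And>S q. q \<in> N \<Longrightarrow> P S q \<longleftrightarrow> (\<exists>c. \<forall>\<^sub>F q' in nhds q. S q' = Y q' *v c)"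
    using triv by simp_all
  obtain c c' where "\<forall>\<^sub>F q in nhds a. S q = Y q *v c" "\<forall>\<^sub>F q in nhds a. S' q = Y q *v c'"
    using S[OF a] N(2,5) by blast
  then have "\<forall>\<^sub>F q in nhds a. S q = Y q *v c \<and> S' q = Y q *v c' \<and> q \<in> N \<and> q \<in> C"
    using eventually_nhds_in_open[OF N(1,2)] eventually_nhds_in_open[OF C(2) a] by eventually_elim auto
  then obtain T where T: "open T" "a \<in> T" "\<And>q. q \<in> T \<Longrightarrow> S q = Y q *v c \<and> S' q = Y q *v c' \<and> q \<in> N \<and> q \<in> C"
    unfolding eventually_nhds by blast
  have "S y = S' y" if "x \<in> T" "y \<in> T" "S x = S' x" for x y
  proof -
    have "Y x *v c = Y x *v c'" "invertible (Y x)" using T(3)[OF that(1)] that(3) N(4) by auto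
    then have "c = c'" using invertible_mult_cancel by blast
    then show ?thesis using T(3)[OF that(2)] by simp
  qed
  moreover have "openin (top_of_set C) T" using T C(2) by (auto simp: openin_open_eq)
  ultimately show "\<exists>T. openin (top_of_set C) T \<and> a \<in> T \<and> (\<forall>x\<in>T. \<forall>y\<in>T. S x = S' x \<longrightarrow> S y = S' y)"
    using T(2) by blast
qed

text \<open>Continuation along a segment: the step extends a flat function from a convex neighbourhood of an
  initial part of the segment over one more ball of local triviality.\<close>

lemma flat_on_segment:
  assumes p0: "p0 \<in> \<Omega>" and x: "x \<in> \<Omega>"
  shows "\<exists>C S. open C \<and> convex C \<and> C \<subseteq> \<Omega> \<and> closed_segment p0 x \<subseteq> C \<and> (\<forall>q\<in>C. P S q) \<and> S p0 = v"
proof -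
  define \<gamma> where "\<gamma> = (\<lambda>a::real. p0 + a *\<^sub>R (x - p0))"
  define good where "good = (\<lambda>b. \<exists>C S. open C \<and> convex C \<and> C \<subseteq> \<Omega> \<and> closed_segment p0 (\<gamma> b) \<subseteq> C \<and> (\<forall>q\<in>C. P S q) \<and> S p0 = v)"
  have seg: "\<gamma> b \<in> closed_segment p0 (\<gamma> b')" if "0 \<le> b" "b \<le> b'" for b b'
  proof (cases "b' = 0")
    case False
    then have "\<gamma> b = (1 - b / b') *\<^sub>R p0 + (b / b') *\<^sub>R \<gamma> b'" using that
      by (simp add: \<gamma>_def algebra_simps)
    then show ?thesis using that False unfolding closed_segment_def by (auto intro!: exI[of _ "b / b'"])
  qed (use that in \<open>simp add: \<gamma>_def\<close>)
  have \<gamma>\<Omega>: "\<gamma> b \<in> \<Omega>" if "0 \<le> b" "b \<le> 1" for b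
  proof -
    have "\<gamma> b \<in> closed_segment p0 x" using seg[OF that] by (simp add: \<gamma>_def)
    then show ?thesis using closed_segment_subset[OF p0 x convex_\<Omega>] by blast
  qed
  have mono: "good b" if g: "good b'" and that: "0 \<le> b" "b \<le> b'" for b b'
  proof -
    obtain C S where C: "open C" "convex C" "C \<subseteq> \<Omega>" "closed_segment p0 (\<gamma> b') \<subseteq> C" "\<forall>q\<in>C. P S q" "S p0 = v"
      using g unfolding good_def by blast
    have "closed_segment p0 (\<gamma> b) \<subseteq> C"
      using C(4) seg[OF that] by (intro closed_segment_subset C(2)) auto
    then show ?thesis unfolding good_def using C by (intro exI[of _ C] exI[of _ S] conjI)
  qed
  have good0: "good 0"
  proof -
    from trivial[OF p0] obtain N and Y :: "'a \<Rightarrow> complex^2^2" where triv: "open N \<and> p0 \<in> N \<and> N \<subseteq> \<Omega> \<and>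
      (\<forall>q\<in>N. invertible (Y q)) \<and> (\<forall>S. \<forall>q\<in>N. P S q \<longleftrightarrow> (\<exists>c. \<forall>\<^sub>F q' in nhds q. S q' = Y q' *v c))"
      by (elim exE)
    have N: "open N" "p0 \<in> N" "N \<subseteq> \<Omega>" "\<And>q. q \<in> N \<Longrightarrow> invertible (Y q)"
      "\<And>S q. q \<in> N \<Longrightarrow> P S q \<longleftrightarrow> (\<exists>c. \<forall>\<^sub>F q' in nhds q. S q' = Y q' *v c)"
      using triv by simp_all
    obtain r where r: "r > 0" "ball p0 r \<subseteq> N" using N by (meson open_contains_ball)
    let ?S = "\<lambda>q. Y q *v (matrix_inv (Y p0) *v v)"
    have "P ?S q" if "q \<in> ball p0 r" for q
    proof -
      have "\<exists>c. \<forall>\<^sub>F q' in nhds q. ?S q' = Y q' *v c" by (intro exI[of _ "matrix_inv (Y p0) *v v"]) simp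
      then show ?thesis using subsetD[OF r(2) that] by (simp only: N(5))
    qed
    moreover have "?S p0 = v" using matrix_inv_vec(1)[OF N(4)[OF N(2)]] by simp
    ultimately show ?thesis unfolding good_def using r N(3)
      by (intro exI[of _ "ball p0 r"] exI[of _ ?S]) (auto simp: \<gamma>_def)
  qed
  have "good 1"
  proof (rule connected_induction_simple[of "{0..1::real}" 0 1 good])
    fix a :: real assume a: "a \<in> {0..1}"
    then have aO: "\<gamma> a \<in> \<Omega>" using \<gamma>\<Omega> by auto
  from trivial[OF aO] obtain N and Y :: "'a \<Rightarrow> complex^2^2" where triv: "open N \<and> \<gamma> a \<in> N \<and> N \<subseteq> \<Omega> \<and>
      (\<forall>q\<in>N. invertible (Y q)) \<and> (\<forall>S. \<forall>q\<in>N. P S q \<longleftrightarrow> (\<exists>c. \<forall>\<^sub>F q' in nhds q. S q' = Y q' *v c))"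
    by (elim exE)
  have N: "open N" "\<gamma> a \<in> N" "N \<subseteq> \<Omega>" "\<And>q. q \<in> N \<Longrightarrow> invertible (Y q)"
    "\<And>S q. q \<in> N \<Longrightarrow> P S q \<longleftrightarrow> (\<exists>c. \<forall>\<^sub>F q' in nhds q. S q' = Y q' *v c)"
    using triv by simp_all
    obtain r where r: "r > 0" "ball (\<gamma> a) r \<subseteq> N" using N by (meson open_contains_ball)
    define B where "B = ball (\<gamma> a) r"
    have YB: "P (\<lambda>q. Y q *v c) q" if "q \<in> B" for q c
    proof -
      have "\<exists>d. \<forall>\<^sub>F q' in nhds q. Y q' *v c = Y q' *v d" by (intro exI[of _ c]) simp
      then show ?thesis using subsetD[OF r(2) that[unfolded B_def]] by (simp only: N(5))
    qed
    define T where "T = {b \<in> {0..1}. \<gamma> b \<in> B}"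
    have "continuous_on {0..1} \<gamma>" unfolding \<gamma>_def by (intro continuous_intros)
    then have T: "openin (top_of_set {0..1}) T"
    proof -
      have "{0..1} \<inter> \<gamma> -` ball (\<gamma> a) r = {b \<in> {0..1}. \<gamma> b \<in> ball (\<gamma> a) r}" by auto
      moreover have "openin (top_of_set {0..1}) ({0..1} \<inter> \<gamma> -` ball (\<gamma> a) r)"
        using \<open>continuous_on {0..1} \<gamma>\<close> open_ball by (rule continuous_openin_preimage_gen)
      ultimately show ?thesis by (simp only: T_def B_def)
    qed
    have step: "good b'" if b: "b \<in> T" "b' \<in> T" "good b" "b < b'" for b b'
    proof -
      have bb: "0 \<le> b" "\<gamma> b \<in> B" "\<gamma> b' \<in> B" using b by (auto simp: T_def)
      obtain C S where C: "open C" "convex C" "C \<subseteq> \<Omega>" "closed_segment p0 (\<gamma> b) \<subseteq> C" "\<And>q. q \<in> C \<Longrightarrow> P S q" "S p0 = v"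
        using b(3) unfolding good_def by blast
      have inC: "\<gamma> b \<in> C" "p0 \<in> C" using C(4) by auto
      define c where "c = matrix_inv (Y (\<gamma> b)) *v S (\<gamma> b)"
      have Sc: "S (\<gamma> b) = Y (\<gamma> b) *v c"
        unfolding c_def using matrix_inv_vec(1)[OF N(4)] bb(2) r(2) by (auto simp: B_def)
      have agree: "S q = Y q *v c" if "q \<in> C \<inter> B" for q
      proof -
        have c: "connected (C \<inter> B)" "open (C \<inter> B)" "C \<inter> B \<subseteq> \<Omega>"
          using C(1-3) by (auto simp: B_def intro!: convex_connected convex_Int)
        show ?thesis
          by (rule flat_unique[OF c, of S "\<lambda>q. Y q *v c" "\<gamma> b" q]) (use C(5) inC bb that Sc YB in auto)
      qed
      define S' where "S' = (\<lambda>q. if q \<in> C then S q else Y q *v c)"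
      have S': "S' q = S q" if "q \<in> C" for q using that by (simp add: S'_def)
      have S'': "S' q = Y q *v c" if "q \<in> B" for q using that agree by (simp add: S'_def)
      have CB: "C \<union> B \<subseteq> \<Omega>" using C(3) r(2) N(3) by (auto simp: B_def)
      have flat: "P S' q" if "q \<in> C \<union> B" for q
      proof (cases "q \<in> C")
        case True
        then show ?thesis using CB that eventually_nhds_in_open[OF C(1) True] C(5)
          by (intro flat_cong[of q S' S]) (auto elim!: eventually_mono simp: S')
      next
        case False
        then have "q \<in> B" using that by simp
        then show ?thesis using CB that eventually_nhds_in_open[of B q] YB
          by (intro flat_cong[of q S' "\<lambda>q. Y q *v c"]) (auto elim!: eventually_mono simp: S'' B_def)
      qed
      let ?K = "closed_segment p0 (\<gamma> b')"
      have K: "?K \<subseteq> C \<union> B"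
      proof -
        have "?K = closed_segment p0 (\<gamma> b) \<union> closed_segment (\<gamma> b) (\<gamma> b')"
          using Un_closed_segment[OF seg[OF bb(1) less_imp_le[OF b(4)]]] by simp
        moreover have "closed_segment (\<gamma> b) (\<gamma> b') \<subseteq> B"
          using bb by (intro closed_segment_subset) (auto simp: B_def)
        ultimately show ?thesis using C(4) by blast
      qed
      obtain e where e: "e > 0" "(\<Union>k\<in>?K. ball k e) \<subseteq> C \<union> B"
        using compact_subset_open_imp_ball_epsilon_subset[OF compact_segment _ K] C(1) by (auto simp: B_def)
      have sums: "(\<Union>k\<in>?K. ball k e) = (\<Union>k\<in>?K. \<Union>y\<in>ball 0 e. {k + y})"
      proof -
        have "ball k e = (\<Union>y\<in>ball 0 e. {k + y})" for k :: 'a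
        proof (intro equalityI subsetI)
          fix x assume "x \<in> ball k e"
          then have "x - k \<in> ball 0 e" "x = k + (x - k)" by (auto simp: dist_norm norm_minus_commute)
          then show "x \<in> (\<Union>y\<in>ball 0 e. {k + y})" by blast
        qed (auto simp: dist_norm)
        then show ?thesis by (rule SUP_cong[OF refl])
      qed
      have "convex (\<Union>k\<in>?K. ball k e)" unfolding sums by (intro convex_sums) auto
      moreover have "?K \<subseteq> (\<Union>k\<in>?K. ball k e)" using e(1) by auto
      moreover have "\<forall>q\<in>(\<Union>k\<in>?K. ball k e). P S' q" by (intro ballI flat) (rule subsetD[OF e(2)])
      moreover have "open (\<Union>k\<in>?K. ball k e)" by (intro open_UN ballI open_ball)
      moreover have "(\<Union>k\<in>?K. ball k e) \<subseteq> \<Omega>" using e(2) CB by (rule order_trans)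
      moreover have "S' p0 = v" using S'[OF inC(2)] C(6) by simp
      ultimately show "good b'" unfolding good_def
        by (intro exI[of _ "\<Union>k\<in>?K. ball k e"] exI[of _ S'] conjI)
    qed
    have "good b'" if "b \<in> T" "b' \<in> T" "good b" for b b'
      using step[OF that] mono[OF that(3), of b'] that by (cases "b < b'") (auto simp: T_def)
    moreover have "a \<in> T" using a r(1) by (simp add: T_def B_def)
    ultimately show "\<exists>T. openin (top_of_set {0..1}) T \<and> a \<in> T \<and> (\<forall>x\<in>T. \<forall>y\<in>T. good x \<longrightarrow> good y)"
      using T by blast
  qed (use good0 in auto)
  then show ?thesis by (simp add: good_def \<gamma>_def)
qed

text \<open>The value at \<open>x\<close> is that of a continuation along the segment from \<open>p0\<close> to \<open>x\<close>.  The continuations for different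
  end points agree where both are defined, since the intersection of their convex domains is connected and contains \<open>p0\<close>.\<close>

lemma flat_extension:
  assumes p0: "p0 \<in> \<Omega>"
  shows "\<exists>S. (\<forall>q\<in>\<Omega>. P S q) \<and> S p0 = v"
proof -
  have "\<forall>x\<in>\<Omega>. \<exists>C S. open C \<and> convex C \<and> C \<subseteq> \<Omega> \<and> closed_segment p0 x \<subseteq> C \<and> (\<forall>q\<in>C. P S q) \<and> S p0 = v"
    using flat_on_segment[OF p0] by blast
  from bchoice[OF this] obtain C where "\<forall>x\<in>\<Omega>. \<exists>S. open (C x) \<and> convex (C x) \<and> C x \<subseteq> \<Omega> \<and> closed_segment p0 x \<subseteq> C x \<and> (\<forall>q\<in>C x. P S q) \<and> S p0 = v" ..
  from bchoice[OF this] obtain S where "\<forall>x\<in>\<Omega>. open (C x) \<and> convex (C x) \<and> C x \<subseteq> \<Omega> \<and> closed_segment p0 x \<subseteq> C x \<and> (\<forall>q\<in>C x. P (S x) q) \<and> S x p0 = v" ..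
  then have C: "\<And>x. x \<in> \<Omega> \<Longrightarrow> open (C x)" "\<And>x. x \<in> \<Omega> \<Longrightarrow> convex (C x)" "\<And>x. x \<in> \<Omega> \<Longrightarrow> C x \<subseteq> \<Omega>"
    "\<And>x. x \<in> \<Omega> \<Longrightarrow> closed_segment p0 x \<subseteq> C x" "\<And>x q. x \<in> \<Omega> \<Longrightarrow> q \<in> C x \<Longrightarrow> P (S x) q" "\<And>x. x \<in> \<Omega> \<Longrightarrow> S x p0 = v"
    by simp_all
  define G where "G = (\<lambda>x. S x x)"
  have in_C: "x \<in> C x" "p0 \<in> C x" if "x \<in> \<Omega>" for x using C(4)[OF that] by auto
  have G: "G y = S x y" if "x \<in> \<Omega>" "y \<in> C x" for x y
  proof -
    have y: "y \<in> \<Omega>" using C(3) that by blast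
    have c: "connected (C x \<inter> C y)" "open (C x \<inter> C y)" "C x \<inter> C y \<subseteq> \<Omega>"
      using C(1-3)[OF that(1)] C(1-3)[OF y] by (auto intro!: convex_connected convex_Int)
    have "S y y = S x y"
      by (rule flat_unique[OF c, of "S y" "S x" p0 y]) (use C(5,6) in_C that y in auto)
    then show ?thesis by (simp add: G_def)
  qed
  have "P G q" if q: "q \<in> \<Omega>" for q
    using eventually_nhds_in_open[OF C(1)[OF q] in_C(1)[OF q]] C(5)[OF q in_C(1)[OF q]]
    by (intro flat_cong[of q G "S q"] q) (auto elim!: eventually_mono simp: G[OF q])
  moreover have "G p0 = v" using C(6)[OF p0] by (simp add: G_def)
  ultimately show ?thesis by blast
qed

end

section \<open>Flat frames\<close>

text \<open>Multiplied by \<open>z\<close>, a linear equation without pole becomes one with residue \<open>0\<close>, to which the Frobenius method applies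
  with exponent \<open>0\<close>.\<close>

lemma linear_ode_column:
  fixes P :: "complex \<times> complex \<Rightarrow> complex^2^2"
  assumes r: "r > 0" "open W" "cball (0 :: complex) r \<times> cball t0 r \<subseteq> W" and hol: "\<And>i j. hol2 W (\<lambda>p. P p $ i $ j)"
  shows "\<exists>s. \<exists>y :: complex \<times> complex \<Rightarrow> complex^2. 0 < s \<and> s \<le> r \<and> (\<forall>i. hol2 (ball 0 s \<times> ball t0 s) (\<lambda>p. y p $ i)) \<and>
    (\<forall>t\<in>ball t0 s. y (0 :: complex, t) = (v :: complex^2)) \<and>
    (\<forall>p\<in>ball (0 :: complex) s \<times> ball t0 s. \<forall>i. partial_z (\<lambda>p. y p $ i) p = - (P p *v y p) $ i)"
proof -
  define M where "M = (\<lambda>p. (\<chi> i j. fst p * P p $ i $ j) :: complex^2^2)"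
  have hM: "hol2 W (\<lambda>p. M p $ i $ j)" for i j unfolding M_def by (simp add: hol2_mult hol2_fst hol)
  obtain s and y :: "complex \<times> complex \<Rightarrow> complex^2" where s: "0 < s" "s \<le> r" "\<And>i. hol2 (ball 0 s \<times> ball t0 s) (\<lambda>p. y p $ i)"
    "\<And>t. t \<in> ball t0 s \<Longrightarrow> y (0, t) = v"
    "\<And>p i. p \<in> ball 0 s \<times> ball t0 s \<Longrightarrow> fst p * partial_z (\<lambda>p. y p $ i) p + (M p *v y p) $ i = 0 * y p $ i"
  proof (rule frobenius_method[where M = M and d = 0 and N = 0 and c = "\<lambda>_. v" and \<mu> = 0, OF r(2,1,3) hM])
    show "M (0, t) $ i $ j = (if i = j then (0 :: complex^2) $ i else 0)" for t i j by (simp add: M_def)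
    show "of_nat n * v $ i + (\<Sum>m\<le>n. (\<chi> i j. zcoeff m (\<lambda>p. M p $ i $ j) t) *v v) $ i = 0 * v $ i" if "n \<le> 0" for t n i
      using that by (simp add: zcoeff_def M_def matrix_vector_2)
  qed (use that in auto)
  let ?D = "ball (0 :: complex) s \<times> ball t0 s"
  have D: "open ?D" "?D \<subseteq> W" using r(3) s(2) by (auto intro: open_Times)
  have "partial_z (\<lambda>p. y p $ i) p = - (P p *v y p) $ i" if "p \<in> ?D" for p i
  proof (rule hol2_extend_eq[OF D(1) _ _ _ that])
    show "hol2 ?D (partial_z (\<lambda>p. y p $ i))" by (rule hol2_partial_z[OF D(1) s(3)])
    show "hol2 ?D (\<lambda>p. - (P p *v y p) $ i)"
      unfolding vector_uminus_component matrix_vector_2 by (intro hol2_intros s(3) hol2_subset[OF hol D(2)])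
    fix p assume p: "p \<in> ?D" "fst p \<noteq> 0"
    have "fst p * (partial_z (\<lambda>p. y p $ i) p + (P p *v y p) $ i) = 0"
      using s(5)[OF p(1), of i] by (simp add: M_def matrix_vector_2 algebra_simps)
    then show "partial_z (\<lambda>p. y p $ i) p = - (P p *v y p) $ i" using p(2) by (simp add: add_eq_0_iff2)
  qed
  then show ?thesis using s(1-4) by blast
qed

lemma matrix_inv_2:
  fixes M :: "complex^2^2"
  assumes "invertible M"
  shows "matrix_inv M $ i $ j = (if i = j then M $ (if i = 1 then 2 else 1) $ (if i = 1 then 2 else 1) else - M $ i $ j) / det M"
proof -
  have d: "det M \<noteq> 0" using assms by (simp add: invertible_det_nz)
  define u where "u = 1 / det M"
  have u: "u * (M $ 1 $ 1 * M $ 2 $ 2 - M $ 1 $ 2 * M $ 2 $ 1) = 1" using d by (simp add: u_def det_2)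
  define N :: "complex^2^2" where "N = (\<chi> i j. (if i = j then M $ (if i = 1 then 2 else 1) $ (if i = 1 then 2 else 1) else - M $ i $ j) * u)"
  have "(M ** N) $ 1 $ 1 = M $ 1 $ 1 * (M $ 2 $ 2 * u) + M $ 1 $ 2 * (- M $ 2 $ 1 * u)"
    "(M ** N) $ 1 $ 2 = M $ 1 $ 1 * (- M $ 1 $ 2 * u) + M $ 1 $ 2 * (M $ 1 $ 1 * u)"
    "(M ** N) $ 2 $ 1 = M $ 2 $ 1 * (M $ 2 $ 2 * u) + M $ 2 $ 2 * (- M $ 2 $ 1 * u)"
    "(M ** N) $ 2 $ 2 = M $ 2 $ 1 * (- M $ 1 $ 2 * u) + M $ 2 $ 2 * (M $ 1 $ 1 * u)"
    by (simp_all add: matrix_matrix_mult_def sum_2 N_def)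
  then have "(M ** N) $ 1 $ 1 = 1" "(M ** N) $ 1 $ 2 = 0" "(M ** N) $ 2 $ 1 = 0" "(M ** N) $ 2 $ 2 = 1"
    using u by (algebra, algebra, algebra, algebra)
  then have "M ** N = mat 1" by (simp add: vec_eq_iff forall_2 mat_def)
  then have "matrix_inv M ** (M ** N) = matrix_inv M" by simp
  then have "N = matrix_inv M" using matrix_inv_mult(1)[OF assms] by (simp add: matrix_mul_assoc)
  then show ?thesis by (simp add: N_def u_def flip: \<open>N = matrix_inv M\<close>)
qed

lemma hol2_matrix_inv:
  fixes M :: "complex \<times> complex \<Rightarrow> complex^2^2"
  assumes "open W" "\<And>i j. hol2 W (\<lambda>p. M p $ i $ j)" "\<And>p. p \<in> W \<Longrightarrow> invertible (M p)"
  shows "hol2 W (\<lambda>p. matrix_inv (M p) $ i $ j)"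
proof (rule hol2_transform[OF _ assms(1)])
  show "matrix_inv (M p) $ i $ j = (if i = j then M p $ (if i = 1 then 2 else 1) $ (if i = 1 then 2 else 1) else - M p $ i $ j) / det (M p)"
    if "p \<in> W" for p by (rule matrix_inv_2[OF assms(3)[OF that]])
  show "hol2 W (\<lambda>p. (if i = j then M p $ (if i = 1 then 2 else 1) $ (if i = 1 then 2 else 1) else - M p $ i $ j) / det (M p))"
    using assms(3) by (cases "i = j") (auto intro!: hol2_intros assms(2) simp: det_2 invertible_det_nz)
qed

lemma linear_ode_fundamental:
  fixes P :: "complex \<times> complex \<Rightarrow> complex^2^2"
  assumes W: "open W" "(z0, t0) \<in> W" and hol: "\<And>i j. hol2 W (\<lambda>p. P p $ i $ j)"
  obtains s X where "s > 0" "ball z0 s \<times> ball t0 s \<subseteq> W" "\<And>i j. hol2 (ball z0 s \<times> ball t0 s) (\<lambda>p. X p $ i $ j)"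
    "\<And>t. t \<in> ball t0 s \<Longrightarrow> X (z0, t) = mat 1"
    "\<And>p i j. p \<in> ball z0 s \<times> ball t0 s \<Longrightarrow> partial_z (\<lambda>p. X p $ i $ j) p = - (P p ** X p) $ i $ j"
    "\<And>p. p \<in> ball z0 s \<times> ball t0 s \<Longrightarrow> invertible (X p :: complex^2^2)"
proof -
  define W0 where "W0 = (\<lambda>p. (z0 + fst p, snd p)) -` W"
  have W0: "open W0" unfolding W0_def by (intro open_vimage W(1) continuous_intros)
  obtain r where r: "r > 0" "cball 0 r \<times> cball t0 r \<subseteq> W0"
    by (rule polydisc_nhd[OF W0, of 0 t0]) (use W(2) in \<open>auto simp: W0_def\<close>)
  define P0 where "P0 = (\<lambda>p. P (z0 + fst p, snd p))"
  have hP0: "hol2 W0 (\<lambda>p. P0 p $ i $ j)" for i j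
    unfolding P0_def by (rule hol2_compose[OF _ hol2_snd hol]) (auto intro!: hol2_intros simp: W0_def)
  have "\<forall>j. \<exists>s y. 0 < s \<and> s \<le> r \<and> (\<forall>i. hol2 (ball 0 s \<times> ball t0 s) (\<lambda>p. y p $ i)) \<and>
    (\<forall>t\<in>ball t0 s. y (0, t) = axis j 1) \<and>
    (\<forall>p\<in>ball 0 s \<times> ball t0 s. \<forall>i. partial_z (\<lambda>p. y p $ i) p = - (P0 p *v y p) $ i)"
    using linear_ode_column[OF r(1) W0 r(2) hP0] by blast
  then obtain s y where "\<forall>j. 0 < s j \<and> s j \<le> r \<and> (\<forall>i. hol2 (ball 0 (s j) \<times> ball t0 (s j)) (\<lambda>p. y j p $ i)) \<and>
    (\<forall>t\<in>ball t0 (s j). y j (0, t) = axis j 1) \<and>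
    (\<forall>p\<in>ball 0 (s j) \<times> ball t0 (s j). \<forall>i. partial_z (\<lambda>p. y j p $ i) p = - (P0 p *v y j p) $ i)"
    unfolding choice_iff by blast
  then have y: "\<And>j. 0 < s j" "\<And>j. s j \<le> r" "\<And>i j. hol2 (ball 0 (s j) \<times> ball t0 (s j)) (\<lambda>p. y j p $ i)"
    "\<And>j t. t \<in> ball t0 (s j) \<Longrightarrow> y j (0, t) = axis j 1"
    "\<And>j p i. p \<in> ball 0 (s j) \<times> ball t0 (s j) \<Longrightarrow> partial_z (\<lambda>p. y j p $ i) p = - (P0 p *v y j p) $ i"
    by blast+
  define \<sigma> where "\<sigma> = min (s 1) (s 2)"
  have \<sigma>: "\<sigma> > 0" "\<sigma> \<le> s j" for j using y(1) exhaust_2[of j] by (auto simp: \<sigma>_def)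
  define X where "X = (\<lambda>p. (\<chi> i j. y j (fst p - z0, snd p) $ i) :: complex^2^2)"
  let ?D = "ball z0 \<sigma> \<times> ball t0 \<sigma>"
  have shift: "(fst p - z0, snd p) \<in> ball 0 (s j) \<times> ball t0 (s j)" if "p \<in> ?D" for p j
    using that \<sigma>(2)[of j] by (auto simp: dist_norm norm_minus_commute)
  have DW: "?D \<subseteq> W"
  proof
    fix p assume p: "p \<in> ?D"
    have "(fst p - z0, snd p) \<in> cball 0 r \<times> cball t0 r" using shift[OF p, of 1] y(2)[of 1] by auto
    then have "(fst p - z0, snd p) \<in> W0" using r(2) by blast
    then show "p \<in> W" by (simp add: W0_def)
  qed
  have hX: "hol2 ?D (\<lambda>p. X p $ i $ j)" for i j
    unfolding X_def vec_lambda_beta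
    by (rule hol2_compose[OF hol2_diff[OF hol2_fst hol2_const] hol2_snd y(3)]) (rule shift)
  have X1: "X (z0, t) = mat 1" if "t \<in> ball t0 \<sigma>" for t
    using y(4)[of t] that \<sigma>(2) by (auto simp: X_def mat_def vec_eq_iff axis_def order_less_le_trans)
  have dX: "partial_z (\<lambda>p. X p $ i $ j) p = - (P p ** X p) $ i $ j" if p: "p \<in> ?D" for p i j
  proof -
    obtain z t where [simp]: "p = (z, t)" by (cases p)
    have "((\<lambda>w. y j (w, t) $ i) has_field_derivative partial_z (\<lambda>p. y j p $ i) (z - z0, t)) (at (z - z0))"
      using shift[OF p, of j] by (intro hol2_slice_z[OF y(3)]) simp
    then have "((\<lambda>w. y j (w - z0, t) $ i) has_field_derivative partial_z (\<lambda>p. y j p $ i) (z - z0, t)) (at z)"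
      using DERIV_shift[of "\<lambda>w. y j (w, t) $ i" _ z "- z0"] by simp
    then have "partial_z (\<lambda>p. X p $ i $ j) p = partial_z (\<lambda>p. y j p $ i) (z - z0, t)"
      unfolding partial_z_def[of "\<lambda>p. X p $ i $ j"] by (simp add: X_def DERIV_imp_deriv)
    also have "\<dots> = - (P0 (z - z0, t) *v y j (z - z0, t)) $ i" using shift[OF p, of j] y(5) by simp
    finally show ?thesis by (simp add: P0_def X_def matrix_vector_2 matrix_matrix_mult_def sum_2)
  qed
  define V where "V = {p \<in> ?D. det (X p) \<noteq> 0}"
  have "open V"
  proof -
    have "continuous_on ?D (\<lambda>p. det (X p))"
      unfolding det_2 by (intro continuous_intros hol2_continuous[OF hX])
    then have "open (?D \<inter> (\<lambda>p. det (X p)) -` (- {0}))"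
      by (rule continuous_open_preimage) (auto intro: open_Times)
    moreover have "V = ?D \<inter> (\<lambda>p. det (X p)) -` (- {0})" by (auto simp: V_def)
    ultimately show ?thesis by simp
  qed
  moreover have "(z0, t0) \<in> V" using \<sigma>(1) X1[of t0] by (simp add: V_def)
  ultimately obtain s' where s': "s' > 0" "cball z0 s' \<times> cball t0 s' \<subseteq> V" by (rule polydisc_nhd)
  have sub: "ball z0 s' \<times> ball t0 s' \<subseteq> V" using s'(2) by auto
  have VD: "V \<subseteq> ?D" by (auto simp: V_def)
  show thesis
  proof (rule that[OF s'(1)])
    show "ball z0 s' \<times> ball t0 s' \<subseteq> W" using sub VD DW by blast
    show "hol2 (ball z0 s' \<times> ball t0 s') (\<lambda>p. X p $ i $ j)" for i j
      using sub VD by (intro hol2_subset[OF hX]) blast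
    show "X (z0, t) = mat 1" if "t \<in> ball t0 s'" for t
    proof -
      have "(z0, t) \<in> ball z0 s' \<times> ball t0 s'" using that s'(1) by simp
      then have "(z0, t) \<in> ?D" using sub VD by blast
      then show ?thesis using X1 by simp
    qed
    fix p assume p: "p \<in> ball z0 s' \<times> ball t0 s'"
    then have "p \<in> ?D" "det (X p) \<noteq> 0" using sub VD by (auto simp: V_def)
    then show "invertible (X p)" "\<And>i j. partial_z (\<lambda>p. X p $ i $ j) p = - (P p ** X p) $ i $ j"
      using dX by (auto simp: invertible_det_nz)
  qed
qed

lemma scale_eq_0: "c \<noteq> 0 \<Longrightarrow> c *s x = 0 \<Longrightarrow> x = (0 :: complex^2)"
  by (simp add: vec_eq_iff)

text \<open>A fundamental system in \<open>z\<close> and a fundamental system in \<open>t\<close> along \<open>z = z0\<close> combine to a flat frame: the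
  \<open>t\<close>-derivative of a column is \<open>z\<close>-flat by flatness of the connection, and it vanishes at \<open>z = z0\<close>.\<close>

lemma (in te_frame) flat_frame:
  assumes U0: "(z0, t0) \<in> U" and z0: "z0 \<noteq> 0"
  obtains s F where "s > 0" "ball z0 s \<times> ball t0 s \<subseteq> U" "\<And>p. p \<in> ball z0 s \<times> ball t0 s \<Longrightarrow> fst p \<noteq> 0"
    "\<And>j. hol_section H (ball z0 s \<times> ball t0 s) (\<lambda>p. column j (F p :: complex^2^2))"
    "\<And>p. p \<in> ball z0 s \<times> ball t0 s \<Longrightarrow> invertible (F p)"
    "\<And>p j. p \<in> ball z0 s \<times> ball t0 s \<Longrightarrow> nabz H (\<lambda>q. column j (F q)) p = 0"
    "\<And>p j. p \<in> ball z0 s \<times> ball t0 s \<Longrightarrow> nabt H (\<lambda>q. column j (F q)) p = 0"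
    "\<And>W u i. hol_section H W u \<Longrightarrow> hol2 (W \<inter> ball z0 s \<times> ball t0 s) (\<lambda>p. (matrix_inv (F p) *v u p) $ i)"
proof -
  define W where "W = U \<inter> {q. fst q \<noteq> 0}"
  have W: "open W" "(z0, t0) \<in> W" using U0 z0 open_U
    by (auto simp: W_def intro!: open_Int open_Collect_neq continuous_intros)
  define P where "P = (\<lambda>p. (\<chi> i j. B p $ i $ j / (fst p)^2) :: complex^2^2)"
  have hP: "hol2 W (\<lambda>p. P p $ i $ j)" for i j
    unfolding P_def vec_lambda_beta by (intro hol2_intros hol2_subset[OF hol_B]) (auto simp: W_def)
  obtain s1 X1 where X1: "s1 > 0" "ball z0 s1 \<times> ball t0 s1 \<subseteq> W" "\<And>i j. hol2 (ball z0 s1 \<times> ball t0 s1) (\<lambda>p. X1 p $ i $ j)"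
    "\<And>t. t \<in> ball t0 s1 \<Longrightarrow> X1 (z0, t) = mat 1"
    "\<And>p i j. p \<in> ball z0 s1 \<times> ball t0 s1 \<Longrightarrow> partial_z (\<lambda>p. X1 p $ i $ j) p = - (P p ** X1 p) $ i $ j"
    "\<And>p. p \<in> ball z0 s1 \<times> ball t0 s1 \<Longrightarrow> invertible (X1 p)"
    by (rule linear_ode_fundamental[OF W hP]) blast
  define W2 where "W2 = (\<lambda>q :: complex \<times> complex. (z0, fst q)) -` U"
  have W2: "open W2" "(t0, 0) \<in> W2" using U0 unfolding W2_def
    by (auto intro!: open_vimage open_U continuous_intros)
  define P2 where "P2 = (\<lambda>q :: complex \<times> complex. (\<chi> i j. A (z0, fst q) $ i $ j / z0) :: complex^2^2)"
  have hP2: "hol2 W2 (\<lambda>q. P2 q $ i $ j)" for i j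
  proof -
    have "hol2 W2 (\<lambda>q. A (z0, fst q) $ i $ j)"
      by (rule hol2_compose[OF hol2_const hol2_fst hol_A]) (simp add: W2_def)
    then show ?thesis unfolding P2_def vec_lambda_beta using z0 by (intro hol2_intros)
  qed
  obtain s2 X2 where X2: "s2 > 0" "ball t0 s2 \<times> ball 0 s2 \<subseteq> W2" "\<And>i j. hol2 (ball t0 s2 \<times> ball 0 s2) (\<lambda>p. X2 p $ i $ j)"
    "\<And>t. t \<in> ball 0 s2 \<Longrightarrow> X2 (t0, t) = mat 1"
    "\<And>p i j. p \<in> ball t0 s2 \<times> ball 0 s2 \<Longrightarrow> partial_z (\<lambda>p. X2 p $ i $ j) p = - (P2 p ** X2 p) $ i $ j"
    "\<And>p. p \<in> ball t0 s2 \<times> ball 0 s2 \<Longrightarrow> invertible (X2 p)"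
    by (rule linear_ode_fundamental[OF W2 hP2]) blast
  define s where "s = min s1 s2"
  have s: "s > 0" "s \<le> s1" "s \<le> s2" using X1(1) X2(1) by (auto simp: s_def)
  define D where "D = ball z0 s \<times> ball t0 s"
  have D: "open D" "D \<subseteq> ball z0 s1 \<times> ball t0 s1" "\<And>p. p \<in> D \<Longrightarrow> (snd p, 0) \<in> ball t0 s2 \<times> ball (0::complex) s2"
    using s by (auto simp: D_def intro: open_Times)
  have DW: "D \<subseteq> W" using D(2) X1(2) by blast
  have DU: "D \<subseteq> U" and Dz: "\<And>p. p \<in> D \<Longrightarrow> fst p \<noteq> 0" using DW by (auto simp: W_def)
  note DP = punctured_sub[OF DU Dz]
  have hX1: "hol2 D (\<lambda>p. X1 p $ i $ j)" for i j by (rule hol2_subset[OF X1(3) D(2)])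
  define Y where "Y = (\<lambda>p :: complex \<times> complex. X2 (snd p, 0))"
  have hY: "hol2 D (\<lambda>p. Y p $ i $ j)" for i j
    unfolding Y_def by (rule hol2_compose[OF hol2_snd hol2_const X2(3) D(3)])
  have pX1: "\<And>p. p \<in> D \<Longrightarrow> invertible (X1 p)" "\<And>p. p \<in> D \<Longrightarrow> invertible (Y p)"
    using X1(6) D(2) X2(6)[OF D(3)] by (auto simp: Y_def)
  \<comment> \<open>Coordinate vectors that depend only on \<open>t\<close> give \<open>z\<close>-flat sections.\<close>
  have zflat: "nabz H (\<lambda>q. \<Phi> q *v (X1 q *v x (snd q))) p = 0" and
    xhol: "hol2 D (\<lambda>p. (X1 p *v x (snd p)) $ i)"
    if x: "\<And>i. hol2 D (\<lambda>p. x (snd p) $ i)" and p: "p \<in> D" for x :: "complex \<Rightarrow> complex^2" and p i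
  proof -
    show hy: "hol2 D (\<lambda>p. (X1 p *v x (snd p)) $ i)" for i
      unfolding matrix_vector_2 by (intro hol2_intros hX1 x)
    have "partial_z (\<lambda>q. (X1 q *v x (snd q)) $ i) p = - (P p *v (X1 p *v x (snd p))) $ i" for i
    proof -
      obtain z t where pz: "p = (z, t)" by (cases p)
      have "((\<lambda>z. X1 (z, t) $ i $ 1 * x t $ 1 + X1 (z, t) $ i $ 2 * x t $ 2) has_field_derivative
          partial_z (\<lambda>p. X1 p $ i $ 1) p * x t $ 1 + partial_z (\<lambda>p. X1 p $ i $ 2) p * x t $ 2) (at z)"
        using p unfolding pz by (intro DERIV_add DERIV_cmult_right hol2_slice_z[OF hX1])
      then have "partial_z (\<lambda>q. (X1 q *v x (snd q)) $ i) p = partial_z (\<lambda>p. X1 p $ i $ 1) p * x t $ 1 + partial_z (\<lambda>p. X1 p $ i $ 2) p * x t $ 2"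
        unfolding matrix_vector_2 partial_z_def[of "\<lambda>q. X1 q $ i $ 1 * x (snd q) $ 1 + X1 q $ i $ 2 * x (snd q) $ 2"]
        by (simp add: pz DERIV_imp_deriv)
      moreover have "partial_z (\<lambda>p. X1 p $ i $ j) p = - (P p $ i $ 1 * X1 p $ 1 $ j + P p $ i $ 2 * X1 p $ 2 $ j)" for j
        using X1(5)[OF subsetD[OF D(2) p]] by (simp add: matrix_matrix_mult_def sum_2)
      ultimately have "partial_z (\<lambda>q. (X1 q *v x (snd q)) $ i) p =
        (- (P p $ i $ 1 * X1 p $ 1 $ 1 + P p $ i $ 2 * X1 p $ 2 $ 1)) * x t $ 1 + (- (P p $ i $ 1 * X1 p $ 1 $ 2 + P p $ i $ 2 * X1 p $ 2 $ 2)) * x t $ 2"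
        by (simp only:)
      then show ?thesis by (simp add: pz matrix_vector_2[of "P (z, t)"] matrix_vector_2[of "X1 (z, t)"] algebra_simps)
    qed
    then have "(fst p)^2 *s (\<chi> i. partial_z (\<lambda>q. (X1 q *v x (snd q)) $ i) p) + B p *v (X1 p *v x (snd p)) = 0"
      using Dz[OF p] by (simp add: vec_eq_iff P_def matrix_vector_2[of "B p"] matrix_vector_2[of "\<chi> i j. B p $ i $ j / (fst p)^2"] field_simps)
    then have "(fst p)^2 *s nabz H (\<lambda>q. \<Phi> q *v (X1 q *v x (snd q))) p = 0"
      using nab_frame(1)[OF D(1) DU Dz hy p] by simp
    then show "nabz H (\<lambda>q. \<Phi> q *v (X1 q *v x (snd q))) p = 0" by (rule scale_eq_0[rotated]) (simp add: Dz[OF p])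
  qed
  define E where "E = (\<lambda>p. \<Phi> p ** X1 p)"
  have cE: "(\<lambda>q. column j (E q)) = (\<lambda>q. \<Phi> q *v (X1 q *v axis j 1))" for j
  proof -
    have "column j (X1 q) = X1 q *v axis j 1" for q by (simp add: vec_eq_iff matrix_vector_axis column_def)
    then show ?thesis by (simp add: E_def column_mult)
  qed
  have invE: "invertible (E p)" if "p \<in> D" for p
    unfolding E_def by (rule invertible_mult[OF inv[OF subsetD[OF DU that]] pX1(1)[OF that]])
  have hE: "hol_section H D (\<lambda>q. column j (E q))" for j
    unfolding cE by (intro hol_section_frame[OF D(1) DU] hol2_intros) (simp only: matrix_vector_axis hX1)
  have zE: "nabz H (\<lambda>q. column j (E q)) p = 0" if "p \<in> D" for p j
    unfolding cE using that by (intro zflat hol2_const)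
  have coordE: "hol2 (V \<inter> D) (\<lambda>p. (matrix_inv (E p) *v u p) $ i)" if u: "hol_section H V u" for V u i
  proof (rule hol2_transform)
    have oV: "open (V \<inter> D)" using u D(1) by (auto simp: hol_section_def)
    show "open (V \<inter> D)" by (rule oV)
    show "hol2 (V \<inter> D) (\<lambda>p. (matrix_inv (X1 p) *v (matrix_inv (\<Phi> p) *v u p)) $ i)"
      unfolding matrix_vector_2[of "matrix_inv (X1 p)" for p]
      using DU by (intro hol2_intros hol2_subset[OF hol2_matrix_inv[OF D(1) hX1 pX1(1)]] hol2_subset[OF coords[OF u]]) auto
    show "(matrix_inv (E p) *v u p) $ i = (matrix_inv (X1 p) *v (matrix_inv (\<Phi> p) *v u p)) $ i" if "p \<in> V \<inter> D" for p
    proof -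
      have "p \<in> D" using that by simp
      from matrix_inv_prod[OF inv[OF subsetD[OF DU this]] pX1(1)[OF this]] show ?thesis
        by (simp add: E_def matrix_vector_mul_assoc)
    qed
  qed
  define F where "F = (\<lambda>p. E p ** Y p)"
  have cF: "(\<lambda>q. column j (F q)) = (\<lambda>q. \<Phi> q *v (X1 q *v column j (X2 (snd q, 0))))" for j
    by (simp add: F_def E_def Y_def column_mult fun_eq_iff matrix_vector_mul_assoc)
  have hx: "hol2 D (\<lambda>p. column j (X2 (snd p, 0)) $ i)" for i j
    using hY[of i j] by (simp add: Y_def column_def)
  have hF: "hol_section H D (\<lambda>q. column j (F q))" for j
    unfolding cF using hx s(1) by (intro hol_section_frame[OF D(1) DU] xhol[of _ "(z0, t0)"]) (auto simp: D_def)
  have zF: "nabz H (\<lambda>q. column j (F q)) p = 0" if "p \<in> D" for p j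
    unfolding cF by (rule zflat[OF hx that])
  have tF: "nabt H (\<lambda>q. column j (F q)) p = 0" if pD: "p \<in> D" for p j
  proof -
    define f where "f = (\<lambda>q. column j (F q))"
    define u where "u = nabt H f"
    have hf: "hol_section H D f" unfolding f_def by (rule hF)
    have hu: "hol_section H D u" unfolding u_def by (rule connection_section(2)[OF conn DP hf])
    define w where "w = (\<lambda>q. matrix_inv (E q) *v u q)"
    have hw: "hol2 D (\<lambda>q. w q $ i)" for i using coordE[OF hu, of i] by (simp add: w_def)
    have uE: "u q = E q *v w q" if "q \<in> D" for q unfolding w_def using matrix_inv_vec(1)[OF invE[OF that]] by simp
    have "nabz H u q = 0" if "q \<in> D" for q
    proof -
      have "nabz H u q = nabt H (nabz H f) q" unfolding u_def by (rule connection_section(3)[OF conn DP hf that])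
      also have "\<dots> = nabt H (\<lambda>_. 0) q"
        by (rule connection_cong(2)[OF conn DP connection_section(1)[OF conn DP hf] hol_section_zero _ that])
          (use D(1) DU U_base zF in \<open>auto simp: f_def\<close>)
      also have "\<dots> = 0" by (rule connection_zero(2)[OF conn DP D(1) that])
      finally show ?thesis .
    qed
    moreover have "nabz H u q = E q *v (\<chi> i. partial_z (\<lambda>q. w q $ i) q)" if "q \<in> D" for q
    proof -
      have "nabz H u q = nabz H (\<lambda>q. E q *v w q) q"
        by (rule connection_cong(1)[OF conn DP hu hol_section_combination[OF hE hw] uE that])
      then show ?thesis using connection_Leibniz(1)[OF conn DP hE hw that] zE[OF that] by simp
    qed
    ultimately have "E q *v (\<chi> i. partial_z (\<lambda>q. w q $ i) q) = E q *v 0" if "q \<in> D" for q using that by simp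
    then have "(\<chi> i. partial_z (\<lambda>q. w q $ i) q) = 0" if "q \<in> D" for q
      using invertible_mult_cancel[OF invE[OF that]] that by blast
    then have wz: "partial_z (\<lambda>q. w q $ i) q = 0" if "q \<in> D" for q i
      using that by (simp add: vec_eq_iff)
    obtain z t where pz: "p = (z, t)" by (cases p)
    have zt: "z \<in> ball z0 s" "t \<in> ball t0 s" using pD by (auto simp: pz D_def)
    have p0: "(z0, t) \<in> D" using zt s(1) by (simp add: D_def)
    have "w (z, t) $ i = w (z0, t) $ i" for i
    proof -
      have "\<exists>c. \<forall>x\<in>ball z0 s. w (x, t) $ i = c"
      proof (rule has_field_derivative_zero_constant)
        fix x assume "x \<in> ball z0 s"
        then have "(x, t) \<in> D" using zt by (simp add: D_def)
        then show "((\<lambda>x. w (x, t) $ i) has_field_derivative 0) (at x within ball z0 s)"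
          using hol2_slice_z[OF hw, of x t i] wz[of "(x, t)" i] by (auto intro: has_field_derivative_at_within)
      qed auto
      then show ?thesis using zt(1) s(1) by auto
    qed
    moreover have "u (z0, t) = 0"
    proof -
      let ?y = "\<lambda>q. X1 q *v column j (X2 (snd q, 0))"
      have hy: "hol2 D (\<lambda>p. ?y p $ i)" for i by (rule xhol[OF hx p0])
      have "partial_t (\<lambda>q. ?y q $ i) (z0, t) = - (P2 (t, 0) ** X2 (t, 0)) $ i $ j" for i
      proof -
        have tb: "(t, 0) \<in> ball t0 s2 \<times> ball (0::complex) s2" using D(3)[OF p0] by simp
        have "eventually (\<lambda>t. ?y (z0, t) $ i = X2 (t, 0) $ i $ j) (nhds t)"
          using eventually_nhds_in_open[OF open_ball zt(2)]
          by eventually_elim (use X1(4) s(2) in \<open>auto simp: column_def\<close>)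
        then have "partial_t (\<lambda>q. ?y q $ i) (z0, t) = deriv (\<lambda>t. X2 (t, 0) $ i $ j) t"
          unfolding partial_t_def by (auto intro!: deriv_cong_ev)
        also have "\<dots> = partial_z (\<lambda>q. X2 q $ i $ j) (t, 0)" by (simp add: partial_z_def)
        finally show ?thesis using X2(5)[OF tb] by simp
      qed
      then have pt: "partial_t (\<lambda>q. ?y q $ i) (z0, t) = - (A (z0, t) $ i $ 1 * X2 (t, 0) $ 1 $ j + A (z0, t) $ i $ 2 * X2 (t, 0) $ 2 $ j) / z0" for i
        by (simp add: P2_def matrix_matrix_mult_def sum_2 add_divide_distrib diff_divide_distrib)
      have "X1 (z0, t) = mat 1" using X1(4) zt(2) s(2) by auto
      then have y0: "?y (z0, t) = column j (X2 (t, 0))" by simp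
      have "z0 *s (\<chi> i. partial_t (\<lambda>q. ?y q $ i) (z0, t)) + A (z0, t) *v ?y (z0, t) = 0"
        using z0 unfolding y0 pt by (simp add: vec_eq_iff matrix_vector_2[of "A (z0, t)"] column_def)
      then have "z0 *s u (z0, t) = 0"
        using nab_frame(2)[OF D(1) DU Dz hy p0] unfolding u_def f_def cF by simp
      then show ?thesis by (rule scale_eq_0[OF z0])
    qed
    then have "w (z0, t) = 0" by (simp add: w_def)
    ultimately have "w p = 0" by (simp add: vec_eq_iff pz)
    then show ?thesis using uE[OF pD] by (simp add: u_def f_def)
  qed
  show thesis
  proof (rule that[of s F, OF s(1)], unfold D_def[symmetric])
    show "D \<subseteq> U" "\<And>p. p \<in> D \<Longrightarrow> fst p \<noteq> 0" using DU Dz .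
    show "invertible (F p)" if "p \<in> D" for p unfolding F_def by (rule invertible_mult[OF invE[OF that] pX1(2)[OF that]])
    fix V u i assume u: "hol_section H V u"
    have oV: "open (V \<inter> D)" using u D(1) by (auto simp: hol_section_def)
    show "hol2 (V \<inter> D) (\<lambda>p. (matrix_inv (F p) *v u p) $ i)"
    proof (rule hol2_transform[OF _ oV])
      show "hol2 (V \<inter> D) (\<lambda>p. (matrix_inv (Y p) *v (matrix_inv (E p) *v u p)) $ i)"
        unfolding matrix_vector_2[of "matrix_inv (Y p)" for p]
        by (intro hol2_intros hol2_subset[OF hol2_matrix_inv[OF D(1) hY pX1(2)]] coordE[OF u]) auto
      show "(matrix_inv (F p) *v u p) $ i = (matrix_inv (Y p) *v (matrix_inv (E p) *v u p)) $ i" if "p \<in> V \<inter> D" for p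
      proof -
        have "p \<in> D" using that by simp
        from matrix_inv_prod[OF invE[OF this] pX1(2)[OF this]] show ?thesis
          by (simp add: F_def matrix_vector_mul_assoc)
      qed
    qed
  qed (use hF zF tF in auto)
qed

section \<open>Flat multivalued sections and monodromy\<close>

text \<open>The total space of the universal covering of \<open>\<complex>\<^sup>* \<times> M\<close>.\<close>

definition cover :: "te \<Rightarrow> (complex \<times> complex) set" where
  "cover H = {p. snd p \<in> base H}"

text \<open>The condition on a flat multivalued section at a single point, which makes it a property of germs.\<close>

definition flat_at :: "te \<Rightarrow> sect \<Rightarrow> complex \<times> complex \<Rightarrow> bool" where
  "flat_at H S p \<longleftrightarrow> (\<exists>N W s. open N \<and> p \<in> N \<and> W \<subseteq> punctured H \<and> hol_section H W s \<and>
      (\<forall>q\<in>W. nabz H s q = 0 \<and> nabt H s q = 0) \<and>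
      (\<forall>q\<in>N. (exp (fst q), snd q) \<in> W \<and> S q = s (exp (fst q), snd q)))"

lemma flat_mv_section_iff:
  "flat_mv_section H S \<longleftrightarrow> (\<forall>p. p \<notin> cover H \<longrightarrow> S p = 0) \<and> (\<forall>p\<in>cover H. flat_at H S p)"
  unfolding flat_mv_section_def flat_at_def cover_def by blast

lemma open_exp_vimage:
  assumes "open D"
  shows "open {q. (exp (fst q), snd q) \<in> (D :: (complex \<times> complex) set)}"
proof -
  have "open ((\<lambda>q. (exp (fst q), snd q)) -` D)" by (intro open_vimage assms continuous_intros)
  then show ?thesis by (simp add: vimage_def)
qed

lemma frame_covering:
  assumes TE: "TE_structure H" and t: "t \<in> base H"
  obtains U \<Phi> A B where "te_frame H U \<Phi> A B" "(z, t) \<in> U"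
proof -
  have "(z, t) \<in> (\<Union>(U, \<Phi>)\<in>frames H. U)"
    using TE t unfolding TE_structure_def vector_bundle_def by simp
  then obtain U \<Phi> where "(U, \<Phi>) \<in> frames H" "(z, t) \<in> U" by auto
  then show thesis using te_frame_exists[OF TE] that by blast
qed

text \<open>The pullback of a flat frame under \<open>(\<zeta>, t) \<mapsto> (e\<^sup>\<zeta>, t)\<close> trivializes.\<close>

lemma flat_at_trivial:
  assumes TE: "TE_structure H" and p: "p \<in> cover H"
  shows "\<exists>N Y. open N \<and> p \<in> N \<and> N \<subseteq> cover H \<and> (\<forall>q\<in>N. invertible (Y q :: complex^2^2)) \<and>
        (\<forall>S. \<forall>q\<in>N. flat_at H S q \<longleftrightarrow> (\<exists>c. \<forall>\<^sub>F q' in nhds q. S q' = Y q' *v c))"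
proof -
  obtain \<zeta> t where pz: "p = (\<zeta>, t)" by (cases p)
  have t: "t \<in> base H" using p by (simp add: cover_def pz)
  obtain U \<Phi> A B where fr: "te_frame H U \<Phi> A B" "(exp \<zeta>, t) \<in> U" by (rule frame_covering[OF TE t])
  interpret te_frame H U \<Phi> A B by (rule fr(1))
  obtain s F where F: "s > 0" "ball (exp \<zeta>) s \<times> ball t s \<subseteq> U" "\<And>p. p \<in> ball (exp \<zeta>) s \<times> ball t s \<Longrightarrow> fst p \<noteq> 0"
    "\<And>j. hol_section H (ball (exp \<zeta>) s \<times> ball t s) (\<lambda>p. column j (F p :: complex^2^2))"
    "\<And>p. p \<in> ball (exp \<zeta>) s \<times> ball t s \<Longrightarrow> invertible (F p)"
    "\<And>p j. p \<in> ball (exp \<zeta>) s \<times> ball t s \<Longrightarrow> nabz H (\<lambda>q. column j (F q)) p = 0"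
    "\<And>p j. p \<in> ball (exp \<zeta>) s \<times> ball t s \<Longrightarrow> nabt H (\<lambda>q. column j (F q)) p = 0"
    "\<And>W u i. hol_section H W u \<Longrightarrow> hol2 (W \<inter> ball (exp \<zeta>) s \<times> ball t s) (\<lambda>p. (matrix_inv (F p) *v u p) $ i)"
    by (rule flat_frame[OF fr(2) exp_not_eq_zero]) blast
  define D where "D = ball (exp \<zeta>) s \<times> ball t s"
  note F = F[folded D_def]
  have D: "open D" "D \<subseteq> punctured H" using punctured_sub[OF F(2,3)] by (auto simp: D_def intro: open_Times)
  define e where "e = (\<lambda>q :: complex \<times> complex. (exp (fst q), snd q))"
  define N where "N = {q. e q \<in> D}"
  define Y where "Y = (\<lambda>q. F (e q))"
  have "q \<in> cover H" if "q \<in> N" for q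
  proof -
    have "e q \<in> UNIV \<times> base H" using subsetD[OF U_base subsetD[OF F(2)]] that by (simp add: N_def)
    then show ?thesis by (simp add: e_def cover_def)
  qed
  then have N: "open N" "p \<in> N" "N \<subseteq> cover H"
    using open_exp_vimage[OF D(1)] F(1) by (auto simp: N_def e_def D_def pz)
  have iff: "flat_at H S q \<longleftrightarrow> (\<exists>c. \<forall>\<^sub>F q' in nhds q. S q' = Y q' *v c)" if q: "q \<in> N" for S q
  proof
    assume "\<exists>c. \<forall>\<^sub>F q' in nhds q. S q' = Y q' *v c"
    then obtain c T where T: "open T" "q \<in> T" "\<And>q'. q' \<in> T \<Longrightarrow> S q' = Y q' *v c"
      unfolding eventually_nhds by blast
    let ?s = "\<lambda>p. F p *v c"
    have hs: "hol_section H D ?s" by (intro hol_section_combination F(4) hol2_const)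
    have "nabz H ?s p = 0 \<and> nabt H ?s p = 0" if "p \<in> D" for p
      using connection_Leibniz[OF conn D(2) F(4) hol2_const that, of c] F(6,7)[OF that]
      by (simp add: partial_z_def partial_t_def) (simp add: vec_eq_iff matrix_vector_2)
    then show "flat_at H S q" unfolding flat_at_def
      using T N(1) q hs D(2)
      by (intro exI[of _ "T \<inter> N"] exI[of _ D] exI[of _ ?s]) (auto simp: Y_def N_def e_def)
  next
    assume "flat_at H S q"
    then obtain N0 W s' where h: "open N0" "q \<in> N0" "W \<subseteq> punctured H" "hol_section H W s'"
      "\<And>q. q \<in> W \<Longrightarrow> nabz H s' q = 0" "\<And>q. q \<in> W \<Longrightarrow> nabt H s' q = 0"
      "\<And>q. q \<in> N0 \<Longrightarrow> e q \<in> W" "\<And>q. q \<in> N0 \<Longrightarrow> S q = s' (e q)"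
      unfolding flat_at_def e_def by blast
    define V0 where "V0 = W \<inter> D"
    have V0: "open V0" "e q \<in> V0" "V0 \<subseteq> W" "V0 \<subseteq> D"
      using h(2,4,7) D(1) q by (auto simp: V0_def hol_section_def N_def)
    define y where "y = (\<lambda>p. matrix_inv (F p) *v s' p)"
    have hy: "hol2 V0 (\<lambda>p. y p $ i)" for i unfolding y_def V0_def by (rule F(8)[OF h(4)])
    have sV: "hol_section H V0 s'" using hol_section_subset[OF h(4) V0(1,3)] .
    have FV: "hol_section H V0 (\<lambda>p. column j (F p))" for j using hol_section_subset[OF F(4) V0(1,4)] .
    have sF: "s' p = F p *v y p" if "p \<in> V0" for p
      unfolding y_def using matrix_inv_vec(1)[OF F(5)[OF subsetD[OF V0(4) that]]] by simp
    have VP: "V0 \<subseteq> punctured H" using V0(4) D(2) by blast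
    have dy: "partial_z (\<lambda>q. y q $ i) p = 0" "partial_t (\<lambda>q. y q $ i) p = 0" if p: "p \<in> V0" for p i
    proof -
      have pD: "p \<in> D" "p \<in> W" using p V0 by auto
      note c = connection_cong[OF conn VP sV hol_section_combination[OF FV hy] sF p]
      have "F p *v (\<chi> i. partial_z (\<lambda>q. y q $ i) p) = 0" "F p *v (\<chi> i. partial_t (\<lambda>q. y q $ i) p) = 0"
        using connection_Leibniz[OF conn VP FV hy p] c h(5,6)[OF pD(2)] F(6,7)[OF pD(1)] by simp_all
      then have "F p *v (\<chi> i. partial_z (\<lambda>q. y q $ i) p) = F p *v 0" "F p *v (\<chi> i. partial_t (\<lambda>q. y q $ i) p) = F p *v 0"
        by simp_all
      then have "(\<chi> i. partial_z (\<lambda>q. y q $ i) p) = 0" "(\<chi> i. partial_t (\<lambda>q. y q $ i) p) = 0"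
        using invertible_mult_cancel[OF F(5)[OF pD(1)]] by blast+
      then show "partial_z (\<lambda>q. y q $ i) p = 0" "partial_t (\<lambda>q. y q $ i) p = 0" by (simp_all add: vec_eq_iff)
    qed
    obtain r where r: "r > 0" "cball (fst (e q)) r \<times> cball (snd (e q)) r \<subseteq> V0"
      by (rule polydisc_nhd[OF V0(1), of "fst (e q)" "snd (e q)"]) (use V0(2) in auto)
    define V where "V = ball (fst (e q)) r \<times> ball (snd (e q)) r"
    have V: "open V" "convex V" "V \<subseteq> V0" "e q \<in> V"
      using r by (auto simp: V_def mem_Times_iff intro: open_Times convex_Times)
    have "y p $ i = y (e q) $ i" if "p \<in> V" for p i
    proof -
      have "\<exists>c. \<forall>x\<in>V. y x $ i = c"
      proof (rule has_derivative_zero_constant[OF V(2)])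
        fix x assume x: "x \<in> V"
        then have "x \<in> V0" using V(3) by blast
        then show "((\<lambda>p. y p $ i) has_derivative (\<lambda>h. 0)) (at x within V)"
          using hol2_has_derivative'[OF hy, of x i] dy by (auto intro: has_derivative_at_withinI)
      qed
      then show ?thesis using that V(4) by auto
    qed
    then have yc: "y p = y (e q)" if "p \<in> V" for p using that by (simp add: vec_eq_iff)
    have "open {q'. e q' \<in> V}" unfolding e_def by (rule open_exp_vimage[OF V(1)])
    from eventually_nhds_in_open[OF this, of q] eventually_nhds_in_open[OF h(1,2)] V(4)
    have "\<forall>\<^sub>F q' in nhds q. q' \<in> {q'. e q' \<in> V}" "\<forall>\<^sub>F q' in nhds q. q' \<in> N0"
      by simp_all
    then have "\<forall>\<^sub>F q' in nhds q. S q' = Y q' *v y (e q)"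
    proof eventually_elim
      case (elim q')
      then show ?case using h(8)[of q'] sF[of "e q'"] yc[of "e q'"] V(3) by (auto simp: Y_def)
    qed
    then show "\<exists>c. \<forall>\<^sub>F q' in nhds q. S q' = Y q' *v c" by blast
  qed
  have "\<forall>q\<in>N. invertible (Y q)" using F(5) by (simp add: N_def Y_def)
  then show ?thesis using N iff by (intro exI[of _ N] exI[of _ Y]) simp
qed

lemma base_convex: "convex (base H)" "open (base H)"
  by (simp_all add: base_def)

lemma flat_local_system:
  assumes "TE_structure H"
  shows "local_system (cover H) (flat_at H)"
proof
  have e: "cover H = UNIV \<times> base H" by (auto simp: cover_def)
  show "open (cover H)" "convex (cover H)"
    unfolding e by (auto intro!: open_Times convex_Times base_convex)
qed (rule flat_at_trivial[OF assms])

lemma (in local_system) flat_combination: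
  assumes "q \<in> \<Omega>" "P S q" "P S' q"
  shows "P (\<lambda>p. a *s S p + b *s S' p) q"
proof -
  from trivial[OF assms(1)] obtain N and Y :: "'a \<Rightarrow> complex^2^2" where N: "q \<in> N"
      "\<forall>S. \<forall>q\<in>N. P S q \<longleftrightarrow> (\<exists>c. \<forall>\<^sub>F q' in nhds q. S q' = Y q' *v c)"
    by blast
  then obtain c c' where "\<forall>\<^sub>F q' in nhds q. S q' = Y q' *v c" "\<forall>\<^sub>F q' in nhds q. S' q' = Y q' *v c'"
    using assms(2,3) by blast
  then have "\<forall>\<^sub>F q' in nhds q. a *s S q' + b *s S' q' = Y q' *v (a *s c + b *s c')"
    by eventually_elim (simp add: vec_eq_iff matrix_vector_2 algebra_simps)
  then show ?thesis using N by blast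
qed

lemma flat_mv_combination:
  assumes "TE_structure H" "flat_mv_section H S" "flat_mv_section H S'"
  shows "flat_mv_section H (\<lambda>p. a *s S p + b *s S' p)"
  using assms local_system.flat_combination[OF flat_local_system[OF assms(1)]]
  by (simp add: flat_mv_section_iff)

lemma flat_mv_unique:
  assumes TE: "TE_structure H" and S: "flat_mv_section H S" "flat_mv_section H S'" and p: "p \<in> cover H" "S p = S' p"
  shows "S = S'"
proof
  fix q
  interpret local_system "cover H" "flat_at H" by (rule flat_local_system[OF TE])
  show "S q = S' q"
  proof (cases "q \<in> cover H")
    case True
    show ?thesis
      by (rule flat_unique[OF convex_connected[OF convex_\<Omega>] open_\<Omega> order_refl, of S S' p q])
        (use S p True in \<open>simp_all add: flat_mv_section_iff\<close>)
  qed (use S in \<open>simp add: flat_mv_section_iff del: split_paired_All\<close>)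
qed

lemma flat_mv_exists:
  assumes TE: "TE_structure H" and p: "p \<in> cover H"
  obtains S where "flat_mv_section H S" "S p = v"
proof -
  interpret local_system "cover H" "flat_at H" by (rule flat_local_system[OF TE])
  obtain S where S: "\<forall>q\<in>cover H. flat_at H S q" "S p = v" using flat_extension[OF p] by blast
  let ?S = "\<lambda>q. if q \<in> cover H then S q else 0"
  have "flat_at H ?S q" if q: "q \<in> cover H" for q
  proof (rule flat_cong[OF q])
    show "\<forall>\<^sub>F q' in nhds q. ?S q' = S q'"
      using eventually_nhds_in_open[OF open_\<Omega> q] by eventually_elim simp
  qed (use S q in blast)
  then have "flat_mv_section H ?S" by (simp add: flat_mv_section_iff)
  then show thesis using that[of ?S] S(2) p by simp
qed

lemma flat_mv_monodromy:
  assumes S: "flat_mv_section H S"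
  shows "flat_mv_section H (monodromy S)"
  unfolding flat_mv_section_iff
proof (intro conjI allI impI ballI)
  let ?c = "2 * of_real pi * \<i>"
  show "monodromy S p = 0" if "p \<notin> cover H" for p
    using S that by (cases p) (auto simp: flat_mv_section_iff cover_def monodromy_def)
  fix p assume p: "p \<in> cover H"
  have "flat_at H S (fst p + ?c, snd p)" using S p by (auto simp: flat_mv_section_iff cover_def)
  then obtain N W s where h: "open N" "(fst p + ?c, snd p) \<in> N" "W \<subseteq> punctured H" "hol_section H W s"
    "\<forall>q\<in>W. nabz H s q = 0 \<and> nabt H s q = 0" "\<And>q. q \<in> N \<Longrightarrow> (exp (fst q), snd q) \<in> W \<and> S q = s (exp (fst q), snd q)"
    unfolding flat_at_def by blast
  define N' where "N' = (\<lambda>q. (fst q + ?c, snd q)) -` N"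
  have "open N'" unfolding N'_def by (intro open_vimage h(1) continuous_intros)
  moreover have "(exp (fst q), snd q) \<in> W \<and> monodromy S q = s (exp (fst q), snd q)" if "q \<in> N'" for q
    using h(6)[of "(fst q + ?c, snd q)"] that by (simp add: N'_def monodromy_def case_prod_unfold exp_add)
  ultimately show "flat_at H (monodromy S) p"
    unfolding flat_at_def using h(2-5) by (intro exI[of _ N'] exI[of _ W] exI[of _ s]) (simp add: N'_def)
qed

text \<open>The monodromy acts diagonally on a basis of the fibre at a single point of the covering.  This suffices because a flat
  multivalued section is determined by its value there.\<close>

definition diagonal_monodromy :: "te \<Rightarrow> complex \<Rightarrow> complex \<Rightarrow> bool" where
  "diagonal_monodromy H m1 m2 \<longleftrightarrow> (\<exists>p v1 v2. p \<in> cover H \<and> v1 \<noteq> 0 \<and> v2 \<noteq> 0 \<and> (\<forall>v. \<exists>c1 c2. v = c1 *s v1 + c2 *s v2) \<and>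
     (\<forall>S c1 c2. flat_mv_section H S \<longrightarrow> S p = c1 *s v1 + c2 *s v2 \<longrightarrow>
        monodromy S p = (m1 * c1) *s v1 + (m2 * c2) *s v2))"

lemma monodromy_combination:
  "monodromy (\<lambda>p. a *s S p + b *s S' p) = (\<lambda>p. a *s monodromy S p + b *s monodromy S' p)"
  by (auto simp: monodromy_def)

context
  fixes H m1 m2
  assumes TE: "TE_structure H" and dm: "diagonal_monodromy H m1 m2"
begin

text \<open>Both sides are flat and agree at the distinguished point.\<close>

lemma monodromy_quadratic:
  assumes S: "flat_mv_section H S"
  shows "monodromy (monodromy S) p = (m1 + m2) *s monodromy S p - (m1 * m2) *s S p"
    and "m1 = m2 \<Longrightarrow> monodromy S = (\<lambda>p. m1 *s S p)"
proof -
  obtain q v1 v2 where q: "q \<in> cover H" "\<And>v. \<exists>c1 c2. v = c1 *s v1 + c2 *s v2"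
    "\<And>S c1 c2. flat_mv_section H S \<Longrightarrow> S q = c1 *s v1 + c2 *s v2 \<Longrightarrow> monodromy S q = (m1 * c1) *s v1 + (m2 * c2) *s v2"
    using dm unfolding diagonal_monodromy_def by blast
  obtain c1 c2 where c: "S q = c1 *s v1 + c2 *s v2" using q(2) by blast
  note S1 = flat_mv_monodromy[OF S] note S2 = flat_mv_monodromy[OF S1]
  have m: "monodromy S q = (m1 * c1) *s v1 + (m2 * c2) *s v2" using q(3)[OF S c] .
  have mm: "monodromy (monodromy S) q = (m1 * (m1 * c1)) *s v1 + (m2 * (m2 * c2)) *s v2" using q(3)[OF S1 m] .
  have "monodromy (monodromy S) = (\<lambda>p. (m1 + m2) *s monodromy S p + (- (m1 * m2)) *s S p)"
    by (rule flat_mv_unique[OF TE S2 flat_mv_combination[OF TE S1 S] q(1)])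
      (simp add: m mm c vec_eq_iff algebra_simps)
  then show "monodromy (monodromy S) p = (m1 + m2) *s monodromy S p - (m1 * m2) *s S p"
    by (simp add: vec_eq_iff)
  assume e: "m1 = m2"
  have "monodromy S = (\<lambda>p. m1 *s S p + 0 *s S p)"
    by (rule flat_mv_unique[OF TE S1 flat_mv_combination[OF TE S S] q(1)])
      (simp add: m c e vec_eq_iff algebra_simps)
  then show "monodromy S = (\<lambda>p. m1 *s S p)" by simp
qed

text \<open>For different eigenvalues the polynomial equation of the monodromy splits a section into two eigensections.\<close>

lemma diagonal_monodromy_semisimple: "monodromy_semisimple H"
  unfolding monodromy_semisimple_def
proof (intro allI impI)
  fix S assume S: "flat_mv_section H S"
  show "\<exists>F. finite F \<and> F \<subseteq> (\<Union>c. monodromy_eigensections H c) \<and> S = (\<lambda>p. \<Sum>E\<in>F. E p)"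
  proof (cases "S = (\<lambda>_. 0)")
    case True
    then show ?thesis by (intro exI[of _ "{}"]) auto
  next
    case S0: False
    show ?thesis
    proof (cases "m1 = m2")
      case True
      then have "S \<in> monodromy_eigensections H m1"
        using monodromy_quadratic(2)[OF S True] S S0 by (simp add: monodromy_eigensections_def)
      then show ?thesis by (intro exI[of _ "{S}"]) auto
    next
      case False
      define r where "r = 1 / (m1 - m2)"
      have r: "(m1 - m2) * r = 1" using False by (simp add: r_def)
      define E1 where "E1 = (\<lambda>p. r *s monodromy S p + (- (m2 * r)) *s S p)"
      define E2 where "E2 = (\<lambda>p. (- r) *s monodromy S p + (m1 * r) *s S p)"
      note S1 = flat_mv_monodromy[OF S]
      have f: "flat_mv_section H E1" "flat_mv_section H E2"
        unfolding E1_def E2_def by (intro flat_mv_combination[OF TE S1 S])+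
      have T: "monodromy E1 = (\<lambda>p. m1 *s E1 p)" "monodromy E2 = (\<lambda>p. m2 *s E2 p)"
        unfolding E1_def E2_def monodromy_combination monodromy_quadratic(1)[OF S]
        by (auto simp: fun_eq_iff vec_eq_iff algebra_simps)
      have sum: "S p = E1 p + E2 p" for p
      proof -
        have "E1 p + E2 p = ((m1 - m2) * r) *s S p" by (simp add: E1_def E2_def vec_eq_iff algebra_simps)
        then show ?thesis by (simp add: r)
      qed
      have eig: "E1 \<noteq> (\<lambda>_. 0) \<Longrightarrow> E1 \<in> monodromy_eigensections H m1" "E2 \<noteq> (\<lambda>_. 0) \<Longrightarrow> E2 \<in> monodromy_eigensections H m2"
        using f T by (auto simp: monodromy_eigensections_def)
      consider "E1 = (\<lambda>_. 0)" | "E2 = (\<lambda>_. 0)" | "E1 \<noteq> (\<lambda>_. 0)" "E2 \<noteq> (\<lambda>_. 0)" by blast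
      then show ?thesis
      proof cases
        case 1
        then have "S = E2" using sum by auto
        then show ?thesis using eig S0 by (intro exI[of _ "{E2}"]) auto
      next
        case 2
        then have "S = E1" using sum by auto
        then show ?thesis using eig S0 by (intro exI[of _ "{E1}"]) auto
      next
        case 3
        have "E1 \<noteq> E2"
        proof
          assume e: "E1 = E2"
          have "m1 *s E1 p = m2 *s E1 p" for p using T e by metis
          then have "E1 p = 0" for p using False by (simp add: vec_eq_iff)
          then show False using 3 by auto
        qed
        then show ?thesis using eig 3 sum by (intro exI[of _ "{E1, E2}"]) auto
      qed
    qed
  qed
qed

lemma diagonal_monodromy_eigenvalues:
  shows "monodromy_eigenvalues H = {m1, m2}"
proof (intro equalityI subsetI)
  fix c assume "c \<in> monodromy_eigenvalues H"
  then obtain S where S: "flat_mv_section H S" "S \<noteq> (\<lambda>_. 0)" "monodromy S = (\<lambda>p. c *s S p)"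
    by (auto simp: monodromy_eigenvalues_def monodromy_eigensections_def)
  have "\<exists>p. S p \<noteq> 0"
  proof (rule ccontr)
    assume "\<nexists>p. S p \<noteq> 0"
    then have "S = (\<lambda>_. 0)" by (intro ext) blast
    then show False using S(2) by blast
  qed
  then obtain p where p: "S p \<noteq> 0" ..
  have "monodromy (monodromy S) p = c *s (c *s S p)"
  proof -
    have "monodromy (\<lambda>p. c *s S p) p = c *s monodromy S p" by (cases p) (simp add: monodromy_def)
    then show ?thesis by (simp only: S(3))
  qed
  then have "c *s (c *s S p) = (m1 + m2) *s (c *s S p) - (m1 * m2) *s S p"
    using monodromy_quadratic(1)[OF S(1), of p] S(3) by simp
  then have "((c - m1) * (c - m2)) *s S p = 0" by (simp add: vec_eq_iff algebra_simps)
  then have "(c - m1) * (c - m2) = 0" using p by (auto simp: vec_eq_iff)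
  then show "c \<in> {m1, m2}" by auto
next
  fix c assume c: "c \<in> {m1, m2}"
  obtain q v1 v2 where q: "q \<in> cover H" "v1 \<noteq> 0" "v2 \<noteq> 0"
    "\<And>S c1 c2. flat_mv_section H S \<Longrightarrow> S q = c1 *s v1 + c2 *s v2 \<Longrightarrow> monodromy S q = (m1 * c1) *s v1 + (m2 * c2) *s v2"
    using dm unfolding diagonal_monodromy_def by blast
  have "\<exists>S. S \<in> monodromy_eigensections H c" if v: "v \<noteq> 0" "\<And>S. flat_mv_section H S \<Longrightarrow> S q = v \<Longrightarrow> monodromy S q = c *s v" for v c
  proof -
    obtain S where S: "flat_mv_section H S" "S q = v" by (rule flat_mv_exists[OF TE q(1)])
    have "monodromy S = (\<lambda>p. c *s S p + 0 *s S p)"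
      by (rule flat_mv_unique[OF TE flat_mv_monodromy[OF S(1)] flat_mv_combination[OF TE S(1) S(1)] q(1)])
        (use v(2)[OF S] S in simp)
    then have "S \<in> monodromy_eigensections H c" using S v(1) by (auto simp: monodromy_eigensections_def)
    then show ?thesis by blast
  qed
  note ex = this
  have "\<exists>S. S \<in> monodromy_eigensections H m1" by (rule ex[OF q(2)]) (use q(4)[of _ 1 0] in simp)
  moreover have "\<exists>S. S \<in> monodromy_eigensections H m2" by (rule ex[OF q(3)]) (use q(4)[of _ 0 1] in simp)
  ultimately show "c \<in> monodromy_eigenvalues H" using c by (auto simp: monodromy_eigenvalues_def)
qed

end

subsection \<open>Solutions at the logarithmic pole\<close>

text \<open>Two solutions of the same linear system have a Wronskian whose logarithmic derivative is a trace; hence the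
  coordinates of a solution with respect to two others are constant.\<close>

definition wronskian :: "complex^2 \<Rightarrow> complex^2 \<Rightarrow> complex" where
  "wronskian u v = u $ 1 * v $ 2 - u $ 2 * v $ 1"

lemma wronskian_ratio_constant:
  fixes K :: "complex \<Rightarrow> complex^2^2"
  assumes T: "convex T" "open T"
    and u: "\<And>x i. x \<in> T \<Longrightarrow> ((\<lambda>x. u x $ i) has_field_derivative (K x *v u x) $ i) (at x)"
    and v: "\<And>x i. x \<in> T \<Longrightarrow> ((\<lambda>x. v x $ i) has_field_derivative (K x *v v x) $ i) (at x)"
    and a: "\<And>x i. x \<in> T \<Longrightarrow> ((\<lambda>x. a x $ i) has_field_derivative (K x *v a x) $ i) (at x)"
    and b: "\<And>x i. x \<in> T \<Longrightarrow> ((\<lambda>x. b x $ i) has_field_derivative (K x *v b x) $ i) (at x)"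
    and nz: "\<And>x. x \<in> T \<Longrightarrow> wronskian (a x) (b x) \<noteq> 0"
  shows "\<exists>c. \<forall>x\<in>T. wronskian (u x) (v x) / wronskian (a x) (b x) = c"
proof (rule has_field_derivative_zero_constant[OF T(1)])
  fix x assume x: "x \<in> T"
  have W: "((\<lambda>x. wronskian (u x) (v x)) has_field_derivative (K x $ 1 $ 1 + K x $ 2 $ 2) * wronskian (u x) (v x)) (at x)"
    if u: "\<And>i. ((\<lambda>x. u x $ i) has_field_derivative (K x *v u x) $ i) (at x)"
      and v: "\<And>i. ((\<lambda>x. v x $ i) has_field_derivative (K x *v v x) $ i) (at x)" for u v
  proof -
    have "((\<lambda>x. u x $ 1 * v x $ 2 - u x $ 2 * v x $ 1) has_field_derivative
      ((K x *v u x) $ 1 * v x $ 2 + (K x *v v x) $ 2 * u x $ 1) - ((K x *v u x) $ 2 * v x $ 1 + (K x *v v x) $ 1 * u x $ 2)) (at x)"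
      by (intro DERIV_diff DERIV_mult' u v DERIV_mult)
    then show ?thesis by (simp add: wronskian_def matrix_vector_2 algebra_simps)
  qed
  have "((\<lambda>x. wronskian (u x) (v x) / wronskian (a x) (b x)) has_field_derivative
     (((K x $ 1 $ 1 + K x $ 2 $ 2) * wronskian (u x) (v x)) * wronskian (a x) (b x)
       - wronskian (u x) (v x) * ((K x $ 1 $ 1 + K x $ 2 $ 2) * wronskian (a x) (b x))) / (wronskian (a x) (b x) * wronskian (a x) (b x))) (at x)"
    by (rule DERIV_divide[OF W[of u v, OF u[OF x] v[OF x]] W[of a b, OF a[OF x] b[OF x]] nz[OF x]])
  then show "((\<lambda>x. wronskian (u x) (v x) / wronskian (a x) (b x)) has_field_derivative 0) (at x within T)"
    by (auto intro: has_field_derivative_at_within)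
qed

lemma wronskian_cramer:
  assumes "wronskian a b \<noteq> 0"
  shows "x = (wronskian x b / wronskian a b) *s a + (wronskian a x / wronskian a b) *s b"
proof -
  have "wronskian a b * x $ i = wronskian x b * a $ i + wronskian a x * b $ i" for i
    using exhaust_2[of i] by (auto simp: wronskian_def algebra_simps)
  then have "x $ i = (wronskian x b * a $ i + wronskian a x * b $ i) / wronskian a b" for i
    using assms by (metis nonzero_mult_div_cancel_left)
  then show ?thesis by (simp add: vec_eq_iff add_divide_distrib)
qed

lemma wronskian_combination:
  "wronskian (c1 *s a + c2 *s b) b = c1 * wronskian a b" "wronskian a (c1 *s a + c2 *s b) = c2 * wronskian a b"
  by (simp_all add: wronskian_def algebra_simps)

lemma eq_quotient_of_mult: "(c::complex) \<noteq> 0 \<Longrightarrow> c * x = y \<Longrightarrow> x = y / c"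
  by auto

text \<open>On a left half plane the functions \<open>e\<^sup>-\<^sup>a\<^sup>\<zeta> y(e\<^sup>\<zeta>)\<close> solve the equation of flat sections over \<open>t = 0\<close>.  A flat section
  is a combination of the two with constant coefficients, and \<open>\<zeta> \<mapsto> \<zeta> + 2 \<pi> \<i>\<close> multiplies them by \<open>e\<^sup>-\<^sup>2\<^sup>\<pi>\<^sup>\<i>\<^sup>a\<close>.\<close>

lemma (in te_frame) log_monodromy:
  assumes s: "s > 0" "\<And>z. z \<in> ball 0 s \<Longrightarrow> (z, 0) \<in> U"
    and hol: "\<And>i. (\<lambda>z. y1 z $ i) holomorphic_on ball 0 s" "\<And>i. (\<lambda>z. y2 z $ i) holomorphic_on ball 0 s"
    and ode1: "\<And>z i. z \<in> ball 0 s \<Longrightarrow> z^2 * deriv (\<lambda>z. y1 z $ i) z + (B (z, 0) *v y1 z) $ i = a1 * z * y1 z $ i"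
    and ode2: "\<And>z i. z \<in> ball 0 s \<Longrightarrow> z^2 * deriv (\<lambda>z. y2 z $ i) z + (B (z, 0) *v y2 z) $ i = a2 * z * y2 z $ i"
    and indep: "\<And>z. z \<in> ball 0 s \<Longrightarrow> wronskian (y1 z) (y2 z) \<noteq> 0"
  shows "diagonal_monodromy H (exp (- (2 * of_real pi * \<i> * a1))) (exp (- (2 * of_real pi * \<i> * a2)))"
proof -
  define T where "T = {\<zeta>. Re \<zeta> < ln s}"
  have T: "convex T" "open T" by (auto simp: T_def convex_halfspace_Re_lt open_halfspace_Re_lt)
  have Te: "exp \<zeta> \<in> ball 0 s" if "\<zeta> \<in> T" for \<zeta>
    using that s(1) exp_less_mono[of "Re \<zeta>" "ln s"] by (simp add: T_def)
  define c where "c = 2 * of_real pi * \<i>"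
  have ec: "exp c = 1" "\<zeta> + c \<in> T \<longleftrightarrow> \<zeta> \<in> T" for \<zeta> by (simp_all add: c_def T_def exp_two_pi_i)
  define K where "K = (\<lambda>\<zeta>. (\<chi> i j. - B (exp \<zeta>, 0) $ i $ j / exp \<zeta>) :: complex^2^2)"
  define g where "g = (\<lambda>a y \<zeta>. exp (- (a * \<zeta>)) *s y (exp \<zeta>) :: complex^2)"
  have g_ode: "((\<lambda>\<zeta>. g a y \<zeta> $ i) has_field_derivative (K \<zeta> *v g a y \<zeta>) $ i) (at \<zeta>)"
    if y: "\<And>i. (\<lambda>z. y z $ i) holomorphic_on ball 0 s"
      "\<And>z i. z \<in> ball 0 s \<Longrightarrow> z^2 * deriv (\<lambda>z. y z $ i) z + (B (z, 0) *v y z) $ i = a * z * y z $ i"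
      and \<zeta>: "\<zeta> \<in> T" for a y \<zeta> i
  proof -
    let ?z = "exp \<zeta>"
    have "((\<lambda>z. y z $ i) has_field_derivative deriv (\<lambda>z. y z $ i) ?z) (at ?z)"
      by (rule holomorphic_derivI[OF y(1) open_ball Te[OF \<zeta>]])
    then have "((\<lambda>\<zeta>. y (exp \<zeta>) $ i) has_field_derivative deriv (\<lambda>z. y z $ i) ?z * ?z) (at \<zeta>)"
      by (rule DERIV_chain2[OF _ DERIV_exp])
    moreover have "((\<lambda>\<zeta>. exp (- (a * \<zeta>))) has_field_derivative exp (- (a * \<zeta>)) * (- a)) (at \<zeta>)"
      by (auto intro!: derivative_eq_intros)
    ultimately have "((\<lambda>\<zeta>. exp (- (a * \<zeta>)) * y (exp \<zeta>) $ i) has_field_derivative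
       exp (- (a * \<zeta>)) * (- a) * y ?z $ i + deriv (\<lambda>z. y z $ i) ?z * ?z * exp (- (a * \<zeta>))) (at \<zeta>)"
      by (intro DERIV_mult)
    moreover have "exp (- (a * \<zeta>)) * (- a) * y ?z $ i + deriv (\<lambda>z. y z $ i) ?z * ?z * exp (- (a * \<zeta>)) = (K \<zeta> *v g a y \<zeta>) $ i"
    proof -
      have "?z * (?z * deriv (\<lambda>z. y z $ i) ?z - a * y ?z $ i) = - (B (?z, 0) *v y ?z) $ i"
        using y(2)[OF Te[OF \<zeta>], of i] by (simp add: power2_eq_square algebra_simps)
      then have "?z * deriv (\<lambda>z. y z $ i) ?z - a * y ?z $ i = - (B (?z, 0) *v y ?z) $ i / ?z"
        by (metis exp_not_eq_zero nonzero_mult_div_cancel_left)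
      then have "exp (- (a * \<zeta>)) * (?z * deriv (\<lambda>z. y z $ i) ?z - a * y ?z $ i) = exp (- (a * \<zeta>)) * (- (B (?z, 0) *v y ?z) $ i / ?z)"
        by simp
      moreover have "(K \<zeta> *v g a y \<zeta>) $ i = exp (- (a * \<zeta>)) * (- (B (?z, 0) *v y ?z) $ i / ?z)"
        by (simp add: K_def g_def matrix_vector_2 diff_divide_distrib algebra_simps)
      ultimately show ?thesis by (simp add: algebra_simps)
    qed
    ultimately show ?thesis by (simp add: g_def)
  qed
  have gc: "g a y (\<zeta> + c) = exp (- (c * a)) *s g a y \<zeta>" for a y \<zeta>
  proof -
    have "exp (- (a * (\<zeta> + c))) = exp (- (c * a)) * exp (- (a * \<zeta>))"
      by (simp add: algebra_simps flip: exp_add)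
    then show ?thesis by (simp add: g_def exp_add ec(1) vector_smult_assoc)
  qed
  have gW: "wronskian (g a1 y1 \<zeta>) (g a2 y2 \<zeta>) \<noteq> 0" if "\<zeta> \<in> T" for \<zeta>
  proof -
    have "wronskian (g a1 y1 \<zeta>) (g a2 y2 \<zeta>) = exp (- (a1 * \<zeta>)) * exp (- (a2 * \<zeta>)) * wronskian (y1 (exp \<zeta>)) (y2 (exp \<zeta>))"
      by (simp add: wronskian_def g_def algebra_simps)
    then show ?thesis using indep[OF Te[OF that]] by simp
  qed
  note g1 = g_ode[OF hol(1) ode1] note g2 = g_ode[OF hol(2) ode2]
  define \<zeta>0 where "\<zeta>0 = complex_of_real (ln s - 1)"
  have z0: "\<zeta>0 \<in> T" by (simp add: T_def \<zeta>0_def)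
  have pU: "(exp \<zeta>, 0) \<in> U" if "\<zeta> \<in> T" for \<zeta> using s(2)[OF Te[OF that]] .
  have base0: "(0 :: complex) \<in> base H" using subsetD[OF U_base pU[OF z0]] by simp
  then have cov: "(\<zeta>, 0) \<in> cover H" for \<zeta> by (simp add: cover_def)
  define v where "v = (\<lambda>a y. \<Phi> (exp \<zeta>0, 0) *v g a y \<zeta>0)"
  have rep: "\<exists>c1 c2. \<forall>\<zeta>\<in>T. matrix_inv (\<Phi> (exp \<zeta>, 0)) *v S (\<zeta>, 0) = c1 *s g a1 y1 \<zeta> + c2 *s g a2 y2 \<zeta>"
    if S: "flat_mv_section H S" for S
  proof -
    define x where "x = (\<lambda>\<zeta>. matrix_inv (\<Phi> (exp \<zeta>, 0)) *v S (\<zeta>, 0))"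
    have x_ode: "((\<lambda>\<zeta>. x \<zeta> $ i) has_field_derivative (K \<zeta> *v x \<zeta>) $ i) (at \<zeta>)" if \<zeta>: "\<zeta> \<in> T" for \<zeta> i
    proof -
      have "flat_at H S (\<zeta>, 0)" using S cov unfolding flat_mv_section_iff by blast
      then obtain N W s' where h: "open N" "(\<zeta>, 0) \<in> N" "W \<subseteq> punctured H" "hol_section H W s'"
        "\<And>q. q \<in> W \<Longrightarrow> nabz H s' q = 0" "\<And>q. q \<in> N \<Longrightarrow> (exp (fst q), snd q) \<in> W"
        "\<And>q. q \<in> N \<Longrightarrow> S q = s' (exp (fst q), snd q)"
        unfolding flat_at_def by blast
      let ?z = "exp \<zeta>"
      let ?y = "\<lambda>q. matrix_inv (\<Phi> q) *v s' q"
      have zW: "(?z, 0) \<in> W" using h(6)[OF h(2)] by simp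
      have "\<Phi> (?z, 0) *v (?z^2 *s (\<chi> i. partial_z (\<lambda>q. ?y q $ i) (?z, 0)) + B (?z, 0) *v ?y (?z, 0)) = \<Phi> (?z, 0) *v 0"
        using nab_section(1)[OF h(4) zW pU[OF \<zeta>]] h(5)[OF zW] by simp
      then have "?z^2 *s (\<chi> i. partial_z (\<lambda>q. ?y q $ i) (?z, 0)) + B (?z, 0) *v ?y (?z, 0) = 0"
        by (rule cancel[OF pU[OF \<zeta>]])
      from arg_cong[OF this, of "\<lambda>x. x $ i"]
      have "?z^2 * partial_z (\<lambda>q. ?y q $ i) (?z, 0) = - (B (?z, 0) *v ?y (?z, 0)) $ i"
        by (simp add: add_eq_0_iff2)
      then have "?z * (partial_z (\<lambda>q. ?y q $ i) (?z, 0) * ?z) = - (B (?z, 0) *v ?y (?z, 0)) $ i"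
        by (simp add: power2_eq_square mult_ac)
      then have "partial_z (\<lambda>q. ?y q $ i) (?z, 0) * ?z = - (B (?z, 0) *v ?y (?z, 0)) $ i / ?z"
        by (rule eq_quotient_of_mult[OF exp_not_eq_zero])
      moreover have "x \<zeta> = ?y (?z, 0)" using h(7)[OF h(2)] by (simp add: x_def)
      ultimately have d: "partial_z (\<lambda>q. ?y q $ i) (?z, 0) * ?z = (K \<zeta> *v x \<zeta>) $ i"
        unfolding matrix_vector_2[of "B (?z, 0)"] matrix_vector_2[of "K \<zeta>"] by (simp add: K_def diff_divide_distrib)
      have "((\<lambda>z. ?y (z, 0) $ i) has_field_derivative partial_z (\<lambda>q. ?y q $ i) (?z, 0)) (at ?z)"
        using zW pU[OF \<zeta>] by (intro hol2_slice_z[OF coords[OF h(4)]]) simp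
      then have "((\<lambda>\<zeta>. ?y (exp \<zeta>, 0) $ i) has_field_derivative partial_z (\<lambda>q. ?y q $ i) (?z, 0) * ?z) (at \<zeta>)"
        by (rule DERIV_chain2[OF _ DERIV_exp])
      then have D: "((\<lambda>\<zeta>. ?y (exp \<zeta>, 0) $ i) has_field_derivative (K \<zeta> *v x \<zeta>) $ i) (at \<zeta>)" unfolding d .
      have "\<zeta> \<in> {\<zeta>. (\<zeta>, 0) \<in> N}" using h(2) by simp
      then show ?thesis
        by (rule has_field_derivative_transform_within_open[OF D open_slices(1)[OF h(1)]]) (use h(7) in \<open>simp add: x_def\<close>)
    qed
    obtain c1 where c1: "\<And>\<zeta>. \<zeta> \<in> T \<Longrightarrow> wronskian (x \<zeta>) (g a2 y2 \<zeta>) / wronskian (g a1 y1 \<zeta>) (g a2 y2 \<zeta>) = c1"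
      using wronskian_ratio_constant[OF T x_ode g2 g1 g2 gW] by blast
    obtain c2 where c2: "\<And>\<zeta>. \<zeta> \<in> T \<Longrightarrow> wronskian (g a1 y1 \<zeta>) (x \<zeta>) / wronskian (g a1 y1 \<zeta>) (g a2 y2 \<zeta>) = c2"
      using wronskian_ratio_constant[OF T g1 x_ode g1 g2 gW] by blast
    have "x \<zeta> = c1 *s g a1 y1 \<zeta> + c2 *s g a2 y2 \<zeta>" if "\<zeta> \<in> T" for \<zeta>
      using wronskian_cramer[OF gW[OF that], of "x \<zeta>"] unfolding c1[OF that] c2[OF that] .
    then show ?thesis unfolding x_def by blast
  qed
  have lin: "M *v (c1 *s x + c2 *s y) = c1 *s (M *v x) + c2 *s (M *v y)" for M :: "complex^2^2" and c1 c2 x y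
    by (simp add: vec_eq_iff matrix_vector_2 algebra_simps)
  note F = matrix_inv_vec[OF inv[OF pU]]
  have vnz: "v a1 y1 \<noteq> 0" "v a2 y2 \<noteq> 0"
  proof -
    have "g a1 y1 \<zeta>0 \<noteq> 0" "g a2 y2 \<zeta>0 \<noteq> 0" using gW[OF z0] by (auto simp: wronskian_def)
    then show "v a1 y1 \<noteq> 0" "v a2 y2 \<noteq> 0"
      using F(2)[OF z0, of "g a1 y1 \<zeta>0"] F(2)[OF z0, of "g a2 y2 \<zeta>0"] unfolding v_def by auto
  qed
  have span: "\<exists>c1 c2. w = c1 *s v a1 y1 + c2 *s v a2 y2" for w
  proof -
    let ?x = "matrix_inv (\<Phi> (exp \<zeta>0, 0)) *v w"
    obtain c1 c2 where "?x = c1 *s g a1 y1 \<zeta>0 + c2 *s g a2 y2 \<zeta>0" using wronskian_cramer[OF gW[OF z0], of ?x] by blast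
    then have "\<Phi> (exp \<zeta>0, 0) *v ?x = c1 *s v a1 y1 + c2 *s v a2 y2" by (simp add: lin v_def)
    then show ?thesis using F(1)[OF z0, of w] by auto
  qed
  have mono: "monodromy S (\<zeta>0, 0) = (exp (- (c * a1)) * c1) *s v a1 y1 + (exp (- (c * a2)) * c2) *s v a2 y2"
    if S: "flat_mv_section H S" and eq: "S (\<zeta>0, 0) = c1 *s v a1 y1 + c2 *s v a2 y2" for S c1 c2
  proof -
    obtain d1 d2 where d: "\<And>\<zeta>. \<zeta> \<in> T \<Longrightarrow> matrix_inv (\<Phi> (exp \<zeta>, 0)) *v S (\<zeta>, 0) = d1 *s g a1 y1 \<zeta> + d2 *s g a2 y2 \<zeta>"
      using rep[OF S] by blast
    have "c1 *s v a1 y1 + c2 *s v a2 y2 = \<Phi> (exp \<zeta>0, 0) *v (c1 *s g a1 y1 \<zeta>0 + c2 *s g a2 y2 \<zeta>0)"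
      by (simp add: lin v_def)
    then have "c1 *s g a1 y1 \<zeta>0 + c2 *s g a2 y2 \<zeta>0 = d1 *s g a1 y1 \<zeta>0 + d2 *s g a2 y2 \<zeta>0"
      using d[OF z0] F(2)[OF z0] eq by simp
    then have "c1 = d1" "c2 = d2"
      using wronskian_combination[where a = "g a1 y1 \<zeta>0" and b = "g a2 y2 \<zeta>0" and ?c1.0 = c1 and ?c2.0 = c2]
        wronskian_combination[where a = "g a1 y1 \<zeta>0" and b = "g a2 y2 \<zeta>0" and ?c1.0 = d1 and ?c2.0 = d2] gW[OF z0]
      by auto
    moreover have "S (\<zeta>0 + c, 0) = \<Phi> (exp \<zeta>0, 0) *v (d1 *s g a1 y1 (\<zeta>0 + c) + d2 *s g a2 y2 (\<zeta>0 + c))"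
    proof -
      have e: "exp (\<zeta>0 + c) = exp \<zeta>0" by (simp add: exp_add ec(1))
      have "\<zeta>0 + c \<in> T" using z0 ec(2) by simp
      from d[OF this] show ?thesis unfolding e using F(1)[OF z0] by metis
    qed
    moreover have "monodromy S (\<zeta>0, 0) = S (\<zeta>0 + c, 0)" by (simp add: monodromy_def c_def)
    ultimately show ?thesis by (simp add: gc lin v_def vector_smult_assoc mult.commute)
  qed
  show ?thesis
    unfolding diagonal_monodromy_def c_def[symmetric]
    using cov[of \<zeta>0] vnz span mono by (intro exI[of _ "(\<zeta>0, 0)"] exI[of _ "v a1 y1"] exI[of _ "v a2 y2"]) simp
qed


context te_frame begin

text \<open>Over \<open>t = 0\<close> the matrix \<open>B\<close> is divisible by \<open>z\<close>.  The quotient, extended constantly in \<open>t\<close>, is the coefficient matrix of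
  an equation for the Frobenius method.\<close>

lemma log_solution:
  fixes d :: "complex^2" and c :: "nat \<Rightarrow> complex^2"
  assumes O: "(0, 0) \<in> U" and B0: "B (0, 0) = 0"
    and R: "\<And>i j. zcoeff 1 (\<lambda>p. B p $ i $ j) 0 = (if i = j then d $ i else 0)"
    and init: "\<And>n i. n \<le> N \<Longrightarrow> of_nat n * c n $ i
        + (\<Sum>m\<le>n. (\<chi> i j. zcoeff (Suc m) (\<lambda>p. B p $ i $ j) 0) *v c (n - m)) $ i = \<mu> * c n $ i"
    and nonres: "\<And>n i. n > N \<Longrightarrow> of_nat n + d $ i - \<mu> \<noteq> 0"
  obtains s y where "0 < s" "\<And>i. (\<lambda>z. y z $ i) holomorphic_on ball 0 s" "y 0 = c 0"
    "\<And>z. z \<in> ball 0 s \<Longrightarrow> (z, 0) \<in> U"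
    "\<And>z i. z \<in> ball 0 s \<Longrightarrow> z^2 * deriv (\<lambda>z. y z $ i) z + (B (z, 0) *v y z) $ i = \<mu> * z * y z $ i"
proof -
  have ex: "\<exists>S g. open S \<and> 0 \<in> S \<and> g holomorphic_on S \<and> (\<forall>z\<in>S. B (z, 0) $ i $ j = z * g z)" for i j
  proof -
    let ?F = "Abs_fps (\<lambda>k. zcoeff k (\<lambda>p. B p $ i $ j) 0)"
    have e: "(\<lambda>z. B (z, 0) $ i $ j) has_fps_expansion ?F"
      by (rule zcoeff_has_fps_expansion[OF open_U hol_B O])
    have "fps_nth ?F 0 = 0" using B0 by (simp add: zcoeff_def)
    then have "?F = fps_X ^ 1 * fps_shift 1 ?F"
      by (intro fps_ext) (auto simp: fps_X_mult_nth)
    with e have "(\<lambda>z. B (z, 0) $ i $ j) has_fps_expansion fps_X ^ 1 * fps_shift 1 ?F" by simp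
    then show ?thesis by (rule has_fps_expansion_power_factor) (auto 4 4)
  qed
  then obtain S g where Sg: "\<And>i j. open (S i j)" "\<And>i j. 0 \<in> S i j" "\<And>i j. g i j holomorphic_on S i j"
    "\<And>i j z. z \<in> S i j \<Longrightarrow> B (z, 0) $ i $ j = z * g i j z" by metis
  define S' where "S' = (\<Inter>i. \<Inter>j. S i j) \<inter> {z. (z, 0) \<in> U}"
  have S': "open S'" "0 \<in> S'"
    using Sg(1,2) O open_slices(1)[OF open_U] by (auto simp: S'_def intro!: open_Int open_INT)
  obtain r where r: "r > 0" "cball 0 r \<subseteq> S'" using open_contains_cball_eq[OF S'(1)] S'(2) by blast
  define M :: "complex \<times> complex \<Rightarrow> complex^2^2" where "M = (\<lambda>p. \<chi> i j. g i j (fst p))"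
  have hM: "hol2 (S' \<times> UNIV) (\<lambda>p. M p $ i $ j)" for i j
    unfolding M_def
    by (simp, rule hol2_of_fst[OF Sg(3,1)]) (auto simp: S'_def)
  have Mc: "zcoeff m (\<lambda>p. M p $ i $ j) t = zcoeff (Suc m) (\<lambda>p. B p $ i $ j) 0" for m i j t
  proof -
    obtain G where G: "g i j has_fps_expansion G"
      using has_fps_expansion_fps_expansion[OF Sg(1,2,3)] by blast
    have "(\<lambda>z. B (z, 0) $ i $ j) has_fps_expansion fps_X * G"
      by (rule has_fps_expansion_transform[OF _ has_fps_expansion_mult[OF has_fps_expansion_fps_X G]])
        (rule eventually_mono[OF eventually_nhds_in_open[OF Sg(1,2)] Sg(4)])
    from zcoeffI[of "\<lambda>p. B p $ i $ j" 0, OF this, of "Suc m"] zcoeffI[of "\<lambda>p. M p $ i $ j" t G m] G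
    show ?thesis by (simp add: M_def)
  qed
  have M0: "M (0, t) $ i $ j = (if i = j then d $ i else 0)" for t i j
    using Mc[of 0 i j t] R[of i j] by (simp add: zcoeff_def)
  obtain s y where y: "0 < s" "s \<le> r" "\<And>i. hol2 (ball 0 s \<times> ball 0 s) (\<lambda>p. y p $ i)"
    "\<And>t. t \<in> ball 0 s \<Longrightarrow> y (0, t) = c 0"
    "\<And>p i. p \<in> ball 0 s \<times> ball 0 s \<Longrightarrow> fst p * partial_z (\<lambda>p. y p $ i) p + (M p *v y p) $ i = \<mu> * y p $ i"
    by (rule frobenius_method[of "S' \<times> UNIV" r 0 M d N c \<mu>])
      (use S' r hM M0 init nonres in \<open>auto simp: Mc open_Times\<close>)
  show thesis
  proof (rule that[of s "\<lambda>z. y (z, 0)"])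
    show "(\<lambda>z. y (z, 0) $ i) holomorphic_on ball 0 s" for i
      by (rule holomorphic_on_subset[OF hol2_holomorphic(1)[OF y(3)]]) (use y(1) in auto)
    fix z :: complex assume z: "z \<in> ball 0 s"
    then have zS: "z \<in> S'" using y(2) r(2) by auto
    show "(z, 0) \<in> U" using zS by (simp add: S'_def)
    fix i
    have "(z, 0) \<in> ball 0 s \<times> ball (0::complex) s" using z y(1) by simp
    from y(5)[OF this, of i]
    have "z * (z * deriv (\<lambda>z. y (z, 0) $ i) z + (M (z, 0) *v y (z, 0)) $ i) = z * (\<mu> * y (z, 0) $ i)"
      by (simp add: partial_z_def)
    moreover have "(B (z, 0) *v y (z, 0)) $ i = z * (M (z, 0) *v y (z, 0)) $ i"
      using zS Sg(4) by (simp add: matrix_vector_2 M_def S'_def algebra_simps)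
    ultimately show "z\<^sup>2 * deriv (\<lambda>z. y (z, 0) $ i) z + (B (z, 0) *v y (z, 0)) $ i = \<mu> * z * y (z, 0) $ i"
      by (simp add: power2_eq_square algebra_simps)
  qed (use y in auto)
qed

lemma log_solution_axis:
  fixes d :: "complex^2"
  assumes O: "(0, 0) \<in> U" and B0: "B (0, 0) = 0"
    and R: "\<And>i j. zcoeff 1 (\<lambda>p. B p $ i $ j) 0 = (if i = j then d $ i else 0)"
    and nonres: "\<And>n i. n > 0 \<Longrightarrow> of_nat n + d $ i - d $ l \<noteq> 0"
  obtains s y where "0 < s" "\<And>i. (\<lambda>z. y z $ i) holomorphic_on ball 0 s" "y 0 = axis l 1"
    "\<And>z. z \<in> ball 0 s \<Longrightarrow> (z, 0) \<in> U"
    "\<And>z i. z \<in> ball 0 s \<Longrightarrow> z^2 * deriv (\<lambda>z. y z $ i) z + (B (z, 0) *v y z) $ i = d $ l * z * y z $ i"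
proof -
  have init: "of_nat n * axis l 1 $ i
        + (\<Sum>m\<le>n. (\<chi> i j. zcoeff (Suc m) (\<lambda>p. B p $ i $ j) 0) *v axis l 1) $ i = d $ l * axis l 1 $ i" if "n \<le> 0" for n i
  proof -
    have "((\<chi> i j. zcoeff (Suc 0) (\<lambda>p. B p $ i $ j) 0) *v axis l 1) $ i = d $ l * axis l 1 $ i"
      using R[of i l] unfolding matrix_vector_axis by (simp add: axis_def)
    then show ?thesis using that by simp
  qed
  show thesis
    by (rule log_solution[OF O B0 R init nonres]) (assumption | rule that)+
qed

lemma independent_log_solutions:
  fixes d :: "complex^2" and y1 y2 :: "complex \<Rightarrow> complex^2"
  assumes s: "0 < s1" "0 < s2"
    and hol: "\<And>i. (\<lambda>z. y1 z $ i) holomorphic_on ball 0 s1" "\<And>i. (\<lambda>z. y2 z $ i) holomorphic_on ball 0 s2"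
    and sU: "\<And>z. z \<in> ball 0 s1 \<Longrightarrow> (z, 0) \<in> U"
    and ode: "\<And>z i. z \<in> ball 0 s1 \<Longrightarrow> z^2 * deriv (\<lambda>z. y1 z $ i) z + (B (z, 0) *v y1 z) $ i = a1 * z * y1 z $ i"
      "\<And>z i. z \<in> ball 0 s2 \<Longrightarrow> z^2 * deriv (\<lambda>z. y2 z $ i) z + (B (z, 0) *v y2 z) $ i = a2 * z * y2 z $ i"
    and indep: "wronskian (y1 0) (y2 0) \<noteq> 0"
  shows "diagonal_monodromy H (exp (- (2 * of_real pi * \<i> * a1))) (exp (- (2 * of_real pi * \<i> * a2)))"
proof -
  let ?w = "\<lambda>z. wronskian (y1 z) (y2 z)" and ?S = "ball (0::complex) (min s1 s2)"
  have S: "open ?S" "?S \<subseteq> ball 0 s1" "?S \<subseteq> ball 0 s2" "0 \<in> ?S" using s by auto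
  have "?w holomorphic_on ?S"
    unfolding wronskian_def
    by (intro holomorphic_intros holomorphic_on_subset[OF hol(1) S(2)] holomorphic_on_subset[OF hol(2) S(3)])
  then have "isCont ?w 0"
    using S holomorphic_on_imp_continuous_on continuous_on_eq_continuous_at by blast
  then have "eventually (\<lambda>z. ?w z \<noteq> 0) (nhds 0)"
    by (rule tendsto_imp_eventually_ne[OF iffD1[OF tendsto_at_iff_tendsto_nhds[of ?w 0]] indep, OF iffD1[OF isCont_def]])
  then have "eventually (\<lambda>z. ?w z \<noteq> 0 \<and> z \<in> ?S) (nhds 0)"
    using eventually_nhds_in_open[OF S(1,4)] by eventually_elim simp
  then obtain s where s': "s > 0" "\<And>z. z \<in> ball 0 s \<Longrightarrow> ?w z \<noteq> 0 \<and> z \<in> ?S"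
    by (auto simp: eventually_nhds_metric dist_commute)
  have sub: "ball (0::complex) s \<subseteq> ball 0 s1" "ball (0::complex) s \<subseteq> ball 0 s2" using s'(2) S(2,3) by - blast+
  show ?thesis
    by (rule log_monodromy[of s y1 y2])
      (use s' sub sU ode in \<open>auto intro: holomorphic_on_subset[OF hol(1)] holomorphic_on_subset[OF hol(2)]\<close>)
qed

text \<open>Without resonance each eigenvector of the residue is the initial value of a solution.\<close>

lemma nonresonant_monodromy:
  assumes O: "(0, 0) \<in> U" and B0: "B (0, 0) = 0"
    and R: "\<And>i j. zcoeff 1 (\<lambda>p. B p $ i $ j) 0 = (if i = j then d $ i else 0)"
    and nonres: "\<And>n. n \<ge> 1 \<Longrightarrow> d $ 1 - d $ 2 \<noteq> of_nat n" "\<And>n. n \<ge> 1 \<Longrightarrow> d $ 2 - d $ 1 \<noteq> of_nat n"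
  shows "diagonal_monodromy H (exp (- (2 * of_real pi * \<i> * d $ 1))) (exp (- (2 * of_real pi * \<i> * d $ 2)))"
proof -
  have nr: "of_nat n + d $ i - d $ l \<noteq> 0" if "n > 0" for n i l
    using that nonres[of n] exhaust_2[of i] exhaust_2[of l] by (auto simp: algebra_simps)
  obtain s1 y1 where 1: "0 < s1" "\<And>i. (\<lambda>z. y1 z $ i) holomorphic_on ball 0 s1" "y1 0 = axis 1 1"
    "\<And>z. z \<in> ball 0 s1 \<Longrightarrow> (z, 0) \<in> U"
    "\<And>z i. z \<in> ball 0 s1 \<Longrightarrow> z^2 * deriv (\<lambda>z. y1 z $ i) z + (B (z, 0) *v y1 z) $ i = d $ 1 * z * y1 z $ i"
    by (rule log_solution_axis[OF O B0 R nr]) blast+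
  obtain s2 y2 where 2: "0 < s2" "\<And>i. (\<lambda>z. y2 z $ i) holomorphic_on ball 0 s2" "y2 0 = axis 2 1"
    "\<And>z. z \<in> ball 0 s2 \<Longrightarrow> (z, 0) \<in> U"
    "\<And>z i. z \<in> ball 0 s2 \<Longrightarrow> z^2 * deriv (\<lambda>z. y2 z $ i) z + (B (z, 0) *v y2 z) $ i = d $ 2 * z * y2 z $ i"
    by (rule log_solution_axis[OF O B0 R nr]) blast+
  show ?thesis
    by (rule independent_log_solutions[OF 1(1) 2(1) 1(2) 2(2) 1(4) 1(5) 2(5)])
      (use 1(3) 2(3) in \<open>auto simp: wronskian_def axis_def\<close>)
qed

text \<open>The recursion with exponent \<open>d $ 1\<close> is resonant in degree \<open>n\<close> only, and \<open>Y\<close> passes this degree.  The recursion with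
  exponent \<open>d $ 2\<close> has no resonance.\<close>

lemma resonant_monodromy:
  fixes Y :: "nat \<Rightarrow> 2 \<Rightarrow> complex"
  assumes O: "(0, 0) \<in> U" and B0: "B (0, 0) = 0"
    and R: "\<And>i j. zcoeff 1 (\<lambda>p. B p $ i $ j) 0 = (if i = j then d $ i else 0)"
    and n: "d $ 1 - d $ 2 = of_nat n" "n \<ge> 1"
    and Y: "Y 0 1 = 1" "\<And>i l. i \<le> n \<Longrightarrow> of_nat i * Y i l + (\<Sum>m\<le>i. zcoeff (Suc m) (\<lambda>p. B p $ l $ 1) 0 * Y (i - m) 1
        + zcoeff (Suc m) (\<lambda>p. B p $ l $ 2) 0 * Y (i - m) 2) = d $ 1 * Y i l"
  shows "diagonal_monodromy H (exp (- (2 * of_real pi * \<i> * d $ 1))) (exp (- (2 * of_real pi * \<i> * d $ 2)))"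
proof -
  have d1: "d $ 1 = d $ 2 + of_nat n" using n by (simp add: algebra_simps)
  obtain s2 y2 where 2: "0 < s2" "\<And>i. (\<lambda>z. y2 z $ i) holomorphic_on ball 0 s2" "y2 0 = axis 2 1"
    "\<And>z. z \<in> ball 0 s2 \<Longrightarrow> (z, 0) \<in> U"
    "\<And>z i. z \<in> ball 0 s2 \<Longrightarrow> z^2 * deriv (\<lambda>z. y2 z $ i) z + (B (z, 0) *v y2 z) $ i = d $ 2 * z * y2 z $ i"
  proof (rule log_solution_axis[OF O B0 R])
    fix m :: nat and i :: 2 assume "m > 0"
    then have "(of_nat m :: complex) \<noteq> 0" "(of_nat m + of_nat n :: complex) \<noteq> 0" by (simp_all flip: of_nat_add)
    then show "of_nat m + d $ i - d $ 2 \<noteq> 0" using exhaust_2[of i] d1 by (auto simp: algebra_simps)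
  qed blast+
  obtain s1 y1 where 1: "0 < s1" "\<And>i. (\<lambda>z. y1 z $ i) holomorphic_on ball 0 s1" "y1 0 = (\<chi> l. Y 0 l)"
    "\<And>z. z \<in> ball 0 s1 \<Longrightarrow> (z, 0) \<in> U"
    "\<And>z i. z \<in> ball 0 s1 \<Longrightarrow> z^2 * deriv (\<lambda>z. y1 z $ i) z + (B (z, 0) *v y1 z) $ i = d $ 1 * z * y1 z $ i"
  proof (rule log_solution[OF O B0 R, of n "\<lambda>m. \<chi> l. Y m l" "d $ 1"])
    fix m :: nat and i :: 2 assume "m > n"
    then have "(of_nat m :: complex) \<noteq> 0" "(of_nat m :: complex) \<noteq> of_nat n" by simp_all
    then show "of_nat m + d $ i - d $ 1 \<noteq> 0" using exhaust_2[of i] d1 by (auto simp: algebra_simps)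
  qed (use Y(2) in \<open>auto simp: matrix_vector_2\<close>)
  show ?thesis
    by (rule independent_log_solutions[OF 1(1) 2(1) 1(2) 2(2) 1(4) 1(5) 2(5)])
      (use 1(3) 2(3) Y(1) in \<open>auto simp: wronskian_def axis_def\<close>)
qed

end

section \<open>Diagonalization by a constant change of basis\<close>

lemma conjugate_by_similarity:
  fixes M g D :: "complex^2^2"
  assumes "invertible g" "M ** g = g ** D"
  shows "matrix_inv g ** (M ** g) = D"
  unfolding assms(2) matrix_mul_assoc matrix_inv_mult(1)[OF assms(1)] by simp

text \<open>The columns of \<open>g\<close> are eigenvectors for the eigenvalues \<open>(tr M + l) / 2\<close> and \<open>(tr M - l) / 2\<close>.\<close>

lemma diagonalize_2:
  fixes M :: "complex^2^2"
  assumes disc: "(M $ 1 $ 1 - M $ 2 $ 2)^2 + 4 * M $ 1 $ 2 * M $ 2 $ 1 = l^2" and l: "l \<noteq> 0"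
  obtains g :: "complex^2^2" where "invertible g" "\<And>i j. (matrix_inv g ** (M ** g)) $ i $ j =
    (if i = j then (if i = 1 then (M $ 1 $ 1 + M $ 2 $ 2 + l) / 2 else (M $ 1 $ 1 + M $ 2 $ 2 - l) / 2) else 0)"
proof -
  note witness = that
  define a m e where "a = (M $ 1 $ 1 - M $ 2 $ 2) / 2" and "m = (M $ 1 $ 1 + M $ 2 $ 2) / 2" and "e = l / 2"
  define b c where "b = M $ 1 $ 2" and "c = M $ 2 $ 1"
  have M: "M $ 1 $ 1 = m + a" "M $ 2 $ 2 = m - a" "M $ 1 $ 2 = b" "M $ 2 $ 1 = c"
    by (simp_all add: a_def m_def b_def c_def field_simps)
  have l2: "l = 2 * e" by (simp add: e_def)
  have "4 * (a^2 + b * c) = 4 * e^2" using disc by (simp add: M l2 power2_eq_square algebra_simps)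
  then have e: "e \<noteq> 0" "a^2 + b * c = e^2" using l l2 by (simp, simp only: mult_cancel_left) simp
  define D :: "complex^2^2" where "D = vector [vector [m + e, 0], vector [0, m - e]]"
  have main: thesis if g: "g = (vector [vector [p, q], vector [r, s]] :: complex^2^2)" "p * s - q * r \<noteq> 0"
      "(m + a) * p + b * r = p * (m + e)" "(m + a) * q + b * s = q * (m - e)"
      "c * p + (m - a) * r = r * (m + e)" "c * q + (m - a) * s = s * (m - e)" for g p q r s
  proof (rule witness[of g])
    show i: "invertible g" using g(2) by (simp add: invertible_det_nz det_2 g(1))
    have "M ** g = g ** D"
      using g(3-6) by (simp add: vec_eq_iff forall_2 matrix_matrix_mult_def sum_2 D_def g(1) M)
    then have "matrix_inv g ** (M ** g) = D" by (rule conjugate_by_similarity[OF i])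
    then show "(matrix_inv g ** (M ** g)) $ i $ j =
      (if i = j then (if i = 1 then (M $ 1 $ 1 + M $ 2 $ 2 + l) / 2 else (M $ 1 $ 1 + M $ 2 $ 2 - l) / 2) else 0)" for i j
      using exhaust_2[of i] exhaust_2[of j] by (auto simp: D_def M l2 field_simps)
  qed
  have "a = e \<or> a = - e" if "b = 0" using e(2) that by (simp add: power2_eq_iff)
  then consider "b \<noteq> 0" | "b = 0" "c \<noteq> 0" | "b = 0" "c = 0" "a = e" | "b = 0" "c = 0" "a = - e"
    by blast
  then show thesis
  proof cases
    case 1
    show thesis
      by (rule main[OF refl, of b "- e - a" b "e - a"]) (use 1 e in algebra)+
  next
    case 2
    show thesis
      by (rule main[OF refl, of "e + a" c "a - e" c]) (use 2 e in algebra)+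
  next
    case 3
    show thesis by (rule main[OF refl, of 1 1 0 0]) (use 3 in algebra)+
  next
    case 4
    show thesis by (rule main[OF refl, of 0 0 1 1]) (use 4 in algebra)+
  qed
qed

lemma eigenvalues_of_diagonalized:
  fixes M g :: "complex^2^2" and d :: "complex^2"
  assumes g: "invertible g" and D: "\<And>i j. (matrix_inv g ** (M ** g)) $ i $ j = (if i = j then d $ i else 0)"
  shows "{c. \<exists>x. x \<noteq> 0 \<and> M *v x = c *s x} = {d $ 1, d $ 2}"
proof -
  let ?D = "matrix_inv g ** (M ** g)"
  have Dv: "(?D *v y) $ i = d $ i * y $ i" for y i
    unfolding matrix_vector_2[of ?D] D using exhaust_2[of i] by auto
  have sc: "N *v (c *s x) = c *s (N *v x)" for N :: "complex^2^2" and c x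
    by (simp add: vec_eq_iff matrix_vector_2 algebra_simps)
  have Mg: "M *v (g *v y) = g *v (?D *v y)" for y
    using matrix_inv_vec(1)[OF g, of "M *v (g *v y)"] by (simp add: matrix_vector_mul_assoc matrix_mul_assoc)
  have "(\<exists>x. x \<noteq> 0 \<and> M *v x = c *s x) \<longleftrightarrow> (\<exists>y. y \<noteq> 0 \<and> ?D *v y = c *s y)" for c
  proof
    assume "\<exists>x. x \<noteq> 0 \<and> M *v x = c *s x"
    then obtain x where x: "x \<noteq> 0" "M *v x = c *s x" by blast
    let ?y = "matrix_inv g *v x"
    have gy: "g *v ?y = x" by (rule matrix_inv_vec(1)[OF g])
    then have "?y \<noteq> 0" using x(1) by auto
    moreover have "g *v (?D *v ?y) = g *v (c *s ?y)" using Mg[of ?y] x(2) by (simp only: sc gy)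
    then have "?D *v ?y = c *s ?y" by (rule invertible_mult_cancel[OF g])
    ultimately show "\<exists>y. y \<noteq> 0 \<and> ?D *v y = c *s y" by blast
  next
    assume "\<exists>y. y \<noteq> 0 \<and> ?D *v y = c *s y"
    then obtain y where y: "y \<noteq> 0" "?D *v y = c *s y" by blast
    have "g *v y \<noteq> 0" using matrix_inv_vec(2)[OF g, of y] y(1) by auto
    moreover have "M *v (g *v y) = c *s (g *v y)" unfolding Mg y(2) sc ..
    ultimately show "\<exists>x. x \<noteq> 0 \<and> M *v x = c *s x" by blast
  qed
  moreover have "(\<exists>y. y \<noteq> 0 \<and> ?D *v y = c *s y) \<longleftrightarrow> c \<in> {d $ 1, d $ 2}" for c
  proof
    assume "\<exists>y. y \<noteq> 0 \<and> ?D *v y = c *s y"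
    then obtain y where y: "y \<noteq> 0" "?D *v y = c *s y" by blast
    have "c * y $ i = d $ i * y $ i" for i using Dv[of y i] unfolding y(2) by (simp only: vector_smult_component)
    then have di: "d $ i = c \<or> y $ i = 0" for i by (metis mult_cancel_right)
    have "y $ 1 \<noteq> 0 \<or> y $ 2 \<noteq> 0" using y(1) by (auto simp: vec_eq_iff forall_2)
    then show "c \<in> {d $ 1, d $ 2}" using di[of 1] di[of 2] by auto
  next
    have "(axis l 1 :: complex^2) \<noteq> 0 \<and> ?D *v axis l 1 = d $ l *s axis l 1" for l
      by (auto simp: vec_eq_iff Dv) (auto simp: axis_def)
    then show "c \<in> {d $ 1, d $ 2} \<Longrightarrow> \<exists>y. y \<noteq> 0 \<and> ?D *v y = c *s y" by blast
  qed
  ultimately show ?thesis by blast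
qed

context
  fixes W :: "(complex \<times> complex) set"
  assumes W: "open W" "(0, 0) \<in> W"
begin

lemma coeff2_taylor_0: "hol2 W f \<Longrightarrow> coeff2 (taylor f) m 0 = zcoeff m f 0"
  using fps_nth_fps_expansion[OF taylor_nth[OF W], of f m 0] by simp

lemma coeff2_taylor_gauge:
  fixes M :: "complex \<times> complex \<Rightarrow> complex^2^2"
  assumes M: "\<And>i j. hol2 W (\<lambda>p. M p $ i $ j)"
  shows "coeff2 (taylor (\<lambda>p. (h ** (M p ** g)) $ i $ j)) m n =
    (h ** ((\<chi> i j. coeff2 (taylor (\<lambda>p. M p $ i $ j)) m n) ** g)) $ i $ j"
proof -
  have e: "(h ** (N ** g)) $ i $ j = (h $ i $ 1 * g $ 1 $ j) * N $ 1 $ 1 + (h $ i $ 2 * g $ 1 $ j) * N $ 2 $ 1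
      + (h $ i $ 1 * g $ 2 $ j) * N $ 1 $ 2 + (h $ i $ 2 * g $ 2 $ j) * N $ 2 $ 2" for N :: "complex^2^2"
    by (simp add: matrix_matrix_mult_def sum_2 algebra_simps)
  show ?thesis
    unfolding e
    by (simp add: taylor_add[OF W] taylor_mult[OF W] taylor_const[OF W] hol2_add hol2_mult hol2_const M)
qed

end

section \<open>The numerical invariants as orders of power series\<close>

context te_frame begin

lemma delta_expansion:
  assumes O: "(0, 0) \<in> U" and k: "k \<le> 1"
  shows "delta H k has_fps_expansion
    fps_nth (taylor (\<lambda>p. B p $ 1 $ 1) * taylor (\<lambda>p. B p $ 2 $ 2) - taylor (\<lambda>p. B p $ 1 $ 2) * taylor (\<lambda>p. B p $ 2 $ 1)) k"
proof -
  have "eventually (\<lambda>t. delta H k t = zcoeff k (\<lambda>p. B p $ 1 $ 1 * B p $ 2 $ 2 - B p $ 1 $ 2 * B p $ 2 $ 1) t) (nhds 0)"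
    using slice_nhd[OF open_U O] by eventually_elim (simp add: delta_eq[OF _ k] det_2)
  then show ?thesis
    by (rule has_fps_expansion_transform)
      (use taylor_nth[OF open_U O, of "\<lambda>p. B p $ 1 $ 1 * B p $ 2 $ 2 - B p $ 1 $ 2 * B p $ 2 $ 1" k] in
        \<open>simp add: taylor_diff[OF open_U O] taylor_mult[OF open_U O] hol2_mult hol2_diff hol_B\<close>)
qed

lemma pole_part_expansion:
  "(0, 0) \<in> U \<Longrightarrow> (\<lambda>t. B (0, t) $ i $ j) has_fps_expansion fps_nth (taylor (\<lambda>p. B p $ i $ j)) 0"
  using taylor_nth[OF open_U _ hol_B, of 0 i j] unfolding zcoeff_def by simp

text \<open>The invariant \<open>k1\<close> is the order in \<open>t\<close> of the pole part, so the quotient does not vanish at \<open>t = 0\<close>.  The order is at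
  least \<open>1\<close> because the pole part vanishes at the origin, and it is finite by \<open>nz\<close>.\<close>

lemma pole_part_series_inv_k1:
  assumes pc: "pole_condition H" and tf: "trace_free_pole_part H" and lg: "logarithmic_over_0 H" and O: "(0, 0) \<in> U"
    and nz: "fps_nth (taylor (\<lambda>p. B p $ i0 $ j0)) 0 \<noteq> 0"
  shows "pole_part_series (\<lambda>i j. taylor (\<lambda>p. A p $ i $ j)) (\<lambda>i j. taylor (\<lambda>p. B p $ i $ j))
    (\<lambda>i j. fps_shift (inv_k1 H) (fps_nth (taylor (\<lambda>p. B p $ i $ j)) 0)) (inv_k1 H)"
proof -
  define b where "b i j = fps_nth (taylor (\<lambda>p. B p $ i $ j)) 0" for i j
  define P where "P = (\<lambda>k. k \<ge> 1 \<and> pole_part_divisible H k)"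
  have div: "pole_part_divisible H k \<longleftrightarrow> (\<forall>i j. \<exists>c. b i j = fps_X ^ k * c)" for k
    unfolding b_def by (rule pole_part_divisible_iff[OF pc O pole_part_expansion[OF O]])
  have shift: "f = fps_X * fps_shift 1 f" if "fps_nth f 0 = 0" for f :: "complex fps"
    using that by (intro fps_ext) (auto simp: fps_X_mult_nth)
  have "fps_nth (b i j) 0 = 0" for i j
    using fps_nth_fps_expansion[OF pole_part_expansion[OF O], of i j 0] pole_part_zero[OF lg O] by (simp add: b_def)
  from shift[OF this] have P1: "P 1" unfolding P_def div by (metis order_refl power_one_right)
  have bound: "k \<le> subdegree (b i0 j0)" if Pk: "P k" for k
  proof -
    obtain c where c: "b i0 j0 = fps_X ^ k * c" using Pk unfolding P_def div by blast
    then have "c \<noteq> 0" using nz by (auto simp: b_def)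
    then show ?thesis unfolding c by simp
  qed
  have kP: "P (inv_k1 H)" and kmax: "\<not> P (Suc (inv_k1 H))"
    unfolding inv_k1_def P_def[symmetric]
    using GreatestI_nat[of P, OF P1 bound] Greatest_le_nat[of P _ , OF _ bound] by (blast, fastforce)
  obtain c where c: "\<And>i j. b i j = fps_X ^ inv_k1 H * c i j" using kP unfolding P_def div by metis
  have C: "fps_shift (inv_k1 H) (b i j) = c i j" for i j unfolding c by (intro fps_ext) (simp add: fps_X_power_mult_nth)
  show ?thesis
    unfolding b_def[symmetric] C
  proof
    show "flat_series (\<lambda>i j. taylor (\<lambda>p. A p $ i $ j)) (\<lambda>i j. taylor (\<lambda>p. B p $ i $ j))"
      by (rule flat_series_taylor[OF O])
    show "1 \<le> inv_k1 H" using kP by (simp add: P_def)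
    show "fps_nth (taylor (\<lambda>p. B p $ i $ j)) 0 = fps_X ^ inv_k1 H * c i j" for i j using c by (simp add: b_def)
    have "(\<lambda>t. B (0, t) $ 1 $ 1 + B (0, t) $ 2 $ 2) has_fps_expansion b 1 1 + b 2 2"
      unfolding b_def by (intro has_fps_expansion_add pole_part_expansion[OF O])
    moreover have "(\<lambda>t. B (0, t) $ 1 $ 1 + B (0, t) $ 2 $ 2) has_fps_expansion 0"
      by (rule has_fps_expansion_transform[OF eventually_mono[OF slice_nhd[OF open_U O] trace_pole_part[OF pc _ tf]] has_fps_expansion_0])
    ultimately have "b 1 1 + b 2 2 = 0" by (rule fps_expansion_unique_complex)
    then have "fps_X ^ inv_k1 H * (c 1 1 + c 2 2) = 0" by (simp add: c algebra_simps)
    then show "c 2 2 = - c 1 1" by (simp add: add_eq_0_iff)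
    show "\<exists>i j. fps_nth (c i j) 0 \<noteq> 0"
    proof (rule ccontr)
      assume "\<not> ?thesis"
      then have "b i j = fps_X ^ Suc (inv_k1 H) * fps_shift 1 (c i j)" for i j
        using c[of i j] shift[of "c i j"] by (simp add: mult_ac)
      then have "P (Suc (inv_k1 H))" unfolding P_def div by auto
      then show False using kmax by blast
    qed
  qed
qed

end

section \<open>From the residue to the monodromy\<close>

lemma eventually_zero_expansion:
  "f has_fps_expansion F \<Longrightarrow> eventually (\<lambda>t. f t = 0) (nhds 0) \<longleftrightarrow> F = (0 :: complex fps)"
  by (auto simp: has_fps_expansion_0_iff[symmetric] intro: fps_expansion_unique_complex)

context te_frame begin

text \<open>The eigenvalues of the residue differ by \<open>l\<close>, which is not an integer.  So there is no resonance, and the eigenvalues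
  \<open>e\<^sup>-\<^sup>2\<^sup>\<pi>\<^sup>\<i>\<^sup>d\<close> of the monodromy are different.\<close>

lemma distinct_residue_eigenvalues:
  fixes l :: real
  assumes TE: "TE_structure H" and lg: "logarithmic_over_0 H" and O: "(0, 0) \<in> U"
    and disc: "(zcoeff 1 (\<lambda>p. B p $ 1 $ 1) 0 - zcoeff 1 (\<lambda>p. B p $ 2 $ 2) 0)^2
      + 4 * zcoeff 1 (\<lambda>p. B p $ 1 $ 2) 0 * zcoeff 1 (\<lambda>p. B p $ 2 $ 1) 0 = (of_real l)^2"
    and l: "0 < l" "l < 1"
  shows "residue_eigenvalues H = {rho1 H 0 + of_real l / 2, rho1 H 0 - of_real l / 2}"
    and "\<forall>a\<in>residue_eigenvalues H. \<forall>b\<in>residue_eigenvalues H. cmod (a - b) < 1"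
    and "card (monodromy_eigenvalues H) = 2" and "monodromy_semisimple H"
proof -
  define R :: "complex^2^2" where "R = (\<chi> i j. zcoeff 1 (\<lambda>p. B p $ i $ j) 0)"
  define d :: "complex^2" where "d = (\<chi> i. if i = 1 then rho1 H 0 + of_real l / 2 else rho1 H 0 - of_real l / 2)"
  have "(R $ 1 $ 1 - R $ 2 $ 2)^2 + 4 * R $ 1 $ 2 * R $ 2 $ 1 = (of_real l)^2" using disc by (simp add: R_def)
  moreover have "(of_real l :: complex) \<noteq> 0" using l by simp
  ultimately obtain g :: "complex^2^2" where g: "invertible g" "\<And>i j. (matrix_inv g ** (R ** g)) $ i $ j =
    (if i = j then (if i = 1 then (R $ 1 $ 1 + R $ 2 $ 2 + of_real l) / 2 else (R $ 1 $ 1 + R $ 2 $ 2 - of_real l) / 2) else 0)"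
    by (rule diagonalize_2) blast
  have rho: "rho1 H 0 = (R $ 1 $ 1 + R $ 2 $ 2) / 2" using rho1_eq[OF O] by (simp add: R_def)
  have gd: "(matrix_inv g ** (R ** g)) $ i $ j = (if i = j then d $ i else 0)" for i j
    unfolding g(2) by (simp add: d_def rho add_divide_distrib diff_divide_distrib)
  show ev: "residue_eigenvalues H = {rho1 H 0 + of_real l / 2, rho1 H 0 - of_real l / 2}"
    unfolding residue_eigenvalues_eq[OF lg O] R_def[symmetric] eigenvalues_of_diagonalized[OF g(1) gd]
    by (simp add: d_def)
  show "\<forall>a\<in>residue_eigenvalues H. \<forall>b\<in>residue_eigenvalues H. cmod (a - b) < 1"
    unfolding ev using l by (auto simp: norm_minus_commute)
  have te: "te_frame H U (\<lambda>p. \<Phi> p ** g) (\<lambda>p. matrix_inv g ** (A p ** g)) (\<lambda>p. matrix_inv g ** (B p ** g))"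
    by (rule te_frame_gauge[OF te_frame_axioms g(1)])
  have hB: "hol2 U (\<lambda>p. (matrix_inv g ** (B p ** g)) $ i $ j)" for i j by (rule te_frame.hol_B[OF te])
  have Rg: "zcoeff 1 (\<lambda>p. (matrix_inv g ** (B p ** g)) $ i $ j) 0 = (if i = j then d $ i else 0)" for i j
    using coeff2_taylor_gauge[OF open_U O hol_B, of "matrix_inv g" g i j 1 0] gd[of i j]
    unfolding coeff2_taylor_0[OF open_U O hB] coeff2_taylor_0[OF open_U O hol_B] by (simp add: R_def)
  have d12: "d $ 1 - d $ 2 = of_real l" "d $ 2 - d $ 1 = of_real (- l)" by (simp_all add: d_def)
  have nr: "d $ 1 - d $ 2 \<noteq> of_nat n" "d $ 2 - d $ 1 \<noteq> of_nat n" if "n \<ge> 1" for n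
  proof -
    have "l \<noteq> real n" "- l \<noteq> real n" using l that by auto
    then show "d $ 1 - d $ 2 \<noteq> of_nat n" "d $ 2 - d $ 1 \<noteq> of_nat n"
      unfolding d12 by (metis of_real_eq_iff of_real_of_nat_eq)+
  qed
  have dm: "diagonal_monodromy H (exp (- (2 * of_real pi * \<i> * d $ 1))) (exp (- (2 * of_real pi * \<i> * d $ 2)))"
    by (rule te_frame.nonresonant_monodromy[OF te O te_frame.pole_part_zero[OF te lg O] Rg nr])
  show "monodromy_semisimple H" by (rule diagonal_monodromy_semisimple[OF TE dm])
  have "exp (- (2 * of_real pi * \<i> * d $ 1)) \<noteq> exp (- (2 * of_real pi * \<i> * d $ 2))"
  proof
    assume "exp (- (2 * of_real pi * \<i> * d $ 1)) = exp (- (2 * of_real pi * \<i> * d $ 2))"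
    then obtain n :: int where "- (2 * of_real pi * \<i> * d $ 1) = - (2 * of_real pi * \<i> * d $ 2) + (of_int (2 * n) * pi) * \<i>"
      unfolding exp_eq by blast
    then have "(2 * of_real pi * \<i>) * (d $ 2 - d $ 1) = (2 * of_real pi * \<i>) * of_int n" by (simp add: algebra_simps)
    then have "d $ 2 - d $ 1 = of_int n" by simp
    then have "complex_of_real (- l) = of_real (of_int n)" unfolding d12 by simp
    then have "- l = of_int n" by (simp only: of_real_eq_iff)
    then have "0 < - n" "- n < 1" using l by linarith+
    then show False by simp
  qed
  then show "card (monodromy_eigenvalues H) = 2" unfolding diagonal_monodromy_eigenvalues[OF TE dm] by simp
qed

text \<open>If the residue is resonant, the difference of its eigenvalues has the sign for which the obstruction to a solution is
  known to vanish.\<close>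

lemma leading_diagonal_monodromy:
  assumes TE: "TE_structure H" and tf: "trace_free_pole_part H" and lg: "logarithmic_over_0 H" and O: "(0, 0) \<in> U"
    and nz: "fps_nth (taylor (\<lambda>p. B p $ i0 $ j0)) 0 \<noteq> 0"
    and L: "\<And>i j. i \<noteq> j \<Longrightarrow> coeff2 (taylor (\<lambda>p. B p $ i $ j)) 0 (inv_k1 H) = 0"
      "coeff2 (taylor (\<lambda>p. B p $ 1 $ 1)) 0 (inv_k1 H) \<noteq> 0"
    and R: "\<And>i j. zcoeff 1 (\<lambda>p. B p $ i $ j) 0 = (if i = j then d $ i else 0)"
    and n: "\<And>n. n \<ge> 1 \<Longrightarrow> d $ 2 - d $ 1 \<noteq> of_nat n"
  shows "diagonal_monodromy H (exp (- (2 * of_real pi * \<i> * d $ 1))) (exp (- (2 * of_real pi * \<i> * d $ 2)))"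
proof (cases "\<exists>n\<ge>1. d $ 1 - d $ 2 = of_nat n")
  case False
  then show ?thesis using nonresonant_monodromy[OF O pole_part_zero[OF lg O] R] n by blast
next
  case True
  then obtain n where n: "n \<ge> 1" "d $ 1 - d $ 2 = of_nat n" by blast
  have pc: "pole_condition H" using TE by (simp add: TE_structure_def)
  interpret pps: pole_part_series "\<lambda>i j. taylor (\<lambda>p. A p $ i $ j)" "\<lambda>i j. taylor (\<lambda>p. B p $ i $ j)"
    "\<lambda>i j. fps_shift (inv_k1 H) (fps_nth (taylor (\<lambda>p. B p $ i $ j)) 0)" "inv_k1 H"
    by (rule pole_part_series_inv_k1[OF pc tf lg O nz])
  note c2 = coeff2_taylor_0[OF open_U O hol_B]
  have "\<exists>Y :: nat \<Rightarrow> 2 \<Rightarrow> complex. Y 0 1 = 1 \<and> Y 0 2 = 0 \<and> (\<forall>i\<le>n. \<forall>l. of_nat i * Y i l +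
     (\<Sum>m\<le>i. coeff2 (taylor (\<lambda>p. B p $ l $ 1)) (Suc m) 0 * Y (i - m) 1
        + coeff2 (taylor (\<lambda>p. B p $ l $ 2)) (Suc m) 0 * Y (i - m) 2) = d $ 1 * Y i l)"
    by (rule pps.no_resonance_obstruction[OF refl _ _ _ _ _ _ _ n(2,1)])
      (use L R in \<open>simp_all add: pps.leading_part_def pps.residue_part_def c2\<close>)
  then obtain Y :: "nat \<Rightarrow> 2 \<Rightarrow> complex" where Y: "Y 0 1 = 1" "\<And>i l. i \<le> n \<Longrightarrow> of_nat i * Y i l +
     (\<Sum>m\<le>i. zcoeff (Suc m) (\<lambda>p. B p $ l $ 1) 0 * Y (i - m) 1
        + zcoeff (Suc m) (\<lambda>p. B p $ l $ 2) 0 * Y (i - m) 2) = d $ 1 * Y i l"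
    unfolding c2 by blast
  show ?thesis by (rule resonant_monodromy[OF O pole_part_zero[OF lg O] R n(2,1) Y])
qed

end

text \<open>This permutation matrix exchanges the two eigenvalues, so that the larger one of a resonant pair comes first.\<close>

definition swap_basis :: "complex^2^2" where "swap_basis = vector [vector [0, 1], vector [1, 0]]"

lemma invertible_swap_basis: "invertible swap_basis"
  by (simp add: invertible_det_nz det_2 swap_basis_def)

lemma swap_basis_conjugate:
  assumes "\<And>i j. M $ i $ j = (if i = j then d $ i else 0)"
  shows "(matrix_inv swap_basis ** (M ** swap_basis)) $ i $ j = (if i = j then d $ (if i = 1 then 2 else 1) else 0)"
proof -
  define D :: "complex^2^2" where "D = vector [vector [d $ 2, 0], vector [0, d $ 1]]"
  have "M ** swap_basis = swap_basis ** D"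
    by (simp add: vec_eq_iff forall_2 matrix_matrix_mult_def sum_2 D_def swap_basis_def assms)
  from conjugate_by_similarity[OF invertible_swap_basis this]
  show "(matrix_inv swap_basis ** (M ** swap_basis)) $ i $ j = (if i = j then d $ (if i = 1 then 2 else 1) else 0)"
    using exhaust_2[of i] exhaust_2[of j] by (auto simp: D_def)
qed

section \<open>The generic types (Sem) and (Bra)\<close>

lemma frame_at_origin:
  assumes TE: "TE_structure H"
  obtains U \<Phi> A B where "te_frame H U \<Phi> A B" "(0, 0) \<in> U"
proof -
  have "(0, 0) \<in> (\<Union>(U, \<Phi>)\<in>frames H. U)"
    using TE by (auto simp: TE_structure_def vector_bundle_def base_def)
  then obtain U \<Phi> where "(U, \<Phi>) \<in> frames H" "(0, 0) \<in> U" by blast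
  then show thesis using te_frame_exists[OF TE] that by blast
qed

context te_frame begin

lemma generic_Sem_iff:
  assumes O: "(0, 0) \<in> U"
  shows "generic_Sem H \<longleftrightarrow> fps_nth (taylor (\<lambda>p. B p $ 1 $ 1) * taylor (\<lambda>p. B p $ 2 $ 2)
    - taylor (\<lambda>p. B p $ 1 $ 2) * taylor (\<lambda>p. B p $ 2 $ 1)) 0 \<noteq> 0"
  unfolding generic_Sem_def using eventually_zero_expansion[OF delta_expansion[OF O, of 0]] by simp

text \<open>The order of \<open>\<delta>\<^sup>(\<^sup>0\<^sup>)\<close> is \<open>k1 + k2\<close>, so that \<open>l\<close> is the number \<open>1 - 2 k1 / (k1 + k2)\<close> of \<open>semisimple_case\<close>.  The
  conclusions for \<open>k1 = k2\<close> concern the leading coefficient of the pole part and its commutator with the residue.\<close>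

lemma Sem_case:
  assumes TE: "TE_structure H" and tf: "trace_free_pole_part H" and lg: "logarithmic_over_0 H" and O: "(0, 0) \<in> U"
    and sem: "generic_Sem H"
  defines "l \<equiv> of_int (inv_k2 H - int (inv_k1 H)) / of_int (inv_k2 H + int (inv_k1 H)) :: real"
  shows "inv_k2 H \<ge> int (inv_k1 H)" and "inv_k1 H \<ge> 1"
    and "inv_k2 H > int (inv_k1 H) \<Longrightarrow> (zcoeff 1 (\<lambda>p. B p $ 1 $ 1) 0 - zcoeff 1 (\<lambda>p. B p $ 2 $ 2) 0)^2
      + 4 * zcoeff 1 (\<lambda>p. B p $ 1 $ 2) 0 * zcoeff 1 (\<lambda>p. B p $ 2 $ 1) 0 = (of_real l)^2"
    and "inv_k2 H = int (inv_k1 H) \<Longrightarrow> coeff2 (taylor (\<lambda>p. B p $ 2 $ 2)) 0 (inv_k1 H) = - coeff2 (taylor (\<lambda>p. B p $ 1 $ 1)) 0 (inv_k1 H)"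
    and "inv_k2 H = int (inv_k1 H) \<Longrightarrow> (coeff2 (taylor (\<lambda>p. B p $ 1 $ 1)) 0 (inv_k1 H))^2
       + coeff2 (taylor (\<lambda>p. B p $ 1 $ 2)) 0 (inv_k1 H) * coeff2 (taylor (\<lambda>p. B p $ 2 $ 1)) 0 (inv_k1 H) \<noteq> 0"
    and "inv_k2 H = int (inv_k1 H) \<Longrightarrow> commutator (\<lambda>i j. zcoeff 1 (\<lambda>p. B p $ i $ j) 0)
       (\<lambda>i j. coeff2 (taylor (\<lambda>p. B p $ i $ j)) 0 (inv_k1 H)) i j = 0"
    and "\<exists>i j. fps_nth (taylor (\<lambda>p. B p $ i $ j)) 0 \<noteq> 0"
proof -
  have pc: "pole_condition H" using TE by (simp add: TE_structure_def)
  define \<delta> where "\<delta> = fps_nth (taylor (\<lambda>p. B p $ 1 $ 1)) 0 * fps_nth (taylor (\<lambda>p. B p $ 2 $ 2)) 0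
    - fps_nth (taylor (\<lambda>p. B p $ 1 $ 2)) 0 * fps_nth (taylor (\<lambda>p. B p $ 2 $ 1)) 0"
  have \<delta>: "delta H 0 has_fps_expansion \<delta>" "\<delta> \<noteq> 0"
    using delta_expansion[OF O, of 0] sem generic_Sem_iff[OF O] by (simp_all add: \<delta>_def fps_mult_nth)
  show nz: "\<exists>i j. fps_nth (taylor (\<lambda>p. B p $ i $ j)) 0 \<noteq> 0" by (rule ccontr) (use \<delta>(2) in \<open>simp add: \<delta>_def\<close>)
  then obtain i0 j0 where nz: "fps_nth (taylor (\<lambda>p. B p $ i0 $ j0)) 0 \<noteq> 0" by blast
  have "zorder (delta H 0) 0 = int (subdegree \<delta>)" by (rule has_fps_expansion_zorder_0[OF \<delta>])
  then have k2: "inv_k2 H + int (inv_k1 H) = int (subdegree \<delta>)" using sem by (simp add: inv_k2_def)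
  interpret pps: pole_part_series "\<lambda>i j. taylor (\<lambda>p. A p $ i $ j)" "\<lambda>i j. taylor (\<lambda>p. B p $ i $ j)"
    "\<lambda>i j. fps_shift (inv_k1 H) (fps_nth (taylor (\<lambda>p. B p $ i $ j)) 0)" "inv_k1 H"
    by (rule pole_part_series_inv_k1[OF pc tf lg O nz])
  note c2 = coeff2_taylor_0[OF open_U O hol_B]
  note S = pps.semisimple_case[OF \<delta>(2)[unfolded \<delta>_def], folded \<delta>_def]
  show "inv_k2 H \<ge> int (inv_k1 H)" using S(1) k2 by simp
  show k1: "inv_k1 H \<ge> 1" by (rule pps.k)
  show "(zcoeff 1 (\<lambda>p. B p $ 1 $ 1) 0 - zcoeff 1 (\<lambda>p. B p $ 2 $ 2) 0)^2
      + 4 * zcoeff 1 (\<lambda>p. B p $ 1 $ 2) 0 * zcoeff 1 (\<lambda>p. B p $ 2 $ 1) 0 = (of_real l)^2"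
    if gt: "inv_k2 H > int (inv_k1 H)"
  proof -
    have "subdegree \<delta> > 2 * inv_k1 H" using gt k2 by simp
    from S(2)[OF this] have "(zcoeff 1 (\<lambda>p. B p $ 1 $ 1) 0 - zcoeff 1 (\<lambda>p. B p $ 2 $ 2) 0)^2
      + 4 * zcoeff 1 (\<lambda>p. B p $ 1 $ 2) 0 * zcoeff 1 (\<lambda>p. B p $ 2 $ 1) 0 = (1 - 2 * of_nat (inv_k1 H) / of_nat (subdegree \<delta>))^2"
      by (simp only: pps.residue_part_def c2)
    moreover have "complex_of_real l = 1 - 2 * of_nat (inv_k1 H) / of_nat (subdegree \<delta>)"
    proof -
      have e: "inv_k2 H - int (inv_k1 H) = int (subdegree \<delta>) - 2 * int (inv_k1 H)" using k2 by simp
      have "subdegree \<delta> \<noteq> 0" using gt k2 k1 by linarith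
      then show ?thesis unfolding l_def k2 e by (simp add: diff_divide_distrib)
    qed
    ultimately show ?thesis by simp
  qed
  assume eq: "inv_k2 H = int (inv_k1 H)"
  then have "subdegree \<delta> = 2 * inv_k1 H" using k2 by simp
  note S' = S(3)[OF this] S(4)[OF this, of i j]
  have tr: "coeff2 (taylor (\<lambda>p. B p $ 2 $ 2)) 0 (inv_k1 H) = - coeff2 (taylor (\<lambda>p. B p $ 1 $ 1)) 0 (inv_k1 H)"
    using arg_cong[OF pps.trace_free, of "\<lambda>c. fps_nth c 0"] by simp
  then show "coeff2 (taylor (\<lambda>p. B p $ 2 $ 2)) 0 (inv_k1 H) = - coeff2 (taylor (\<lambda>p. B p $ 1 $ 1)) 0 (inv_k1 H)" .
  show "(coeff2 (taylor (\<lambda>p. B p $ 1 $ 1)) 0 (inv_k1 H))^2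
       + coeff2 (taylor (\<lambda>p. B p $ 1 $ 2)) 0 (inv_k1 H) * coeff2 (taylor (\<lambda>p. B p $ 2 $ 1)) 0 (inv_k1 H) \<noteq> 0"
    using S'(1) by (simp add: pps.discriminant_part_def power2_eq_square)
  have "pps.residue_part = (\<lambda>i j. zcoeff 1 (\<lambda>p. B p $ i $ j) 0)"
    by (intro ext) (simp only: pps.residue_part_def c2)
  moreover have "pps.leading_part = (\<lambda>i j. coeff2 (taylor (\<lambda>p. B p $ i $ j)) 0 (inv_k1 H))"
    by (intro ext) (simp add: pps.leading_part_def)
  ultimately show "commutator (\<lambda>i j. zcoeff 1 (\<lambda>p. B p $ i $ j) 0)
       (\<lambda>i j. coeff2 (taylor (\<lambda>p. B p $ i $ j)) 0 (inv_k1 H)) i j = 0"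
    using S'(2) by simp
qed

text \<open>The order of \<open>\<delta>\<^sup>(\<^sup>1\<^sup>)\<close> is \<open>k1 + k2\<close>, so that \<open>l\<close> is the number \<open>1 - k1 / (k1 + k2)\<close> of \<open>nilpotent_case\<close>.\<close>

lemma Bra_case:
  assumes TE: "TE_structure H" and tf: "trace_free_pole_part H" and lg: "logarithmic_over_0 H" and O: "(0, 0) \<in> U"
    and bra: "generic_Bra H"
  defines "l \<equiv> of_int (inv_k2 H) / of_int (inv_k2 H + int (inv_k1 H)) :: real"
  shows "inv_k2 H \<ge> 1" and "inv_k1 H \<ge> 1"
    and "(zcoeff 1 (\<lambda>p. B p $ 1 $ 1) 0 - zcoeff 1 (\<lambda>p. B p $ 2 $ 2) 0)^2
      + 4 * zcoeff 1 (\<lambda>p. B p $ 1 $ 2) 0 * zcoeff 1 (\<lambda>p. B p $ 2 $ 1) 0 = (of_real l)^2"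
proof -
  have pc: "pole_condition H" using TE by (simp add: TE_structure_def)
  have nsem: "\<not> generic_Sem H" using bra by (simp add: generic_Sem_def generic_Bra_def)
  define \<delta> where "\<delta> = fps_nth (taylor (\<lambda>p. B p $ 1 $ 1)) 0 * fps_nth (taylor (\<lambda>p. B p $ 2 $ 2)) 1
    + fps_nth (taylor (\<lambda>p. B p $ 1 $ 1)) 1 * fps_nth (taylor (\<lambda>p. B p $ 2 $ 2)) 0
    - fps_nth (taylor (\<lambda>p. B p $ 1 $ 2)) 0 * fps_nth (taylor (\<lambda>p. B p $ 2 $ 1)) 1
    - fps_nth (taylor (\<lambda>p. B p $ 1 $ 2)) 1 * fps_nth (taylor (\<lambda>p. B p $ 2 $ 1)) 0"
  have \<delta>1: "delta H 1 has_fps_expansion \<delta>"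
    using delta_expansion[OF O, of 1] by (simp add: \<delta>_def fps_mult_nth algebra_simps)
  have \<delta>2: "\<delta> \<noteq> 0" using bra eventually_zero_expansion[OF \<delta>1] by (simp add: generic_Bra_def)
  have det: "fps_nth (taylor (\<lambda>p. B p $ 1 $ 1)) 0 * fps_nth (taylor (\<lambda>p. B p $ 2 $ 2)) 0
    - fps_nth (taylor (\<lambda>p. B p $ 1 $ 2)) 0 * fps_nth (taylor (\<lambda>p. B p $ 2 $ 1)) 0 = 0"
    using nsem generic_Sem_iff[OF O] by (simp add: fps_mult_nth)
  have "\<exists>i j. fps_nth (taylor (\<lambda>p. B p $ i $ j)) 0 \<noteq> 0" by (rule ccontr) (use \<delta>2 in \<open>simp add: \<delta>_def\<close>)
  then obtain i0 j0 where nz: "fps_nth (taylor (\<lambda>p. B p $ i0 $ j0)) 0 \<noteq> 0" by blast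
  have "zorder (delta H 1) 0 = int (subdegree \<delta>)" by (rule has_fps_expansion_zorder_0[OF \<delta>1 \<delta>2])
  then have k2: "inv_k2 H + int (inv_k1 H) = int (subdegree \<delta>)" using nsem by (simp add: inv_k2_def)
  interpret pps: pole_part_series "\<lambda>i j. taylor (\<lambda>p. A p $ i $ j)" "\<lambda>i j. taylor (\<lambda>p. B p $ i $ j)"
    "\<lambda>i j. fps_shift (inv_k1 H) (fps_nth (taylor (\<lambda>p. B p $ i $ j)) 0)" "inv_k1 H"
    by (rule pole_part_series_inv_k1[OF pc tf lg O nz])
  note c2 = coeff2_taylor_0[OF open_U O hol_B]
  note S = pps.nilpotent_case[OF det \<delta>2[unfolded \<delta>_def], folded \<delta>_def]
  show gt: "inv_k2 H \<ge> 1" using S(1) k2 by simp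
  show k1: "inv_k1 H \<ge> 1" by (rule pps.k)
  from S(2) have "(zcoeff 1 (\<lambda>p. B p $ 1 $ 1) 0 - zcoeff 1 (\<lambda>p. B p $ 2 $ 2) 0)^2
    + 4 * zcoeff 1 (\<lambda>p. B p $ 1 $ 2) 0 * zcoeff 1 (\<lambda>p. B p $ 2 $ 1) 0 = (1 - of_nat (inv_k1 H) / of_nat (subdegree \<delta>))^2"
    by (simp only: pps.residue_part_def c2)
  moreover have "complex_of_real l = 1 - of_nat (inv_k1 H) / of_nat (subdegree \<delta>)"
  proof -
    have e: "inv_k2 H = int (subdegree \<delta>) - int (inv_k1 H)" using k2 by simp
    have "subdegree \<delta> \<noteq> 0" using gt k2 k1 by linarith
    then show ?thesis unfolding l_def k2 unfolding e by (simp add: diff_divide_distrib)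
  qed
  ultimately show "(zcoeff 1 (\<lambda>p. B p $ 1 $ 1) 0 - zcoeff 1 (\<lambda>p. B p $ 2 $ 2) 0)^2
      + 4 * zcoeff 1 (\<lambda>p. B p $ 1 $ 2) 0 * zcoeff 1 (\<lambda>p. B p $ 2 $ 1) 0 = (of_real l)^2" by simp
qed

text \<open>In a frame in which the leading coefficient of the pole part is diagonal, the residue endomorphism is diagonal.
  If its eigenvalues resonate in the wrong order, exchanging the two basis vectors repairs it.\<close>

lemma Sem_equal_orders_semisimple:
  assumes TE: "TE_structure H" and tf: "trace_free_pole_part H" and lg: "logarithmic_over_0 H" and O: "(0, 0) \<in> U"
    and sem: "generic_Sem H" and eq: "inv_k2 H = int (inv_k1 H)"
  shows "monodromy_semisimple H"
proof -
  define L :: "complex^2^2" where "L = (\<chi> i j. coeff2 (taylor (\<lambda>p. B p $ i $ j)) 0 (inv_k1 H))"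
  note S = Sem_case[OF TE tf lg O sem]
  have L: "L $ 2 $ 2 = - L $ 1 $ 1" "(L $ 1 $ 1)^2 + L $ 1 $ 2 * L $ 2 $ 1 \<noteq> 0"
    using S(4,5)[OF eq] by (simp_all add: L_def)
  define \<alpha> where "\<alpha> = csqrt ((L $ 1 $ 1)^2 + L $ 1 $ 2 * L $ 2 $ 1)"
  have \<alpha>: "\<alpha> \<noteq> 0" "\<alpha>^2 = (L $ 1 $ 1)^2 + L $ 1 $ 2 * L $ 2 $ 1" using L(2) by (simp_all add: \<alpha>_def)
  have "(L $ 1 $ 1 - L $ 2 $ 2)^2 + 4 * L $ 1 $ 2 * L $ 2 $ 1 = (2 * \<alpha>)^2" "2 * \<alpha> \<noteq> 0"
    using \<alpha>(2) L(1) by (algebra, simp add: \<alpha>(1))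
  then obtain g :: "complex^2^2" where g: "invertible g" "\<And>i j. (matrix_inv g ** (L ** g)) $ i $ j =
    (if i = j then (if i = 1 then (L $ 1 $ 1 + L $ 2 $ 2 + 2 * \<alpha>) / 2 else (L $ 1 $ 1 + L $ 2 $ 2 - 2 * \<alpha>) / 2) else 0)"
    by (rule diagonalize_2) blast
  define A' B' where "A' = (\<lambda>p. matrix_inv g ** (A p ** g))" and "B' = (\<lambda>p. matrix_inv g ** (B p ** g))"
  have te: "te_frame H U (\<lambda>p. \<Phi> p ** g) A' B'"
    unfolding A'_def B'_def by (rule te_frame_gauge[OF te_frame_axioms g(1)])
  interpret F: te_frame H U "\<lambda>p. \<Phi> p ** g" A' B' by (rule te)
  have L': "coeff2 (taylor (\<lambda>p. B' p $ i $ j)) 0 (inv_k1 H) = (if i = j then (if i = 1 then \<alpha> else - \<alpha>) else 0)" for i j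
    using g(2)[of i j] L(1) unfolding B'_def coeff2_taylor_gauge[OF open_U O hol_B] L_def[symmetric] by simp
  define d :: "complex^2" where "d = (\<chi> i. zcoeff 1 (\<lambda>p. B' p $ i $ i) 0)"
  note S' = F.Sem_case[OF TE tf lg O sem]
  have R': "zcoeff 1 (\<lambda>p. B' p $ i $ j) 0 = (if i = j then d $ i else 0)" for i j
    using S'(6)[OF eq, of 1 2] S'(6)[OF eq, of 2 1] \<alpha>(1) exhaust_2[of i] exhaust_2[of j]
    by (auto simp: commutator_def L' d_def)
  obtain i0 j0 where nz: "fps_nth (taylor (\<lambda>p. B' p $ i0 $ j0)) 0 \<noteq> 0" using S'(7) by blast
  show ?thesis
  proof (cases "\<exists>n\<ge>1. d $ 2 - d $ 1 = of_nat n")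
    case False
    have "diagonal_monodromy H (exp (- (2 * of_real pi * \<i> * d $ 1))) (exp (- (2 * of_real pi * \<i> * d $ 2)))"
      by (rule F.leading_diagonal_monodromy[OF TE tf lg O nz _ _ R']) (use False L' \<alpha> in auto)
    then show ?thesis by (rule diagonal_monodromy_semisimple[OF TE])
  next
    case True
    then obtain m :: nat where m: "m \<ge> 1" "d $ 2 - d $ 1 = of_nat m" by blast
    define A2 B2 where "A2 = (\<lambda>p. matrix_inv swap_basis ** (A' p ** swap_basis))"
      and "B2 = (\<lambda>p. matrix_inv swap_basis ** (B' p ** swap_basis))"
    have te2: "te_frame H U (\<lambda>p. (\<Phi> p ** g) ** swap_basis) A2 B2"
      unfolding A2_def B2_def by (rule te_frame_gauge[OF te invertible_swap_basis])
    interpret F2: te_frame H U "\<lambda>p. (\<Phi> p ** g) ** swap_basis" A2 B2 by (rule te2)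
    define d2 :: "complex^2" where "d2 = (\<chi> i. d $ (if i = 1 then 2 else 1))"
    have c2: "coeff2 (taylor (\<lambda>p. B2 p $ i $ j)) a b = (if i = j then e $ (if i = 1 then 2 else 1) else 0)"
      if "\<And>i j. coeff2 (taylor (\<lambda>p. B' p $ i $ j)) a b = (if i = j then e $ i else 0)" for a b e i j
      unfolding B2_def coeff2_taylor_gauge[OF open_U O F.hol_B]
      by (rule swap_basis_conjugate) (simp add: that)
    have R2: "zcoeff 1 (\<lambda>p. B2 p $ i $ j) 0 = (if i = j then d2 $ i else 0)" for i j
      using c2[of 1 0 d i j] R' unfolding coeff2_taylor_0[OF open_U O F.hol_B] coeff2_taylor_0[OF open_U O F2.hol_B]
      by (simp add: d2_def)
    have L2: "coeff2 (taylor (\<lambda>p. B2 p $ i $ j)) 0 (inv_k1 H) = (if i = j then (if i = 1 then - \<alpha> else \<alpha>) else 0)" for i j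
      using c2[of 0 "inv_k1 H" "\<chi> i. if i = 1 then \<alpha> else - \<alpha>" i j] L' by simp
    obtain i1 j1 where nz2: "fps_nth (taylor (\<lambda>p. B2 p $ i1 $ j1)) 0 \<noteq> 0"
      using F2.Sem_case(7)[OF TE tf lg O sem] by blast
    have ne: "d2 $ 2 - d2 $ 1 \<noteq> of_nat n" if "n \<ge> 1" for n
    proof
      assume e: "d2 $ 2 - d2 $ 1 = of_nat n"
      have "complex_of_nat (n + m) = (d2 $ 2 - d2 $ 1) + (d $ 2 - d $ 1)" unfolding e m(2) by simp
      then have "complex_of_nat (n + m) = 0" by (simp add: d2_def)
      then have "n + m = 0" by (simp only: of_nat_eq_0_iff)
      then show False using that by simp
    qed
    have "diagonal_monodromy H (exp (- (2 * of_real pi * \<i> * d2 $ 1))) (exp (- (2 * of_real pi * \<i> * d2 $ 2)))"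
      by (rule F2.leading_diagonal_monodromy[OF TE tf lg O nz2 _ _ R2 ne]) (use L2 \<alpha> in auto)
    then show ?thesis by (rule diagonal_monodromy_semisimple[OF TE])
  qed
qed

end

theorem theorem6p2:
  fixes H :: te and \<rho> :: complex and k1 :: nat and k2 :: int
  assumes TE: "TE_structure H"
    and trace_free: "trace_free_pole_part H"
    and logarithmic: "logarithmic_over_0 H"
    and rho: "\<rho> = rho1 H 0"
    and k1: "k1 = inv_k1 H"
    and k2: "k2 = inv_k2 H"
  shows "(generic_Sem H \<longrightarrow>
            k2 \<ge> int k1 \<and>
            (k2 > int k1 \<longrightarrow>
               residue_eigenvalues H =
                 {\<rho> + of_int (int k1 - k2) / (2 * of_int (int k1 + k2)),
                  \<rho> - of_int (int k1 - k2) / (2 * of_int (int k1 + k2))} \<and>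
               (\<forall>a\<in>residue_eigenvalues H. \<forall>b\<in>residue_eigenvalues H. cmod (a - b) < 1) \<and>
               card (monodromy_eigenvalues H) = 2 \<and>
               monodromy_semisimple H) \<and>
            (k2 = int k1 \<longrightarrow> monodromy_semisimple H)) \<and>
         (generic_Bra H \<longrightarrow>
            k2 \<ge> 1 \<and>
            residue_eigenvalues H =
              {\<rho> + of_int (- k2) / (2 * of_int (int k1 + k2)),
               \<rho> - of_int (- k2) / (2 * of_int (int k1 + k2))} \<and>
            (\<forall>a\<in>residue_eigenvalues H. \<forall>b\<in>residue_eigenvalues H. cmod (a - b) < 1) \<and>
            card (monodromy_eigenvalues H) = 2 \<and>
            monodromy_semisimple H)"
proof -
  obtain U \<Phi> A B where te: "te_frame H U \<Phi> A B" and O: "(0, 0) \<in> U" by (rule frame_at_origin[OF TE])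
  interpret te_frame H U \<Phi> A B by (rule te)
  have half: "complex_of_real (of_int a / of_int b) / 2 = - (of_int (- a) / (2 * of_int b))" for a b :: int by simp
  show ?thesis
  proof (intro conjI[of "generic_Sem H \<longrightarrow> _"] impI)
    assume sem: "generic_Sem H"
    note S = Sem_case[OF TE trace_free logarithmic O sem]
    show "k2 \<ge> int k1 \<and>
            (k2 > int k1 \<longrightarrow>
               residue_eigenvalues H =
                 {\<rho> + of_int (int k1 - k2) / (2 * of_int (int k1 + k2)),
                  \<rho> - of_int (int k1 - k2) / (2 * of_int (int k1 + k2))} \<and>
               (\<forall>a\<in>residue_eigenvalues H. \<forall>b\<in>residue_eigenvalues H. cmod (a - b) < 1) \<and>
               card (monodromy_eigenvalues H) = 2 \<and>
               monodromy_semisimple H) \<and>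
            (k2 = int k1 \<longrightarrow> monodromy_semisimple H)"
    proof (intro conjI[of "k2 \<ge> int k1"] conjI[of "k2 > int k1 \<longrightarrow> _"] impI)
      show "k2 \<ge> int k1" using S(1) by (simp add: k1 k2)
      show "monodromy_semisimple H" if "k2 = int k1"
        using Sem_equal_orders_semisimple[OF TE trace_free logarithmic O sem] that by (simp add: k1 k2)
      assume gt: "k2 > int k1"
      then have "0 < real_of_int (k2 - int k1) / real_of_int (k2 + int k1)" "real_of_int (k2 - int k1) / real_of_int (k2 + int k1) < 1"
        using S(2) by (simp_all add: k1 field_simps)
      from distinct_residue_eigenvalues[OF TE logarithmic O S(3)[folded k1 k2, OF gt] this]
      show "residue_eigenvalues H =
                 {\<rho> + of_int (int k1 - k2) / (2 * of_int (int k1 + k2)),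
                  \<rho> - of_int (int k1 - k2) / (2 * of_int (int k1 + k2))} \<and>
               (\<forall>a\<in>residue_eigenvalues H. \<forall>b\<in>residue_eigenvalues H. cmod (a - b) < 1) \<and>
               card (monodromy_eigenvalues H) = 2 \<and>
               monodromy_semisimple H"
        unfolding half rho[symmetric] by (simp add: add.commute[of k2] insert_commute)
    qed
  next
    assume bra: "generic_Bra H"
    note S = Bra_case[OF TE trace_free logarithmic O bra]
    have k: "k2 \<ge> 1" "k1 \<ge> 1" using S(1,2) by (simp_all add: k1 k2)
    then have "0 < real_of_int k2 / real_of_int (k2 + int k1)" "real_of_int k2 / real_of_int (k2 + int k1) < 1"
      by (simp_all add: field_simps)
    from distinct_residue_eigenvalues[OF TE logarithmic O S(3)[folded k1 k2] this]
    show "k2 \<ge> 1 \<and>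
            residue_eigenvalues H =
              {\<rho> + of_int (- k2) / (2 * of_int (int k1 + k2)),
               \<rho> - of_int (- k2) / (2 * of_int (int k1 + k2))} \<and>
            (\<forall>a\<in>residue_eigenvalues H. \<forall>b\<in>residue_eigenvalues H. cmod (a - b) < 1) \<and>
            card (monodromy_eigenvalues H) = 2 \<and>
            monodromy_semisimple H"
      unfolding half rho[symmetric] using k by (simp add: add.commute[of k2] insert_commute)
  qed
qed

end
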